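(* Let $B^H_t$, $t\ge 0$, be a fractional Brownian motion with Hurst parameter $H\in(0,1)$ on a probability space $(\Omega,\mathcal{F},\mathbb{P})$, let $L$ be its local time, and let $C=\lim_{n\to+\infty}\frac1n\mathbb{E}\,\mathrm{TV}^1(B^H,[0,n])$. There exist a sequence $(c_n)_{n\ge1}$ of positive reals with $c_n\to0+$ as $n\to+\infty$ and a measurable set $\Omega_H\subset\Omega$ with $\mathbb{P}(\Omega_H)=1$ such that for each $\omega\in\Omega_H$ and each $t\in[0,+\infty)$ the measures $c_n^{1/H-1}\,\mathrm{n}^{y,c_n}(B^H(\omega),[0,t])\,\mathrm{d}y$ converge weakly to $C\cdot L^y_t(\omega)\,\mathrm{d}y$ as $n\to+\infty$. Moreover, the measures $c^{1/H-1}\,\mathrm{n}^{y,c}(B^H(\omega),[0,t])\,\mathrm{d}y$, $t\ge0$, tend weakly locally uniformly in probability as $c\to0+$ to the measures $C\cdot L^y_t\,\mathrm{d}y$, $t\ge 0$.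
   Context: Fractional Brownian motion with Hurst parameter $H\in(0,1)$: a centred Gaussian process with continuous paths, self-similar with index $H$ (i.e. $(A^{-H}B^H_{At})_{t\ge0}$ has the same law as $B^H$ for all $A>0$) and with stationary increments, $B^H_t-B^H_s\sim\mathcal{N}(0,\mathrm{const}\cdot|t-s|^{2H})$ with a positive constant. Truncated variation: for $x:[0,+\infty)\to\mathbb{R}$, $c\ge 0$ and $0\le s<t$, $\mathrm{TV}^{c}(x,[s,t])=\sup_{\pi}\sum_{[u,v]\in\pi}\max(|x_v-x_u|-c,0)$, the supremum being over all finite partitions $\pi$ of $[s,t]$ into subintervals with disjoint interiors. Numbers of interval crossings of a càdlàg path $x$: for $y\in\mathbb{R}$, $c>0$, put $\sigma^c_0=s$ and for $n=0,1,2,\dots$ $$\rho^c_n=\inf\{u\in[\sigma^c_n,t]: x_u\ge y+c/2\},\qquad \sigma^c_{n+1}=\inf\{u\in[\rho^c_n,t]: x_u<y-c/2\},$$ with $\inf\emptyset=+\infty$ and $[+\infty,t]=\emptyset$. Then $\mathrm{d}^{y,c}(x,[s,t])=\max\{n:\sigma^c_n\le t\}$, $\mathrm{u}^{y,c}(x,[s,t])=\mathrm{d}^{-y,c}(-x,[s,t])$ and $\mathrm{n}^{y,c}(x,[s,t])=\mathrm{u}^{y,c}(x,[s,t])+\mathrm{d}^{y,c}(x,[s,t])$. Local time of a process $X$ (relative to Lebesgue measures in space and time): with the occupation measure $\mu_t(\Gamma)=\int_{[0,t]}\mathbf{1}_\Gamma(X_s(\omega))\,\mathrm{d}s$, $X$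 possesses a local time if for each $t\ge0$, $\mu_t$ is $\mathbb{P}$-a.s. absolutely continuous with respect to the Lebesgue measure $\mathrm{d}y$; the local time is $L^y_t(\omega)=(\mathrm{d}\mu_t/\mathrm{d}y)(y)$ (defined $\mathbb{P}$-a.s.). It is known that $B^H$ possesses a local time. Weak local uniform convergence in probability: finite random measures $\mu^c_t$, $t\ge0$, on $\mathbb{R}$ tend weakly locally uniformly in probability as $c\to0+$ to random measures $\mu^0_t$, $t\ge0$, if for any continuous and bounded $g:\mathbb{R}\to\mathbb{R}$ and any $T\ge0$, $D^c_T=\sup_{t\in[0,T]}\left|\int_{\mathbb{R}}g\,\mathrm{d}\mu^c_t-\int_{\mathbb{R}}g\,\mathrm{d}\mu^0_t\right|$ is a random variable (measurable) and $D^c_T\to0$ in probability as $c\to0+$. *)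

theory Defs
  imports "HOL-Probability.Probability"
begin

text \<open>
  A real process on the time set \<open>[0, \<infinity>)\<close> is a function \<open>X\<close> with \<open>X t \<omega>\<close> the value at time \<open>t\<close>;
  values at negative times are never used.
\<close>

section \<open>Fractional Brownian motion\<close>

text \<open>Parametrised by the variance \<open>v \<ge> 0\<close>; \<open>v = 0\<close> is the Dirac measure.\<close>
definition normal_law :: "real \<Rightarrow> real \<Rightarrow> real measure" where
  "normal_law m v = (if v = 0 then return borel m
     else density lborel (\<lambda>x. ennreal (normal_density m (sqrt v) x)))"

definition gaussian_process :: "'a measure \<Rightarrow> (real \<Rightarrow> 'a \<Rightarrow> real) \<Rightarrow> bool" where
  "gaussian_process M X \<longleftrightarrow>
     (\<forall>t\<ge>0. X t \<in> borel_measurable M) \<and>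
     (\<forall>F a. finite F \<and> F \<subseteq> {0..} \<longrightarrow>
        (\<exists>m v. 0 \<le> v \<and> distr M borel (\<lambda>\<omega>. \<Sum>t\<in>F. a t * X t \<omega>) = normal_law m v))"

definition process_law :: "'a measure \<Rightarrow> (real \<Rightarrow> 'a \<Rightarrow> real) \<Rightarrow> (real \<Rightarrow> real) measure" where
  "process_law M X = distr M (\<Pi>\<^sub>M t\<in>{0..}. borel) (\<lambda>\<omega>. \<lambda>t\<in>{0..}. X t \<omega>)"

locale fractional_brownian_motion = prob_space M
  for M :: "'a measure" +
  fixes H :: real and B :: "real \<Rightarrow> 'a \<Rightarrow> real"
  assumes hurst: "0 < H" "H < 1"
    and gaussian: "gaussian_process M B"
    and centred: "\<And>t. 0 \<le> t \<Longrightarrow> expectation (B t) = 0"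
    and continuous_paths: "\<And>\<omega>. \<omega> \<in> space M \<Longrightarrow> continuous_on {0..} (\<lambda>t. B t \<omega>)"
    and self_similar:
      "\<And>A. 0 < A \<Longrightarrow> process_law M (\<lambda>t \<omega>. A powr (- H) * B (A * t) \<omega>) = process_law M B"
    and stationary_increments:
      "\<And>s. 0 \<le> s \<Longrightarrow>
         process_law M (\<lambda>t \<omega>. B (s + t) \<omega> - B s \<omega>) = process_law M (\<lambda>t \<omega>. B t \<omega> - B 0 \<omega>)"
    and increment_law:
      "\<exists>\<kappa>>0. \<forall>s\<ge>0. \<forall>t\<ge>0.
         distr M borel (\<lambda>\<omega>. B t \<omega> - B s \<omega>) = normal_law 0 (\<kappa> * \<bar>t - s\<bar> powr (2 * H))"

section \<open>Truncated variation\<close>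

definition truncated_variation :: "real \<Rightarrow> (real \<Rightarrow> real) \<Rightarrow> real \<Rightarrow> real \<Rightarrow> ennreal" where
  "truncated_variation c x s t =
     (SUP \<pi>\<in>{\<pi>. \<pi> division_of {s..t}}.
        ennreal (\<Sum>I\<in>\<pi>. max (\<bar>x (Sup I) - x (Inf I)\<bar> - c) 0))"

definition tv_constant :: "'a measure \<Rightarrow> (real \<Rightarrow> 'a \<Rightarrow> real) \<Rightarrow> ennreal" where
  "tv_constant M X =
     lim (\<lambda>n. (\<integral>\<^sup>+\<omega>. truncated_variation 1 (\<lambda>t. X t \<omega>) 0 (real n) \<partial>M) / of_nat n)"

section \<open>Numbers of interval crossings\<close>

text \<open>
  Times are extended reals, so that \<open>Inf {} = \<infinity>\<close> as required; \<open>upper_time x y c t (\<sigma>\<^sub>n)\<close> is \<open>\<rho>\<^sub>n\<close>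
  and \<open>lower_time x y c s t n\<close> is \<open>\<sigma>\<^sub>n\<close>.
\<close>
definition upper_time :: "(real \<Rightarrow> real) \<Rightarrow> real \<Rightarrow> real \<Rightarrow> real \<Rightarrow> ereal \<Rightarrow> ereal" where
  "upper_time x y c t \<sigma> = Inf (ereal ` {u. \<sigma> \<le> ereal u \<and> u \<le> t \<and> x u \<ge> y + c / 2})"

primrec lower_time :: "(real \<Rightarrow> real) \<Rightarrow> real \<Rightarrow> real \<Rightarrow> real \<Rightarrow> real \<Rightarrow> nat \<Rightarrow> ereal" where
  "lower_time x y c s t 0 = ereal s"
| "lower_time x y c s t (Suc n) =
     Inf (ereal ` {u. upper_time x y c t (lower_time x y c s t n) \<le> ereal u \<and> u \<le> t
                      \<and> x u < y - c / 2})"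

text \<open>
  The set below always contains \<open>0\<close> (for \<open>s \<le> t\<close>), and it is finite for cadlag \<open>x\<close> and \<open>c > 0\<close>;
  outside that setting the value of \<open>Max\<close> is meaningless.
\<close>
definition down_crossings :: "(real \<Rightarrow> real) \<Rightarrow> real \<Rightarrow> real \<Rightarrow> real \<Rightarrow> real \<Rightarrow> nat" where
  "down_crossings x y c s t = Max {n. lower_time x y c s t n \<le> ereal t}"

definition up_crossings :: "(real \<Rightarrow> real) \<Rightarrow> real \<Rightarrow> real \<Rightarrow> real \<Rightarrow> real \<Rightarrow> nat" where
  "up_crossings x y c s t = down_crossings (\<lambda>u. - x u) (- y) c s t"

definition crossings :: "(real \<Rightarrow> real) \<Rightarrow> real \<Rightarrow> real \<Rightarrow> real \<Rightarrow> real \<Rightarrow> nat" where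
  "crossings x y c s t = up_crossings x y c s t + down_crossings x y c s t"

section \<open>Local time\<close>

definition occupation_measure :: "(real \<Rightarrow> 'a \<Rightarrow> real) \<Rightarrow> real \<Rightarrow> 'a \<Rightarrow> real measure" where
  "occupation_measure X t \<omega> = distr (restrict_space lborel {0..t}) borel (\<lambda>s. X s \<omega>)"

text \<open>
  The Radon-Nikodym derivative is taken path by path, simultaneously for all \<open>t\<close>. It is the genuine
  density whenever the occupation measure is absolutely continuous, and \<open>0\<close> otherwise.
  As \<open>t \<mapsto> occupation_measure X t \<omega>\<close> is increasing, absolute continuity almost surely
  for each \<open>t\<close> gives absolute continuity for all \<open>t\<close> outside one null set.
\<close>
definition local_time :: "(real \<Rightarrow> 'a \<Rightarrow> real) \<Rightarrow> real \<Rightarrow> real \<Rightarrow> 'a \<Rightarrow> ennreal" where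
  "local_time X t y \<omega> = RN_deriv lborel (occupation_measure X t \<omega>) y"

section \<open>Convergence of finite measures on the line\<close>

text \<open>
  The library's \<open>weak_conv_m\<close> compares distribution functions and is meant for probability measures;
  here the total masses vary.
\<close>
definition weakly_converges :: "(nat \<Rightarrow> real measure) \<Rightarrow> real measure \<Rightarrow> bool" where
  "weakly_converges \<mu> \<nu> \<longleftrightarrow>
     (\<forall>n. finite_borel_measure (\<mu> n)) \<and> finite_borel_measure \<nu> \<and>
     (\<forall>g :: real \<Rightarrow> real. continuous_on UNIV g \<and> bounded (range g) \<longrightarrow>
        (\<lambda>n. \<integral>y. g y \<partial>\<mu> n) \<longlonglongrightarrow> (\<integral>y. g y \<partial>\<nu>))"

definition finite_random_measure :: "'a measure \<Rightarrow> ('a \<Rightarrow> real measure) \<Rightarrow> bool" where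
  "finite_random_measure M \<mu> \<longleftrightarrow>
     (\<forall>\<omega>\<in>space M. finite_borel_measure (\<mu> \<omega>)) \<and>
     (\<forall>A\<in>sets borel. (\<lambda>\<omega>. emeasure (\<mu> \<omega>) A) \<in> borel_measurable M)"

definition weak_sup_distance ::
    "(real \<Rightarrow> real) \<Rightarrow> real \<Rightarrow> (real \<Rightarrow> 'a \<Rightarrow> real measure) \<Rightarrow> (real \<Rightarrow> 'a \<Rightarrow> real measure) \<Rightarrow> 'a \<Rightarrow> ennreal"
  where
  "weak_sup_distance g T \<mu> \<nu> \<omega> =
     (SUP t\<in>{0..T}. ennreal \<bar>(\<integral>y. g y \<partial>\<mu> t \<omega>) - (\<integral>y. g y \<partial>\<nu> t \<omega>)\<bar>)"

definition weakly_locally_uniformly_in_probability ::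
    "'a measure \<Rightarrow> (real \<Rightarrow> real \<Rightarrow> 'a \<Rightarrow> real measure) \<Rightarrow> (real \<Rightarrow> 'a \<Rightarrow> real measure) \<Rightarrow> bool"
  where
  "weakly_locally_uniformly_in_probability M \<mu> \<nu> \<longleftrightarrow>
     (\<forall>c>0. \<forall>t\<ge>0. finite_random_measure M (\<mu> c t)) \<and>
     (\<forall>t\<ge>0. finite_random_measure M (\<nu> t)) \<and>
     (\<forall>(g :: real \<Rightarrow> real) T. continuous_on UNIV g \<and> bounded (range g) \<and> 0 \<le> T \<longrightarrow>
        (\<forall>c>0. weak_sup_distance g T (\<mu> c) \<nu> \<in> borel_measurable M) \<and>
        (\<forall>\<epsilon>>0. ((\<lambda>c. measure M {\<omega> \<in> space M. weak_sup_distance g T (\<mu> c) \<nu> \<omega> > ennreal \<epsilon>})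
                  \<longlongrightarrow> 0) (at_right 0)))"

end

theory Submission
  imports Defs
begin

text \<open>
  By self-similarity \<open>c powr (1 / H - 1) * TV\<^sup>c(B, [0, t])\<close> has the law of \<open>t / N * TV\<^sup>1(B, [0, N])\<close> with
  \<open>N = t * c powr (- 1 / H)\<close>. Truncated variation over adjacent intervals is additive up to \<open>c\<close>, so the
  limit \<open>C * t\<close> in \<open>L\<^sup>1\<close> comes from a law of large numbers for functionals of the increments on blocks.
  Such a law holds for trigonometric polynomials of the increments, because the covariances of distant
  increments tend to \<open>0\<close>, and extends to integrable functionals by density in \<open>L\<^sup>1\<close>.

  Along a subsequence the convergence holds almost surely at all rational times, hence at all times by
  monotonicity. The rest is an argument about a single continuous path \<open>x\<close>: since
  \<open>TV\<^sup>c \<le> \<integral>n\<^sup>y\<^sup>,\<^sup>c dy \<le> TV\<^sup>c + c\<close> on every interval, comparison on short intervals, where \<open>g \<circ> x\<close> is almost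
  constant, shows that \<open>c powr (1 / H - 1) * \<integral>g(y) n\<^sup>y\<^sup>,\<^sup>c dy\<close> tends to \<open>C * \<integral>\<^sub>0\<^sup>t g(x s) ds\<close>, the integral of \<open>g\<close>
  against \<open>C\<close> times the occupation measure. That this measure has a density follows from an energy
  estimate: two independent uniform times in \<open>[0, T]\<close> put \<open>B\<close> into the same dyadic cell of length \<open>2\<^sup>-\<^sup>n\<close>
  with probability \<open>O(2\<^sup>-\<^sup>n)\<close>.
\<close>

section \<open>Truncated variation of a continuous path\<close>

text \<open>The increments of B are dependent, and no rate of decay of their correlations is used: a
  mean ergodic statement in L^1 asks only that covariances of Gaussian linear forms tend to 0.
  Self-similarity is applied to one c at a time, so the limit holds in L^1 as c tends to 0 and
  almost surely only along subsequences; this is why the second claim is reached through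
  subsequences of subsequences.

  Every cut of the time interval has a price: c in truncated variation, at most two crossings per
  level in the crossing number. After scaling by c powr (1 / H - 1) both prices vanish, the second
  because H < 1. So the number of cuts can be fixed first and c sent to 0 afterwards.

  Measurability shapes much of the text. The suprema over divisions and over t in [0, T] and the
  quantifier over Lebesgue null sets are uncountable, and M need not be complete. Each is therefore
  replaced by countable operations valid for every outcome: dyadic grids, rational times with
  left-continuity in t, and a countable family of open sets that tests absolute continuity.\<close>

definition trunc_incr :: "real \<Rightarrow> (real \<Rightarrow> real) \<Rightarrow> real \<Rightarrow> real \<Rightarrow> real" where
  "trunc_incr c x a b = max (\<bar>x b - x a\<bar> - c) 0"

lemma trunc_incr_nonneg [simp]: "0 \<le> trunc_incr c x a b"
  by (simp add: trunc_incr_def)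

lemma trunc_incr_same [simp]: "0 \<le> c \<Longrightarrow> trunc_incr c x a a = 0"
  by (simp add: trunc_incr_def)

lemma truncated_variation_eq:
  "truncated_variation c x s t =
     (SUP \<pi>\<in>{\<pi>. \<pi> division_of {s..t}}. ennreal (\<Sum>I\<in>\<pi>. trunc_incr c x (Inf I) (Sup I)))"
  by (simp add: truncated_variation_def trunc_incr_def)

lemma trunc_incr_le_truncated_variation:
  assumes "s \<le> t"
  shows "ennreal (trunc_incr c x s t) \<le> truncated_variation c x s t"
proof -
  have "{{s..t}} division_of {s..t}"
    using division_of_self[of s t] assms by simp
  then have "ennreal (\<Sum>I\<in>{{s..t}}. trunc_incr c x (Inf I) (Sup I)) \<le> truncated_variation c x s t"
    unfolding truncated_variation_eq by (intro SUP_upper) auto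
  with assms show ?thesis by simp
qed

lemma ennreal_SUP_add_SUP_le:
  fixes f :: "'i \<Rightarrow> ennreal" and g :: "'j \<Rightarrow> ennreal"
  assumes "I \<noteq> {}" "J \<noteq> {}" "\<And>i j. i \<in> I \<Longrightarrow> j \<in> J \<Longrightarrow> f i + g j \<le> c"
  shows "(SUP i\<in>I. f i) + (SUP j\<in>J. g j) \<le> c"
proof -
  have "f i + (SUP j\<in>J. g j) \<le> c" if "i \<in> I" for i
    unfolding add.commute[of "f i"] ennreal_SUP_add_left[OF assms(2), symmetric]
    using assms(3)[OF that] by (intro SUP_least) (simp add: add.commute)
  then show ?thesis
    unfolding ennreal_SUP_add_left[OF assms(1), symmetric] by (intro SUP_least)
qed

lemma truncated_variation_superadditive:
  assumes "0 \<le> c" "s \<le> u" "u \<le> t"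
  shows "truncated_variation c x s u + truncated_variation c x u t \<le> truncated_variation c x s t"
proof -
  let ?S = "\<lambda>\<pi>. ennreal (\<Sum>I\<in>\<pi>. trunc_incr c x (Inf I) (Sup I))"
  have ne: "{\<pi>. \<pi> division_of {s..u}} \<noteq> {}" "{\<pi>. \<pi> division_of {u..t}} \<noteq> {}"
    by (metis (mono_tags) elementary_interval interval_cbox mem_Collect_eq empty_iff)+
  have *: "?S p + ?S q \<le> truncated_variation c x s t" if p: "p division_of {s..u}" and q: "q division_of {u..t}" for p q
  proof -
    have int: "interior {s..u} \<inter> interior {u..t} = {}" by auto
    have un: "{s..u} \<union> {u..t} = {s..t}" using assms by auto
    have pq: "(p \<union> q) division_of {s..t}"
      using division_disjoint_union[OF p q int] un by simp
    have fin: "finite p" "finite q" using p q by auto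
    \<comment> \<open>Divisions may contain degenerate intervals, so both may contain {u}. It would
      be counted twice in the two sums and once in the union; its truncated increment is 0 because c
      >= 0.\<close>
    have zero: "trunc_incr c x (Inf I) (Sup I) = 0" if "I \<in> p \<inter> q" for I
    proof -
      have "I \<subseteq> {s..u}" "I \<noteq> {}" "I \<subseteq> {u..t}"
        using that division_ofD(2,3)[OF p, of I] division_ofD(2)[OF q, of I] by auto
      then have "I \<subseteq> {s..u} \<inter> {u..t}" by blast
      moreover have "{s..u} \<inter> {u..t} \<subseteq> {u}" by auto
      ultimately have "I \<subseteq> {u}" by (rule subset_trans)
      with \<open>I \<noteq> {}\<close> have "I = {u}" by auto
      then show ?thesis using assms by simp
    qed
    have "(\<Sum>I\<in>p\<union>q. trunc_incr c x (Inf I) (Sup I)) = (\<Sum>I\<in>p. trunc_incr c x (Inf I) (Sup I)) + (\<Sum>I\<in>q. trunc_incr c x (Inf I) (Sup I))"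
      using sum.union_inter[OF fin, of "\<lambda>I. trunc_incr c x (Inf I) (Sup I)"] zero by simp
    then have "?S p + ?S q = ?S (p \<union> q)"
      by (simp add: ennreal_plus[symmetric] sum_nonneg del: ennreal_plus)
    also have "\<dots> \<le> truncated_variation c x s t"
      unfolding truncated_variation_eq using pq by (intro SUP_upper) auto
    finally show ?thesis .
  qed
  show ?thesis
    unfolding truncated_variation_eq[of c x s u] truncated_variation_eq[of c x u t]
    by (rule ennreal_SUP_add_SUP_le[OF ne]) (use * in auto)
qed

text \<open>Every estimate from above is obtained from a dominating increment, which telescopes over divisions.\<close>
lemma truncated_variation_le:
  fixes \<Psi> :: "real \<Rightarrow> real"
  assumes "s \<le> t"
    and "\<And>a b. s \<le> a \<Longrightarrow> a \<le> b \<Longrightarrow> b \<le> t \<Longrightarrow> trunc_incr c x a b \<le> \<Psi> b - \<Psi> a"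
  shows "truncated_variation c x s t \<le> ennreal (\<Psi> t - \<Psi> s)"
  unfolding truncated_variation_eq
proof (intro SUP_least ennreal_leI)
  fix p assume "p \<in> {\<pi>. \<pi> division_of {s..t}}"
  then have p: "p division_of {s..t}" by simp
  have bd: "Inf I \<in> I \<and> s \<le> Inf I \<and> Inf I \<le> Sup I \<and> Sup I \<le> t" if "I \<in> p" for I
  proof -
    obtain a b where "I = cbox a b" using division_ofD(4)[OF p \<open>I \<in> p\<close>] by blast
    moreover have "I \<noteq> {}" "I \<subseteq> {s..t}" using division_ofD(2,3)[OF p] that by auto
    ultimately show ?thesis by auto
  qed
  \<comment> \<open>Tagging each interval by its left end turns the division into a tagged one, for
    which sums of differences are known to telescope.\<close>
  have tag: "(\<lambda>I. (Inf I, I)) ` p tagged_division_of {s..t}"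
    unfolding tagged_division_of
  proof (intro conjI allI impI)
    show "finite ((\<lambda>I. (Inf I, I)) ` p)" using p by auto
    show "\<Union>{K. \<exists>x. (x, K) \<in> (\<lambda>I. (Inf I, I)) ` p} = {s..t}"
      using division_ofD(6)[OF p] by (auto simp: image_iff)
  next
    fix a K b K' assume "(a, K) \<in> (\<lambda>I. (Inf I, I)) ` p \<and> (b, K') \<in> (\<lambda>I. (Inf I, I)) ` p \<and> (a, K) \<noteq> (b, K')"
    then have "K \<in> p" "K' \<in> p" "K \<noteq> K'" by auto
    then show "interior K \<inter> interior K' = {}" by (rule division_ofD(5)[OF p])
  next
    fix a K assume "(a, K) \<in> (\<lambda>I. (Inf I, I)) ` p"
    then have K: "K \<in> p" "a = Inf K" by auto
    show "a \<in> K" "K \<subseteq> {s..t}" "\<exists>a b. K = cbox a b"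
      using bd[OF K(1)] K(2) division_ofD(2,4)[OF p K(1)] by auto
  qed
  have inj: "inj_on (\<lambda>I::real set. (Inf I, I)) p" by (auto simp: inj_on_def)
  have "(\<Sum>I\<in>p. trunc_incr c x (Inf I) (Sup I)) \<le> (\<Sum>I\<in>p. \<Psi> (Sup I) - \<Psi> (Inf I))"
    by (intro sum_mono assms(2)) (use bd in auto)
  also have "\<dots> = (\<Sum>(x, K)\<in>(\<lambda>I. (Inf I, I)) ` p. \<Psi> (Sup K) - \<Psi> (Inf K))"
    by (subst sum.reindex[OF inj]) simp
  also have "\<dots> = \<Psi> t - \<Psi> s"
    by (rule additive_tagged_division_1[OF assms(1) tag])
  finally show "(\<Sum>I\<in>p. trunc_incr c x (Inf I) (Sup I)) \<le> \<Psi> t - \<Psi> s" .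
qed

text \<open>A real-valued version. The default 0 of \<open>enn2real\<close> at infinity never occurs
  for continuous x and c > 0, by \<open>truncated_variation_finite\<close>.\<close>

definition tv :: "real \<Rightarrow> (real \<Rightarrow> real) \<Rightarrow> real \<Rightarrow> real \<Rightarrow> real" where
  "tv c x s t = enn2real (truncated_variation c x s t)"

lemma tv_nonneg [simp]: "0 \<le> tv c x s t"
  by (simp add: tv_def)

lemma tv_le:
  fixes \<Psi> :: "real \<Rightarrow> real"
  assumes "s \<le> t"
    and "\<And>a b. s \<le> a \<Longrightarrow> a \<le> b \<Longrightarrow> b \<le> t \<Longrightarrow> trunc_incr c x a b \<le> \<Psi> b - \<Psi> a"
  shows "tv c x s t \<le> \<Psi> t - \<Psi> s"
proof -
  have "0 \<le> trunc_incr c x s t" by simp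
  also have "\<dots> \<le> \<Psi> t - \<Psi> s" using assms(2)[of s t] assms(1) by simp
  finally have "0 \<le> \<Psi> t - \<Psi> s" .
  then show ?thesis
    unfolding tv_def using truncated_variation_le[OF assms] by (simp add: enn2real_leI)
qed

lemma uniform_modulus:
  fixes x :: "real \<Rightarrow> real"
  assumes "continuous_on {s..t} x" "0 < d"
  obtains \<eta> where "0 < \<eta>" "\<And>a b. a \<in> {s..t} \<Longrightarrow> b \<in> {s..t} \<Longrightarrow> \<bar>b - a\<bar> < \<eta> \<Longrightarrow> \<bar>x b - x a\<bar> < d"
proof -
  obtain \<eta> where "0 < \<eta>" "\<forall>a\<in>{s..t}. \<forall>b\<in>{s..t}. dist b a < \<eta> \<longrightarrow> dist (x b) (x a) < d"
    using compact_uniformly_continuous[OF assms(1) compact_Icc] assms(2)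
    unfolding uniformly_continuous_on_def by blast
  then show ?thesis using that by (simp add: dist_real_def)
qed

lemma path_bound:
  fixes x :: "real \<Rightarrow> real"
  assumes "continuous_on {s..t} x"
  obtains R where "0 < R" "\<And>a. a \<in> {s..t} \<Longrightarrow> \<bar>x a\<bar> < R"
proof -
  have "bounded (x ` {s..t})"
    using assms by (intro compact_imp_bounded compact_continuous_image) auto
  then obtain R where R: "\<forall>a\<in>{s..t}. \<bar>x a\<bar> \<le> R"
    unfolding bounded_real by blast
  then have "\<bar>x a\<bar> < \<bar>R\<bar> + 1" if "a \<in> {s..t}" for a
    using bspec[OF R that] by linarith
  moreover have "0 < \<bar>R\<bar> + 1" by simp
  ultimately show ?thesis using that by blast
qed

text \<open>Replacing \<open>c\<close> by a smaller \<open>c - d\<close> costs at most \<open>d\<close> for each interval that is not short.\<close>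
lemma trunc_incr_shift:
  assumes "0 \<le> d" "0 < \<eta>" "a \<le> b" "\<bar>b - a\<bar> < \<eta> \<Longrightarrow> \<bar>x b - x a\<bar> \<le> c - d"
  shows "trunc_incr (c - d) x a b \<le> trunc_incr c x a b + d * (b - a) / \<eta>"
proof (cases "b - a < \<eta>")
  case True
  with assms have "trunc_incr (c - d) x a b = 0" by (simp add: trunc_incr_def)
  with assms show ?thesis by (simp add: trunc_incr_def)
next
  case False
  with assms have "1 \<le> (b - a) / \<eta>" by (simp add: field_simps)
  from mult_left_mono[OF this assms(1)] have "d \<le> d * (b - a) / \<eta>" by simp
  then show ?thesis using assms by (auto simp: trunc_incr_def)
qed

text \<open>Intervals shorter than \<eta> contribute nothing, since x moves by less than c on them.
  A longer one contributes at most 2 R, hence at most 2 R / \<eta> times its length, and a linear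
  function dominates all truncated increments.\<close>

lemma truncated_variation_finite:
  assumes "continuous_on {s..t} x" "0 < c" "s \<le> t"
  shows "truncated_variation c x s t < \<infinity>"
proof -
  obtain R where R: "0 < R" "\<And>a. a \<in> {s..t} \<Longrightarrow> \<bar>x a\<bar> < R" using path_bound[OF assms(1)] by blast
  obtain \<eta> where \<eta>: "0 < \<eta>" "\<And>a b. a \<in> {s..t} \<Longrightarrow> b \<in> {s..t} \<Longrightarrow> \<bar>b - a\<bar> < \<eta> \<Longrightarrow> \<bar>x b - x a\<bar> < c"
    using uniform_modulus[OF assms(1,2)] by blast
  have "truncated_variation c x s t \<le> ennreal ((2*R/\<eta>) * t - (2*R/\<eta>) * s)"
  proof (rule truncated_variation_le[OF assms(3)])
    fix a b assume ab: "s \<le> a" "a \<le> b" "b \<le> t"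
    show "trunc_incr c x a b \<le> (2*R/\<eta>) * b - (2*R/\<eta>) * a"
    proof (cases "b - a < \<eta>")
      case True
      then have "\<bar>x b - x a\<bar> < c" using ab \<eta>(2) by auto
      then have "trunc_incr c x a b = 0" by (simp add: trunc_incr_def)
      moreover have "(2*R/\<eta>) * a \<le> (2*R/\<eta>) * b" using ab R(1) \<eta>(1) by (intro mult_left_mono) auto
      ultimately show ?thesis by simp
    next
      case False
      have "trunc_incr c x a b \<le> 2 * R"
        using R(2)[of a] R(2)[of b] ab assms(2) by (auto simp: trunc_incr_def)
      also have "\<dots> \<le> 2 * R * ((b - a) / \<eta>)"
        using mult_left_mono[of 1 "(b - a) / \<eta>" "2 * R"] False \<eta>(1) R(1) by simp
      finally show ?thesis by (simp add: algebra_simps diff_divide_distrib)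
    qed
  qed
  also have "\<dots> < \<infinity>" by simp
  finally show ?thesis .
qed

section \<open>Additivity of the truncated variation up to the truncation level\<close>

locale continuous_path =
  fixes x :: "real \<Rightarrow> real" and s0 t0 :: real
  assumes cont: "continuous_on {s0..t0} x"
begin

lemma cont_sub: "s0 \<le> s \<Longrightarrow> t \<le> t0 \<Longrightarrow> continuous_on {s..t} x"
  using cont by (rule continuous_on_subset) auto

context
  fixes c :: real assumes c: "0 < c"
begin

lemma ennreal_tv:
  assumes "s0 \<le> s" "s \<le> t" "t \<le> t0"
  shows "truncated_variation c x s t = ennreal (tv c x s t)"
  using truncated_variation_finite[OF cont_sub c] assms by (simp add: tv_def less_top)

lemma trunc_incr_le_tv:
  assumes "s0 \<le> s" "s \<le> t" "t \<le> t0"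
  shows "trunc_incr c x s t \<le> tv c x s t"
  using trunc_incr_le_truncated_variation[of s t c x] ennreal_tv[OF assms] assms(2)
  by (simp)

lemma tv_superadditive:
  assumes "s0 \<le> s" "s \<le> u" "u \<le> t" "t \<le> t0"
  shows "tv c x s u + tv c x u t \<le> tv c x s t"
  using truncated_variation_superadditive[of c s u t x] ennreal_tv[of s u] ennreal_tv[of u t] ennreal_tv[of s t] assms c
  by (simp add: ennreal_plus[symmetric] del: ennreal_plus)

lemma tv_mono:
  assumes "s0 \<le> s" "s \<le> u" "u \<le> t" "t \<le> t0"
  shows "tv c x s u \<le> tv c x s t"
  using tv_superadditive[OF assms] tv_nonneg[of c x u t] by linarith

text \<open>The dominating function follows the truncated variation from s up to u, jumps by c, and
  continues with the truncated variation from u. An increment across u is split at u; both parts are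
  then truncated, and the jump repays the second c.\<close>

lemma tv_subadditive:
  assumes "s0 \<le> s" "s \<le> u" "u \<le> t" "t \<le> t0"
  shows "tv c x s t \<le> tv c x s u + tv c x u t + c"
proof -
  let ?\<Psi> = "\<lambda>v. if v \<le> u then tv c x s v else tv c x s u + c + tv c x u v"
  have "tv c x s t \<le> ?\<Psi> t - ?\<Psi> s"
  proof (rule tv_le)
    fix a b assume ab: "s \<le> a" "a \<le> b" "b \<le> t"
    consider "b \<le> u" | "u < a" | "a \<le> u" "u < b" using ab by linarith
    then show "trunc_incr c x a b \<le> ?\<Psi> b - ?\<Psi> a"
    proof cases
      case 1
      then show ?thesis using ab assms trunc_incr_le_tv[of a b] tv_superadditive[of s a b] by auto
    next
      case 2
      then show ?thesis using ab assms trunc_incr_le_tv[of a b] tv_superadditive[of u a b] by auto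
    next
      case 3
      have "trunc_incr c x a b \<le> trunc_incr c x a u + trunc_incr c x u b + c"
        using c by (auto simp: trunc_incr_def max_def)
      then show ?thesis using 3 ab assms trunc_incr_le_tv[of a u] trunc_incr_le_tv[of u b]
         tv_superadditive[of s a u] by auto
    qed
  qed (use assms in auto)
  moreover have "tv c x s s = 0"
    using tv_le[of s s c x "\<lambda>_. 0"] tv_nonneg[of c x s s] c
    by (smt (verit) trunc_incr_same)
  ultimately show ?thesis using assms
    by (cases "t \<le> u") (auto split: if_splits simp: antisym, insert c, auto)
qed

end

end

lemma tv_self [simp]: "0 \<le> c \<Longrightarrow> tv c x s s = 0"
  using tv_le[of s s c x "\<lambda>_. 0"] tv_nonneg[of c x s s]
  by (smt (verit) trunc_incr_same)

text \<open>Allows the path restarted at a later time to be read as an increment path, to which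
  stationarity applies.\<close>

lemma truncated_variation_increments:
  assumes "\<And>u v. u \<in> {s..t} \<Longrightarrow> v \<in> {s..t} \<Longrightarrow> x v - x u = y v - y u"
  shows "truncated_variation c x s t = truncated_variation c y s t"
  unfolding truncated_variation_eq
proof (rule SUP_cong[OF refl])
  fix p assume "p \<in> {\<pi>. \<pi> division_of {s..t}}"
  then have p: "p division_of {s..t}" by simp
  have "trunc_incr c x (Inf I) (Sup I) = trunc_incr c y (Inf I) (Sup I)" if "I \<in> p" for I
  proof -
    obtain a b where "I = cbox a b" using division_ofD(4)[OF p \<open>I \<in> p\<close>] by blast
    moreover have "I \<noteq> {}" "I \<subseteq> {s..t}" using division_ofD(2,3)[OF p] that by auto
    ultimately have "Inf I \<in> {s..t}" "Sup I \<in> {s..t}" by auto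
    from assms[OF this] show ?thesis by (simp add: trunc_incr_def)
  qed
  then show "ennreal (\<Sum>I\<in>p. trunc_incr c x (Inf I) (Sup I)) = ennreal (\<Sum>I\<in>p. trunc_incr c y (Inf I) (Sup I))"
    by simp
qed

lemma tv_scale_le:
  assumes x: "continuous_on {A * s + d..A * t + d} x" and "0 < A" "0 < k" "0 < c" "s \<le> t"
  shows "tv (k * c) (\<lambda>u. k * x (A * u + d)) s t \<le> k * tv c x (A * s + d) (A * t + d)"
proof -
  interpret continuous_path x "A * s + d" "A * t + d" by standard (rule x)
  have "tv (k * c) (\<lambda>u. k * x (A * u + d)) s t
      \<le> k * tv c x (A * s + d) (A * t + d) - k * tv c x (A * s + d) (A * s + d)"
  proof (rule tv_le[OF \<open>s \<le> t\<close>])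
    fix a b assume ab: "s \<le> a" "a \<le> b" "b \<le> t"
    then have le: "A * s \<le> A * a" "A * a \<le> A * b" "A * b \<le> A * t" using assms by auto
    have "\<bar>k * x (A * b + d) - k * x (A * a + d)\<bar> - k * c = k * (\<bar>x (A * b + d) - x (A * a + d)\<bar> - c)"
      using \<open>0 < k\<close> by (simp add: right_diff_distrib[symmetric] abs_mult)
    then have "trunc_incr (k * c) (\<lambda>u. k * x (A * u + d)) a b = k * trunc_incr c x (A * a + d) (A * b + d)"
      using \<open>0 < k\<close> max_mult_distrib_left[of k "\<bar>x (A * b + d) - x (A * a + d)\<bar> - c" 0]
      by (simp add: trunc_incr_def)
    also have "\<dots> \<le> k * tv c x (A * a + d) (A * b + d)"
      using \<open>0 < k\<close> le \<open>0 < c\<close> by (intro mult_left_mono trunc_incr_le_tv) auto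
    also have "\<dots> \<le> k * (tv c x (A * s + d) (A * b + d) - tv c x (A * s + d) (A * a + d))"
      using \<open>0 < k\<close> le tv_superadditive[OF \<open>0 < c\<close>, of "A * s + d" "A * a + d" "A * b + d"]
      by (intro mult_left_mono) auto
    finally show "trunc_incr (k * c) (\<lambda>u. k * x (A * u + d)) a b
       \<le> k * tv c x (A * s + d) (A * b + d) - k * tv c x (A * s + d) (A * a + d)"
      by (simp add: right_diff_distrib)
  qed
  then show ?thesis using \<open>0 < c\<close> by simp
qed

text \<open>The reverse inequality is \<open>tv_scale_le\<close> for the inverse substitution, with
  factors 1 / A and 1 / k.\<close>

lemma tv_scale:
  assumes x: "continuous_on {A * s + d..A * t + d} x" and "0 < A" "0 < k" "0 < c" "s \<le> t"
  shows "tv (k * c) (\<lambda>u. k * x (A * u + d)) s t = k * tv c x (A * s + d) (A * t + d)"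
proof (rule antisym[OF tv_scale_le[OF assms]])
  let ?y = "\<lambda>u. k * x (A * u + d)"
  have cy: "continuous_on {s..t} ?y"
    using assms(2) by (intro continuous_intros continuous_on_compose2[OF x]) auto
  have e: "(1 / A) * (A * s + d) + (- d / A) = s" "(1 / A) * (A * t + d) + (- d / A) = t"
    using assms(2) by (simp_all add: field_simps)
  have f: "(1/k) * ?y ((1/A) * u + (- d/A)) = x u" for u
    using assms(2,3) by (simp add: field_simps)
  have "tv ((1/k) * (k * c)) (\<lambda>u. (1/k) * ?y ((1/A) * u + (- d/A))) (A * s + d) (A * t + d) \<le> (1/k) * tv (k * c) ?y s t"
    using tv_scale_le[of "1/A" "A * s + d" "- d/A" "A * t + d" ?y "1/k" "k * c"] cy assms(2-5) by (simp only: e) simp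
  then have "tv c x (A * s + d) (A * t + d) \<le> (1/k) * tv (k * c) ?y s t"
    unfolding f using assms(3) by simp
  then show "k * tv c x (A * s + d) (A * t + d) \<le> tv (k * c) ?y s t"
    using assms(3) by (simp add: field_simps)
qed

section \<open>Discrete truncated variation\<close>

text \<open>
  For a sequence \<open>a\<close> the recursion computes \<open>W n\<close>, the truncated variation of \<open>a 0, \<dots>, a n\<close>, together
  with the maxima over \<open>i \<le> n\<close> of \<open>W i - a i\<close> and \<open>W i + a i\<close>, which determine the next value.
\<close>
primrec dtv_state :: "real \<Rightarrow> (nat \<Rightarrow> real) \<Rightarrow> nat \<Rightarrow> real \<times> real \<times> real" where
  "dtv_state c a 0 = (0, - a 0, a 0)"
| "dtv_state c a (Suc n) = (case dtv_state c a n of (W, L, U) \<Rightarrow>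
     let W' = max W (max (L + a (Suc n) - c) (U - a (Suc n) - c))
     in (W', max L (W' - a (Suc n)), max U (W' + a (Suc n))))"

definition dtv :: "real \<Rightarrow> (nat \<Rightarrow> real) \<Rightarrow> nat \<Rightarrow> real" where
  "dtv c a n = fst (dtv_state c a n)"

lemma dtv_0 [simp]: "dtv c a 0 = 0"
  by (simp add: dtv_def)

lemma dtv_Suc_ge: "dtv c a n \<le> dtv c a (Suc n)"
  by (simp add: dtv_def Let_def case_prod_beta)

lemma dtv_mono: "i \<le> j \<Longrightarrow> dtv c a i \<le> dtv c a j"
  by (rule lift_Suc_mono_le[of "dtv c a"]) (rule dtv_Suc_ge)

lemma dtv_nonneg [simp]: "0 \<le> dtv c a n"
  using dtv_mono[of 0 n c a] by simp

lemma dtv_state_ge: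
  "i \<le> n \<Longrightarrow> dtv c a i - a i \<le> fst (snd (dtv_state c a n)) \<and> dtv c a i + a i \<le> snd (snd (dtv_state c a n))"
proof (induction n)
  case (Suc n)
  obtain W L U where st: "dtv_state c a n = (W, L, U)" by (cases "dtv_state c a n")
  define W' where "W' = max W (max (L + a (Suc n) - c) (U - a (Suc n) - c))"
  have st': "dtv_state c a (Suc n) = (W', max L (W' - a (Suc n)), max U (W' + a (Suc n)))"
    by (simp add: st W'_def Let_def)
  show ?case
  proof (cases "i = Suc n")
    case True
    then show ?thesis by (simp add: dtv_def st' del: dtv_state.simps)
  next
    case False
    with Suc have "dtv c a i - a i \<le> L \<and> dtv c a i + a i \<le> U" by (simp add: st)
    then show ?thesis unfolding st' fst_conv snd_conv by (blast intro: max.coboundedI1)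
  qed
qed simp

lemma dtv_increment:
  assumes "i \<le> j" "0 \<le> c"
  shows "max (\<bar>a j - a i\<bar> - c) 0 \<le> dtv c a j - dtv c a i"
proof (cases "i = j")
  case False
  then obtain n where n: "j = Suc n" "i \<le> n" using assms by (cases j) auto
  obtain W L U where st: "dtv_state c a n = (W, L, U)" by (cases "dtv_state c a n")
  have "dtv c a j = max (dtv c a n) (max (L + a j - c) (U - a j - c))"
    by (simp add: n(1) dtv_def st Let_def)
  then have "L + a j - c \<le> dtv c a j" "U - a j - c \<le> dtv c a j" by simp_all
  moreover have "dtv c a i - a i \<le> L" "dtv c a i + a i \<le> U"
    using dtv_state_ge[OF n(2), of c a] by (simp_all add: st)
  ultimately have "dtv c a j \<ge> dtv c a i + \<bar>a j - a i\<bar> - c" by linarith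
  with dtv_mono[OF assms(1), of c a] show ?thesis by auto
qed (use assms in auto)

text \<open>With \<open>dtv_increment\<close> this identifies \<open>dtv\<close> as the least
  dominating function that starts at a nonnegative value, which is what the truncated variation of a
  finite sequence is. The induction carries along that the two stored maxima are bounded by \<Psi> i
  - a i and \<Psi> j + a j for suitable earlier indices i and j.\<close>

lemma dtv_le:
  assumes "0 \<le> \<Psi> 0" "\<And>i j. i \<le> j \<Longrightarrow> j \<le> n \<Longrightarrow> max (\<bar>a j - a i\<bar> - c) 0 \<le> \<Psi> j - \<Psi> i"
  shows "dtv c a n \<le> \<Psi> n"
proof -
  have "k \<le> n \<Longrightarrow> dtv c a k \<le> \<Psi> k \<and> (\<exists>i\<le>k. fst (snd (dtv_state c a k)) \<le> \<Psi> i - a i) \<and>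
      (\<exists>i\<le>k. snd (snd (dtv_state c a k)) \<le> \<Psi> i + a i)" for k
  proof (induction k)
    case (Suc k)
    obtain W L U where st: "dtv_state c a k = (W, L, U)" by (cases "dtv_state c a k") auto
    have "W \<le> \<Psi> k" "\<exists>i\<le>k. L \<le> \<Psi> i - a i" "\<exists>i\<le>k. U \<le> \<Psi> i + a i"
      using Suc st by (simp_all add: dtv_def)
    then obtain i j where W: "W \<le> \<Psi> k" and i: "i \<le> k" "L \<le> \<Psi> i - a i" and j: "j \<le> k" "U \<le> \<Psi> j + a j"
      by blast
    define W' where "W' = max W (max (L + a (Suc k) - c) (U - a (Suc k) - c))"
    have W': "W' \<le> \<Psi> (Suc k)"
    proof -
      have "\<bar>a (Suc k) - a i\<bar> - c \<le> \<Psi> (Suc k) - \<Psi> i" "\<bar>a (Suc k) - a j\<bar> - c \<le> \<Psi> (Suc k) - \<Psi> j"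
        "0 \<le> \<Psi> (Suc k) - \<Psi> k"
        using assms(2)[of i "Suc k"] assms(2)[of j "Suc k"] assms(2)[of k "Suc k"] i j Suc.prems by simp_all
      then show ?thesis unfolding W'_def max.bounded_iff using i j W by linarith
    qed
    have "\<exists>i\<le>Suc k. max L (W' - a (Suc k)) \<le> \<Psi> i - a i"
    proof (cases "W' - a (Suc k) \<le> L")
      case True
      with i show ?thesis unfolding max_absorb1[OF True] by (meson le_SucI)
    next
      case False
      then have "max L (W' - a (Suc k)) = W' - a (Suc k)" by (intro max_absorb2) linarith
      with W' show ?thesis by (metis diff_right_mono le_refl)
    qed
    moreover have "\<exists>i\<le>Suc k. max U (W' + a (Suc k)) \<le> \<Psi> i + a i"
    proof (cases "W' + a (Suc k) \<le> U")
      case True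
      with j show ?thesis unfolding max_absorb1[OF True] by (meson le_SucI)
    next
      case False
      then have "max U (W' + a (Suc k)) = W' + a (Suc k)" by (intro max_absorb2) linarith
      with W' show ?thesis by (metis add_right_mono le_refl)
    qed
    moreover have "dtv_state c a (Suc k) = (W', max L (W' - a (Suc k)), max U (W' + a (Suc k)))"
      by (simp add: st W'_def Let_def)
    ultimately show ?case using W' unfolding dtv_def by (simp only: fst_conv snd_conv simp_thms)
  qed (use assms(1) in \<open>auto simp: dtv_def\<close>)
  then show ?thesis by auto
qed

text \<open>The gain from the recursive form: finitely many maxima and sums of coordinates, with no
  supremum over divisions.\<close>

lemma measurable_dtv_state [measurable]:
  assumes [measurable]: "\<And>k. a k \<in> borel_measurable N"
  shows "(\<lambda>\<omega>. dtv_state c (\<lambda>k. a k \<omega>) n) \<in> measurable N (borel \<Otimes>\<^sub>M borel \<Otimes>\<^sub>M borel)"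
proof (induction n)
  case (Suc n)
  note [measurable] = Suc.IH
  show ?case by (simp add: Let_def case_prod_beta)
qed simp

lemma measurable_dtv [measurable]:
  assumes [measurable]: "\<And>k. a k \<in> borel_measurable N"
  shows "(\<lambda>\<omega>. dtv c (\<lambda>k. a k \<omega>) n) \<in> borel_measurable N"
  unfolding dtv_def by measurable

section \<open>Approximation of the truncated variation on grids\<close>

definition grid_index :: "real \<Rightarrow> nat \<Rightarrow> real \<Rightarrow> nat" where
  "grid_index t N u = nat \<lfloor>u * real N / t\<rfloor>"

lemma grid_index_mono: "0 < t \<Longrightarrow> u \<le> v \<Longrightarrow> grid_index t N u \<le> grid_index t N v"
  unfolding grid_index_def by (intro nat_mono floor_mono divide_right_mono mult_right_mono) auto

lemma grid_index_end: "0 < t \<Longrightarrow> grid_index t N t = N"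
  by (simp add: grid_index_def)

lemma grid_index_near:
  assumes "0 < t" "0 \<le> u" "u \<le> t" "0 < N"
  shows "0 \<le> u - t * real (grid_index t N u) / real N" "u - t * real (grid_index t N u) / real N < t / real N"
    "grid_index t N u \<le> N"
proof -
  let ?r = "u * real N / t"
  have "0 \<le> ?r" using assms by simp
  then have "real (grid_index t N u) = of_int \<lfloor>?r\<rfloor>" by (simp add: grid_index_def)
  then have k: "real (grid_index t N u) \<le> ?r" "?r < real (grid_index t N u) + 1" by linarith+
  show "0 \<le> u - t * real (grid_index t N u) / real N" "u - t * real (grid_index t N u) / real N < t / real N"
  proof -
    have "t * real (grid_index t N u) \<le> u * real N" using k(1) assms by (simp add: field_simps)
    then show "0 \<le> u - t * real (grid_index t N u) / real N" using assms by (simp add: field_simps)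
    have "u * real N < t * (real (grid_index t N u) + 1)" using k(2) assms by (simp add: field_simps)
    then have "u < t * (real (grid_index t N u) + 1) / real N" using assms by (simp add: pos_less_divide_eq)
    then show "u - t * real (grid_index t N u) / real N < t / real N" by (simp add: add_divide_distrib distrib_left)
  qed
  show "grid_index t N u \<le> N"
    using grid_index_mono[of t u t N] grid_index_end[of t N] assms by simp
qed

lemma grid_point_in: "0 \<le> t \<Longrightarrow> k \<le> N \<Longrightarrow> 0 < N \<Longrightarrow> t * real k / real N \<in> {0..t}"
  by (auto simp: field_simps mult_left_mono)

text \<open>A countable supremum of functions of finitely many coordinates. It is thus measurable on
  the product space of all paths, whose elements need not be continuous, and equals the truncated
  variation on the continuous ones.\<close>

definition dyadic_tv :: "real \<Rightarrow> (real \<Rightarrow> real) \<Rightarrow> real \<Rightarrow> ennreal" where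
  "dyadic_tv c x t = (SUP m. ennreal (dtv c (\<lambda>k. x (t * real k / 2 ^ m)) (2 ^ m)))"

lemma dtv_le_tv:
  assumes "continuous_on {0..t} x" "0 < c" "0 \<le> t" "0 < N"
  shows "dtv c (\<lambda>k. x (t * real k / real N)) N \<le> tv c x 0 t"
proof -
  interpret continuous_path x 0 t by standard fact
  let ?q = "\<lambda>k. t * real k / real N"
  have "dtv c (\<lambda>k. x (?q k)) N \<le> tv c x 0 (?q N)"
  proof (rule dtv_le[where \<Psi> = "\<lambda>k. tv c x 0 (?q k)"])
    fix i j assume ij: "i \<le> j" "j \<le> N"
    then have "?q i \<le> ?q j" using assms by (intro divide_right_mono mult_left_mono) auto
    moreover have "?q i \<in> {0..t}" "?q j \<in> {0..t}" using ij assms by (auto intro!: grid_point_in simp del: atLeastAtMost_iff)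
    ultimately show "max (\<bar>x (?q j) - x (?q i)\<bar> - c) 0 \<le> tv c x 0 (?q j) - tv c x 0 (?q i)"
      using trunc_incr_le_tv[OF assms(2), of "?q i" "?q j"] tv_superadditive[OF assms(2), of 0 "?q i" "?q j"]
        tv_nonneg[of c x "?q i" "?q j"]
      unfolding trunc_incr_def by (intro max.boundedI) (simp_all del: tv_nonneg)
  qed simp
  then show ?thesis using assms by simp
qed

text \<open>For the upper bound, every time is rounded down to a fine dyadic grid, which changes
  each increment by at most 2 \<delta>. Intervals shorter than \<eta> have no truncated increment at
  all, so the error is paid only by the long ones and can be charged to their length.\<close>

lemma truncated_variation_eq_dyadic_tv:
  assumes x: "continuous_on {0..t} x" and c: "0 < c" and t: "0 < t"
  shows "truncated_variation c x 0 t = dyadic_tv c x t"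
proof (rule antisym)
  interpret continuous_path x 0 t by standard fact
  show "dyadic_tv c x t \<le> truncated_variation c x 0 t"
    unfolding dyadic_tv_def
  proof (rule SUP_least)
    fix m
    show "ennreal (dtv c (\<lambda>k. x (t * real k / 2 ^ m)) (2 ^ m)) \<le> truncated_variation c x 0 t"
      using dtv_le_tv[OF x c, of "2 ^ m"] t ennreal_tv[OF c, of 0 t] by (simp add: ennreal_leI)
  qed
  show "truncated_variation c x 0 t \<le> dyadic_tv c x t"
  proof (rule ennreal_le_epsilon)
    fix e :: real assume e: "0 < e"
    obtain \<eta> where \<eta>: "0 < \<eta>" "\<And>a b. a \<in> {0..t} \<Longrightarrow> b \<in> {0..t} \<Longrightarrow> \<bar>b - a\<bar> < \<eta> \<Longrightarrow> \<bar>x b - x a\<bar> < c"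
      using uniform_modulus[OF x c] by blast
    \<comment> \<open>Chosen so that the total charge 2 \<delta> t / \<eta> over [0, t] is
      e.\<close>
    define \<delta> where "\<delta> = e * \<eta> / (2 * t)"
    have \<delta>: "0 < \<delta>" using e \<eta>(1) t by (simp add: \<delta>_def)
    obtain \<zeta> where \<zeta>: "0 < \<zeta>" "\<And>a b. a \<in> {0..t} \<Longrightarrow> b \<in> {0..t} \<Longrightarrow> \<bar>b - a\<bar> < \<zeta> \<Longrightarrow> \<bar>x b - x a\<bar> < \<delta>"
      using uniform_modulus[OF x \<delta>] by blast
    obtain m :: nat where m: "t / \<zeta> < 2 ^ m" using real_arch_pow[of 2 "t / \<zeta>"] by auto
    define N :: nat where "N = 2 ^ m"
    have N: "0 < N" "t / real N < \<zeta>" using m \<zeta>(1) by (simp_all add: N_def field_simps)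
    let ?q = "\<lambda>k. t * real k / real N"
    let ?k = "grid_index t N"
    let ?W = "dtv c (\<lambda>k. x (?q k))"
    have near: "\<bar>x u - x (?q (?k u))\<bar> < \<delta>" if "0 \<le> u" "u \<le> t" for u
    proof (rule \<zeta>(2))
      show "?q (?k u) \<in> {0..t}" using grid_index_near(3)[OF t that N(1)] t N(1) by (intro grid_point_in) auto
      show "\<bar>u - ?q (?k u)\<bar> < \<zeta>" using grid_index_near(1,2)[OF t that N(1)] N(2) by linarith
    qed (use that in auto)
    have "truncated_variation c x 0 t \<le> ennreal ((real_of_nat 0 + ?W (?k t) + 2 * \<delta> * t / \<eta>) - (?W (?k 0) + 2 * \<delta> * 0 / \<eta>))"
      unfolding of_nat_0 add_0
    proof (rule truncated_variation_le[where \<Psi> = "\<lambda>v. ?W (?k v) + 2 * \<delta> * v / \<eta>"])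
      fix a b assume ab: "0 \<le> a" "a \<le> b" "b \<le> t"
      have W: "max (\<bar>x (?q (?k b)) - x (?q (?k a))\<bar> - c) 0 \<le> ?W (?k b) - ?W (?k a)"
        using dtv_increment[OF grid_index_mono[OF t ab(2), of N], of c "\<lambda>k. x (?q k)"] c by simp
      show "trunc_incr c x a b \<le> (?W (?k b) + 2 * \<delta> * b / \<eta>) - (?W (?k a) + 2 * \<delta> * a / \<eta>)"
      proof (cases "b - a < \<eta>")
        case True
        then have "\<bar>x b - x a\<bar> < c" using \<eta>(2)[of a b] ab by auto
        then have "trunc_incr c x a b = 0" by (simp add: trunc_incr_def)
        moreover have "2 * \<delta> * a / \<eta> \<le> 2 * \<delta> * b / \<eta>" using ab \<delta> \<eta>(1) by (intro divide_right_mono mult_left_mono) auto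
        ultimately show ?thesis using W by linarith
      next
        case False
        have "trunc_incr c x a b \<le> max (\<bar>x (?q (?k b)) - x (?q (?k a))\<bar> - c) 0 + 2 * \<delta>"
          using near[of a] near[of b] ab \<delta> by (auto simp: trunc_incr_def)
        moreover have "2 * \<delta> \<le> 2 * \<delta> * ((b - a) / \<eta>)"
          using mult_left_mono[of 1 "(b - a) / \<eta>" "2 * \<delta>"] False \<eta>(1) \<delta> by simp
        ultimately show ?thesis using W by (simp add: algebra_simps diff_divide_distrib)
      qed
    qed (use t in auto)
    also have "\<dots> \<le> ennreal (?W N + e)"
      using t \<eta>(1) dtv_nonneg[of c "\<lambda>k. x (?q k)" "?k 0"] by (intro ennreal_leI) (simp add: grid_index_end \<delta>_def)
    also have "\<dots> = ennreal (?W N) + ennreal e" using e by simp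
    also have "ennreal (?W N) \<le> dyadic_tv c x t"
      unfolding dyadic_tv_def N_def by (rule SUP_upper2[of m]) auto
    finally show "truncated_variation c x 0 t \<le> dyadic_tv c x t + ennreal e" by (simp add: add_right_mono)
  qed
qed

section \<open>Dyadic chaining\<close>

text \<open>If g j i belongs to the dyadic interval of level j with left end i / 2^j, this is the
  total of g over all dyadic intervals of levels up to m that lie inside [0, k / 2^m]. Passing to
  the next coarser level replaces k by k div 2.\<close>

primrec dyadic_excess :: "(nat \<Rightarrow> nat \<Rightarrow> real) \<Rightarrow> nat \<Rightarrow> nat \<Rightarrow> real" where
  "dyadic_excess g 0 k = (\<Sum>i<k. g 0 i)"
| "dyadic_excess g (Suc m) k = dyadic_excess g m (k div 2) + (\<Sum>i<k. g (Suc m) i)"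

lemma dyadic_excess_mono:
  assumes "\<And>j i. 0 \<le> g j i" "k \<le> l"
  shows "dyadic_excess g m k \<le> dyadic_excess g m l"
  using assms(2)
proof (induction m arbitrary: k l)
  case (Suc m)
  have "(\<Sum>i<k. g (Suc m) i) \<le> (\<Sum>i<l. g (Suc m) i)"
    using Suc.prems assms(1) by (intro sum_mono2) auto
  moreover have "dyadic_excess g m (k div 2) \<le> dyadic_excess g m (l div 2)"
    using Suc by (simp add: div_le_mono)
  ultimately show ?case by simp
qed (use assms(1) in \<open>auto intro!: sum_mono2\<close>)

lemma dyadic_excess_full:
  "dyadic_excess g m (2 ^ m) = (\<Sum>j\<le>m. \<Sum>i<2 ^ j. g j i)"
  by (induction m) auto

lemma dyadic_excess_0 [simp]: "dyadic_excess g m 0 = 0"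
  by (induction m) auto

text \<open>Induction on the level. The left end is rounded up and the right end down to even
  indices; each rounding is at most one step of the finest level and costs its threshold plus its
  excess. What remains is an interval of the coarser level. Hence two thresholds per level, and
  excesses of intervals inside [a, b] only.\<close>

lemma dyadic_chaining:
  fixes x :: "real \<Rightarrow> real" and w :: "nat \<Rightarrow> real"
  assumes w: "\<And>j. 0 \<le> w j"
  defines "g \<equiv> \<lambda>j i. max (\<bar>x (real (Suc i) / 2 ^ j) - x (real i / 2 ^ j)\<bar> - w j) 0"
  assumes "a \<le> b" "b \<le> 2 ^ m"
  shows "\<bar>x (real b / 2 ^ m) - x (real a / 2 ^ m)\<bar>
       \<le> (\<Sum>j\<le>m. 2 * w j) + (dyadic_excess g m b - dyadic_excess g m a)"
  using assms(3,4)
proof (induction m arbitrary: a b)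
  case 0
  have g0: "\<bar>x 1 - x 0\<bar> \<le> w 0 + g 0 0" by (auto simp: g_def)
  consider "a = b" | "a = 0" "b = 1" using 0 by fastforce
  then show ?case using w[of 0] g0 by cases auto
next
  case (Suc m)
  let ?X = "\<lambda>i. x (real i / 2 ^ Suc m)"
  have g: "0 \<le> g j i" for j i by (simp add: g_def)
  have step: "\<bar>?X (Suc i) - ?X i\<bar> \<le> w (Suc m) + g (Suc m) i" for i by (auto simp: g_def)
  have double: "?X (2 * i) = x (real i / 2 ^ m)" for i by simp
  let ?a = "(a + 1) div 2" and ?b = "b div 2"
  show ?case
  proof (cases "?a \<le> ?b")
    case False
    with Suc.prems have "a = b" by auto
    have "0 \<le> (\<Sum>j\<le>Suc m. 2 * w j)" using w by (intro sum_nonneg) simp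
    with \<open>a = b\<close> show ?thesis by simp
  next
    case True
    have IH: "\<bar>x (real ?b / 2 ^ m) - x (real ?a / 2 ^ m)\<bar> \<le> (\<Sum>j\<le>m. 2 * w j) + (dyadic_excess g m ?b - dyadic_excess g m ?a)"
      using True Suc.prems by (intro Suc.IH) auto
    \<comment> \<open>The recursion of \<open>dyadic_excess\<close> rounds a down, while the chain
      starts from a rounded up; monotonicity closes the gap.\<close>
    have mono: "dyadic_excess g m (a div 2) \<le> dyadic_excess g m ?a"
      by (intro dyadic_excess_mono g) auto
    have split: "(\<Sum>i<b. g (Suc m) i) - (\<Sum>i<a. g (Suc m) i) = (\<Sum>i\<in>{a..<b}. g (Suc m) i)"
      using sum_diff[of "{..<b}" "{..<a}" "g (Suc m)"] Suc.prems
      by (simp add: lessThan_minus_lessThan)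
    let ?L = "if even a then {} else {a}" and ?R = "if even b then {} else {2 * ?b}"
    have sub: "?L \<union> ?R \<subseteq> {a..<b}" "?L \<inter> ?R = {}" using True by (auto split: if_splits elim!: oddE evenE)
    have "(\<Sum>i\<in>?L. g (Suc m) i) + (\<Sum>i\<in>?R. g (Suc m) i) = (\<Sum>i\<in>?L \<union> ?R. g (Suc m) i)"
      using sub(2) by (intro sum.union_disjoint[symmetric]) auto
    also have "\<dots> \<le> (\<Sum>i\<in>{a..<b}. g (Suc m) i)"
      using sub(1) g by (intro sum_mono2) auto
    finally have LR: "(\<Sum>i\<in>?L. g (Suc m) i) + (\<Sum>i\<in>?R. g (Suc m) i) \<le> (\<Sum>i\<in>{a..<b}. g (Suc m) i)" .
    have L: "\<bar>?X (2 * ?a) - ?X a\<bar> \<le> w (Suc m) + (\<Sum>i\<in>?L. g (Suc m) i)"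
    proof (cases "even a")
      case False
      then have e: "2 * ?a = Suc a" by (auto elim!: oddE)
      show ?thesis using step[of a] False unfolding e by simp
    next
      case True
      then have e: "2 * ?a = a" by (auto elim!: evenE)
      show ?thesis using w[of "Suc m"] True unfolding e by simp
    qed
    have R: "\<bar>?X b - ?X (2 * ?b)\<bar> \<le> w (Suc m) + (\<Sum>i\<in>?R. g (Suc m) i)"
    proof (cases "even b")
      case False
      then have e: "?X b = ?X (Suc (2 * ?b))" by (auto elim!: oddE)
      show ?thesis using step[of "2 * ?b"] False unfolding e by simp
    next
      case True
      then have e: "2 * ?b = b" by (auto elim!: evenE)
      show ?thesis using w[of "Suc m"] True unfolding e by simp
    qed
    have "\<bar>?X b - ?X a\<bar> \<le> \<bar>?X b - ?X (2 * ?b)\<bar> + \<bar>?X (2 * ?b) - ?X (2 * ?a)\<bar> + \<bar>?X (2 * ?a) - ?X a\<bar>"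
      by linarith
    moreover have "(\<Sum>j\<le>Suc m. 2 * w j) = (\<Sum>j\<le>m. 2 * w j) + 2 * w (Suc m)" by simp
    ultimately show ?thesis
      using L R LR IH mono split unfolding double dyadic_excess.simps(2) by linarith
  qed
qed

text \<open>The thresholds along a chain add up to at most 1 and are swallowed by the truncation.
  The excesses remain; being differences of \<open>dyadic_excess\<close>, they telescope and yield a
  dominating function.\<close>

lemma truncated_variation_chaining:
  fixes x :: "real \<Rightarrow> real" and w :: "nat \<Rightarrow> real"
  assumes x: "continuous_on {0..1} x" and w: "\<And>j. 0 \<le> w j" "\<And>m. (\<Sum>j\<le>m. 2 * w j) \<le> 1"
  shows "truncated_variation 1 x 0 1
      \<le> (\<Sum>j. \<Sum>i<2 ^ j. ennreal (max (\<bar>x (real (Suc i) / 2 ^ j) - x (real i / 2 ^ j)\<bar> - w j) 0))"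
proof -
  define g where "g = (\<lambda>j i. max (\<bar>x (real (Suc i) / 2 ^ j) - x (real i / 2 ^ j)\<bar> - w j) 0)"
  have g0: "0 \<le> g j i" for j i by (simp add: g_def)
  have "dyadic_tv 1 x 1 \<le> (\<Sum>j. \<Sum>i<2 ^ j. ennreal (g j i))"
    unfolding dyadic_tv_def
  proof (rule SUP_least)
    fix m
    have "dtv 1 (\<lambda>k. x (1 * real k / 2 ^ m)) (2 ^ m) \<le> dyadic_excess g m (2 ^ m)"
    proof (rule dtv_le[where \<Psi> = "dyadic_excess g m"])
      show "0 \<le> dyadic_excess g m 0" by simp
      fix i j :: nat assume ij: "i \<le> j" "j \<le> 2 ^ m"
      show "max (\<bar>x (1 * real j / 2 ^ m) - x (1 * real i / 2 ^ m)\<bar> - 1) 0 \<le> dyadic_excess g m j - dyadic_excess g m i"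
      proof -
        have "\<bar>x (real j / 2 ^ m) - x (real i / 2 ^ m)\<bar> \<le> (\<Sum>j\<le>m. 2 * w j) + (dyadic_excess g m j - dyadic_excess g m i)"
          using dyadic_chaining[of w i j m x, OF w(1) ij] unfolding g_def .
        moreover have "dyadic_excess g m i \<le> dyadic_excess g m j" by (rule dyadic_excess_mono[OF g0 ij(1)])
        ultimately have "\<bar>x (real j / 2 ^ m) - x (real i / 2 ^ m)\<bar> - 1 \<le> dyadic_excess g m j - dyadic_excess g m i" "0 \<le> dyadic_excess g m j - dyadic_excess g m i"
          using w(2)[of m] by linarith+
        then show ?thesis unfolding mult_1 by (rule max.boundedI)
      qed
    qed
    then have "ennreal (dtv 1 (\<lambda>k. x (1 * real k / 2 ^ m)) (2 ^ m)) \<le> ennreal (\<Sum>j\<le>m. \<Sum>i<2 ^ j. g j i)"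
      unfolding dyadic_excess_full by (rule ennreal_leI)
    also have "\<dots> = (\<Sum>j\<le>m. \<Sum>i<2 ^ j. ennreal (g j i))"
      by (subst sum_ennreal[symmetric], simp add: g0 sum_nonneg, subst sum_ennreal) (simp_all add: g0)
    also have "\<dots> \<le> (\<Sum>j. \<Sum>i<2 ^ j. ennreal (g j i))"
      by (intro sum_le_suminf summableI) auto
    finally show "ennreal (dtv 1 (\<lambda>k. x (1 * real k / 2 ^ m)) (2 ^ m)) \<le> (\<Sum>j. \<Sum>i<2 ^ j. ennreal (g j i))" .
  qed
  then show ?thesis
    unfolding g_def truncated_variation_eq_dyadic_tv[OF x zero_less_one zero_less_one] by assumption
qed

section \<open>Interval crossings of a continuous path\<close>

text \<open>At least \<open>n\<close> successive descents from \<open>[a, \<infinity>)\<close> to \<open>(-\<infinity>, b)\<close> take place in \<open>[s, t]\<close>.\<close>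
primrec descents :: "(real \<Rightarrow> real) \<Rightarrow> real \<Rightarrow> real \<Rightarrow> real \<Rightarrow> nat \<Rightarrow> real \<Rightarrow> bool" where
  "descents x a b s 0 t \<longleftrightarrow> s \<le> t"
| "descents x a b s (Suc n) t \<longleftrightarrow>
     (\<exists>u v. descents x a b s n u \<and> u \<le> v \<and> v \<le> t \<and> a \<le> x u \<and> x v < b)"

lemma descents_mono: "descents x a b s n t \<Longrightarrow> t \<le> t' \<Longrightarrow> descents x a b s n t'"
  by (cases n) fastforce+

lemma descents_ge: "descents x a b s n t \<Longrightarrow> s \<le> t"
  by (induction n arbitrary: t) fastforce+

lemma descents_Suc: "descents x a b s (Suc n) t \<Longrightarrow> descents x a b s n t"
proof -
  assume "descents x a b s (Suc n) t"
  then obtain u v where "descents x a b s n u" "u \<le> v" "v \<le> t" by auto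
  then show ?thesis using descents_mono[of x a b s n u t] by simp
qed

lemma descents_antimono: "m \<le> n \<Longrightarrow> descents x a b s n t \<Longrightarrow> descents x a b s m t"
  by (induction rule: inc_induct) (blast dest: descents_Suc)+

lemma descents_append:
  assumes "descents x a b s n u" "descents x a b u m t"
  shows "descents x a b s (n + m) t"
  using assms(2)
proof (induction m arbitrary: t)
  case 0
  then show ?case using descents_mono[OF assms(1)] by simp
next
  case (Suc m)
  then show ?case by fastforce
qed

text \<open>Only the descent in progress at time w can be lost, hence the 1.\<close>

lemma descents_split:
  assumes "descents x a b s n t" "s \<le> w" "w \<le> t"
  shows "\<exists>k m. descents x a b s k w \<and> descents x a b w m t \<and> n \<le> k + m + 1"
  using assms(1,3)
proof (induction n arbitrary: t)
  case 0
  then show ?case using assms(2) by (intro exI[of _ 0]) auto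
next
  case (Suc n)
  then obtain u v where uv: "descents x a b s n u" "u \<le> v" "v \<le> t" "a \<le> x u" "x v < b" by auto
  show ?case
  proof (cases "w \<le> u")
    case True
    then obtain k m where km: "descents x a b s k w" "descents x a b w m u" "n \<le> k + m + 1"
      using Suc.IH[OF uv(1)] by blast
    then have "descents x a b w (Suc m) t" using uv by auto
    with km show ?thesis by (intro exI[of _ k] exI[of _ "Suc m"]) auto
  next
    case False
    then have "descents x a b s n w" using uv(1) descents_mono by fastforce
    with Suc.prems(2) show ?thesis by (intro exI[of _ n] exI[of _ 0]) auto
  qed
qed

text \<open>A descent drops by more than a - b, so by uniform continuity it lasts at least \<eta>.
  This is the source of every finiteness statement for crossings.\<close>

lemma descents_length:
  assumes "descents x a b s n t" "t \<le> t0" "0 < \<eta>"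
    and "\<And>u v. u \<in> {s..t0} \<Longrightarrow> v \<in> {s..t0} \<Longrightarrow> \<bar>v - u\<bar> < \<eta> \<Longrightarrow> \<bar>x v - x u\<bar> < a - b"
  shows "s + real n * \<eta> \<le> t"
  using assms(1,2)
proof (induction n arbitrary: t)
  case (Suc n)
  then obtain u v where uv: "descents x a b s n u" "u \<le> v" "v \<le> t" "a \<le> x u" "x v < b" by auto
  then have "s + real n * \<eta> \<le> u" using Suc by simp
  moreover have "\<eta> \<le> v - u"
  proof (rule ccontr)
    assume "\<not> \<eta> \<le> v - u"
    then have "\<bar>x v - x u\<bar> < a - b"
      using assms(4)[of u v] uv descents_ge[OF uv(1)] Suc.prems(2) by auto
    with uv show False by linarith
  qed
  ultimately show ?case using uv by (simp add: algebra_simps)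
qed simp

lemma descents_exD:
  assumes "descents x a b s (Suc n) t"
  shows "\<exists>u\<in>{s..t}. \<exists>v\<in>{s..t}. a \<le> x u \<and> x v < b"
proof -
  obtain u v where uv: "descents x a b s n u" "u \<le> v" "v \<le> t" "a \<le> x u" "x v < b" using assms by auto
  then show ?thesis using descents_ge[OF uv(1)] by (intro bexI[of _ u] bexI[of _ v]) auto
qed

section \<open>The stopping times expressed through descents\<close>

lemma Inf_ereal_le_iff_ex:
  assumes "Inf (ereal ` A) \<le> ereal t"
  shows "A \<noteq> {}"
  using assms by (auto simp: top_ereal_def)

context continuous_path
begin

context
  fixes y c :: real
  assumes c: "0 < c"
begin

text \<open>The lower time is an infimum over an open condition and need not be attained, so n
  descents are known to be complete only strictly after it. The upper time is an infimum over a
  closed set and is attained, at u. If u were equal to the lower time with n > 0, then x u \<le> y -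
  c / 2 would contradict x u \<ge> y + c / 2; so u lies strictly after it.\<close>

lemma lower_time_Suc_descents:
  assumes IH: "ereal s0 \<le> lower_time x y c s0 t n"
      "\<And>z. z \<le> t \<Longrightarrow> lower_time x y c s0 t n < ereal z \<Longrightarrow> descents x (y + c/2) (y - c/2) s0 n z"
      "\<And>r. 0 < n \<Longrightarrow> r \<le> t \<Longrightarrow> lower_time x y c s0 t n = ereal r \<Longrightarrow> x r \<le> y - c/2"
    and "t \<le> t0" and v: "upper_time x y c t (lower_time x y c s0 t n) \<le> ereal v" "v \<le> t" "x v < y - c/2"
  shows "descents x (y + c/2) (y - c/2) s0 (Suc n) v"
proof -
  let ?\<sigma> = "lower_time x y c s0 t n"
  define U where "U = {u. ?\<sigma> \<le> ereal u \<and> u \<le> t \<and> x u \<ge> y + c / 2}"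
  have "U \<noteq> {}" using v(1,2) Inf_ereal_le_iff_ex[of U v] unfolding upper_time_def U_def by auto
  then obtain u1 where "?\<sigma> \<le> ereal u1" "u1 \<le> t" by (auto simp: U_def)
  then obtain r where r: "?\<sigma> = ereal r" using IH(1) by (cases ?\<sigma>) auto
  have sr: "s0 \<le> r" using IH(1) r by simp
  have U_eq: "U = {r..t} \<inter> x -` {y + c/2..}" by (auto simp: U_def r)
  have "continuous_on {r..t} x" using sr \<open>t \<le> t0\<close> by (rule cont_sub)
  then have "closed U" unfolding U_eq by (intro continuous_closed_preimage) auto
  then have "compact U"
    using compact_Int_closed[of "{r..t}" U] by (simp add: U_eq Int_absorb1 inf_commute inf_left_commute)
  then obtain u where u: "u \<in> U" "\<And>z. z \<in> U \<Longrightarrow> u \<le> z"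
    using compact_attains_inf[of U] \<open>U \<noteq> {}\<close> by blast
  have "ereal u \<le> Inf (ereal ` U)" using u(2) by (intro Inf_greatest) auto
  also have "\<dots> \<le> ereal v" using v(1) by (simp add: upper_time_def U_def)
  finally have uv: "u \<le> v" by simp
  have ru: "r \<le> u" "u \<le> t" "y + c/2 \<le> x u" using u(1) by (auto simp: U_def r)
  have "descents x (y + c/2) (y - c/2) s0 n u"
  proof (cases "n = 0 \<or> r < u")
    case True
    then show ?thesis using ru IH(2)[of u] r sr by auto
  next
    case False
    then have "x u \<le> y - c/2" using IH(3)[of u] ru r by auto
    with ru c show ?thesis by simp
  qed
  then show ?thesis using uv v ru by auto
qed

text \<open>One induction carries four facts: the bound by s0 keeps the infimum away from minus
  infinity, the second and third feed \<open>lower_time_Suc_descents\<close>, and the fourth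
  compares the infimum with any completed descent.\<close>

lemma lower_time_descents:
  assumes "t \<le> t0"
  shows "ereal s0 \<le> lower_time x y c s0 t n \<and>
    (\<forall>z\<le>t. lower_time x y c s0 t n < ereal z \<longrightarrow> descents x (y + c/2) (y - c/2) s0 n z) \<and>
    (0 < n \<longrightarrow> (\<forall>r\<le>t. lower_time x y c s0 t n = ereal r \<longrightarrow> x r \<le> y - c/2)) \<and>
    (\<forall>z\<le>t. descents x (y + c/2) (y - c/2) s0 n z \<longrightarrow> lower_time x y c s0 t n \<le> ereal z)"
proof (induction n)
  case (Suc n)
  let ?\<sigma> = "lower_time x y c s0 t n"
  let ?\<rho> = "upper_time x y c t ?\<sigma>"
  define V where "V = {u. ?\<rho> \<le> ereal u \<and> u \<le> t \<and> x u < y - c / 2}"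
  have \<sigma>: "lower_time x y c s0 t (Suc n) = Inf (ereal ` V)" by (simp add: V_def)
  have \<rho>: "?\<sigma> \<le> ?\<rho>" unfolding upper_time_def by (intro Inf_greatest) auto
  then have \<rho>s: "ereal s0 \<le> ?\<rho>" using Suc by (meson order_trans)
  have 1: "ereal s0 \<le> Inf (ereal ` V)"
    using \<rho>s by (intro Inf_greatest) (auto simp: V_def intro: order_trans)
  have V: "descents x (y + c/2) (y - c/2) s0 (Suc n) v" if "v \<in> V" for v
    by (rule lower_time_Suc_descents[of t]) (use Suc that assms in \<open>auto simp: V_def\<close>)
  have 2: "descents x (y + c/2) (y - c/2) s0 (Suc n) z" if lt: "Inf (ereal ` V) < ereal z" for z
  proof -
    obtain v where "v \<in> V" "v < z" using lt[unfolded Inf_less_iff] by auto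
    then show ?thesis using V[of v] descents_mono[of x _ _ s0 "Suc n" v z] by simp
  qed
  \<comment> \<open>Otherwise x stays above y - c / 2 on a right neighbourhood of r by continuity,
    although V has points arbitrarily close to r.\<close>
  have 3: "x r \<le> y - c/2" if rt: "r \<le> t" "Inf (ereal ` V) = ereal r" for r
  proof (rule ccontr)
    assume neg: "\<not> x r \<le> y - c/2"
    have r: "s0 \<le> r" using 1 rt by simp
    have "continuous_on {r..t} x" using r assms by (rule cont_sub)
    then obtain d where d: "0 < d" "\<And>u. u \<in> {r..t} \<Longrightarrow> dist u r < d \<Longrightarrow> dist (x u) (x r) < x r - (y - c/2)"
    proof -
      have "r \<in> {r..t}" "0 < x r - (y - c/2)" using neg rt(1) by auto
      then show ?thesis using \<open>continuous_on {r..t} x\<close> that unfolding continuous_on_iff by blast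
    qed
    have "Inf (ereal ` V) < ereal (r + d)" using rt d by simp
    then obtain v where v: "v \<in> V" "v < r + d" unfolding Inf_less_iff by auto
    have "Inf (ereal ` V) \<le> ereal v" using v(1) by (intro Inf_lower) auto
    then have "r \<le> v" using rt by simp
    then have "dist (x v) (x r) < x r - (y - c/2)" using d(2)[of v] v by (auto simp: V_def dist_real_def)
    then show False using v(1) by (auto simp: V_def dist_real_def)
  qed
  have 4: "Inf (ereal ` V) \<le> ereal z" if zt: "z \<le> t" and D: "descents x (y + c/2) (y - c/2) s0 (Suc n) z" for z
  proof -
    obtain u v where uv: "descents x (y + c/2) (y - c/2) s0 n u" "u \<le> v" "v \<le> z" "y + c/2 \<le> x u" "x v < y - c/2"
      using D by auto
    have "?\<sigma> \<le> ereal u" using Suc uv zt by auto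
    then have "?\<rho> \<le> ereal u" unfolding upper_time_def using uv zt by (intro Inf_lower) auto
    also have "\<dots> \<le> ereal v" using uv by simp
    finally have "v \<in> V" using uv zt by (auto simp: V_def)
    then have "Inf (ereal ` V) \<le> ereal v" by (intro Inf_lower) auto
    then show ?thesis using uv(3) by (meson ereal_less_eq(3) order_trans)
  qed
  show ?case unfolding \<sigma> using 1 2 3 4 by blast
qed auto

text \<open>An infimum over the empty set is infinite, so a lower time at most t provides some
  member of its set. That member ends the last descent, whether or not the infimum is
  attained.\<close>

lemma lower_time_le_iff_descents:
  assumes "s0 \<le> t" "t \<le> t0"
  shows "lower_time x y c s0 t n \<le> ereal t \<longleftrightarrow> descents x (y + c/2) (y - c/2) s0 n t"
proof
  assume "descents x (y + c/2) (y - c/2) s0 n t"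
  then show "lower_time x y c s0 t n \<le> ereal t" using lower_time_descents[OF assms(2), of n] by blast
next
  assume le: "lower_time x y c s0 t n \<le> ereal t"
  show "descents x (y + c/2) (y - c/2) s0 n t"
  proof (cases n)
    case (Suc m)
    let ?V = "{u. upper_time x y c t (lower_time x y c s0 t m) \<le> ereal u \<and> u \<le> t \<and> x u < y - c / 2}"
    have "?V \<noteq> {}" using le Inf_ereal_le_iff_ex[of ?V t] unfolding Suc by auto
    then obtain v where v: "v \<in> ?V" by blast
    have "descents x (y + c/2) (y - c/2) s0 (Suc m) v"
      by (rule lower_time_Suc_descents[of t]) (use lower_time_descents[OF assms(2), of m] v assms in auto)
    then show ?thesis using Suc v descents_mono[of x _ _ s0 "Suc m" v t] by simp
  qed (use assms in simp)
qed

end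

end

text \<open>The set below \<open>Max\<close> is finite by \<open>descents_length\<close> and
  downward closed, so comparing a number with its maximum is the same as membership.\<close>

lemma le_down_crossings_iff:
  assumes x: "continuous_on {s..t} x" and c: "0 < c" and st: "s \<le> t"
  shows "n \<le> down_crossings x y c s t \<longleftrightarrow> descents x (y + c/2) (y - c/2) s n t"
proof -
  interpret continuous_path x s t by standard (rule x)
  let ?D = "{n. descents x (y + c/2) (y - c/2) s n t}"
  obtain \<eta> where \<eta>: "0 < \<eta>" "\<And>a b. a \<in> {s..t} \<Longrightarrow> b \<in> {s..t} \<Longrightarrow> \<bar>b - a\<bar> < \<eta> \<Longrightarrow> \<bar>x b - x a\<bar> < c"
    using uniform_modulus[OF x c] by blast
  have "n \<le> nat \<lceil>(t - s) / \<eta>\<rceil>" if "n \<in> ?D" for n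
  proof -
    have "s + real n * \<eta> \<le> t"
      using that \<eta> by (intro descents_length[of x "y + c/2" "y - c/2" s n t t \<eta>]) auto
    then have "real n \<le> (t - s) / \<eta>" using \<eta>(1) by (simp add: field_simps)
    then show ?thesis by linarith
  qed
  then have "finite ?D" by (meson finite_nat_set_iff_bounded_le)
  moreover have "0 \<in> ?D" using st by simp
  moreover have "down_crossings x y c s t = Max ?D"
    unfolding down_crossings_def using lower_time_le_iff_descents[OF c st] by simp
  ultimately show ?thesis
    by (metis (no_types, lifting) Max_ge Max_in descents_antimono empty_iff mem_Collect_eq)
qed

lemma le_up_crossings_iff:
  assumes "continuous_on {s..t} x" "0 < c" "s \<le> t"
  shows "n \<le> up_crossings x y c s t \<longleftrightarrow> descents (\<lambda>u. - x u) (- y + c/2) (- y - c/2) s n t"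
  unfolding up_crossings_def by (rule le_down_crossings_iff) (use assms in \<open>auto intro: continuous_on_minus\<close>)

lemma down_crossings_append:
  assumes "continuous_on {s..t} x" "0 < c" "s \<le> u" "u \<le> t"
  shows "down_crossings x y c s u + down_crossings x y c u t \<le> down_crossings x y c s t"
    "down_crossings x y c s t \<le> down_crossings x y c s u + down_crossings x y c u t + 1"
proof -
  have cs: "continuous_on {s..u} x" "continuous_on {u..t} x"
    using assms by (auto intro: continuous_on_subset)
  note iff = le_down_crossings_iff[OF cs(1) assms(2,3)] le_down_crossings_iff[OF cs(2) assms(2,4)]
    le_down_crossings_iff[OF assms(1,2) order_trans[OF assms(3,4)]]
  show "down_crossings x y c s u + down_crossings x y c u t \<le> down_crossings x y c s t"
    using descents_append iff by blast
  obtain k m where "descents x (y + c/2) (y - c/2) s k u" "descents x (y + c/2) (y - c/2) u m t"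
      "down_crossings x y c s t \<le> k + m + 1"
    using descents_split[OF iffD1[OF iff(3) order_refl] assms(3,4)] by blast
  then have "k \<le> down_crossings x y c s u" "m \<le> down_crossings x y c u t" using iff by blast+
  then show "down_crossings x y c s t \<le> down_crossings x y c s u + down_crossings x y c u t + 1"
    using \<open>down_crossings x y c s t \<le> k + m + 1\<close> by linarith
qed

text \<open>By the intermediate value theorem. This confines crossings during a short time interval
  to levels where g is close to its values along the path.\<close>

lemma down_crossings_range:
  assumes "continuous_on {s..t} x" "0 < c" "s \<le> t" "0 < down_crossings x y c s t"
  shows "y \<in> x ` {s..t}"
proof -
  have "descents x (y + c/2) (y - c/2) s (Suc 0) t"
    using le_down_crossings_iff[OF assms(1-3), of "Suc 0" y] assms(4) by simp
  then obtain u v where uv: "u \<in> {s..t}" "v \<in> {s..t}" "y + c/2 \<le> x u" "x v < y - c/2"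
    using descents_exD by blast
  have "connected (x ` {s..t})" using assms(1) by (intro connected_continuous_image) auto
  then show ?thesis
    using connected_contains_Icc[of "x ` {s..t}" "x v" "x u"] uv assms(2) by auto
qed

lemma crossings_append:
  assumes "continuous_on {s..t} x" "0 < c" "s \<le> u" "u \<le> t"
  shows "crossings x y c s u + crossings x y c u t \<le> crossings x y c s t"
    "crossings x y c s t \<le> crossings x y c s u + crossings x y c u t + 2"
  using down_crossings_append[OF assms, of y] down_crossings_append[OF continuous_on_minus[OF assms(1)] assms(2-4), of "- y"]
  unfolding crossings_def up_crossings_def by linarith+

lemma crossings_mono:
  assumes "continuous_on {s..t} x" "0 < c" "s \<le> u" "u \<le> t"
  shows "crossings x y c s u \<le> crossings x y c s t"
  using crossings_append(1)[OF assms, of y] by linarith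

lemma crossings_range:
  assumes "continuous_on {s..t} x" "0 < c" "s \<le> t" "0 < crossings x y c s t"
  shows "y \<in> x ` {s..t}"
proof -
  have "0 < down_crossings x y c s t \<or> 0 < down_crossings (\<lambda>u. - x u) (- y) c s t"
    using assms(4) by (auto simp: crossings_def up_crossings_def)
  then show ?thesis
  proof
    assume "0 < down_crossings (\<lambda>u. - x u) (- y) c s t"
    then have "- y \<in> (\<lambda>u. - x u) ` {s..t}"
      by (intro down_crossings_range) (use assms in \<open>auto intro: continuous_on_minus\<close>)
    then show ?thesis by auto
  qed (use down_crossings_range assms in auto)
qed

subsection \<open>Measurability\<close>

text \<open>
  By continuity the descents can be located at rational times, except that the level \<open>a\<close> is
  reached only in the limit; this expresses their number by countable operations.
\<close>

definition rational_times :: "real \<Rightarrow> real \<Rightarrow> real set" where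
  "rational_times s t = {q \<in> \<rat> \<union> {s}. s \<le> q \<and> q \<le> t}"

lemma countable_rational_times: "countable (rational_times s t)"
  unfolding rational_times_def by (rule countable_subset[of _ "\<rat> \<union> {s}"]) (auto simp: countable_rat)

lemma continuous_on_nbhd:
  fixes x :: "real \<Rightarrow> real"
  assumes "continuous_on {s..t} x" "u \<in> {s..t}" "0 < e"
  obtains d where "0 < d" "\<And>v. v \<in> {s..t} \<Longrightarrow> \<bar>v - u\<bar> < d \<Longrightarrow> \<bar>x v - x u\<bar> < e"
  using assms unfolding continuous_on_iff dist_real_def by blast

text \<open>The last condition x v < b is open, so v can be moved back to a rational time still
  after u. The start s counts as admissible because with n = 0 and s = t no other time is
  available.\<close>

lemma descents_rational_time:
  assumes x: "continuous_on {s..t0} x" and ba: "b < a"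
    and D: "descents x a b s n t" "t \<le> t0"
  shows "\<exists>w\<in>rational_times s t0. w \<le> t \<and> descents x a b s n w"
proof (cases n)
  case 0
  then show ?thesis using D by (intro bexI[of _ s]) (auto simp: rational_times_def)
next
  case (Suc m)
  then obtain u v where uv: "descents x a b s m u" "u \<le> v" "v \<le> t" "a \<le> x u" "x v < b" using D by auto
  have su: "s \<le> u" by (rule descents_ge[OF uv(1)])
  have "u \<noteq> v" using uv ba by auto
  then have "u < v" using uv by simp
  have "v \<in> {s..t0}" using su uv D by auto
  then obtain d where d: "0 < d" "\<And>w. w \<in> {s..t0} \<Longrightarrow> \<bar>w - v\<bar> < d \<Longrightarrow> \<bar>x w - x v\<bar> < b - x v"
    using continuous_on_nbhd[OF x, of v "b - x v"] uv(5) by auto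
  have "max u (v - d) < v" using \<open>u < v\<close> d(1) by simp
  then obtain q where q: "q \<in> \<rat>" "max u (v - d) < q" "q < v" using Rats_dense_in_real by blast
  then have q': "u < q" "\<bar>q - v\<bar> < d" by auto
  have "x q < b" using d(2)[of q] q q' su uv D by auto
  then have "descents x a b s (Suc m) q"
    using uv q' unfolding descents.simps by (intro exI[of _ u] exI[of _ q]) auto
  moreover have "q \<in> rational_times s t0" "q \<le> t" using q q' su uv D by (auto simp: rational_times_def)
  ultimately show ?thesis using Suc by blast
qed

text \<open>From left to right, u < v because a > b, which leaves room for rational times just to
  the right of u, where x is almost a. Conversely the maximum of x over [w, v] exceeds a - 1 / (k +
  1) for every k, so it is at least a, and a point of maximum serves as u.\<close>

lemma descents_Suc_rational:
  assumes x: "continuous_on {s..t0} x" and ba: "b < a" and t: "t \<le> t0"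
  shows "descents x a b s (Suc n) t \<longleftrightarrow>
    (\<exists>w\<in>rational_times s t0. \<exists>v\<in>rational_times s t0. w \<le> v \<and> v \<le> t \<and> descents x a b s n w \<and> x v < b \<and>
       (\<forall>k::nat. \<exists>u\<in>rational_times s t0. w \<le> u \<and> u \<le> v \<and> a - 1 / real (Suc k) < x u))"
    (is "?L \<longleftrightarrow> (\<exists>w\<in>_. \<exists>v\<in>_. ?R w v)")
proof
  assume ?L
  then obtain v where v: "v \<in> rational_times s t0" "v \<le> t" "descents x a b s (Suc n) v"
    using descents_rational_time[OF x ba _ t] by blast
  then obtain u v' where uv: "descents x a b s n u" "u \<le> v'" "v' \<le> v" "a \<le> x u" "x v' < b" by auto
  have su: "s \<le> u" by (rule descents_ge[OF uv(1)])
  have v't: "v' \<le> t0" using uv v t by linarith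
  have "u \<noteq> v'" using uv ba by auto
  then have "u < v'" using uv by simp
  obtain q where q: "q \<in> rational_times s t0" "q \<le> v'" "u < q" "x q < b"
  proof -
    have "v' \<in> {s..t0}" using su uv v't by auto
    then obtain d where d: "0 < d" "\<And>w. w \<in> {s..t0} \<Longrightarrow> \<bar>w - v'\<bar> < d \<Longrightarrow> \<bar>x w - x v'\<bar> < b - x v'"
      using continuous_on_nbhd[OF x, of v' "b - x v'"] uv(5) by auto
    have "max u (v' - d) < v'" using \<open>u < v'\<close> d(1) by simp
    then obtain q where q: "q \<in> \<rat>" "max u (v' - d) < q" "q < v'" using Rats_dense_in_real by blast
    then have q': "u < q" "\<bar>q - v'\<bar> < d" by auto
    have "x q < b" using d(2)[of q] q q' su v't by auto
    then show ?thesis using that[of q] q q' su v't by (auto simp: rational_times_def)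
  qed
  obtain w where w: "w \<in> rational_times s t0" "w \<le> u" "descents x a b s n w"
    using descents_rational_time[OF x ba uv(1)] q by (auto simp: rational_times_def)
  have "\<exists>u\<in>rational_times s t0. w \<le> u \<and> u \<le> q \<and> a - 1 / real (Suc k) < x u" for k
  proof -
    have "u \<in> {s..t0}" "(0::real) < 1 / real (Suc k)" using su q by (auto simp: rational_times_def)
    then obtain d where d: "0 < d" "\<And>w. w \<in> {s..t0} \<Longrightarrow> \<bar>w - u\<bar> < d \<Longrightarrow> \<bar>x w - x u\<bar> < 1 / real (Suc k)"
      using continuous_on_nbhd[OF x, of u "1 / real (Suc k)"] by metis
    have "u < min q (u + d)" using q d by simp
    then obtain p where p: "p \<in> \<rat>" "u < p" "p < min q (u + d)" using Rats_dense_in_real by blast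
    have p': "p < q" "\<bar>p - u\<bar> < d" "p \<in> {s..t0}" using p su q by (auto simp: rational_times_def)
    have "\<bar>x p - x u\<bar> < 1 / real (Suc k)" by (rule d(2)[OF p'(3,2)])
    then have "a - 1 / real (Suc k) < x p" using uv(4) by linarith
    then show ?thesis using p p' w by (intro bexI[of _ p]) (auto simp: rational_times_def)
  qed
  then have "?R w q" using w q uv v by auto
  with w q show "\<exists>w\<in>rational_times s t0. \<exists>v\<in>rational_times s t0. ?R w v" by blast
next
  assume "\<exists>w\<in>rational_times s t0. \<exists>v\<in>rational_times s t0. ?R w v"
  then obtain w v where w: "w \<in> rational_times s t0" and v: "v \<in> rational_times s t0" and R: "?R w v" by blast
  have "continuous_on {w..v} x" using x by (rule continuous_on_subset) (use w v in \<open>auto simp: rational_times_def\<close>)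
  moreover have "{w..v} \<noteq> {}" using R by auto
  ultimately obtain u where u: "u \<in> {w..v}" "\<And>z. z \<in> {w..v} \<Longrightarrow> x z \<le> x u"
    using continuous_attains_sup[of "{w..v}" x] by auto
  have "a \<le> x u"
  proof (rule ccontr)
    assume "\<not> a \<le> x u"
    then obtain k where k: "1 / real (Suc k) < a - x u"
      using reals_Archimedean[of "a - x u"] by (auto simp: inverse_eq_divide)
    obtain z where z: "z \<in> rational_times s t0" "w \<le> z \<and> z \<le> v \<and> a - 1 / real (Suc k) < x z" using R by blast
    with u(2)[of z] k show False by auto
  qed
  moreover have "descents x a b s n u" using R u descents_mono by auto
  ultimately show ?L using R u by auto
qed

text \<open>The levels may depend on the outcome, so that N can be the product of the probability
  space with the axis of levels and joint measurability in outcome and level follows.\<close>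

lemma measurable_descents:
  assumes X: "\<And>u. u \<in> {s..t0} \<Longrightarrow> X u \<in> borel_measurable N"
    and [measurable]: "a \<in> borel_measurable N" "b \<in> borel_measurable N"
    and cont: "\<And>\<omega>. \<omega> \<in> space N \<Longrightarrow> continuous_on {s..t0} (\<lambda>u. X u \<omega>)"
    and ba: "\<And>\<omega>. \<omega> \<in> space N \<Longrightarrow> b \<omega> < a \<omega>"
    and t: "t \<le> t0"
  shows "{\<omega> \<in> space N. descents (\<lambda>u. X u \<omega>) (a \<omega>) (b \<omega>) s n t} \<in> sets N"
  using t
proof (induction n arbitrary: t)
  case (Suc n)
  let ?Q = "rational_times s t0"
  have X': "X u \<in> borel_measurable N" if "u \<in> ?Q" for u using that X by (auto simp: rational_times_def)
  have "{\<omega> \<in> space N. descents (\<lambda>u. X u \<omega>) (a \<omega>) (b \<omega>) s (Suc n) t} =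
    {\<omega> \<in> space N. \<exists>w\<in>?Q. \<exists>v\<in>?Q. w \<le> v \<and> v \<le> t \<and> descents (\<lambda>u. X u \<omega>) (a \<omega>) (b \<omega>) s n w \<and> X v \<omega> < b \<omega> \<and>
       (\<forall>k::nat. \<exists>u\<in>?Q. w \<le> u \<and> u \<le> v \<and> a \<omega> - 1 / real (Suc k) < X u \<omega>)}"
    by (intro Collect_cong conj_cong refl descents_Suc_rational[OF cont ba Suc.prems])
  also have "\<dots> \<in> sets N"
  proof (intro sets.sets_Collect_countable_Ex' sets.sets_Collect_countable_All sets.sets_Collect_conj sets.sets_Collect_const
      countable_rational_times)
    fix w v assume w: "w \<in> ?Q" and v: "v \<in> ?Q"
    show "{\<omega> \<in> space N. descents (\<lambda>u. X u \<omega>) (a \<omega>) (b \<omega>) s n w} \<in> sets N"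
      using w by (intro Suc.IH) (auto simp: rational_times_def)
    note [measurable] = X'[OF v]
    show "{\<omega> \<in> space N. X v \<omega> < b \<omega>} \<in> sets N" by measurable
  next
    fix k :: nat and u assume "u \<in> ?Q"
    note [measurable] = X'[OF this]
    show "{\<omega> \<in> space N. a \<omega> - 1 / real (Suc k) < X u \<omega>} \<in> sets N" by measurable
  qed
  finally show ?case .
qed simp

lemma measurable_down_crossings:
  assumes X: "\<And>u. u \<in> {s..t} \<Longrightarrow> X u \<in> borel_measurable N"
    and [measurable]: "y \<in> borel_measurable N"
    and cont: "\<And>\<omega>. \<omega> \<in> space N \<Longrightarrow> continuous_on {s..t} (\<lambda>u. X u \<omega>)"
    and c: "0 < c" "s \<le> t"
  shows "(\<lambda>\<omega>. down_crossings (\<lambda>u. X u \<omega>) (y \<omega>) c s t) \<in> measurable N (count_space UNIV)"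
proof (subst measurable_count_space_eq2_countable, intro conjI ballI)
  fix n
  let ?d = "\<lambda>\<omega>. down_crossings (\<lambda>u. X u \<omega>) (y \<omega>) c s t"
  have ge: "{\<omega> \<in> space N. n \<le> ?d \<omega>} \<in> sets N" for n
  proof -
    have "{\<omega> \<in> space N. n \<le> ?d \<omega>} = {\<omega> \<in> space N. descents (\<lambda>u. X u \<omega>) (y \<omega> + c/2) (y \<omega> - c/2) s n t}"
      using le_down_crossings_iff[OF cont c] by blast
    also have "\<dots> \<in> sets N" by (rule measurable_descents[OF X]) (use cont c in auto)
    finally show ?thesis .
  qed
  have "?d -` {n} \<inter> space N = {\<omega> \<in> space N. n \<le> ?d \<omega>} - {\<omega> \<in> space N. Suc n \<le> ?d \<omega>}" by auto
  then show "?d -` {n} \<inter> space N \<in> sets N" using ge by auto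
qed auto

lemma measurable_crossings:
  assumes X: "\<And>u. u \<in> {s..t} \<Longrightarrow> X u \<in> borel_measurable N"
    and [measurable]: "y \<in> borel_measurable N"
    and cont: "\<And>\<omega>. \<omega> \<in> space N \<Longrightarrow> continuous_on {s..t} (\<lambda>u. X u \<omega>)"
    and c: "0 < c" "s \<le> t"
  shows "(\<lambda>\<omega>. crossings (\<lambda>u. X u \<omega>) (y \<omega>) c s t) \<in> measurable N (count_space UNIV)"
proof -
  have [measurable]: "(\<lambda>\<omega>. down_crossings (\<lambda>u. X u \<omega>) (y \<omega>) c s t) \<in> measurable N (count_space UNIV)"
    by (rule measurable_down_crossings[OF X]) (use cont c in auto)
  have [measurable]: "(\<lambda>\<omega>. down_crossings (\<lambda>u. - X u \<omega>) (- y \<omega>) c s t) \<in> measurable N (count_space UNIV)"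
    by (rule measurable_down_crossings) (use X cont c in \<open>auto intro: continuous_on_minus\<close>)
  show ?thesis unfolding crossings_def up_crossings_def by measurable
qed

lemma measurable_crossings_level [measurable]:
  assumes "continuous_on {s..t} x" "0 < c" "s \<le> t"
  shows "(\<lambda>y. real (crossings x y c s t)) \<in> borel_measurable borel"
proof -
  have [measurable]: "(\<lambda>y. crossings x y c s t) \<in> measurable borel (count_space UNIV)"
    by (rule measurable_crossings) (use assms in auto)
  show ?thesis by measurable
qed

section \<open>Crossings and truncated variation\<close>

lemma no_crossings_point:
  assumes "0 < c"
  shows "crossings x y c s s = 0"
proof -
  have *: "down_crossings z y c s s = 0" for z y
    using le_down_crossings_iff[of s s z c "Suc 0" y] descents_exD[of z "y + c/2" "y - c/2" s 0 s] assms
    by (cases "down_crossings z y c s s") fastforce+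
  show ?thesis by (simp add: crossings_def up_crossings_def *)
qed

text \<open>The bound uses only the modulus of continuity of x for the band width c, so one bound
  serves all levels.\<close>

lemma down_crossings_bounded:
  assumes x: "continuous_on {s..t} x" and c: "0 < c" and st: "s \<le> t"
  shows "\<exists>K. \<forall>y. down_crossings x y c s t \<le> K"
proof -
  obtain \<eta> where \<eta>: "0 < \<eta>" "\<And>a b. a \<in> {s..t} \<Longrightarrow> b \<in> {s..t} \<Longrightarrow> \<bar>b - a\<bar> < \<eta> \<Longrightarrow> \<bar>x b - x a\<bar> < c"
    using uniform_modulus[OF x c] by blast
  have "down_crossings x y c s t \<le> nat \<lceil>(t - s) / \<eta>\<rceil>" for y
  proof -
    let ?n = "down_crossings x y c s t"
    have "descents x (y + c/2) (y - c/2) s ?n t" using le_down_crossings_iff[OF x c st] by blast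
    then have "s + real ?n * \<eta> \<le> t"
      using \<eta> by (intro descents_length[of x "y + c/2" "y - c/2" s ?n t t \<eta>]) auto
    then have "real ?n \<le> (t - s) / \<eta>" using \<eta>(1) by (simp add: field_simps)
    then show ?thesis by linarith
  qed
  then show ?thesis by blast
qed

lemma crossings_bounded:
  assumes "continuous_on {s..t} x" "0 < c" "s \<le> t" "\<And>u. u \<in> {s..t} \<Longrightarrow> \<bar>x u\<bar> < R"
  shows "\<exists>K. \<forall>y. real (crossings x y c s t) \<le> K * indicator {-R..R} y"
proof -
  obtain K L where K: "\<And>y. down_crossings x y c s t \<le> K" and L: "\<And>y. down_crossings (\<lambda>u. - x u) y c s t \<le> L"
    using down_crossings_bounded[OF assms(1-3)] down_crossings_bounded[OF continuous_on_minus[OF assms(1)] assms(2,3)] by blast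
  have "real (crossings x y c s t) \<le> real (K + L) * indicator {-R..R} y" for y
  proof (cases "crossings x y c s t = 0")
    case False
    then have "y \<in> x ` {s..t}" using crossings_range[OF assms(1-3)] by blast
    then have "y \<in> {-R..R}" using assms(4) by (force simp: abs_less_iff)
    then show ?thesis using K[of y] L[of "- y"] by (simp add: crossings_def up_crossings_def)
  qed (simp add: indicator_def)
  then show ?thesis by blast
qed

definition crossing_integral :: "(real \<Rightarrow> real) \<Rightarrow> real \<Rightarrow> (real \<Rightarrow> real) \<Rightarrow> real \<Rightarrow> real \<Rightarrow> real" where
  "crossing_integral g c x s t = (\<integral>y. g y * real (crossings x y c s t) \<partial>lborel)"

lemma integrable_crossings:
  assumes x: "continuous_on {s..t} x" and c: "0 < c" "s \<le> t"
    and g: "g \<in> borel_measurable borel" "\<And>y. \<bar>g y\<bar> \<le> K"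
  shows "integrable lborel (\<lambda>y. g y * real (crossings x y c s t))"
proof -
  obtain R where R: "0 < R" "\<And>a. a \<in> {s..t} \<Longrightarrow> \<bar>x a\<bar> < R" using path_bound[OF x] by blast
  obtain L where L: "\<And>y. real (crossings x y c s t) \<le> L * indicator {-R..R} y"
    using crossings_bounded[OF x c R(2)] by blast
  have K: "0 \<le> K" using g(2)[of 0] by linarith
  show ?thesis
  proof (rule Bochner_Integration.integrable_bound[where f = "\<lambda>y. K * (L * indicator {-R..R} y)"])
    show "integrable lborel (\<lambda>y. K * (L * indicator {-R..R} y))"
      by (intro integrable_mult_right integrable_real_indicator) (auto simp: emeasure_lborel_Icc_eq)
    show "(\<lambda>y. g y * real (crossings x y c s t)) \<in> borel_measurable lborel"
      using g(1) measurable_crossings_level[OF x c] by measurable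
    have "\<bar>g y\<bar> * real (crossings x y c s t) \<le> K * (L * indicator {-R..R} y)" for y
      using g(2)[of y] L[of y] K by (intro mult_mono) auto
    then have "\<bar>g y * real (crossings x y c s t)\<bar> \<le> \<bar>K * (L * indicator {-R..R} y)\<bar>" for y
      unfolding abs_mult[of "g y"] abs_of_nat by (rule order_trans[OF _ abs_ge_self])
    then show "AE y in lborel. norm (g y * real (crossings x y c s t)) \<le> norm (K * (L * indicator {-R..R} y))"
      by (intro AE_I2) (simp only: real_norm_def)
  qed
qed

lemma integrable_crossings_1:
  assumes "continuous_on {s..t} x" "0 < c" "s \<le> t"
  shows "integrable lborel (\<lambda>y. real (crossings x y c s t))"
  using integrable_crossings[OF assms, of "\<lambda>_. 1" 1] by simp

lemma integral_indicator_Ico_Ioc: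
  fixes a b :: real
  shows "integral\<^sup>L lborel (indicator {a..<b}) = max (b - a) 0" "integral\<^sup>L lborel (indicator {a<..b}) = max (b - a) 0"
    "integrable lborel (indicator {a..<b} :: real \<Rightarrow> real)" "integrable lborel (indicator {a<..b} :: real \<Rightarrow> real)"
  by (cases "a \<le> b"; simp)+

lemma has_integral_level_crossings:
  fixes a b :: real
  shows "has_bochner_integral lborel (\<lambda>y. indicator {a..<b} y + indicator {b<..a} y) \<bar>b - a\<bar>"
proof -
  have "has_bochner_integral lborel (\<lambda>y. indicator {a..<b} y + indicator {b<..a} y) (max (b - a) 0 + max (a - b) 0)"
    using integral_indicator_Ico_Ioc[of a b] integral_indicator_Ico_Ioc[of b a]
    by (intro has_bochner_integral_add) (simp_all only: has_bochner_integral_iff)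
  moreover have "max (b - a) 0 + max (a - b) 0 = \<bar>b - a\<bar>" by simp
  ultimately show ?thesis by simp
qed

text \<open>A move from x a to x b passes through the whole band around every level between them
  that is at least c / 2 away from both, up to end points. Such levels form an interval of length |x
  b - x a| - c, if this is positive. As the crossing integral is superadditive in time, it is a
  dominating function.\<close>

lemma tv_le_crossing_integral:
  assumes x: "continuous_on {s..t} x" and c: "0 < c" and st: "s \<le> t"
  shows "tv c x s t \<le> crossing_integral (\<lambda>_. 1) c x s t"
proof -
  let ?I = "\<lambda>a b. crossing_integral (\<lambda>_. 1) c x a b"
  have sub: "continuous_on {a..b} x" if "s \<le> a" "b \<le> t" for a b
    using x by (rule continuous_on_subset) (use that in auto)
  have "tv c x s t \<le> ?I s t - ?I s s"
  proof (rule tv_le[OF st])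
    fix a b assume ab: "s \<le> a" "a \<le> b" "b \<le> t"
    let ?S = "if x a \<le> x b then {x a + c/2..<x b - c/2} else {x b + c/2<..x a - c/2}"
    have S1: "indicator ?S y \<le> real (crossings x y c a b)" for y
    proof (cases "y \<in> ?S")
      case True
      have "1 \<le> crossings x y c a b"
      proof (cases "x a \<le> x b")
        case True
        with \<open>y \<in> ?S\<close> have "descents (\<lambda>u. - x u) (- y + c/2) (- y - c/2) a (Suc 0) b"
          using ab unfolding descents.simps by (intro exI[of _ a] exI[of _ b]) auto
        then show ?thesis using le_up_crossings_iff[OF sub c ab(2), of "Suc 0" y] ab by (simp add: crossings_def)
      next
        case False
        with \<open>y \<in> ?S\<close> have "descents x (y + c/2) (y - c/2) a (Suc 0) b"
          using ab unfolding descents.simps by (intro exI[of _ a] exI[of _ b]) auto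
        then show ?thesis using le_down_crossings_iff[OF sub c ab(2), of "Suc 0" y] ab by (simp add: crossings_def)
      qed
      with True show ?thesis by simp
    qed simp
    have "trunc_incr c x a b = integral\<^sup>L lborel (indicator ?S)"
    proof (cases "x a \<le> x b")
      case True
      then show ?thesis
        unfolding if_P[OF True] integral_indicator_Ico_Ioc trunc_incr_def by simp
    next
      case False
      then show ?thesis
        unfolding if_not_P[OF False] integral_indicator_Ico_Ioc trunc_incr_def by simp
    qed
    also have "\<dots> \<le> integral\<^sup>L lborel (\<lambda>y. real (crossings x y c a b))"
      by (rule integral_mono) (use S1 integral_indicator_Ico_Ioc integrable_crossings_1[OF sub c ab(2)] ab in auto)
    also have "\<dots> = ?I a b" by (simp add: crossing_integral_def)
    also have "\<dots> \<le> ?I s b - ?I s a"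
    proof -
      have "?I s a + ?I a b = (\<integral>y. real (crossings x y c s a) + real (crossings x y c a b) \<partial>lborel)"
        unfolding crossing_integral_def using ab
        by (subst Bochner_Integration.integral_add) (auto intro!: integrable_crossings_1 sub c)
      also have "\<dots> \<le> (\<integral>y. real (crossings x y c s b) \<partial>lborel)"
        using crossings_append(1)[OF sub c, of s b a] ab
        by (intro integral_mono Bochner_Integration.integrable_add integrable_crossings_1 sub c)
          (auto simp: of_nat_add[symmetric] simp del: of_nat_add)
      finally show ?thesis by (simp add: crossing_integral_def)
    qed
    finally show "trunc_incr c x a b \<le> ?I s b - ?I s a" .
  qed
  then show ?thesis by (simp add: crossing_integral_def no_crossings_point[OF c])
qed

text \<open>
  The play operator follows \<open>a\<close> lazily inside a band of width \<open>c\<close>. Its total variation is almost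
  the truncated variation of \<open>a\<close>, and a descent of \<open>a\<close> through the band around \<open>y\<close> makes it cross \<open>y\<close>.
\<close>
primrec play :: "real \<Rightarrow> (nat \<Rightarrow> real) \<Rightarrow> nat \<Rightarrow> real" where
  "play c a 0 = a 0"
| "play c a (Suc k) = max (a (Suc k) - c/2) (min (play c a k) (a (Suc k) + c/2))"

lemma play_near: "0 \<le> c \<Longrightarrow> \<bar>play c a k - a k\<bar> \<le> c/2"
proof -
  assume c: "0 \<le> c"
  then have "a k - c/2 \<le> play c a k" "play c a k \<le> a k + c/2"
    by (cases k; simp)+
  then show ?thesis by (simp only: abs_le_iff) linarith
qed

lemma play_cases:
  assumes "0 \<le> c"
  obtains "play c a (Suc k) = play c a k"
    | "play c a k < play c a (Suc k)" "play c a (Suc k) = a (Suc k) - c/2"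
    | "play c a (Suc k) < play c a k" "play c a (Suc k) = a (Suc k) + c/2"
proof -
  have c: "a (Suc k) - c/2 \<le> a (Suc k) + c/2" using assms by simp
  consider "play c a k < a (Suc k) - c/2" | "a (Suc k) + c/2 < play c a k"
    | "a (Suc k) - c/2 \<le> play c a k" "play c a k \<le> a (Suc k) + c/2" by linarith
  then show ?thesis
  proof cases
    case 1
    then have "play c a (Suc k) = a (Suc k) - c/2"
      using c by (simp add: min_absorb1 max_absorb1)
    with 1 that(2) show ?thesis by simp
  next
    case 2
    then have "play c a (Suc k) = a (Suc k) + c/2"
      using c by (simp add: min_absorb2 max_absorb2)
    with 2 that(3) show ?thesis by simp
  next
    case 3
    then have "play c a (Suc k) = play c a k" by (simp add: min_absorb1 max_absorb2)
    with that(1) show ?thesis by simp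
  qed
qed

text \<open>Let V be the variation so far and p the play. While p moves up, V - p is constant and p
  = a - c / 2, so the new V + p is at most \<Phi> i - a i + 2 a' - c for the new value a', hence at
  most \<Phi>' + a'. Moving down is symmetric with V + p constant. The invariant thus bounds V - p
  and V + p by \<Phi> i - a i and \<Phi> j + a j; replacing p by a at the end costs c / 2.\<close>

lemma play_variation:
  assumes c: "0 \<le> c" and "0 \<le> \<Phi> 0"
    and \<Phi>: "\<And>i j. i \<le> j \<Longrightarrow> j \<le> n \<Longrightarrow> \<bar>a j - a i\<bar> - c \<le> \<Phi> j - \<Phi> i" "\<And>i j. i \<le> j \<Longrightarrow> j \<le> n \<Longrightarrow> \<Phi> i \<le> \<Phi> j"
  shows "(\<Sum>i<n. \<bar>play c a (Suc i) - play c a i\<bar>) \<le> \<Phi> n + c/2"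
proof -
  let ?p = "play c a" and ?V = "\<lambda>k. \<Sum>i<k. \<bar>play c a (Suc i) - play c a i\<bar>"
  have "k \<le> n \<Longrightarrow> (\<exists>i\<le>k. ?V k - ?p k \<le> \<Phi> i - a i) \<and> (\<exists>i\<le>k. ?V k + ?p k \<le> \<Phi> i + a i) \<and> ?V k \<le> \<Phi> k + c/2" for k
  proof (induction k)
    case (Suc k)
    then obtain i j where i: "i \<le> k" "?V k - ?p k \<le> \<Phi> i - a i" and j: "j \<le> k" "?V k + ?p k \<le> \<Phi> j + a j"
      and V: "?V k \<le> \<Phi> k + c/2" by auto
    have V': "?V (Suc k) = ?V k + \<bar>?p (Suc k) - ?p k\<bar>" by simp
    have gi: "\<bar>a (Suc k) - a i\<bar> - c \<le> \<Phi> (Suc k) - \<Phi> i" and gj: "\<bar>a (Suc k) - a j\<bar> - c \<le> \<Phi> (Suc k) - \<Phi> j"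
      and gk: "\<Phi> k \<le> \<Phi> (Suc k)"
      using \<Phi>(1)[of i "Suc k"] \<Phi>(1)[of j "Suc k"] \<Phi>(2)[of k "Suc k"] i(1) j(1) Suc.prems by linarith+
    show ?case
    proof (cases rule: play_cases[OF c, of a k])
      case 1
      have V1: "?V (Suc k) = ?V k" unfolding V' 1 by simp
      have "?V (Suc k) - ?p (Suc k) \<le> \<Phi> i - a i" "?V (Suc k) + ?p (Suc k) \<le> \<Phi> j + a j"
        "?V (Suc k) \<le> \<Phi> (Suc k) + c/2" unfolding V1 1 using i(2) j(2) V gk by linarith+
      then show ?thesis using i(1) j(1) by (meson le_SucI)
    next
      case 2
      have V2: "?V (Suc k) = ?V k + ?p (Suc k) - ?p k" unfolding V' using 2(1) by linarith
      have "?V (Suc k) - ?p (Suc k) \<le> \<Phi> i - a i" unfolding V2 using i(2) by linarith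
      moreover have "?V (Suc k) + ?p (Suc k) \<le> \<Phi> (Suc k) + a (Suc k)" "?V (Suc k) \<le> \<Phi> (Suc k) + c/2"
        unfolding V2 using i(2) gi 2(2) c by linarith+
      ultimately show ?thesis using i(1) by (meson le_SucI order_refl)
    next
      case 3
      have V3: "?V (Suc k) = ?V k + ?p k - ?p (Suc k)" unfolding V' using 3(1) by linarith
      have "?V (Suc k) + ?p (Suc k) \<le> \<Phi> j + a j" unfolding V3 using j(2) by linarith
      moreover have "?V (Suc k) - ?p (Suc k) \<le> \<Phi> (Suc k) - a (Suc k)" "?V (Suc k) \<le> \<Phi> (Suc k) + c/2"
        unfolding V3 using j(2) gj 3(2) c by linarith+
      ultimately show ?thesis using j(1) by (meson le_SucI order_refl)
    qed
  qed (use assms(2) c in auto)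
  then show ?thesis by blast
qed

lemma level_crossing_step:
  fixes p :: "nat \<Rightarrow> real"
  assumes "k \<le> l" "y \<le> p k" "p l < y"
  shows "\<exists>i\<in>{k..<l}. p (Suc i) < y \<and> y \<le> p i"
proof (rule ccontr)
  assume neg: "\<not> ?thesis"
  have "y \<le> p l"
    using assms(1)
  proof (induction rule: dec_induct)
    case (step i)
    then show ?case using neg by (meson atLeastLessThan_iff not_le)
  qed (use assms in simp)
  with assms show False by simp
qed

text \<open>As p stays within c / 2 of x, a descent of x through the band takes p from at least y to
  below y, hence some single step of p across y. Successive descents use disjoint ranges of indices,
  so the steps are distinct.\<close>

lemma descents_le_level_crossings:
  fixes p :: "nat \<Rightarrow> real"
  assumes k: "\<And>u v. s \<le> u \<Longrightarrow> u \<le> v \<Longrightarrow> k u \<le> k v"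
    and near: "\<And>u. s \<le> u \<Longrightarrow> u \<le> t \<Longrightarrow> \<bar>p (k u) - x u\<bar> \<le> c/2"
    and D: "descents x (y + c/2) (y - c/2) s n \<tau>" "\<tau> \<le> t"
  shows "real n \<le> (\<Sum>i<k \<tau>. indicator {p (Suc i)<..p i} y)"
  using D
proof (induction n arbitrary: \<tau>)
  case (Suc n)
  then obtain u v where uv: "descents x (y + c/2) (y - c/2) s n u" "u \<le> v" "v \<le> \<tau>" "y + c/2 \<le> x u" "x v < y - c/2"
    by auto
  have su: "s \<le> u" by (rule descents_ge[OF uv(1)])
  have le: "k u \<le> k v" "k v \<le> k \<tau>" using k su uv by auto
  have IH: "real n \<le> (\<Sum>i<k u. indicator {p (Suc i)<..p i} y)" using Suc.IH[OF uv(1)] uv Suc.prems by simp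
  have "\<bar>p (k u) - x u\<bar> \<le> c/2" "\<bar>p (k v) - x v\<bar> \<le> c/2" using near su uv Suc.prems by auto
  then have "y \<le> p (k u)" "p (k v) < y" using uv(4,5) by linarith+
  then obtain i where i: "i \<in> {k u..<k v}" "p (Suc i) < y" "y \<le> p i"
    using level_crossing_step[OF le(1)] by blast
  have "(1::real) \<le> (\<Sum>i\<in>{i}. indicator {p (Suc i)<..p i} y)" using i by simp
  also have "\<dots> \<le> (\<Sum>i\<in>{k u..<k \<tau>}. indicator {p (Suc i)<..p i} y)"
    using i le by (intro sum_mono2) auto
  finally have "real (Suc n) \<le> (\<Sum>i<k u. indicator {p (Suc i)<..p i} y) + (\<Sum>i\<in>{k u..<k \<tau>}. indicator {p (Suc i)<..p i} y)"
    using IH by simp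
  also have "\<dots> = (\<Sum>i<k \<tau>. indicator {p (Suc i)<..p i} y)"
    using le by (subst sum.union_disjoint[symmetric]) (auto intro!: sum.cong)
  finally show ?case .
qed (auto intro: sum_nonneg)

text \<open>The play is run on a grid, and between grid points x may deviate by \<delta>. To stay
  within c / 2 of x at all times the play gets the narrower width c' = c - 2 \<delta>. Passing from
  c' back to c costs at most c / 4 and the play at most c' / 2, together less than c.\<close>

lemma crossing_integral_le_tv:
  assumes x: "continuous_on {s..t} x" and c: "0 < c" and st: "s \<le> t"
  shows "crossing_integral (\<lambda>_. 1) c x s t \<le> tv c x s t + c"
proof (cases "s = t")
  case True
  then show ?thesis using c by (simp add: crossing_integral_def no_crossings_point[OF c])
next
  case False
  with st have "s < t" by simp
  define l where "l = t - s"
  have l: "0 < l" using \<open>s < t\<close> by (simp add: l_def)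
  interpret continuous_path x s t by standard (rule x)
  obtain \<eta> where \<eta>: "0 < \<eta>" "\<And>a b. a \<in> {s..t} \<Longrightarrow> b \<in> {s..t} \<Longrightarrow> \<bar>b - a\<bar> < \<eta> \<Longrightarrow> \<bar>x b - x a\<bar> < c/2"
    using uniform_modulus[OF x, of "c/2"] c by auto
  \<comment> \<open>The first bound keeps c' \<ge> c / 2, so that increments over times shorter than
    \<eta>, which are below c / 2, also stay below c'. The second makes the charge 2 \<delta> l /
    \<eta> over the whole interval at most c / 4.\<close>
  define \<delta> where "\<delta> = min (c/4) (c * \<eta> / (8 * l))"
  have \<delta>: "0 < \<delta>" "\<delta> \<le> c/4" "2 * \<delta> * l / \<eta> \<le> c/4"
  proof -
    show "0 < \<delta>" "\<delta> \<le> c/4" using c \<eta>(1) l by (auto simp: \<delta>_def)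
    have "\<delta> \<le> c * \<eta> / (8 * l)" by (simp add: \<delta>_def)
    then have "\<delta> * (8 * l) \<le> c * \<eta>" using l by (simp add: pos_le_divide_eq)
    then show "2 * \<delta> * l / \<eta> \<le> c/4" using \<eta>(1) by (simp add: pos_divide_le_eq)
  qed
  define c' where "c' = c - 2 * \<delta>"
  have c': "0 < c'" "c' \<le> c" using \<delta> c unfolding c'_def by linarith+
  have tv': "tv c' x s t \<le> tv c x s t + c/4"
  proof -
    have "tv c' x s t \<le> (tv c x s t + 2 * \<delta> * t / \<eta>) - (tv c x s s + 2 * \<delta> * s / \<eta>)"
    proof (rule tv_le[OF st])
      fix a b assume ab: "s \<le> a" "a \<le> b" "b \<le> t"
      have "\<bar>x b - x a\<bar> \<le> c - 2 * \<delta>" if "\<bar>b - a\<bar> < \<eta>"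
        using \<eta>(2)[of a b] that ab \<delta>(2) c by auto
      then have "trunc_incr c' x a b \<le> trunc_incr c x a b + 2 * \<delta> * (b - a) / \<eta>"
        unfolding c'_def using \<delta>(1) \<eta>(1) ab(2) by (intro trunc_incr_shift) auto
      also have "2 * \<delta> * (b - a) / \<eta> = 2 * \<delta> * b / \<eta> - 2 * \<delta> * a / \<eta>"
        by (simp add: right_diff_distrib diff_divide_distrib)
      finally show "trunc_incr c' x a b \<le> (tv c x s b + 2 * \<delta> * b / \<eta>) - (tv c x s a + 2 * \<delta> * a / \<eta>)"
        using trunc_incr_le_tv[OF c, of a b] tv_superadditive[OF c, of s a b] ab by simp
    qed
    also have "\<dots> = tv c x s t + 2 * \<delta> * l / \<eta>"
      using c by (simp add: l_def right_diff_distrib diff_divide_distrib)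
    finally show ?thesis using \<delta>(3) by linarith
  qed
  obtain \<zeta> where \<zeta>: "0 < \<zeta>" "\<And>a b. a \<in> {s..t} \<Longrightarrow> b \<in> {s..t} \<Longrightarrow> \<bar>b - a\<bar> < \<zeta> \<Longrightarrow> \<bar>x b - x a\<bar> < \<delta>"
    using uniform_modulus[OF x \<delta>(1)] by blast
  obtain N :: nat where "l / \<zeta> < real N" using reals_Archimedean2 by blast
  then have N: "0 < N" "l / real N < \<zeta>"
  proof -
    have "0 < l / \<zeta>" using l \<zeta>(1) by simp
    with \<open>l / \<zeta> < real N\<close> show "0 < N" by (cases N) auto
    with \<open>l / \<zeta> < real N\<close> show "l / real N < \<zeta>" using \<zeta>(1) by (simp add: pos_divide_less_eq mult.commute)
  qed
  define q where "q = (\<lambda>i. s + l * real i / real N)"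
  define k where "k = (\<lambda>u. grid_index l N (u - s))"
  have q_in: "q i \<in> {s..t}" if "i \<le> N" for i
    using grid_point_in[of l i N] l that N(1) by (auto simp: q_def l_def)
  have q_mono: "q i \<le> q j" if "i \<le> j" for i j
    using l N(1) that by (auto simp: q_def intro!: divide_right_mono mult_left_mono)
  define p where "p = play c' (\<lambda>i. x (q i))"
  have kmono: "k u \<le> k v" if "s \<le> u" "u \<le> v" for u v
    unfolding k_def using l that by (intro grid_index_mono) auto
  have kt: "k t = N" using l by (simp add: k_def l_def[symmetric] grid_index_end)
  have near: "\<bar>p (k u) - x u\<bar> \<le> c/2" if "s \<le> u" "u \<le> t" for u
  proof -
    have g: "0 \<le> u - q (k u)" "u - q (k u) < l / real N" "k u \<le> N"
      using grid_index_near[of l "u - s" N] l N(1) that by (auto simp: k_def q_def l_def algebra_simps)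
    then have "\<bar>x u - x (q (k u))\<bar> < \<delta>"
      using \<zeta>(2)[of "q (k u)" u] q_in[of "k u"] that N(2) by auto
    moreover have "\<bar>p (k u) - x (q (k u))\<bar> \<le> c'/2"
      unfolding p_def using c'(1) by (intro play_near) simp
    moreover have "\<bar>p (k u) - x u\<bar> \<le> \<bar>p (k u) - x (q (k u))\<bar> + \<bar>x u - x (q (k u))\<bar>" by linarith
    moreover have "c'/2 + \<delta> = c/2" by (simp add: c'_def field_simps)
    ultimately show ?thesis by linarith
  qed
  have down: "real (down_crossings x y c s t) \<le> (\<Sum>i<N. indicator {p (Suc i)<..p i} y)" for y
  proof -
    have "descents x (y + c/2) (y - c/2) s (down_crossings x y c s t) t"
      using le_down_crossings_iff[OF x c st] by blast
    from descents_le_level_crossings[of s k t p x c, OF kmono near this order_refl] show ?thesis by (simp add: kt)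
  qed
  have up: "real (up_crossings x y c s t) \<le> (\<Sum>i<N. indicator {p i..<p (Suc i)} y)" for y
  proof -
    have near': "\<bar>- p (k u) - (- x u)\<bar> \<le> c/2" if "s \<le> u" "u \<le> t" for u using near[OF that] by linarith
    have "descents (\<lambda>u. - x u) (- y + c/2) (- y - c/2) s (up_crossings x y c s t) t"
      using le_up_crossings_iff[OF x c st] by blast
    from descents_le_level_crossings[of s k t "\<lambda>i. - p i" "\<lambda>u. - x u" c, OF kmono near' this order_refl]
    have "real (up_crossings x y c s t) \<le> (\<Sum>i<N. indicator {- p (Suc i)<..- p i} (- y))" by (simp add: kt)
    also have "\<dots> = (\<Sum>i<N. indicator {p i..<p (Suc i)} y)"
      by (intro sum.cong) (auto simp: indicator_def)
    finally show ?thesis .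
  qed
  have "crossing_integral (\<lambda>_. 1) c x s t
      \<le> (\<integral>y. (\<Sum>i<N. indicator {p i..<p (Suc i)} y + indicator {p (Suc i)<..p i} y) \<partial>lborel)"
    unfolding crossing_integral_def
  proof (rule integral_mono)
    show "integrable lborel (\<lambda>y. 1 * real (crossings x y c s t))"
      using integrable_crossings_1[OF x c st] by simp
    show "integrable lborel (\<lambda>y. \<Sum>i<N. indicator {p i..<p (Suc i)} y + indicator {p (Suc i)<..p i} y :: real)"
      by (intro Bochner_Integration.integrable_sum Bochner_Integration.integrable_add integral_indicator_Ico_Ioc)
    show "1 * real (crossings x y c s t) \<le> (\<Sum>i<N. indicator {p i..<p (Suc i)} y + indicator {p (Suc i)<..p i} y)" for y
      using up[of y] down[of y] by (simp add: crossings_def sum.distrib)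
  qed
  also have "\<dots> = (\<Sum>i<N. \<bar>p (Suc i) - p i\<bar>)"
    using has_integral_level_crossings
    by (intro has_bochner_integral_integral_eq has_bochner_integral_sum) auto
  also have "\<dots> \<le> tv c' x s (q N) + c'/2"
    unfolding p_def
  proof (rule play_variation)
    fix i j assume ij: "i \<le> j" "j \<le> N"
    have qq: "s \<le> q i" "q i \<le> q j" "q j \<le> t" using q_in[of i] q_in[of j] q_mono[OF ij(1)] ij by auto
    show "tv c' x s (q i) \<le> tv c' x s (q j)" by (rule tv_mono) (use qq c' in auto)
    have "\<bar>x (q j) - x (q i)\<bar> - c' \<le> trunc_incr c' x (q i) (q j)" by (simp add: trunc_incr_def)
    also have "\<dots> \<le> tv c' x (q i) (q j)" by (rule trunc_incr_le_tv) (use qq c' in auto)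
    also have "\<dots> \<le> tv c' x s (q j) - tv c' x s (q i)"
      using tv_superadditive[OF c'(1), of s "q i" "q j"] qq by simp
    finally show "\<bar>x (q j) - x (q i)\<bar> - c' \<le> tv c' x s (q j) - tv c' x s (q i)" .
  qed (use c' in simp_all)
  also have "q N = t" using N(1) by (simp add: q_def l_def)
  finally show ?thesis using tv' c' c by linarith
qed

section \<open>From truncated variation to the occupation integral\<close>

lemma abs_integral_le:
  fixes f g :: "'a \<Rightarrow> real"
  assumes "integrable M f" "integrable M g" "\<And>y. \<bar>f y\<bar> \<le> g y"
  shows "\<bar>\<integral>y. f y \<partial>M\<bar> \<le> (\<integral>y. g y \<partial>M)"
  using assms by (intro order_trans[OF integral_abs_bound integral_mono]) auto

text \<open>A cut loses at most two crossings per level, one in each direction, and only for levels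
  in [-R, R], an interval of length 2 R.\<close>

lemma crossing_integral_append:
  assumes x: "continuous_on {a..e} x" and R: "\<And>u. u \<in> {a..e} \<Longrightarrow> \<bar>x u\<bar> < R" and c: "0 < c" and ab: "a \<le> b" "b \<le> e"
    and g: "g \<in> borel_measurable borel" "\<And>y. \<bar>g y\<bar> \<le> K"
  shows "\<bar>crossing_integral g c x a e - crossing_integral g c x a b - crossing_integral g c x b e\<bar> \<le> 4 * K * R"
proof -
  have cs: "continuous_on {a..b} x" "continuous_on {b..e} x"
    by (rule continuous_on_subset[OF x]; use ab in auto)+
  have ae: "a \<le> e" using ab by simp
  have "\<bar>x a\<bar> < R" using R[of a] ae by simp
  then have R0: "0 \<le> R" by linarith
  have K0: "0 \<le> K" using g(2)[of 0] by linarith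
  let ?N = "\<lambda>a e y. real (crossings x y c a e)"
  let ?f = "\<lambda>y. g y * ?N a e y - g y * ?N a b y - g y * ?N b e y"
  have int: "integrable lborel (\<lambda>y. g y * ?N a e y)" "integrable lborel (\<lambda>y. g y * ?N a b y)" "integrable lborel (\<lambda>y. g y * ?N b e y)"
    using integrable_crossings[OF x c ae g] integrable_crossings[OF cs(1) c ab(1) g] integrable_crossings[OF cs(2) c ab(2) g] .
  have eq: "crossing_integral g c x a e - crossing_integral g c x a b - crossing_integral g c x b e = (\<integral>y. ?f y \<partial>lborel)"
    unfolding crossing_integral_def using int by simp
  have bd: "\<bar>?f y\<bar> \<le> 2 * K * indicator {-R..R} y" for y
  proof (cases "crossings x y c a e = 0")
    case True
    then have "crossings x y c a b = 0" "crossings x y c b e = 0"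
      using crossings_append(1)[OF x c ab, of y] by linarith+
    with True K0 show ?thesis by (simp add: indicator_def)
  next
    case False
    then have "y \<in> x ` {a..e}" using crossings_range[OF x c ae] by blast
    then have ind: "indicator {-R..R} y = (1::real)" using R by (force simp: abs_less_iff)
    have d: "0 \<le> ?N a e y - ?N a b y - ?N b e y" "?N a e y - ?N a b y - ?N b e y \<le> 2"
      using crossings_append[OF x c ab, of y] by linarith+
    have "?f y = g y * (?N a e y - ?N a b y - ?N b e y)" by (simp add: right_diff_distrib)
    then have "\<bar>?f y\<bar> = \<bar>g y\<bar> * (?N a e y - ?N a b y - ?N b e y)" using d(1) by (simp only: abs_mult abs_of_nonneg)
    also have "\<dots> \<le> K * 2" using g(2)[of y] d K0 by (intro mult_mono) auto
    finally show ?thesis using ind by simp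
  qed
  have "\<bar>\<integral>y. ?f y \<partial>lborel\<bar> \<le> (\<integral>y. 2 * K * indicator {-R..R} y \<partial>lborel)"
  proof (rule abs_integral_le)
    show "integrable lborel ?f" using int by simp
    show "integrable lborel (\<lambda>y. 2 * K * indicator {-R..R} y)"
      by (intro integrable_mult_right integrable_real_indicator) (auto simp: emeasure_lborel_Icc_eq)
  qed (use bd in auto)
  also have "\<dots> = 4 * K * R" using R0 by simp
  finally show ?thesis unfolding eq .
qed

lemma crossing_integral_near:
  assumes x: "continuous_on {a..b} x" and c: "0 < c" and ab: "a \<le> b"
    and g: "g \<in> borel_measurable borel" "\<And>y. \<bar>g y\<bar> \<le> K"
    and near: "\<And>u. u \<in> {a..b} \<Longrightarrow> \<bar>g (x u) - g0\<bar> \<le> w"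
  shows "\<bar>crossing_integral g c x a b - g0 * crossing_integral (\<lambda>_. 1) c x a b\<bar> \<le> w * crossing_integral (\<lambda>_. 1) c x a b"
proof -
  let ?N = "\<lambda>y. real (crossings x y c a b)"
  note i1 = integrable_crossings_1[OF x c ab] and ig = integrable_crossings[OF x c ab g]
  have eq: "crossing_integral g c x a b - g0 * crossing_integral (\<lambda>_. 1) c x a b = (\<integral>y. g y * ?N y - g0 * ?N y \<partial>lborel)"
    unfolding crossing_integral_def using i1 ig by simp
  have bd: "\<bar>g y * ?N y - g0 * ?N y\<bar> \<le> w * ?N y" for y
  proof (cases "crossings x y c a b = 0")
    case False
    then have "y \<in> x ` {a..b}" using crossings_range[OF x c ab] by blast
    then have "\<bar>g y - g0\<bar> \<le> w" using near by auto
    then have "\<bar>g y - g0\<bar> * ?N y \<le> w * ?N y" by (rule mult_right_mono) simp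
    then show ?thesis by (simp add: left_diff_distrib[symmetric] abs_mult)
  qed simp
  have "\<bar>\<integral>y. g y * ?N y - g0 * ?N y \<partial>lborel\<bar> \<le> (\<integral>y. w * ?N y \<partial>lborel)"
    by (rule abs_integral_le) (use i1 ig bd in auto)
  then show ?thesis unfolding eq by (simp add: crossing_integral_def)
qed

lemma riemann_sum_step:
  fixes f :: "real \<Rightarrow> real"
  assumes "continuous_on {a..b} f" "a \<le> b" "\<And>u. u \<in> {a..b} \<Longrightarrow> \<bar>f u - m\<bar> \<le> w"
  shows "\<bar>integral {a..b} f - m * (b - a)\<bar> \<le> w * (b - a)"
proof -
  have i: "f integrable_on {a..b}" using assms(1) by (rule integrable_continuous_interval)
  have "norm (integral {a..b} (\<lambda>u. f u - m)) \<le> w * (b - a)"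
    using assms by (intro integral_bound continuous_intros) auto
  moreover have "integral {a..b} (\<lambda>u. f u - m) = integral {a..b} f - m * (b - a)"
    using assms(2) by (subst Henstock_Kurzweil_Integration.integral_diff[OF i]) auto
  ultimately show ?thesis by simp
qed

text \<open>Applied with \<phi> n = c n powr (1 / H - 1). A cut in time costs c n in truncated
  variation and a bounded amount in the crossing integral; the two null limits make both costs
  disappear after scaling.\<close>

locale tv_limit =
  fixes x :: "real \<Rightarrow> real" and T C :: real and c \<phi> :: "nat \<Rightarrow> real"
  assumes T: "0 \<le> T" and x: "continuous_on {0..T} x" and c: "\<And>n. 0 < c n"
    and \<phi>: "\<And>n. 0 \<le> \<phi> n" "\<phi> \<longlonglongrightarrow> 0" "(\<lambda>n. \<phi> n * c n) \<longlonglongrightarrow> 0"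
    and lim: "\<And>t. t \<in> {0..T} \<Longrightarrow> (\<lambda>n. \<phi> n * tv (c n) x 0 t) \<longlonglongrightarrow> C * t"
begin

sublocale continuous_path x 0 T by standard (rule x)

lemma tv_interval_limit:
  assumes ab: "0 \<le> a" "a \<le> b" "b \<le> T"
  shows "(\<lambda>n. \<phi> n * tv (c n) x a b) \<longlonglongrightarrow> C * (b - a)"
proof -
  have 1: "(\<lambda>n. \<phi> n * tv (c n) x 0 b - \<phi> n * tv (c n) x 0 a) \<longlonglongrightarrow> C * b - C * a"
    using ab by (intro tendsto_diff lim) auto
  have 2: "(\<lambda>n. \<phi> n * tv (c n) x 0 b - \<phi> n * tv (c n) x 0 a - \<phi> n * c n) \<longlonglongrightarrow> C * b - C * a - 0"
    by (intro tendsto_diff[OF 1 \<phi>(3)])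
  have le1: "\<phi> n * tv (c n) x a b \<le> \<phi> n * tv (c n) x 0 b - \<phi> n * tv (c n) x 0 a" for n
  proof -
    have "\<phi> n * tv (c n) x a b \<le> \<phi> n * (tv (c n) x 0 b - tv (c n) x 0 a)"
      using tv_superadditive[OF c, of 0 a b n] ab by (intro mult_left_mono \<phi>(1)) auto
    then show ?thesis by (simp add: right_diff_distrib)
  qed
  have le2: "\<phi> n * tv (c n) x 0 b - \<phi> n * tv (c n) x 0 a - \<phi> n * c n \<le> \<phi> n * tv (c n) x a b" for n
  proof -
    have "\<phi> n * (tv (c n) x 0 b - tv (c n) x 0 a - c n) \<le> \<phi> n * tv (c n) x a b"
      using tv_subadditive[OF c, of 0 a b n] ab by (intro mult_left_mono \<phi>(1)) auto
    then show ?thesis by (simp add: right_diff_distrib)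
  qed
  have "(\<lambda>n. \<phi> n * tv (c n) x a b) \<longlonglongrightarrow> C * b - C * a"
    using 1 2 le1 le2 by (intro tendsto_sandwich[OF _ _ 2[simplified] 1]) auto
  then show ?thesis by (simp add: right_diff_distrib)
qed

lemma crossing_integral_1_limit:
  assumes ab: "0 \<le> a" "a \<le> b" "b \<le> T"
  shows "(\<lambda>n. \<phi> n * crossing_integral (\<lambda>_. 1) (c n) x a b) \<longlonglongrightarrow> C * (b - a)"
proof -
  note 1 = tv_interval_limit[OF ab]
  have 2: "(\<lambda>n. \<phi> n * tv (c n) x a b + \<phi> n * c n) \<longlonglongrightarrow> C * (b - a)"
    using tendsto_add[OF 1 \<phi>(3)] by simp
  have cs: "continuous_on {a..b} x" using ab by (intro cont_sub) auto
  have le1: "\<phi> n * tv (c n) x a b \<le> \<phi> n * crossing_integral (\<lambda>_. 1) (c n) x a b" for n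
    by (intro mult_left_mono \<phi>(1) tv_le_crossing_integral cs c ab)
  have le2: "\<phi> n * crossing_integral (\<lambda>_. 1) (c n) x a b \<le> \<phi> n * tv (c n) x a b + \<phi> n * c n" for n
    unfolding distrib_left[symmetric] by (intro mult_left_mono \<phi>(1) crossing_integral_le_tv cs c ab)
  show ?thesis by (rule tendsto_sandwich[OF _ _ 1 2]) (use le1 le2 in auto)
qed

text \<open>Freezing g at g0 is paid twice, once against the crossings and once in the time
  integral, hence the factor 2. The remaining \<eta> covers the convergence of the total crossing
  integral.\<close>

lemma crossing_integral_step:
  assumes ab: "0 \<le> a" "a \<le> b" "b \<le> T"
    and g: "continuous_on UNIV g" "\<And>y. \<bar>g y\<bar> \<le> K"
    and near: "\<And>u. u \<in> {a..b} \<Longrightarrow> \<bar>g (x u) - g0\<bar> \<le> w"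
    and \<eta>: "0 < \<eta>"
  shows "\<forall>\<^sub>F n in sequentially. \<bar>\<phi> n * crossing_integral g (c n) x a b - C * integral {a..b} (\<lambda>s. g (x s))\<bar> \<le> 2 * w * (C * (b - a)) + \<eta>"
proof -
  have cs: "continuous_on {a..b} x" using ab by (intro cont_sub) auto
  have gm: "g \<in> borel_measurable borel" using g(1) by (rule borel_measurable_continuous_onI)
  let ?I = "\<lambda>n. \<phi> n * crossing_integral (\<lambda>_. 1) (c n) x a b" and ?Z = "integral {a..b} (\<lambda>s. g (x s))"
  have lim1: "?I \<longlonglongrightarrow> C * (b - a)" by (rule crossing_integral_1_limit[OF ab])
  have pos: "0 \<le> C * (b - a)"
    by (rule LIMSEQ_le_const[OF lim1]) (auto simp: crossing_integral_def intro!: mult_nonneg_nonneg \<phi>(1))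
  have "(\<lambda>n. \<bar>?I n * g0 - C * (b - a) * g0\<bar> + w * ?I n) \<longlonglongrightarrow> \<bar>C * (b - a) * g0 - C * (b - a) * g0\<bar> + w * (C * (b - a))"
    by (intro tendsto_intros lim1)
  then have "(\<lambda>n. \<bar>?I n * g0 - C * (b - a) * g0\<bar> + w * ?I n) \<longlonglongrightarrow> w * (C * (b - a))" by simp
  from order_tendstoD(2)[OF this, of "w * (C * (b - a)) + \<eta>"] \<eta>
  have "\<forall>\<^sub>F n in sequentially. \<bar>?I n * g0 - C * (b - a) * g0\<bar> + w * ?I n < w * (C * (b - a)) + \<eta>" by simp
  then show ?thesis
  proof eventually_elim
    case (elim n)
    have A: "\<bar>\<phi> n * crossing_integral g (c n) x a b - ?I n * g0\<bar> \<le> w * ?I n"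
    proof -
      have "\<bar>\<phi> n * (crossing_integral g (c n) x a b - g0 * crossing_integral (\<lambda>_. 1) (c n) x a b)\<bar>
          \<le> \<phi> n * (w * crossing_integral (\<lambda>_. 1) (c n) x a b)"
        unfolding abs_mult abs_of_nonneg[OF \<phi>(1)[of n]]
        by (intro mult_left_mono \<phi>(1) crossing_integral_near[OF cs c ab(2) gm g(2) near])
      then show ?thesis by (simp add: algebra_simps)
    qed
    have "\<bar>?Z - g0 * (b - a)\<bar> \<le> w * (b - a)"
      by (intro riemann_sum_step ab near continuous_on_compose2[OF g(1) cs]) auto
    then have B: "\<bar>C * (b - a) * g0 - C * ?Z\<bar> \<le> w * (C * (b - a))"
    \<comment> \<open>The sign of C can be read off from \<open>0 \<le> C * (b - a)\<close> only
      when a < b.\<close>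
    proof (cases "a = b")
      case False
      then have "0 \<le> C" using pos ab(2) by (simp add: zero_le_mult_iff)
      then have "C * \<bar>?Z - g0 * (b - a)\<bar> \<le> C * (w * (b - a))"
        using \<open>\<bar>?Z - g0 * (b - a)\<bar> \<le> w * (b - a)\<close> by (intro mult_left_mono)
      moreover have "\<bar>C * (b - a) * g0 - C * ?Z\<bar> = C * \<bar>?Z - g0 * (b - a)\<bar>"
      proof -
        have "C * (b - a) * g0 - C * ?Z = C * - (?Z - g0 * (b - a))" by (simp add: algebra_simps)
        then show ?thesis using \<open>0 \<le> C\<close> by (simp only: abs_mult abs_minus_cancel abs_of_nonneg)
      qed
      ultimately show ?thesis by (simp add: mult.left_commute)
    qed simp
    show ?case using A B elim by linarith
  qed
qed

text \<open>The grid is fixed by the oscillation of g along x, before n grows. Freezing g then costs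
  an amount proportional to w and to the elapsed time, independent of the number of cells, while the
  finitely many cuts cost nothing in the limit.\<close>

theorem crossing_integral_limit:
  assumes t: "t \<in> {0..T}" and g: "continuous_on UNIV g" "\<And>y. \<bar>g y\<bar> \<le> K"
  shows "(\<lambda>n. \<phi> n * crossing_integral g (c n) x 0 t) \<longlonglongrightarrow> C * integral {0..t} (\<lambda>s. g (x s))"
proof (cases "t = 0")
  case True
  then show ?thesis by (simp add: crossing_integral_def no_crossings_point[OF c])
next
  case False
  with t have t0: "0 < t" "t \<le> T" by auto
  have gm: "g \<in> borel_measurable borel" using g(1) by (rule borel_measurable_continuous_onI)
  have gx: "continuous_on {0..t} (\<lambda>s. g (x s))"
    by (rule continuous_on_compose2[OF g(1) cont_sub]) (use t0 in auto)
  have xt: "continuous_on {0..t} x" using t0 by (intro cont_sub) auto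
  obtain R where R: "0 < R" "\<And>a. a \<in> {0..t} \<Longrightarrow> \<bar>x a\<bar> < R" using path_bound[OF xt] by blast
  define E where "E = (\<lambda>n a b. \<phi> n * crossing_integral g (c n) x a b - C * integral {a..b} (\<lambda>s. g (x s)))"
  have "\<forall>\<^sub>F n in sequentially. \<bar>E n 0 t\<bar> < e" if e: "0 < e" for e
  proof -
    have Ct: "0 \<le> C * t"
      by (rule LIMSEQ_le_const[OF lim[OF t]]) (auto intro!: mult_nonneg_nonneg \<phi>(1))
    \<comment> \<open>Makes the freezing error 2 w C t at most e / 2; the summand 1 covers C t =
      0.\<close>
    define w where "w = e / (4 * (C * t + 1))"
    have w: "0 < w" using e Ct by (simp add: w_def)
    have w2: "2 * w * (C * t) < e"
    proof -
      have "C * t + 1 \<noteq> 0" using Ct by linarith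
      then have "4 * w * (C * t + 1) = e" unfolding w_def by (simp only: times_divide_eq_right times_divide_eq_left mult.assoc) (simp add: field_simps)
      then have "4 * (w * (C * t)) + 4 * w = e" by (simp add: algebra_simps)
      then show ?thesis using w e Ct mult_nonneg_nonneg[of w "C * t"] by simp
    qed
    obtain \<zeta> where \<zeta>: "0 < \<zeta>" "\<And>a b. a \<in> {0..t} \<Longrightarrow> b \<in> {0..t} \<Longrightarrow> \<bar>b - a\<bar> < \<zeta> \<Longrightarrow> \<bar>g (x b) - g (x a)\<bar> < w"
      using uniform_modulus[OF gx w] by blast
    obtain m :: nat where m: "t / \<zeta> < real m" using reals_Archimedean2 by blast
    have "0 < t / \<zeta>" using t0 \<zeta>(1) by simp
    with m have m0: "0 < m" by (cases m) auto
    have tm: "t / real m < \<zeta>" using m m0 \<zeta>(1) by (simp add: pos_divide_less_eq mult.commute)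
    define q where "q = (\<lambda>k. t * real k / real m)"
    have q_in: "q k \<in> {0..t}" if "k \<le> m" for k using grid_point_in[of t k m] t0 that m0 by (simp add: q_def)
    have q_Suc: "q (Suc k) - q k = t / real m" for k by (simp add: q_def distrib_left add_divide_distrib)
    \<comment> \<open>Cells are added one at a time. The slack \<eta> is split into thirds: the new
      cell, the earlier cells, and the cut between them.\<close>
    have claim: "k \<le> m \<Longrightarrow> 0 < \<eta> \<Longrightarrow> \<forall>\<^sub>F n in sequentially. \<bar>E n 0 (q k)\<bar> \<le> 2 * w * (C * q k) + \<eta>" for k \<eta>
    proof (induction k arbitrary: \<eta>)
      case 0
      then show ?case by (simp add: E_def q_def crossing_integral_def no_crossings_point[OF c])
    next
      case (Suc k)
      let ?a = "q k" and ?b = "q (Suc k)"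
      have "0 \<le> t / real m" using t0 by simp
      then have "?a \<le> ?b" using q_Suc[of k] by linarith
      then have ab: "0 \<le> ?a" "?a \<le> ?b" "?b \<le> t"
        using q_in[of k] q_in[of "Suc k"] Suc.prems by auto
      have "\<forall>\<^sub>F n in sequentially. \<bar>E n ?a ?b\<bar> \<le> 2 * w * (C * (?b - ?a)) + \<eta>/3"
        unfolding E_def
      proof (rule crossing_integral_step[OF _ _ _ g, where ?g0.0 = "g (x ?a)"])
        fix u assume "u \<in> {?a..?b}"
        then show "\<bar>g (x u) - g (x ?a)\<bar> \<le> w"
          using \<zeta>(2)[of ?a u] ab tm q_Suc[of k] by (auto intro: less_imp_le)
      qed (use ab t0 Suc.prems in auto)
      moreover have "\<forall>\<^sub>F n in sequentially. \<bar>E n 0 ?a\<bar> \<le> 2 * w * (C * ?a) + \<eta>/3"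
        using Suc.prems by (intro Suc.IH) auto
      moreover have "\<forall>\<^sub>F n in sequentially. \<phi> n * (4 * K * R) < \<eta>/3"
        using order_tendstoD(2)[OF tendsto_mult_left_zero[OF \<phi>(2), of "4 * K * R"], of "\<eta>/3"] Suc.prems by simp
      ultimately show ?case
      proof eventually_elim
        case (elim n)
        have "\<bar>\<phi> n * (crossing_integral g (c n) x 0 ?b - crossing_integral g (c n) x 0 ?a - crossing_integral g (c n) x ?a ?b)\<bar> \<le> \<phi> n * (4 * K * R)"
          unfolding abs_mult abs_of_nonneg[OF \<phi>(1)[of n]]
          by (intro mult_left_mono \<phi>(1) crossing_integral_append c gm g(2) cont_sub)
            (use ab t0 R(2) in auto)
        moreover have "integral {0..?a} (\<lambda>s. g (x s)) + integral {?a..?b} (\<lambda>s. g (x s)) = integral {0..?b} (\<lambda>s. g (x s))"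
          by (rule Henstock_Kurzweil_Integration.integral_combine)
            (use ab in \<open>auto intro!: integrable_continuous_interval continuous_on_subset[OF gx]\<close>)
        then have "C * integral {0..?b} (\<lambda>s. g (x s)) = C * integral {0..?a} (\<lambda>s. g (x s)) + C * integral {?a..?b} (\<lambda>s. g (x s))"
          by (metis distrib_left)
        ultimately have "\<bar>E n 0 ?b - E n 0 ?a - E n ?a ?b\<bar> \<le> \<phi> n * (4 * K * R)"
          unfolding E_def by (simp add: right_diff_distrib)
        moreover have "2 * w * (C * ?b) = 2 * w * (C * ?a) + 2 * w * (C * (?b - ?a))" by (simp add: algebra_simps)
        ultimately show ?case using elim by linarith
      qed
    qed
    have "q m = t" using m0 by (simp add: q_def)
    with claim[of m "(e - 2 * w * (C * t)) / 2"] w2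
    have "\<forall>\<^sub>F n in sequentially. \<bar>E n 0 t\<bar> \<le> 2 * w * (C * t) + (e - 2 * w * (C * t)) / 2" by simp
    then show ?thesis
    proof (rule eventually_mono)
      have "2 * w * (C * t) + (e - 2 * w * (C * t)) / 2 < e" using w2 by (simp add: field_simps)
      then show "\<bar>E n 0 t\<bar> < e" if "\<bar>E n 0 t\<bar> \<le> 2 * w * (C * t) + (e - 2 * w * (C * t)) / 2" for n
        using that by linarith
    qed
  qed
  then show ?thesis unfolding E_def tendsto_iff dist_real_def by blast
qed

end

text \<open>Polya's argument: by monotonicity f n t lies between its values at the neighbouring grid
  points, where convergence is simultaneous because they are finitely many, and the continuous limit
  hardly varies between them.\<close>

lemma mono_pointwise_limit_uniform:
  fixes f :: "nat \<Rightarrow> real \<Rightarrow> real"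
  assumes T: "0 < T" and h: "continuous_on {0..T} h" and e: "0 < e"
    and mono: "\<And>n a b. 0 \<le> a \<Longrightarrow> a \<le> b \<Longrightarrow> b \<le> T \<Longrightarrow> f n a \<le> f n b"
    and lim: "\<And>t. t \<in> {0..T} \<Longrightarrow> (\<lambda>n. f n t) \<longlonglongrightarrow> h t"
  shows "\<forall>\<^sub>F n in sequentially. \<forall>t\<in>{0..T}. \<bar>f n t - h t\<bar> \<le> e"
proof -
  obtain \<zeta> where \<zeta>: "0 < \<zeta>" "\<And>a b. a \<in> {0..T} \<Longrightarrow> b \<in> {0..T} \<Longrightarrow> \<bar>b - a\<bar> < \<zeta> \<Longrightarrow> \<bar>h b - h a\<bar> < e/2"
    using uniform_modulus[OF h, of "e/2"] e by auto
  obtain m :: nat where m: "T / \<zeta> < real m" using reals_Archimedean2 by blast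
  have "0 < T / \<zeta>" using T \<zeta>(1) by simp
  with m have m0: "0 < m" by (cases m) auto
  have tm: "T / real m < \<zeta>" using m m0 \<zeta>(1) by (simp add: pos_divide_less_eq mult.commute)
  define q where "q = (\<lambda>k. T * real k / real m)"
  have q_in: "q k \<in> {0..T}" if "k \<le> m" for k using grid_point_in[of T k m] T that m0 by (simp add: q_def)
  have "\<forall>\<^sub>F n in sequentially. \<forall>k\<in>{..m}. \<bar>f n (q k) - h (q k)\<bar> < e/2"
  proof (intro eventually_ball_finite ballI)
    fix k assume "k \<in> {..m}"
    then have "(\<lambda>n. f n (q k)) \<longlonglongrightarrow> h (q k)" by (intro lim q_in) auto
    then show "\<forall>\<^sub>F n in sequentially. \<bar>f n (q k) - h (q k)\<bar> < e/2"
      using e unfolding tendsto_iff dist_real_def by (metis half_gt_zero)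
  qed simp
  then show ?thesis
  proof eventually_elim
    case (elim n)
    show ?case
    proof
      fix t assume t: "t \<in> {0..T}"
      let ?k = "grid_index T m t"
      have k: "0 \<le> t - q ?k" "t - q ?k < T / real m" "?k \<le> m"
        using grid_index_near[of T t m] T t m0 by (auto simp: q_def)
      have low: "h t - e \<le> f n t"
      proof -
        have "\<bar>f n (q ?k) - h (q ?k)\<bar> < e/2" using elim k(3) by auto
        moreover have "\<bar>h t - h (q ?k)\<bar> < e/2" using \<zeta>(2)[of "q ?k" t] q_in[OF k(3)] t k tm by auto
        moreover have "f n (q ?k) \<le> f n t" using q_in[OF k(3)] k t by (intro mono) auto
        ultimately show ?thesis by linarith
      qed
      have up: "f n t \<le> h t + e"
      proof (cases "?k = m")
        case True
        then have "q m \<le> t" using k(1) by simp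
        then have "t = T" using m0 t by (simp add: q_def)
        moreover have "\<bar>f n (q m) - h (q m)\<bar> < e/2" using elim by auto
        moreover have "q m = T" using m0 by (simp add: q_def)
        ultimately have "\<bar>f n T - h T\<bar> < e/2" by simp
        then have "f n T \<le> h T + e" using e by linarith
        with \<open>t = T\<close> show ?thesis by simp
      next
        case False
        then have k': "Suc ?k \<le> m" using k(3) by simp
        have s: "q (Suc ?k) - q ?k = T / real m" by (simp add: q_def distrib_left add_divide_distrib)
        have "\<bar>f n (q (Suc ?k)) - h (q (Suc ?k))\<bar> < e/2" using elim k' by auto
        moreover have "\<bar>h t - h (q (Suc ?k))\<bar> < e/2" using \<zeta>(2)[of "q (Suc ?k)" t] q_in[OF k'] t k tm s by auto
        moreover have "f n t \<le> f n (q (Suc ?k))" using q_in[OF k'] k t s by (intro mono) auto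
        ultimately show ?thesis by linarith
      qed
      show "\<bar>f n t - h t\<bar> \<le> e" using low up by linarith
    qed
  qed
qed

context tv_limit
begin

lemma crossing_integral_mono:
  assumes g: "g \<in> borel_measurable borel" "\<And>y. 0 \<le> g y" "\<And>y. g y \<le> K"
    and ab: "0 \<le> a" "a \<le> b" "b \<le> T"
  shows "crossing_integral g (c n) x 0 a \<le> crossing_integral g (c n) x 0 b"
proof -
  have gK: "\<bar>g y\<bar> \<le> K" for y using g(2,3)[of y] by simp
  have sub: "continuous_on {0..a} x" "continuous_on {0..b} x" using ab by (auto intro: cont_sub)
  show ?thesis unfolding crossing_integral_def
  proof (rule integral_mono)
    show "integrable lborel (\<lambda>y. g y * real (crossings x y (c n) 0 a))"
      by (rule integrable_crossings[OF sub(1) c ab(1) g(1) gK])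
    show "integrable lborel (\<lambda>y. g y * real (crossings x y (c n) 0 b))"
      using ab by (intro integrable_crossings[OF sub(2) c _ g(1) gK]) auto
    show "g y * real (crossings x y (c n) 0 a) \<le> g y * real (crossings x y (c n) 0 b)" for y
      using crossings_mono[OF sub(2) c ab(1,2), of y n] g(2) by (intro mult_left_mono) auto
  qed
qed

text \<open>Monotonicity in t requires a nonnegative g. Hence g is written as (g + K) - K; both
  parts are nonnegative and bounded by 2 K, and each is given an error of e / 2.\<close>

theorem crossing_integral_limit_uniform:
  assumes g: "continuous_on UNIV g" "\<And>y. \<bar>g y\<bar> \<le> K" and e: "0 < e" and T: "0 < T"
  shows "\<forall>\<^sub>F n in sequentially. \<forall>t\<in>{0..T}. \<bar>\<phi> n * crossing_integral g (c n) x 0 t - C * integral {0..t} (\<lambda>s. g (x s))\<bar> \<le> e"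
proof -
  have nonneg: "\<forall>\<^sub>F n in sequentially. \<forall>t\<in>{0..T}. \<bar>\<phi> n * crossing_integral f (c n) x 0 t - C * integral {0..t} (\<lambda>s. f (x s))\<bar> \<le> e/2"
    if f: "continuous_on UNIV f" "\<And>y. 0 \<le> f y" "\<And>y. f y \<le> 2 * K" for f
  proof (rule mono_pointwise_limit_uniform[OF T])
    have fK: "\<bar>f y\<bar> \<le> 2 * K" for y using f(2,3)[of y] by simp
    have fx: "continuous_on {0..T} (\<lambda>s. f (x s))" by (rule continuous_on_compose2[OF f(1) x]) auto
    show "continuous_on {0..T} (\<lambda>t. C * integral {0..t} (\<lambda>s. f (x s)))"
      by (intro continuous_intros indefinite_integral_continuous_1 integrable_continuous_interval fx)
    show "(\<lambda>n. \<phi> n * crossing_integral f (c n) x 0 t) \<longlonglongrightarrow> C * integral {0..t} (\<lambda>s. f (x s))" if "t \<in> {0..T}" for t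
      by (rule crossing_integral_limit[OF that f(1) fK])
    show "\<phi> n * crossing_integral f (c n) x 0 a \<le> \<phi> n * crossing_integral f (c n) x 0 b" if "0 \<le> a" "a \<le> b" "b \<le> T" for n a b
      using f that by (intro mult_left_mono \<phi>(1) crossing_integral_mono[where K = "2 * K"] borel_measurable_continuous_onI) auto
  qed (use e in simp)
  have K: "0 \<le> K" "\<And>y. - K \<le> g y" "\<And>y. g y \<le> K" using g(2) by (simp_all add: abs_le_iff) (metis abs_ge_zero g(2) order_trans, metis g(2) abs_le_iff minus_le_iff)
  have gm: "g \<in> borel_measurable borel" using g(1) by (rule borel_measurable_continuous_onI)
  let ?f = "\<lambda>y. g y + K" and ?k = "\<lambda>_::real. K"
  have "\<forall>\<^sub>F n in sequentially. \<forall>t\<in>{0..T}. \<bar>\<phi> n * crossing_integral ?f (c n) x 0 t - C * integral {0..t} (\<lambda>s. ?f (x s))\<bar> \<le> e/2"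
  proof (rule nonneg)
    show "0 \<le> ?f y" "?f y \<le> 2 * K" for y using K(2,3)[of y] by linarith+
  qed (intro continuous_intros g(1))
  moreover have "\<forall>\<^sub>F n in sequentially. \<forall>t\<in>{0..T}. \<bar>\<phi> n * crossing_integral ?k (c n) x 0 t - C * integral {0..t} (\<lambda>s. ?k (x s))\<bar> \<le> e/2"
    by (rule nonneg) (use K(1) in auto)
  ultimately show ?thesis
  proof eventually_elim
    case (elim n)
    show ?case
    proof
      fix t assume t: "t \<in> {0..T}"
      have sub: "continuous_on {0..t} x" using t by (intro cont_sub) auto
      have gx: "(\<lambda>s. g (x s)) integrable_on {0..t}"
        by (intro integrable_continuous_interval continuous_on_compose2[OF g(1) sub]) auto
      have i1: "integrable lborel (\<lambda>y. g y * real (crossings x y (c n) 0 t))"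
        using t by (intro integrable_crossings[OF sub c _ gm g(2)]) auto
      have i2: "integrable lborel (\<lambda>y. K * real (crossings x y (c n) 0 t))"
        using t integrable_crossings_1[OF sub c] by auto
      have "crossing_integral ?f (c n) x 0 t = crossing_integral g (c n) x 0 t + crossing_integral ?k (c n) x 0 t"
        unfolding crossing_integral_def distrib_right by (rule Bochner_Integration.integral_add[OF i1 i2])
      then have A: "\<phi> n * crossing_integral ?f (c n) x 0 t = \<phi> n * crossing_integral g (c n) x 0 t + \<phi> n * crossing_integral ?k (c n) x 0 t"
        by (simp only: distrib_left)
      have "integral {0..t} (\<lambda>s. ?f (x s)) = integral {0..t} (\<lambda>s. g (x s)) + integral {0..t} (\<lambda>s. ?k (x s))"
        by (rule Henstock_Kurzweil_Integration.integral_add[OF gx]) auto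
      then have B: "C * integral {0..t} (\<lambda>s. ?f (x s)) = C * integral {0..t} (\<lambda>s. g (x s)) + C * integral {0..t} (\<lambda>s. ?k (x s))"
        by (simp only: distrib_left)
      have "\<bar>\<phi> n * crossing_integral ?f (c n) x 0 t - C * integral {0..t} (\<lambda>s. ?f (x s))\<bar> \<le> e/2"
        "\<bar>\<phi> n * crossing_integral ?k (c n) x 0 t - C * integral {0..t} (\<lambda>s. ?k (x s))\<bar> \<le> e/2"
        using bspec[OF elim(1) t] bspec[OF elim(2) t] .
      then show "\<bar>\<phi> n * crossing_integral g (c n) x 0 t - C * integral {0..t} (\<lambda>s. g (x s))\<bar> \<le> e"
        unfolding A B by linarith
    qed
  qed
qed

end

section \<open>Gaussian linear forms\<close>

text \<open>As an image of the standard normal law, so that the degenerate case v = 0 is covered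
  uniformly afterwards.\<close>

lemma normal_law_eq:
  assumes v: "0 \<le> v"
  shows "normal_law m v = distr std_normal_distribution borel (\<lambda>x. m + sqrt v * x)"
proof (cases "v = 0")
  case True
  interpret N: prob_space std_normal_distribution by (rule prob_space_normal_density) simp
  show ?thesis using True by (simp add: normal_law_def N.distr_const)
next
  case False
  let ?s = "sqrt v"
  have s: "0 < ?s" using v False by simp
  show ?thesis
  proof (rule measure_eqI)
    show "sets (normal_law m v) = sets (distr std_normal_distribution borel (\<lambda>x. m + ?s * x))"
      by (simp add: normal_law_def)
    fix A assume "A \<in> sets (normal_law m v)"
    then have A[measurable]: "A \<in> sets borel" by (simp add: normal_law_def split: if_splits)
    have d: "ennreal ?s * ennreal (normal_density m ?s (m + ?s * x)) = ennreal (std_normal_density x)" for x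
      using s by (simp add: ennreal_mult'[symmetric] normal_density_def power_mult_distrib real_sqrt_mult)
    have "emeasure (normal_law m v) A = (\<integral>\<^sup>+x. ennreal (normal_density m ?s x) * indicator A x \<partial>lborel)"
      using False by (simp add: normal_law_def emeasure_density)
    also have "\<dots> = ennreal ?s * (\<integral>\<^sup>+x. ennreal (normal_density m ?s (m + ?s * x)) * indicator A (m + ?s * x) \<partial>lborel)"
      using s by (subst nn_integral_real_affine[where c = ?s and t = m]) auto
    also have "\<dots> = (\<integral>\<^sup>+x. ennreal ?s * (ennreal (normal_density m ?s (m + ?s * x)) * indicator A (m + ?s * x)) \<partial>lborel)"
      by (rule nn_integral_cmult[symmetric]) measurable
    also have "\<dots> = (\<integral>\<^sup>+x. ennreal (std_normal_density x) * indicator ((\<lambda>x. m + ?s * x) -` A) x \<partial>lborel)"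
      by (intro nn_integral_cong) (simp add: mult.assoc[symmetric] d indicator_def)
    also have "\<dots> = emeasure (distr std_normal_distribution borel (\<lambda>x. m + ?s * x)) A"
      using measurable_sets_borel[of "\<lambda>x. m + ?s * x" borel A]
      by (subst emeasure_distr) (auto simp: emeasure_density)
    finally show "emeasure (normal_law m v) A = emeasure (distr std_normal_distribution borel (\<lambda>x. m + ?s * x)) A" .
  qed
qed

lemma std_normal_cos_sin:
  "(\<integral>x. cos (t * x) \<partial>std_normal_distribution) = exp (- t\<^sup>2 / 2)"
  "(\<integral>x. sin (t * x) \<partial>std_normal_distribution) = 0"
proof -
  interpret N: prob_space std_normal_distribution by (rule prob_space_normal_density) simp
  have i: "complex_integrable std_normal_distribution (\<lambda>x. iexp (t * x))"
    by (rule N.integrable_iexp) auto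
  have c: "(CLINT x|std_normal_distribution. iexp (t * x)) = complex_of_real (exp (- t\<^sup>2 / 2))"
    using fun_cong[OF char_std_normal_distribution, of t] unfolding char_def by simp
  have "(\<integral>x. Re (iexp (t * x)) \<partial>std_normal_distribution) = Re (complex_of_real (exp (- t\<^sup>2 / 2)))"
    using integral_Re[OF i] c by simp
  then show "(\<integral>x. cos (t * x) \<partial>std_normal_distribution) = exp (- t\<^sup>2 / 2)" by (simp add: Re_exp)
  have "(\<integral>x. Im (iexp (t * x)) \<partial>std_normal_distribution) = Im (complex_of_real (exp (- t\<^sup>2 / 2)))"
    using integral_Im[OF i] c by simp
  then show "(\<integral>x. sin (t * x) \<partial>std_normal_distribution) = 0" by (simp add: Im_exp)
qed

lemma (in prob_space) normal_law_facts:
  assumes L[measurable]: "L \<in> borel_measurable M" and D: "distr M borel L = normal_law m v" and v: "0 \<le> v"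
  shows "integrable M L" "expectation L = m" "integrable M (\<lambda>\<omega>. (L \<omega>)\<^sup>2)" "expectation (\<lambda>\<omega>. (L \<omega>)\<^sup>2) = m\<^sup>2 + v"
    "expectation (\<lambda>\<omega>. cos (L \<omega> + \<theta>)) = cos (m + \<theta>) * exp (- v / 2)"
proof -
  interpret N: prob_space std_normal_distribution by (rule prob_space_normal_density) simp
  let ?s = "sqrt v" and ?N = std_normal_distribution
  have D': "distr M borel L = distr ?N borel (\<lambda>x. m + ?s * x)" unfolding D by (rule normal_law_eq[OF v])
  have nm: "(\<lambda>x. m + ?s * x) \<in> measurable ?N borel" by simp
  have E: "expectation (\<lambda>\<omega>. f (L \<omega>)) = (\<integral>x. f (m + ?s * x) \<partial>?N)" if [measurable]: "f \<in> borel_measurable borel" for f :: "real \<Rightarrow> real"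
  proof -
    have "expectation (\<lambda>\<omega>. f (L \<omega>)) = (\<integral>x. f x \<partial>distr M borel L)"
      by (rule integral_distr[symmetric]) (rule L, rule that)
    also have "\<dots> = (\<integral>x. f (m + ?s * x) \<partial>?N)"
      unfolding D' by (rule integral_distr[OF nm that])
    finally show ?thesis .
  qed
  have I: "integrable M (\<lambda>\<omega>. f (L \<omega>)) \<longleftrightarrow> integrable ?N (\<lambda>x. f (m + ?s * x))" if [measurable]: "f \<in> borel_measurable borel" for f :: "real \<Rightarrow> real"
  proof -
    have "integrable M (\<lambda>\<omega>. f (L \<omega>)) \<longleftrightarrow> integrable (distr M borel L) f"
      by (rule integrable_distr_eq[symmetric]) (rule L, rule that)
    also have "\<dots> \<longleftrightarrow> integrable ?N (\<lambda>x. f (m + ?s * x))"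
      unfolding D' by (rule integrable_distr_eq[OF nm that])
    finally show ?thesis .
  qed
  have i1: "integrable ?N (\<lambda>x. x)" using integrable_std_normal_distribution_moment[of 1] by simp
  have i2: "integrable ?N (\<lambda>x. x\<^sup>2)" using integrable_std_normal_distribution_moment[of 2] by simp
  have m1: "(\<integral>x. x \<partial>?N) = 0" using integral_std_normal_distribution_moment_odd[of 1] by simp
  have m2: "(\<integral>x. x\<^sup>2 \<partial>?N) = 1" using std_normal_distribution_even_moments(1)[of 1] by simp
  have one: "integrable ?N (\<lambda>x. c)" "(\<integral>x. c \<partial>?N) = c" for c :: real
    using N.prob_space by simp_all
  have lin: "integrable ?N (\<lambda>x. m + ?s * x)" by (intro Bochner_Integration.integrable_add one integrable_mult_right i1)
  have "integrable M (\<lambda>\<omega>. L \<omega>)" using lin unfolding I[OF measurable_ident_sets[OF refl]] .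
  then show "integrable M L" .
  have "expectation (\<lambda>\<omega>. L \<omega>) = (\<integral>x. m + ?s * x \<partial>?N)" by (rule E) measurable
  also have "\<dots> = m + ?s * 0"
    by (subst Bochner_Integration.integral_add) (use one i1 m1 in auto)
  finally show "expectation L = m" by simp
  have sq: "(m + ?s * x)\<^sup>2 = m\<^sup>2 + (2 * m * ?s * x + v * x\<^sup>2)" for x
    using v by (simp add: power2_sum power_mult_distrib)
  have i3: "integrable ?N (\<lambda>x. 2 * m * ?s * x)" "integrable ?N (\<lambda>x. v * x\<^sup>2)"
    "integrable ?N (\<lambda>x. 2 * m * ?s * x + v * x\<^sup>2)"
    by (intro Bochner_Integration.integrable_add integrable_mult_right i1 i2)+
  have isq: "integrable ?N (\<lambda>x. (m + ?s * x)\<^sup>2)"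
    unfolding sq by (intro Bochner_Integration.integrable_add one i3)
  have sqm: "(\<lambda>x::real. x\<^sup>2) \<in> borel_measurable borel" by measurable
  show "integrable M (\<lambda>\<omega>. (L \<omega>)\<^sup>2)" unfolding I[OF sqm] by (rule isq)
  have "expectation (\<lambda>\<omega>. (L \<omega>)\<^sup>2) = (\<integral>x. m\<^sup>2 + (2 * m * ?s * x + v * x\<^sup>2) \<partial>?N)"
    unfolding E[OF sqm] sq ..
  also have "\<dots> = m\<^sup>2 + ((\<integral>x. 2 * m * ?s * x \<partial>?N) + (\<integral>x. v * x\<^sup>2 \<partial>?N))"
    by (simp only: Bochner_Integration.integral_add[OF one(1) i3(3)] Bochner_Integration.integral_add[OF i3(1,2)] one(2))
  also have "\<dots> = m\<^sup>2 + v"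
    unfolding integral_mult_right_zero m1 m2 by simp
  finally show "expectation (\<lambda>\<omega>. (L \<omega>)\<^sup>2) = m\<^sup>2 + v" .
  have ic: "integrable ?N (\<lambda>x. cos (?s * x))" "integrable ?N (\<lambda>x. sin (?s * x))"
    by (rule N.integrable_const_bound[of _ 1]; simp)+
  have "expectation (\<lambda>\<omega>. cos (L \<omega> + \<theta>)) = (\<integral>x. cos (m + ?s * x + \<theta>) \<partial>?N)"
    by (rule E) measurable
  also have "\<dots> = (\<integral>x. cos (m + \<theta>) * cos (?s * x) - sin (m + \<theta>) * sin (?s * x) \<partial>?N)"
    by (intro Bochner_Integration.integral_cong refl) (simp add: cos_add[symmetric] algebra_simps)
  also have "\<dots> = cos (m + \<theta>) * exp (- v / 2)"
    unfolding Bochner_Integration.integral_diff[OF integrable_mult_right[OF ic(1)] integrable_mult_right[OF ic(2)]]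
      integral_mult_right_zero std_normal_cos_sin using v by simp
  finally show "expectation (\<lambda>\<omega>. cos (L \<omega> + \<theta>)) = cos (m + \<theta>) * exp (- v / 2)" .
qed

text \<open>Functionals of a path rather than random variables, so that the same form can be
  evaluated at B and at its increment paths from different times.\<close>

definition linform :: "((real \<Rightarrow> real) \<Rightarrow> real) set" where
  "linform = {l. \<exists>F a. finite F \<and> F \<subseteq> {0..} \<and> l = (\<lambda>w. \<Sum>t\<in>F. a t * w t)}"

lemma linform_zero: "(\<lambda>w. 0) \<in> linform"
  unfolding linform_def by (intro CollectI exI[of _ "{}"]) auto

lemma linform_eval: "0 \<le> t \<Longrightarrow> (\<lambda>w. w t) \<in> linform"
  unfolding linform_def by (intro CollectI exI[of _ "{t}"] exI[of _ "\<lambda>_. 1"]) auto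

lemma linform_scale: "l \<in> linform \<Longrightarrow> (\<lambda>w. r * l w) \<in> linform"
proof -
  assume "l \<in> linform"
  then obtain F a where "finite F" "F \<subseteq> {0..}" "l = (\<lambda>w. \<Sum>t\<in>F. a t * w t)" unfolding linform_def by blast
  then show ?thesis unfolding linform_def
    by (intro CollectI exI[of _ F] exI[of _ "\<lambda>t. r * a t"]) (auto simp: sum_distrib_left mult.assoc)
qed

lemma linform_add:
  assumes "l \<in> linform" "k \<in> linform"
  shows "(\<lambda>w. l w + k w) \<in> linform"
proof -
  obtain F a where F: "finite F" "F \<subseteq> {0..}" "l = (\<lambda>w. \<Sum>t\<in>F. a t * w t)" using assms(1) unfolding linform_def by blast
  obtain G b where G: "finite G" "G \<subseteq> {0..}" "k = (\<lambda>w. \<Sum>t\<in>G. b t * w t)" using assms(2) unfolding linform_def by blast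
  let ?a = "\<lambda>t. if t \<in> F then a t else 0" and ?b = "\<lambda>t. if t \<in> G then b t else 0"
  have "l w + k w = (\<Sum>t\<in>F \<union> G. (?a t + ?b t) * w t)" for w
  proof -
    have "l w = (\<Sum>t\<in>F \<union> G. ?a t * w t)" unfolding F(3)
      using F(1) G(1) by (intro sum.mono_neutral_cong_left) auto
    moreover have "k w = (\<Sum>t\<in>F \<union> G. ?b t * w t)" unfolding G(3)
      using F(1) G(1) by (intro sum.mono_neutral_cong_left) auto
    ultimately show ?thesis by (simp only: distrib_right sum.distrib)
  qed
  then show ?thesis unfolding linform_def using F(1,2) G(1,2)
    by (intro CollectI exI[of _ "F \<union> G"] exI[of _ "\<lambda>t. ?a t + ?b t"]) auto
qed

lemma linform_diff: "l \<in> linform \<Longrightarrow> k \<in> linform \<Longrightarrow> (\<lambda>w. l w - k w) \<in> linform"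
  using linform_add[OF _ linform_scale[of k "-1"], of l] by simp

lemma linform_sum: "finite I \<Longrightarrow> (\<And>i. i \<in> I \<Longrightarrow> l i \<in> linform) \<Longrightarrow> (\<lambda>w. \<Sum>i\<in>I. l i w) \<in> linform"
  by (induction I rule: finite_induct) (auto intro: linform_zero linform_add)

abbreviation path_space :: "(real \<Rightarrow> real) measure" where
  "path_space \<equiv> \<Pi>\<^sub>M t\<in>{0..}. borel"

lemma measurable_linform: "l \<in> linform \<Longrightarrow> l \<in> borel_measurable path_space"
proof -
  assume "l \<in> linform"
  then obtain F a where F: "F \<subseteq> {0..}" "l = (\<lambda>w. \<Sum>t\<in>F. a t * w t)" unfolding linform_def by blast
  show ?thesis unfolding F(2)
    by (intro borel_measurable_sum borel_measurable_times measurable_const measurable_component_singleton)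
      (use F(1) in auto)
qed

subsection \<open>Trigonometric polynomials of paths\<close>

text \<open>The phase \<theta> makes sines special cases, so the product-to-sum formula keeps
  products of generators inside the span. Expectations of generators under a Gaussian law are
  explicit.\<close>

inductive_set trig :: "((real \<Rightarrow> real) \<Rightarrow> real) set" where
  trig_cos: "l \<in> linform \<Longrightarrow> (\<lambda>w. cos (l w + \<theta>)) \<in> trig"
| trig_add: "T \<in> trig \<Longrightarrow> S \<in> trig \<Longrightarrow> (\<lambda>w. T w + S w) \<in> trig"
| trig_scale: "T \<in> trig \<Longrightarrow> (\<lambda>w. r * T w) \<in> trig"

lemma trig_const: "(\<lambda>w. r) \<in> trig"
  using trig_scale[OF trig_cos[OF linform_zero, of 0], of r] by simp

lemma trig_diff: "T \<in> trig \<Longrightarrow> S \<in> trig \<Longrightarrow> (\<lambda>w. T w - S w) \<in> trig"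
  using trig_add[OF _ trig_scale[of S "-1"], of T] by simp

lemma trig_bounded: "T \<in> trig \<Longrightarrow> \<exists>K. \<forall>w. \<bar>T w\<bar> \<le> K"
proof (induction rule: trig.induct)
  case (trig_add T S)
  then obtain K L where K: "\<And>w. \<bar>T w\<bar> \<le> K" and L: "\<And>w. \<bar>S w\<bar> \<le> L" by blast
  have "\<bar>T w + S w\<bar> \<le> K + L" for w using K[of w] L[of w] by linarith
  then show ?case by blast
next
  case (trig_scale T r)
  then obtain K where "\<And>w. \<bar>T w\<bar> \<le> K" by blast
  then have "\<bar>r * T w\<bar> \<le> \<bar>r\<bar> * K" for w unfolding abs_mult by (intro mult_left_mono) auto
  then show ?case by blast
next
  case (trig_cos l \<theta>)
  have "\<bar>cos (l w + \<theta>)\<bar> \<le> 1" for w by simp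
  then show ?case by blast
qed

lemma measurable_trig: "T \<in> trig \<Longrightarrow> T \<in> borel_measurable path_space"
proof (induction rule: trig.induct)
  case (trig_cos l \<theta>)
  note [measurable] = measurable_linform[OF trig_cos]
  show ?case by measurable
next
  case (trig_add T S)
  note [measurable] = trig_add.IH
  show ?case by measurable
next
  case (trig_scale T r)
  note [measurable] = trig_scale.IH
  show ?case by measurable
qed

lemma trig_mult:
  assumes "T \<in> trig" "S \<in> trig"
  shows "(\<lambda>w. T w * S w) \<in> trig"
  using assms
proof (induction arbitrary: S rule: trig.induct)
  case (trig_cos l \<theta>)
  from trig_cos(2) show ?case
  proof (induction rule: trig.induct)
    case (trig_cos k \<phi>)
    have "(\<lambda>w. (1/2) * cos ((l w - k w) + (\<theta> - \<phi>)) + (1/2) * cos ((l w + k w) + (\<theta> + \<phi>))) \<in> trig"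
      using \<open>l \<in> linform\<close> trig_cos by (intro trig.intros linform_add linform_diff)
    moreover have "(1/2) * cos ((l w - k w) + (\<theta> - \<phi>)) + (1/2) * cos ((l w + k w) + (\<theta> + \<phi>)) = cos (l w + \<theta>) * cos (k w + \<phi>)" for w
      unfolding cos_times_cos by (simp add: algebra_simps)
    ultimately show ?case by simp
  next
    case (trig_add T S)
    then show ?case using trig.trig_add[of "\<lambda>w. cos (l w + \<theta>) * T w" "\<lambda>w. cos (l w + \<theta>) * S w"] by (simp add: distrib_left)
  next
    case (trig_scale T r)
    then show ?case using trig.trig_scale[of "\<lambda>w. cos (l w + \<theta>) * T w" r] by (simp add: mult.left_commute)
  qed
next
  case (trig_add T1 T2)
  then show ?case using trig.trig_add[of "\<lambda>w. T1 w * S w" "\<lambda>w. T2 w * S w"] by (simp add: distrib_right)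
next
  case (trig_scale T r)
  then show ?case using trig.trig_scale[of "\<lambda>w. T w * S w" r] by (simp add: mult.assoc)
qed

lemma trig_polynomial:
  assumes "T \<in> trig" "real_polynomial_function p"
  shows "(\<lambda>w. p (T w)) \<in> trig"
  using assms(2)
proof (induction rule: real_polynomial_function.induct)
  case (linear f)
  have "f u = f 1 * u" for u
    using linear_scale[OF bounded_linear.linear[OF linear], of u 1] by (simp add: mult.commute)
  then have "(\<lambda>w. f (T w)) = (\<lambda>w. f 1 * T w)" by (rule ext)
  then show ?case using trig_scale[OF assms(1), of "f 1"] by simp
qed (auto intro: trig_const trig_add trig_mult)

subsection \<open>Density in \<open>L\<^sup>1\<close>\<close>

locale path_law = prob_space P for P :: "(real \<Rightarrow> real) measure" +
  assumes sets_P: "sets P = sets path_space"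
begin

lemma space_P: "space P = space path_space"
  using sets_eq_imp_space_eq[OF sets_P] .

lemma measurable_P: "f \<in> borel_measurable path_space \<Longrightarrow> f \<in> borel_measurable P"
  using measurable_cong_sets[OF sets_P refl] by blast

lemma integrable_ind: "A \<in> sets P \<Longrightarrow> integrable P (indicator A :: _ \<Rightarrow> real)"
  by (intro integrable_real_indicator) (auto simp: less_top[symmetric])

lemma integrable_trig: "T \<in> trig \<Longrightarrow> integrable P T"
proof -
  assume T: "T \<in> trig"
  then obtain K where "\<And>w. \<bar>T w\<bar> \<le> K" using trig_bounded by blast
  then show ?thesis using measurable_P[OF measurable_trig[OF T]] by (intro integrable_const_bound[of _ K]) auto
qed

definition trig_approx :: "((real \<Rightarrow> real) \<Rightarrow> real) \<Rightarrow> bool" where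
  "trig_approx F \<longleftrightarrow> integrable P F \<and> (\<forall>e>0. \<exists>T\<in>trig. (\<integral>w. \<bar>F w - T w\<bar> \<partial>P) < e)"

lemma trig_approxD:
  assumes "trig_approx F" "0 < e"
  obtains T where "T \<in> trig" "(\<integral>w. \<bar>F w - T w\<bar> \<partial>P) < e"
  using assms unfolding trig_approx_def by blast

lemma trig_approx_trig: "T \<in> trig \<Longrightarrow> trig_approx T"
  unfolding trig_approx_def using integrable_trig by (auto intro: bexI[of _ T])

lemma trig_approx_limit:
  assumes F: "integrable P F" and G: "\<And>e. 0 < e \<Longrightarrow> \<exists>G. trig_approx G \<and> (\<integral>w. \<bar>F w - G w\<bar> \<partial>P) < e"
  shows "trig_approx F"
  unfolding trig_approx_def
proof (intro conjI F allI impI)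
  fix e :: real assume "0 < e"
  then have e2: "0 < e/2" by simp
  obtain G where G: "trig_approx G" "(\<integral>w. \<bar>F w - G w\<bar> \<partial>P) < e/2" using G[OF e2] by blast
  obtain T where T: "T \<in> trig" "(\<integral>w. \<bar>G w - T w\<bar> \<partial>P) < e/2" by (rule trig_approxD[OF G(1) e2])
  have i: "integrable P G" "integrable P T" using G T integrable_trig by (auto simp: trig_approx_def)
  have "(\<integral>w. \<bar>F w - T w\<bar> \<partial>P) \<le> (\<integral>w. \<bar>F w - G w\<bar> + \<bar>G w - T w\<bar> \<partial>P)"
    using F i by (intro integral_mono integrable_abs Bochner_Integration.integrable_add Bochner_Integration.integrable_diff) auto
  also have "\<dots> = (\<integral>w. \<bar>F w - G w\<bar> \<partial>P) + (\<integral>w. \<bar>G w - T w\<bar> \<partial>P)"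
    using F i by (intro Bochner_Integration.integral_add integrable_abs Bochner_Integration.integrable_diff)
  also have "\<dots> < e" using G(2) T(2) by linarith
  finally show "\<exists>T\<in>trig. (\<integral>w. \<bar>F w - T w\<bar> \<partial>P) < e" by (intro bexI[of _ T] T)
qed

lemma trig_approx_add:
  assumes "trig_approx F" "trig_approx G"
  shows "trig_approx (\<lambda>w. F w + G w)"
  unfolding trig_approx_def
proof (intro conjI allI impI)
  have i: "integrable P F" "integrable P G" using assms by (auto simp: trig_approx_def)
  then show "integrable P (\<lambda>w. F w + G w)" by simp
  fix e :: real assume "0 < e"
  then have e2: "0 < e/2" by simp
  obtain T where T: "T \<in> trig" "(\<integral>w. \<bar>F w - T w\<bar> \<partial>P) < e/2" by (rule trig_approxD[OF assms(1) e2])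
  obtain S where S: "S \<in> trig" "(\<integral>w. \<bar>G w - S w\<bar> \<partial>P) < e/2" by (rule trig_approxD[OF assms(2) e2])
  have it: "integrable P T" "integrable P S" using T S integrable_trig by auto
  have "(\<integral>w. \<bar>(F w + G w) - (T w + S w)\<bar> \<partial>P) \<le> (\<integral>w. \<bar>F w - T w\<bar> + \<bar>G w - S w\<bar> \<partial>P)"
    using i it by (intro integral_mono integrable_abs Bochner_Integration.integrable_add Bochner_Integration.integrable_diff) auto
  also have "\<dots> = (\<integral>w. \<bar>F w - T w\<bar> \<partial>P) + (\<integral>w. \<bar>G w - S w\<bar> \<partial>P)"
    using i it by (intro Bochner_Integration.integral_add integrable_abs Bochner_Integration.integrable_diff)
  also have "\<dots> < e" using S(2) T(2) by linarith
  finally show "\<exists>T\<in>trig. (\<integral>w. \<bar>(F w + G w) - T w\<bar> \<partial>P) < e"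
    by (intro bexI[of _ "\<lambda>w. T w + S w"] trig_add T S)
qed

text \<open>From F G - T S = (F - T) G + T (G - S). The order of choice matters: S must be accurate
  relative to a bound K of T, so T comes first.\<close>

lemma trig_approx_mult:
  assumes F: "trig_approx F" and G: "trig_approx G" "\<And>w. \<bar>G w\<bar> \<le> 1" and FG: "integrable P (\<lambda>w. F w * G w)"
  shows "trig_approx (\<lambda>w. F w * G w)"
  unfolding trig_approx_def
proof (intro conjI FG allI impI)
  have i: "integrable P F" "integrable P G" using assms by (auto simp: trig_approx_def)
  fix e :: real assume "0 < e"
  then have e2: "0 < e/2" by simp
  obtain T where T: "T \<in> trig" "(\<integral>w. \<bar>F w - T w\<bar> \<partial>P) < e/2" by (rule trig_approxD[OF F e2])
  obtain K0 where K0: "\<And>w. \<bar>T w\<bar> \<le> K0" using trig_bounded[OF T(1)] by blast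
  define K where "K = \<bar>K0\<bar> + 1"
  have K: "0 < K" "\<And>w. \<bar>T w\<bar> \<le> K"
  proof -
    show "0 < K" by (simp add: K_def)
    show "\<bar>T w\<bar> \<le> K" for w using K0[of w] unfolding K_def by linarith
  qed
  have "0 < e/(2*K)" using K(1) \<open>0 < e\<close> by simp
  then obtain S where S: "S \<in> trig" "(\<integral>w. \<bar>G w - S w\<bar> \<partial>P) < e/(2*K)" by (rule trig_approxD[OF G(1)])
  have it: "integrable P T" "integrable P S" "integrable P (\<lambda>w. T w * S w)" using T S integrable_trig trig_mult by auto
  have "(\<integral>w. \<bar>F w * G w - T w * S w\<bar> \<partial>P) \<le> (\<integral>w. \<bar>F w - T w\<bar> + K * \<bar>G w - S w\<bar> \<partial>P)"
  proof (rule integral_mono)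
    show "\<bar>F w * G w - T w * S w\<bar> \<le> \<bar>F w - T w\<bar> + K * \<bar>G w - S w\<bar>" for w
    proof -
      have "F w * G w - T w * S w = (F w - T w) * G w + T w * (G w - S w)" by (simp add: algebra_simps)
      then have "\<bar>F w * G w - T w * S w\<bar> \<le> \<bar>F w - T w\<bar> * \<bar>G w\<bar> + \<bar>T w\<bar> * \<bar>G w - S w\<bar>"
        unfolding abs_mult[symmetric] by (simp only: abs_triangle_ineq)
      also have "\<dots> \<le> \<bar>F w - T w\<bar> * 1 + K * \<bar>G w - S w\<bar>"
        using G(2)[of w] K(2)[of w] by (intro add_mono mult_left_mono mult_right_mono) auto
      finally show ?thesis by simp
    qed
  qed (use i it FG in auto)
  also have "\<dots> = (\<integral>w. \<bar>F w - T w\<bar> \<partial>P) + K * (\<integral>w. \<bar>G w - S w\<bar> \<partial>P)"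
    using i it by simp
  also have "K * (\<integral>w. \<bar>G w - S w\<bar> \<partial>P) < e/2"
    using S(2) K(1) by (simp add: field_simps)
  finally have "(\<integral>w. \<bar>F w * G w - T w * S w\<bar> \<partial>P) < e" using T(2) by linarith
  then show "\<exists>T\<in>trig. (\<integral>w. \<bar>F w * G w - T w\<bar> \<partial>P) < e"
    by (intro bexI[of _ "\<lambda>w. T w * S w"] trig_mult T S)
qed

text \<open>The events on which the approximation is established first. They form a \<sigma>-algebra
  containing the coordinate cylinders, hence exhaust all events.\<close>

definition trig_sets :: "(real \<Rightarrow> real) set set" where
  "trig_sets = {A \<in> sets P. trig_approx (indicator A)}"

lemma trig_sets_Compl:
  assumes "A \<in> trig_sets"
  shows "space P - A \<in> trig_sets"
proof -
  have A[measurable]: "A \<in> sets P" and a: "trig_approx (indicator A)" using assms by (auto simp: trig_sets_def)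
  have "trig_approx (indicator (space P - A))"
    unfolding trig_approx_def
  proof (intro conjI allI impI)
    show "integrable P (indicator (space P - A) :: _ \<Rightarrow> real)" by (rule integrable_ind) measurable
    fix e :: real assume "0 < e"
    then obtain T where T: "T \<in> trig" "(\<integral>w. \<bar>indicator A w - T w\<bar> \<partial>P) < e" using trig_approxD[OF a] by blast
    have "(\<integral>w. \<bar>indicator (space P - A) w - (1 - T w)\<bar> \<partial>P) = (\<integral>w. \<bar>indicator A w - T w\<bar> \<partial>P)"
      by (intro Bochner_Integration.integral_cong refl) (auto simp: indicator_def abs_minus_commute)
    then show "\<exists>T\<in>trig. (\<integral>w. \<bar>indicator (space P - A) w - T w\<bar> \<partial>P) < e"
      using T(2) by (intro bexI[of _ "\<lambda>w. 1 - T w"] trig_diff trig_const T(1)) simp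
  qed
  then show ?thesis by (simp add: trig_sets_def)
qed

lemma trig_sets_Int:
  assumes "A \<in> trig_sets" "B \<in> trig_sets"
  shows "A \<inter> B \<in> trig_sets"
proof -
  have [measurable]: "A \<in> sets P" "B \<in> sets P" using assms by (auto simp: trig_sets_def)
  have e: "(\<lambda>w. indicator A w * indicator B w :: real) = indicator (A \<inter> B)" by (auto simp: indicator_def)
  have "trig_approx (\<lambda>w. indicator A w * indicator B w :: real)"
  proof (rule trig_approx_mult)
    show "trig_approx (indicator A :: _ \<Rightarrow> real)" "trig_approx (indicator B :: _ \<Rightarrow> real)" using assms by (simp_all add: trig_sets_def)
    show "integrable P (\<lambda>w. indicator A w * indicator B w :: real)" unfolding e by (rule integrable_ind) measurable
  qed (simp add: indicator_def)
  then show ?thesis by (simp add: trig_sets_def e)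
qed

lemma trig_sets_empty: "{} \<in> trig_sets"
  using trig_approx_trig[OF trig_const[of 0]] by (simp add: trig_sets_def indicator_def[abs_def])

lemma trig_sets_Un: "A \<in> trig_sets \<Longrightarrow> B \<in> trig_sets \<Longrightarrow> A \<union> B \<in> trig_sets"
proof -
  assume A: "A \<in> trig_sets" and B: "B \<in> trig_sets"
  then have "A \<subseteq> space P" "B \<subseteq> space P" by (auto simp: trig_sets_def sets.sets_into_space)
  then have "A \<union> B = space P - ((space P - A) \<inter> (space P - B))" by auto
  then show ?thesis using A B by (auto intro: trig_sets_Compl trig_sets_Int)
qed

lemma trig_sets_UN:
  fixes A :: "nat \<Rightarrow> _"
  assumes "\<And>n. A n \<in> trig_sets"
  shows "(\<Union>n. A n) \<in> trig_sets"
proof -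
  let ?U = "\<lambda>n. \<Union>i<n. A i" and ?V = "\<Union>n. A n"
  have U: "?U n \<in> trig_sets" for n
    by (induction n) (auto simp: lessThan_Suc trig_sets_empty intro: trig_sets_Un assms)
  have [measurable]: "A n \<in> sets P" for n using assms by (simp add: trig_sets_def)
  have UV: "(\<Union>n. ?U n) = ?V" by auto
  have "(\<lambda>n. prob (?U n)) \<longlonglongrightarrow> prob (\<Union>n. ?U n)"
    by (rule finite_Lim_measure_incseq) (auto simp: incseq_def intro: less_le_trans)
  then have lim: "(\<lambda>n. prob (?U n)) \<longlonglongrightarrow> prob ?V" unfolding UV .
  have "trig_approx (indicator ?V)"
  proof (rule trig_approx_limit)
    fix e :: real assume "0 < e"
    then have "\<forall>\<^sub>F n in sequentially. \<bar>prob (?U n) - prob ?V\<bar> < e"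
      using lim unfolding tendsto_iff dist_real_def by blast
    then obtain n where n: "\<bar>prob (?U n) - prob ?V\<bar> < e" by (blast dest: eventually_happens'[OF sequentially_bot])
    have "(\<integral>w. \<bar>indicator ?V w - indicator (?U n) w :: real\<bar> \<partial>P) = (\<integral>w. indicator (?V - ?U n) w \<partial>P)"
      by (intro Bochner_Integration.integral_cong refl) (auto simp: indicator_def)
    also have "\<dots> = prob (?V - ?U n)" by simp
    also have "\<dots> = prob ?V - prob (?U n)" by (rule finite_measure_Diff) auto
    finally have "(\<integral>w. \<bar>indicator ?V w - indicator (?U n) w :: real\<bar> \<partial>P) < e" using n by linarith
    then show "\<exists>G. trig_approx G \<and> (\<integral>w. \<bar>indicator ?V w - G w\<bar> \<partial>P) < e"
      using U[of n] by (auto simp: trig_sets_def)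
  qed (rule integrable_ind, measurable)
  then show ?thesis by (simp add: trig_sets_def)
qed

text \<open>Weierstrass approximation on [-1, 1], where T takes its values; a polynomial in T is
  again trigonometric by \<open>trig_mult\<close>.\<close>

lemma trig_approx_continuous:
  assumes T: "T \<in> trig" "\<And>w. \<bar>T w\<bar> \<le> 1" and f: "continuous_on {-1..1} f" "f \<in> borel_measurable borel"
  shows "trig_approx (\<lambda>w. f (T w))"
proof (rule trig_approx_limit)
  have Tm[measurable]: "T \<in> borel_measurable P" by (intro measurable_P measurable_trig T)
  have fT: "(\<lambda>w. f (T w)) \<in> borel_measurable P" using f(2) by measurable
  have "bounded (f ` {-1..1})" by (intro compact_imp_bounded compact_continuous_image f) auto
  then obtain K where K: "\<forall>u\<in>{-1..1}. \<bar>f u\<bar> \<le> K" unfolding bounded_real by blast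
  have "\<bar>f (T w)\<bar> \<le> K" for w using K T(2)[of w] by (auto simp: abs_le_iff)
  then show i: "integrable P (\<lambda>w. f (T w))" using fT by (intro integrable_const_bound[of _ K]) auto
  fix e :: real assume e: "0 < e"
  obtain p where p: "real_polynomial_function p" "\<And>u. u \<in> {-1..1} \<Longrightarrow> \<bar>f u - p u\<bar> < e/2"
    using Stone_Weierstrass_real_polynomial_function[OF compact_Icc f(1), of "e/2"] e by auto
  have pT: "(\<lambda>w. p (T w)) \<in> trig" by (rule trig_polynomial[OF T(1) p(1)])
  have "(\<integral>w. \<bar>f (T w) - p (T w)\<bar> \<partial>P) \<le> (\<integral>w. e/2 \<partial>P)"
  proof (rule integral_mono)
    show "\<bar>f (T w) - p (T w)\<bar> \<le> e/2" for w using p(2)[of "T w"] T(2)[of w] by (auto simp: abs_le_iff)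
  qed (use i integrable_trig[OF pT] in auto)
  also have "\<dots> < e" using e prob_space by simp
  finally show "\<exists>G. trig_approx G \<and> (\<integral>w. \<bar>f (T w) - G w\<bar> \<partial>P) < e" using trig_approx_trig[OF pT] by blast
qed

lemma trig_sets_cos:
  assumes l: "l \<in> linform"
  shows "{w \<in> space P. a < cos (l w + \<theta>)} \<in> trig_sets"
proof -
  let ?T = "\<lambda>w. cos (l w + \<theta>)" and ?A = "{w \<in> space P. a < cos (l w + \<theta>)}"
  have T: "?T \<in> trig" using l by (rule trig_cos)
  have [measurable]: "?T \<in> borel_measurable P" by (intro measurable_P measurable_trig T)
  \<comment> \<open>Continuous ramps increasing to the indicator of the open half-line above
    a.\<close>
  define f where "f = (\<lambda>n::nat. \<lambda>u::real. min 1 (max 0 (real n * (u - a))))"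
  have fc: "continuous_on S (f n)" for S n unfolding f_def by (intro continuous_intros)
  have fm[measurable]: "f n \<in> borel_measurable borel" for n by (rule borel_measurable_continuous_onI[OF fc])
  have f01: "0 \<le> f n u" "f n u \<le> 1" for n u by (auto simp: f_def)
  have flim: "(\<lambda>n. f n u) \<longlonglongrightarrow> indicator {a<..} u" for u
  proof (cases "a < u")
    case True
    then obtain N where N: "1 \<le> real N * (u - a)" using ex_less_of_nat_mult[of "u - a" 1] by (auto intro: less_imp_le)
    have "f n u = 1" if "n \<ge> N" for n
    proof -
      have "real N * (u - a) \<le> real n * (u - a)" using that True by (intro mult_right_mono) auto
      then show ?thesis using N by (simp add: f_def)
    qed
    then have "\<forall>\<^sub>F n in sequentially. f n u = indicator {a<..} u" using True by (auto simp: eventually_sequentially)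
    then show ?thesis by (rule tendsto_eventually)
  next
    case False
    then have "f n u = 0" for n by (auto simp: f_def mult_le_0_iff)
    then show ?thesis using False by simp
  qed
  have "(\<lambda>n. \<integral>w. \<bar>indicator ?A w - f n (?T w)\<bar> \<partial>P) \<longlonglongrightarrow> (\<integral>w. 0 \<partial>P)"
  proof (rule integral_dominated_convergence[where w = "\<lambda>_. 1"])
    show "AE w in P. (\<lambda>n. \<bar>indicator ?A w - f n (?T w)\<bar>) \<longlonglongrightarrow> 0"
    proof (rule AE_I2)
      fix w assume "w \<in> space P"
      then have e: "indicator ?A w = (indicator {a<..} (?T w) :: real)" by (auto simp: indicator_def)
      have "(\<lambda>n. \<bar>indicator ?A w - f n (?T w)\<bar>) \<longlonglongrightarrow> \<bar>indicator ?A w - indicator {a<..} (?T w)\<bar>"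
        by (intro tendsto_intros flim)
      then show "(\<lambda>n. \<bar>indicator ?A w - f n (?T w)\<bar>) \<longlonglongrightarrow> 0" by (simp add: e)
    qed
    show "AE w in P. norm \<bar>indicator ?A w - f n (?T w)\<bar> \<le> 1" for n
      using f01[of n] by (intro AE_I2) (auto simp: indicator_def)
  qed auto
  then have lim: "(\<lambda>n. \<integral>w. \<bar>indicator ?A w - f n (?T w)\<bar> \<partial>P) \<longlonglongrightarrow> 0" by simp
  have "trig_approx (indicator ?A)"
  proof (rule trig_approx_limit)
    fix e :: real assume "0 < e"
    then obtain n where "(\<integral>w. \<bar>indicator ?A w - f n (?T w)\<bar> \<partial>P) < e"
      using eventually_happens'[OF sequentially_bot order_tendstoD(2)[OF lim]] by blast
    then show "\<exists>G. trig_approx G \<and> (\<integral>w. \<bar>indicator ?A w - G w\<bar> \<partial>P) < e"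
      using trig_approx_continuous[OF T _ fc fm, of n] by (intro exI[of _ "\<lambda>w. f n (?T w)"]) auto
  qed (rule integrable_ind, measurable)
  then show ?thesis by (simp add: trig_sets_def)
qed

text \<open>For u = w t - m the condition cos (r / N) < cos (u / N) means |u| < r only up to the
  period of the cosine. Imposing it for all N from n0 on removes the spurious periods: for N large
  compared with u, the point u / N lies where the cosine is monotone in the absolute value. Taking
  n0 > r keeps r / N below pi.\<close>

lemma trig_sets_interval:
  assumes t: "0 \<le> t"
  shows "{w \<in> space P. a < w t \<and> w t < b} \<in> trig_sets"
proof (cases "a < b")
  case False
  then show ?thesis using trig_sets_empty by (auto simp: not_less intro: subst[of "{}" "{w \<in> space P. a < w t \<and> w t < b}" "\<lambda>A. A \<in> trig_sets"])
next
  case True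
  define m r where "m = (a + b) / 2" and "r = (b - a) / 2"
  have ab: "a = m - r" "b = m + r" by (auto simp: m_def r_def field_simps)
  have r: "0 < r" using True by (simp add: r_def)
  obtain n0 :: nat where n0: "r < real n0" using reals_Archimedean2 by blast
  let ?A = "\<lambda>n. {w \<in> space P. cos (r / real (n0 + n)) < cos ((1 / real (n0 + n)) * w t + (- m / real (n0 + n)))}"
  have "space P - (\<Union>n. space P - ?A n) \<in> trig_sets"
    by (intro trig_sets_Compl trig_sets_UN trig_sets_cos linform_scale linform_eval t)
  also have "space P - (\<Union>n. space P - ?A n) = {w \<in> space P. a < w t \<and> w t < b}"
  proof -
    have cosiff: "cos (r / N) < cos (u / N) \<longleftrightarrow> \<bar>u\<bar> < r" if "r < N * pi" "\<bar>u\<bar> < N * pi" "0 < N" for u N :: real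
    proof -
      have "cos (r / N) < cos (\<bar>u\<bar> / N) \<longleftrightarrow> \<bar>u\<bar> / N < r / N"
        using that r by (intro cos_mono_less_eq) (auto simp: field_simps)
      moreover have "cos (\<bar>u\<bar> / N) = cos (u / N)" by (cases "0 \<le> u") auto
      ultimately show ?thesis using that(3) by (simp add: divide_less_cancel)
    qed
    have pi1: "1 < pi" using pi_gt3 by linarith
    have "(\<forall>n. cos (r / real (n0 + n)) < cos (u / real (n0 + n))) \<longleftrightarrow> \<bar>u\<bar> < r" for u
    proof
      assume all: "\<forall>n. cos (r / real (n0 + n)) < cos (u / real (n0 + n))"
      obtain n :: nat where n: "\<bar>u\<bar> < real n" using reals_Archimedean2 by blast
      let ?N = "real (n0 + n)"
      have N: "0 < ?N" "r < ?N" "\<bar>u\<bar> < ?N" using n0 n r by auto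
      have "?N \<le> ?N * pi" using N(1) pi1 by simp
      with N have "r < ?N * pi" "\<bar>u\<bar> < ?N * pi" by linarith+
      from cosiff[OF this N(1)] all show "\<bar>u\<bar> < r" by blast
    next
      assume u: "\<bar>u\<bar> < r"
      show "\<forall>n. cos (r / real (n0 + n)) < cos (u / real (n0 + n))"
      proof
        fix n
        let ?N = "real (n0 + n)"
        have N: "0 < ?N" "r < ?N" using n0 r by auto
        have "?N \<le> ?N * pi" using N(1) pi1 by simp
        with N u have "r < ?N * pi" "\<bar>u\<bar> < ?N * pi" by linarith+
        from cosiff[OF this N(1)] u show "cos (r / ?N) < cos (u / ?N)" by blast
      qed
    qed
    then have "(\<forall>n. cos (r / real (n0 + n)) < cos ((1 / real (n0 + n)) * w t + (- m / real (n0 + n)))) \<longleftrightarrow> \<bar>w t - m\<bar> < r" for w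
      by (simp add: diff_divide_distrib[symmetric])
    moreover have "\<bar>w t - m\<bar> < r \<longleftrightarrow> a < w t \<and> w t < b" for w :: "real \<Rightarrow> real" unfolding ab by linarith
    ultimately show ?thesis by auto
  qed
  finally show ?thesis .
qed

lemma trig_sets_component:
  assumes t: "0 \<le> t" and A: "A \<in> sets borel"
  shows "{w \<in> space P. w t \<in> A} \<in> trig_sets"
proof -
  have "A \<in> sigma_sets UNIV (range (\<lambda>(a, b). {a<..<b::real}))"
    using A unfolding borel_eq_box by (simp add: box_real case_prod_unfold image_def)
  then show ?thesis
  proof (induction rule: sigma_sets.induct)
    case (Basic A)
    then obtain a b where "A = {a<..<b}" by auto
    then show ?case using trig_sets_interval[OF t, of a b] by simp
  next
    case Empty
    then show ?case using trig_sets_empty by simp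
  next
    case (Compl A)
    have "{w \<in> space P. w t \<in> UNIV - A} = space P - {w \<in> space P. w t \<in> A}" by auto
    then show ?case using trig_sets_Compl[OF Compl.IH] by simp
  next
    case (Union A)
    have "{w \<in> space P. w t \<in> (\<Union>i. A i)} = (\<Union>i. {w \<in> space P. w t \<in> A i})" by auto
    then show ?case using trig_sets_UN[OF Union.IH] by simp
  qed
qed

lemma trig_sets_eq: "A \<in> sets P \<Longrightarrow> A \<in> trig_sets"
proof -
  assume "A \<in> sets P"
  then have "A \<in> sigma_sets (\<Pi>\<^sub>E t\<in>{0..}. space borel) {{f\<in>\<Pi>\<^sub>E t\<in>{0..}. space borel. f t \<in> A} | t A. t \<in> {0..} \<and> A \<in> sets (borel :: real measure)}"
    unfolding sets_P by (simp only: sets_PiM_single)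
  then show ?thesis
  proof (induction rule: sigma_sets.induct)
    case (Basic A)
    then obtain t B where "0 \<le> t" "B \<in> sets borel" "A = {w \<in> space P. w t \<in> B}"
      by (auto simp: space_P space_PiM)
    then show ?case using trig_sets_component by simp
  next
    case (Compl A)
    have "(\<Pi>\<^sub>E t\<in>{0::real..}. space (borel :: real measure)) = space P" by (simp add: space_P space_PiM)
    then show ?case using trig_sets_Compl[OF Compl.IH] by (simp only:)
  qed (auto intro: trig_sets_empty trig_sets_UN)
qed

theorem trig_dense: "integrable P F \<Longrightarrow> trig_approx F"
proof (induction rule: integrable_induct)
  case (base A c)
  have "trig_approx (\<lambda>w. indicator A w)" using trig_sets_eq[OF base(1)] by (simp add: trig_sets_def)
  moreover have "trig_approx (\<lambda>w. indicator A w * c)" if a: "trig_approx (\<lambda>w. indicator A w)"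
    unfolding trig_approx_def
  proof (intro conjI allI impI)
    show "integrable P (\<lambda>w. indicator A w * c)" using base by simp
    fix e :: real assume "0 < e"
    then obtain T where T: "T \<in> trig" "(\<integral>w. \<bar>indicator A w - T w\<bar> \<partial>P) < e / (\<bar>c\<bar> + 1)"
      using trig_approxD[OF a, of "e / (\<bar>c\<bar> + 1)"] by auto
    have "(\<integral>w. \<bar>indicator A w * c - c * T w\<bar> \<partial>P) = (\<integral>w. \<bar>c\<bar> * \<bar>indicator A w - T w\<bar> \<partial>P)"
      by (intro Bochner_Integration.integral_cong refl) (simp add: abs_mult[symmetric] algebra_simps)
    also have "\<dots> = \<bar>c\<bar> * (\<integral>w. \<bar>indicator A w - T w\<bar> \<partial>P)" by simp
    also have "\<dots> \<le> (\<bar>c\<bar> + 1) * (\<integral>w. \<bar>indicator A w - T w\<bar> \<partial>P)" by (intro mult_right_mono) auto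
    also have "\<dots> < e" using T(2) by (simp add: pos_less_divide_eq mult.commute)
    finally show "\<exists>T\<in>trig. (\<integral>w. \<bar>indicator A w * c - T w\<bar> \<partial>P) < e"
      by (intro bexI[of _ "\<lambda>w. c * T w"] trig_scale T)
  qed
  ultimately show ?case by simp
next
  case (add f g)
  then show ?case by (intro trig_approx_add)
next
  case (lim f s)
  have "(\<lambda>n. \<integral>w. \<bar>f w - s n w\<bar> \<partial>P) \<longlonglongrightarrow> (\<integral>w. 0 \<partial>P)"
  proof (rule integral_dominated_convergence[where w = "\<lambda>w. 3 * \<bar>f w\<bar>"])
    show "AE w in P. (\<lambda>n. \<bar>f w - s n w\<bar>) \<longlonglongrightarrow> 0"
    proof (rule AE_I2)
      fix w assume "w \<in> space P"
      then have "(\<lambda>n. \<bar>f w - s n w\<bar>) \<longlonglongrightarrow> \<bar>f w - f w\<bar>" by (intro tendsto_intros lim)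
      then show "(\<lambda>n. \<bar>f w - s n w\<bar>) \<longlonglongrightarrow> 0" by simp
    qed
    show "AE w in P. norm \<bar>f w - s n w\<bar> \<le> 3 * \<bar>f w\<bar>" for n
    proof (rule AE_I2)
      fix w assume "w \<in> space P"
      then have "\<bar>s n w\<bar> \<le> 2 * \<bar>f w\<bar>" using lim(3)[of w n] by simp
      then show "norm \<bar>f w - s n w\<bar> \<le> 3 * \<bar>f w\<bar>" by simp
    qed
  qed (use lim in auto)
  then have l: "(\<lambda>n. \<integral>w. \<bar>f w - s n w\<bar> \<partial>P) \<longlonglongrightarrow> 0" by simp
  show ?case
  proof (rule trig_approx_limit)
    show "integrable P f" by fact
    fix e :: real assume "0 < e"
    then obtain n where "(\<integral>w. \<bar>f w - s n w\<bar> \<partial>P) < e"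
      using eventually_happens'[OF sequentially_bot order_tendstoD(2)[OF l]] by blast
    then show "\<exists>G. trig_approx G \<and> (\<integral>w. \<bar>f w - G w\<bar> \<partial>P) < e" using lim by blast
  qed
qed

end

text \<open>A mixed second difference of |u|^p. The mean value theorem, first with step t and then
  with step s, bounds it by a constant times (k - t)^(p - 2), which tends to 0 because p < 2. With p
  = 2 H this is the decay of the covariance of distant increments.\<close>

lemma powr_second_difference:
  fixes p s t :: real
  assumes p: "0 < p" "p < 2" and st: "0 \<le> s" "0 \<le> t"
  shows "(\<lambda>k::nat. \<bar>real k + s\<bar> powr p - \<bar>real k + s - t\<bar> powr p - (\<bar>real k\<bar> powr p - \<bar>real k - t\<bar> powr p)) \<longlonglongrightarrow> 0"
proof (cases "s = 0 \<or> t = 0")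
  case True
  then show ?thesis by auto
next
  case False
  with st have s: "0 < s" and t: "0 < t" by auto
  define c where "c = t * s * p * \<bar>p - 1\<bar>"
  let ?D = "\<lambda>k::nat. \<bar>real k + s\<bar> powr p - \<bar>real k + s - t\<bar> powr p - (\<bar>real k\<bar> powr p - \<bar>real k - t\<bar> powr p)"
  have bd: "\<bar>?D k\<bar> \<le> c * (real k - t) powr (p - 2)" if k: "t < real k" for k
  proof -
    let ?G = "\<lambda>u. (u + s) powr p - u powr p" and ?h = "\<lambda>v. p * v powr (p - 1)"
    have "\<exists>\<xi>. real k - t < \<xi> \<and> \<xi> < real k \<and> ?G (real k) - ?G (real k - t) = (real k - (real k - t)) * (?h (\<xi> + s) - ?h \<xi>)"
    proof (rule MVT2)
      show "real k - t < real k" using t by simp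
      fix u assume u: "real k - t \<le> u" "u \<le> real k"
      then have "0 < u" using k by simp
      then show "DERIV ?G u :> ?h (u + s) - ?h u" using s by (auto intro!: derivative_eq_intros)
    qed
    then obtain \<xi> where \<xi>: "real k - t < \<xi>" "\<xi> < real k" "?G (real k) - ?G (real k - t) = t * (?h (\<xi> + s) - ?h \<xi>)" by auto
    have "\<exists>z. \<xi> < z \<and> z < \<xi> + s \<and> ?h (\<xi> + s) - ?h \<xi> = ((\<xi> + s) - \<xi>) * (p * ((p - 1) * z powr (p - 2)))"
    proof (rule MVT2)
      show "\<xi> < \<xi> + s" using s by simp
      fix u assume "\<xi> \<le> u" "u \<le> \<xi> + s"
      then have "0 < u" using k \<xi>(1) by simp
      then show "DERIV ?h u :> p * ((p - 1) * u powr (p - 2))" by (auto intro!: derivative_eq_intros)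
    qed
    then obtain z where z: "\<xi> < z" "?h (\<xi> + s) - ?h \<xi> = s * (p * ((p - 1) * z powr (p - 2)))" by auto
    have abs: "\<bar>real k + s\<bar> = real k + s" "\<bar>real k + s - t\<bar> = real k - t + s" "\<bar>real k\<bar> = real k" "\<bar>real k - t\<bar> = real k - t"
      using k s t by auto
    have "?D k = ?G (real k) - ?G (real k - t)" unfolding abs by simp
    also have "\<dots> = t * (s * (p * ((p - 1) * z powr (p - 2))))" unfolding \<xi>(3) z(2) ..
    finally have "\<bar>?D k\<bar> = c * z powr (p - 2)"
      using s t p by (simp add: abs_mult c_def mult.assoc)
    also have "\<dots> \<le> c * (real k - t) powr (p - 2)"
      using s t p k \<xi>(1) z(1) by (intro mult_left_mono powr_mono2') (auto simp: c_def)
    finally show ?thesis .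
  qed
  have "LIM k sequentially. real k - t :> at_top"
    using filterlim_tendsto_add_at_top[OF tendsto_const[of "- t"] filterlim_real_sequentially] by simp
  then have "(\<lambda>k. (real k - t) powr (p - 2)) \<longlonglongrightarrow> 0" using p(2) by (intro tendsto_neg_powr) auto
  then have "(\<lambda>k. c * (real k - t) powr (p - 2)) \<longlonglongrightarrow> 0" by (rule tendsto_mult_right_zero)
  moreover obtain k0 :: nat where "t < real k0" using reals_Archimedean2 by blast
  then have "\<forall>\<^sub>F k in sequentially. norm (?D k) \<le> c * (real k - t) powr (p - 2)"
    using bd by (auto simp: eventually_sequentially intro!: exI[of _ k0])
  ultimately show ?thesis by (rule Lim_null_comparison[rotated])
qed

section \<open>The law of large numbers for the increments\<close>

text \<open>In the natural numbers (j - i) + (i - j) is the distance of i and j. In each row at most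
  2 d0 terms lie near the diagonal, where r is merely bounded; the others are small, so rows average
  to something small.\<close>

lemma double_sum_average_null:
  fixes r :: "nat \<Rightarrow> real"
  assumes r: "r \<longlonglongrightarrow> 0"
  shows "(\<lambda>n. (\<Sum>i<n. \<Sum>j<n. r ((j - i) + (i - j))) / (real n)\<^sup>2) \<longlonglongrightarrow> 0"
proof -
  obtain K where K: "0 < K" "\<And>d. \<bar>r d\<bar> \<le> K"
  proof -
    have "Bseq r" using r by (intro convergent_imp_Bseq convergentI)
    then show ?thesis using that unfolding Bseq_def real_norm_def by blast
  qed
  show ?thesis
    unfolding tendsto_iff dist_real_def
  proof (intro allI impI)
    fix e :: real assume e: "0 < e"
    then have "0 < e/2" by simp
    from LIMSEQ_D[OF r this] obtain d0 where d0: "\<And>d. d0 \<le> d \<Longrightarrow> \<bar>r d\<bar> < e/2" by auto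
    have row: "\<bar>\<Sum>j<n. r ((j - i) + (i - j))\<bar> \<le> real n * (e/2) + K * real (2 * d0)" for i n
    proof -
      let ?D = "{j \<in> {..<n}. (j - i) + (i - j) < d0}"
      have sub: "?D \<subseteq> {i - d0..<i + d0}" by auto
      have "card ?D \<le> card {i - d0..<i + d0}" by (rule card_mono[OF _ sub]) simp
      then have cD: "card ?D \<le> 2 * d0" by simp
      have "\<bar>\<Sum>j<n. r ((j - i) + (i - j))\<bar> \<le> (\<Sum>j<n. \<bar>r ((j - i) + (i - j))\<bar>)" by (rule sum_abs)
      also have "\<dots> \<le> (\<Sum>j<n. e/2 + (if j \<in> ?D then K else 0))"
      proof (rule sum_mono)
        fix j assume "j \<in> {..<n}"
        then show "\<bar>r ((j - i) + (i - j))\<bar> \<le> e/2 + (if j \<in> ?D then K else 0)"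
          using K(2)[of "(j - i) + (i - j)"] d0[of "(j - i) + (i - j)"] e by (cases "(j - i) + (i - j) < d0") auto
      qed
      also have "\<dots> = real n * (e/2) + K * real (card ?D)"
        by (simp add: sum.distrib sum.If_cases Int_def conj_commute mult.commute)
      also have "\<dots> \<le> real n * (e/2) + K * real (2 * d0)"
        using cD K(1) by (intro add_left_mono mult_left_mono) (simp_all only: of_nat_le_iff less_imp_le)
      finally show ?thesis .
    qed
    obtain N :: nat where N: "K * real (2 * d0) / (e/2) < real N" using reals_Archimedean2 by blast
    have "\<bar>(\<Sum>i<n. \<Sum>j<n. r ((j - i) + (i - j))) / (real n)\<^sup>2 - 0\<bar> < e" if n: "max 1 N \<le> n" for n
    proof -
      have n0: "0 < real n" using n by simp
      have "\<bar>\<Sum>i<n. \<Sum>j<n. r ((j - i) + (i - j))\<bar> \<le> (\<Sum>i<n. \<bar>\<Sum>j<n. r ((j - i) + (i - j))\<bar>)" by (rule sum_abs)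
      also have "\<dots> \<le> (\<Sum>i<n. real n * (e/2) + K * real (2 * d0))" by (rule sum_mono) (rule row)
      also have "\<dots> = real n * (real n * (e/2) + K * real (2 * d0))" by simp
      also have "\<dots> < real n * (real n * (e/2) + real n * (e/2))"
      proof -
        have "K * real (2 * d0) / (e/2) < real n" using N n by simp
        then have "K * real (2 * d0) < real n * (e/2)" using e by (simp only: pos_divide_less_eq half_gt_zero)
        then show ?thesis using n0 by (intro mult_strict_left_mono add_strict_left_mono)
      qed
      also have "\<dots> = e * (real n)\<^sup>2" by (simp add: power2_eq_square algebra_simps)
      finally show ?thesis using n0 by (simp add: abs_divide pos_divide_less_eq)
    qed
    then show "\<forall>\<^sub>F n in sequentially. \<bar>(\<Sum>i<n. \<Sum>j<n. r ((j - i) + (i - j))) / (real n)\<^sup>2 - 0\<bar> < e"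
      unfolding eventually_sequentially by blast
  qed
qed

lemma (in prob_space) L2_null_imp_L1_null:
  assumes X: "\<And>n::nat. integrable M (X n)" "\<And>n. integrable M (\<lambda>\<omega>. (X n \<omega>)\<^sup>2 :: real)"
    and lim: "(\<lambda>n. expectation (\<lambda>\<omega>. (X n \<omega>)\<^sup>2)) \<longlonglongrightarrow> 0"
  shows "(\<lambda>n. expectation (\<lambda>\<omega>. \<bar>X n \<omega>\<bar>)) \<longlonglongrightarrow> 0"
  unfolding tendsto_iff dist_real_def
proof (intro allI impI)
  fix e :: real assume e: "0 < e"
  define d where "d = e/2"
  have d: "0 < d" using e by (simp add: d_def)
  have le: "\<bar>u\<bar> \<le> d + u\<^sup>2 / d" for u :: real
  proof (cases "\<bar>u\<bar> \<le> d")
    case True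
    then show ?thesis using d by (simp add: add_increasing2)
  next
    case False
    then have "\<bar>u\<bar> * d \<le> \<bar>u\<bar> * \<bar>u\<bar>" by (intro mult_left_mono) auto
    then have "\<bar>u\<bar> * d \<le> u\<^sup>2" by (simp add: power2_eq_square abs_mult[symmetric])
    then have "\<bar>u\<bar> \<le> u\<^sup>2 / d" using d by (simp add: pos_le_divide_eq)
    then show ?thesis using d by simp
  qed
  have "\<forall>\<^sub>F n in sequentially. expectation (\<lambda>\<omega>. (X n \<omega>)\<^sup>2) < d * d"
    using order_tendstoD(2)[OF lim] d by simp
  then show "\<forall>\<^sub>F n in sequentially. \<bar>expectation (\<lambda>\<omega>. \<bar>X n \<omega>\<bar>) - 0\<bar> < e"
  proof eventually_elim
    case (elim n)
    have "expectation (\<lambda>\<omega>. \<bar>X n \<omega>\<bar>) \<le> expectation (\<lambda>\<omega>. d + (X n \<omega>)\<^sup>2 / d)"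
      using X le by (intro integral_mono) auto
    also have "\<dots> = d + expectation (\<lambda>\<omega>. (X n \<omega>)\<^sup>2) / d" using X(2)[of n] prob_space by simp
    also have "\<dots> < d + d" using elim d by (simp add: pos_divide_less_eq)
    also have "\<dots> = e" by (simp add: d_def)
    finally have "expectation (\<lambda>\<omega>. \<bar>X n \<omega>\<bar>) < e" .
    moreover have "0 \<le> expectation (\<lambda>\<omega>. \<bar>X n \<omega>\<bar>)" by (rule Bochner_Integration.integral_nonneg) simp
    ultimately show ?case by simp
  qed
qed

section \<open>Covariances, mixing and the mean ergodic theorem for increment paths\<close>

context fractional_brownian_motion
begin

lemma B_measurable [measurable]: "0 \<le> t \<Longrightarrow> B t \<in> borel_measurable M"
  using gaussian unfolding gaussian_process_def by blast

abbreviation path :: "'a \<Rightarrow> real \<Rightarrow> real" where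
  "path \<omega> \<equiv> \<lambda>t. B t \<omega>"

lemma linform_normal:
  assumes "l \<in> linform"
  shows "(\<lambda>\<omega>. l (path \<omega>)) \<in> borel_measurable M"
    "\<exists>m v. 0 \<le> v \<and> distr M borel (\<lambda>\<omega>. l (path \<omega>)) = normal_law m v"
proof -
  obtain F a where F: "finite F" "F \<subseteq> {0..}" "l = (\<lambda>w. \<Sum>t\<in>F. a t * w t)" using assms unfolding linform_def by blast
  show "(\<lambda>\<omega>. l (path \<omega>)) \<in> borel_measurable M" unfolding F(3)
    by (intro borel_measurable_sum borel_measurable_times measurable_const B_measurable) (use F(2) in auto)
  show "\<exists>m v. 0 \<le> v \<and> distr M borel (\<lambda>\<omega>. l (path \<omega>)) = normal_law m v"
    using gaussian F(1,2) unfolding gaussian_process_def F(3) by blast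
qed

lemma B_integrable: "0 \<le> t \<Longrightarrow> integrable M (B t)"
  using linform_normal[OF linform_eval[of t]] normal_law_facts(1)[of "\<lambda>\<omega>. B t \<omega>"] by blast

lemma linform_facts:
  assumes l: "l \<in> linform"
  shows "integrable M (\<lambda>\<omega>. l (path \<omega>))" "integrable M (\<lambda>\<omega>. (l (path \<omega>))\<^sup>2)"
    "expectation (\<lambda>\<omega>. cos (l (path \<omega>) + \<theta>)) = cos \<theta> * exp (- expectation (\<lambda>\<omega>. (l (path \<omega>))\<^sup>2) / 2)"
proof -
  obtain F a where F: "finite F" "F \<subseteq> {0..}" "l = (\<lambda>w. \<Sum>t\<in>F. a t * w t)" using l unfolding linform_def by blast
  obtain m v where v: "0 \<le> v" "distr M borel (\<lambda>\<omega>. l (path \<omega>)) = normal_law m v" using linform_normal(2)[OF l] by blast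
  note facts = normal_law_facts[OF linform_normal(1)[OF l] v(2,1)]
  have "expectation (\<lambda>\<omega>. l (path \<omega>)) = (\<Sum>t\<in>F. a t * expectation (B t))"
    unfolding F(3) using F(2) B_integrable by (subst Bochner_Integration.integral_sum) auto
  also have "\<dots> = 0" using F(2) centred by (intro sum.neutral) auto
  finally have m: "m = 0" using facts(2) by simp
  show "integrable M (\<lambda>\<omega>. l (path \<omega>))" "integrable M (\<lambda>\<omega>. (l (path \<omega>))\<^sup>2)" using facts(1,3) .
  show "expectation (\<lambda>\<omega>. cos (l (path \<omega>) + \<theta>)) = cos \<theta> * exp (- expectation (\<lambda>\<omega>. (l (path \<omega>))\<^sup>2) / 2)"
    using facts(4) facts(5)[of \<theta>] m by simp
qed

lemma linform_mult_integrable: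
  assumes "l \<in> linform" "k \<in> linform"
  shows "integrable M (\<lambda>\<omega>. l (path \<omega>) * k (path \<omega>))"
proof -
  have e: "(\<lambda>\<omega>. l (path \<omega>) * k (path \<omega>)) = (\<lambda>\<omega>. (1/4) * ((l (path \<omega>) + k (path \<omega>))\<^sup>2 - (l (path \<omega>) - k (path \<omega>))\<^sup>2))"
    by (simp add: fun_eq_iff power2_eq_square algebra_simps)
  show ?thesis unfolding e
    by (intro integrable_mult_right Bochner_Integration.integrable_diff linform_facts(2)[OF linform_add[OF assms]]
        linform_facts(2)[OF linform_diff[OF assms]])
qed

definition kappa :: real where
  "kappa = (SOME \<kappa>. 0 < \<kappa> \<and> (\<forall>s\<ge>0. \<forall>t\<ge>0. distr M borel (\<lambda>\<omega>. B t \<omega> - B s \<omega>) = normal_law 0 (\<kappa> * \<bar>t - s\<bar> powr (2 * H))))"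

lemma kappa: "0 < kappa"
    "0 \<le> s \<Longrightarrow> 0 \<le> t \<Longrightarrow> distr M borel (\<lambda>\<omega>. B t \<omega> - B s \<omega>) = normal_law 0 (kappa * \<bar>t - s\<bar> powr (2 * H))"
  using someI_ex[OF increment_law] unfolding kappa_def by blast+

lemma increment_second_moment:
  assumes "0 \<le> s" "0 \<le> t"
  shows "expectation (\<lambda>\<omega>. (B t \<omega> - B s \<omega>)\<^sup>2) = kappa * \<bar>t - s\<bar> powr (2 * H)"
  using normal_law_facts(4)[OF _ kappa(2)[OF assms]] kappa(1) assms by simp

text \<open>Polarisation: all covariances of increments are determined by second moments, which the
  increment law prescribes.\<close>

lemma increment_product_moment:
  assumes "0 \<le> a" "0 \<le> b" "0 \<le> c" "0 \<le> d"
  shows "expectation (\<lambda>\<omega>. (B a \<omega> - B b \<omega>) * (B c \<omega> - B d \<omega>))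
    = kappa / 2 * (\<bar>a - d\<bar> powr (2 * H) + \<bar>b - c\<bar> powr (2 * H) - \<bar>a - c\<bar> powr (2 * H) - \<bar>b - d\<bar> powr (2 * H))"
proof -
  have i: "integrable M (\<lambda>\<omega>. (B s \<omega> - B t \<omega>)\<^sup>2)" if "0 \<le> s" "0 \<le> t" for s t
    using linform_facts(2)[OF linform_diff[OF linform_eval linform_eval]] that by blast
  have "expectation (\<lambda>\<omega>. (B a \<omega> - B b \<omega>) * (B c \<omega> - B d \<omega>))
    = expectation (\<lambda>\<omega>. (1/2) * ((B a \<omega> - B d \<omega>)\<^sup>2 + (B b \<omega> - B c \<omega>)\<^sup>2 - (B a \<omega> - B c \<omega>)\<^sup>2 - (B b \<omega> - B d \<omega>)\<^sup>2))"
    by (intro Bochner_Integration.integral_cong refl) (simp add: power2_eq_square algebra_simps)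
  also have "\<dots> = (1/2) * (expectation (\<lambda>\<omega>. (B a \<omega> - B d \<omega>)\<^sup>2) + expectation (\<lambda>\<omega>. (B b \<omega> - B c \<omega>)\<^sup>2)
     - expectation (\<lambda>\<omega>. (B a \<omega> - B c \<omega>)\<^sup>2) - expectation (\<lambda>\<omega>. (B b \<omega> - B d \<omega>)\<^sup>2))"
    using i assms by simp
  finally show ?thesis using assms by (simp add: increment_second_moment algebra_simps)
qed

text \<open>The path restarted at time k. Its law does not depend on k by stationarity of
  increments, whereas B itself is not stationary. The restriction to nonnegative times makes it a
  point of \<open>path_space\<close>.\<close>

definition incr_path :: "real \<Rightarrow> 'a \<Rightarrow> real \<Rightarrow> real" where
  "incr_path k \<omega> = (\<lambda>t\<in>{0..}. B (k + t) \<omega> - B k \<omega>)"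

lemma measurable_incr_path [measurable]: "0 \<le> k \<Longrightarrow> incr_path k \<in> measurable M path_space"
  unfolding incr_path_def by (intro measurable_restrict) auto

definition incr_law :: "(real \<Rightarrow> real) measure" where
  "incr_law = distr M path_space (incr_path 0)"

lemma distr_incr_path: "0 \<le> k \<Longrightarrow> distr M path_space (incr_path k) = incr_law"
  using stationary_increments[of k] unfolding process_law_def incr_law_def incr_path_def by simp

sublocale incr: path_law incr_law
proof (intro path_law.intro path_law_axioms.intro)
  show "prob_space incr_law" unfolding incr_law_def by (rule prob_space_distr) measurable
qed (simp add: incr_law_def)

lemma integrable_incr_path:
  fixes F :: "(real \<Rightarrow> real) \<Rightarrow> real"
  assumes "0 \<le> k" "integrable incr_law F"
  shows "integrable M (\<lambda>\<omega>. F (incr_path k \<omega>))"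
  using assms(2) unfolding distr_incr_path[OF assms(1), symmetric]
  by (rule integrable_distr[OF measurable_incr_path[OF assms(1)]])

lemma expectation_incr_path:
  fixes F :: "(real \<Rightarrow> real) \<Rightarrow> real"
  assumes "0 \<le> k" "F \<in> borel_measurable path_space"
  shows "expectation (\<lambda>\<omega>. F (incr_path k \<omega>)) = (\<integral>w. F w \<partial>incr_law)"
  unfolding distr_incr_path[OF assms(1), symmetric]
  by (rule integral_distr[symmetric]) (use assms in auto)

lemma linform_incr_path:
  assumes "l \<in> linform" "0 \<le> k"
  shows "\<exists>l'\<in>linform. \<forall>\<omega>. l (incr_path k \<omega>) = l' (path \<omega>)"
proof -
  obtain F a where F: "finite F" "F \<subseteq> {0..}" "l = (\<lambda>w. \<Sum>t\<in>F. a t * w t)" using assms unfolding linform_def by blast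
  have "(\<lambda>w. \<Sum>t\<in>F. a t * (w (k + t) - w k)) \<in> linform"
    using F(1,2) assms(2) by (intro linform_sum linform_scale linform_diff linform_eval) auto
  moreover have "l (incr_path k \<omega>) = (\<Sum>t\<in>F. a t * (B (k + t) \<omega> - B k \<omega>))" for \<omega>
    unfolding F(3) incr_path_def using F(2) by (intro sum.cong refl) auto
  ultimately show ?thesis by (intro bexI[of _ "\<lambda>w. \<Sum>t\<in>F. a t * (w (k + t) - w k)"]) auto
qed

text \<open>Bilinearity reduces the claim to two single increments, whose covariance is a second
  difference of |u|^(2 H).\<close>

lemma cross_moment_limit:
  assumes "l \<in> linform" "l' \<in> linform"
  shows "(\<lambda>k. expectation (\<lambda>\<omega>. l (incr_path 0 \<omega>) * l' (incr_path (real k) \<omega>))) \<longlonglongrightarrow> 0"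
proof -
  obtain F a where F: "finite F" "F \<subseteq> {0..}" "l = (\<lambda>w. \<Sum>t\<in>F. a t * w t)" using assms unfolding linform_def by blast
  obtain G b where G: "finite G" "G \<subseteq> {0..}" "l' = (\<lambda>w. \<Sum>t\<in>G. b t * w t)" using assms unfolding linform_def by blast
  let ?m = "\<lambda>t s k. expectation (\<lambda>\<omega>. (B t \<omega> - B 0 \<omega>) * (B (real k + s) \<omega> - B (real k) \<omega>))"
  have i: "integrable M (\<lambda>\<omega>. (B t \<omega> - B 0 \<omega>) * (B (real k + s) \<omega> - B (real k) \<omega>))" if "0 \<le> t" "0 \<le> s" for t s k
    using linform_mult_integrable[OF linform_diff[OF linform_eval linform_eval] linform_diff[OF linform_eval linform_eval],
        of t 0 "real k + s" "real k"] that by simp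
  have eq: "expectation (\<lambda>\<omega>. l (incr_path 0 \<omega>) * l' (incr_path (real k) \<omega>)) = (\<Sum>t\<in>F. \<Sum>s\<in>G. a t * b s * ?m t s k)" for k
  proof -
    have "l (incr_path 0 \<omega>) * l' (incr_path (real k) \<omega>)
        = (\<Sum>t\<in>F. \<Sum>s\<in>G. a t * b s * ((B t \<omega> - B 0 \<omega>) * (B (real k + s) \<omega> - B (real k) \<omega>)))" for \<omega>
    proof -
      have "l (incr_path 0 \<omega>) = (\<Sum>t\<in>F. a t * (B t \<omega> - B 0 \<omega>))"
        unfolding F(3) incr_path_def using F(2) by (intro sum.cong refl) auto
      moreover have "l' (incr_path (real k) \<omega>) = (\<Sum>s\<in>G. b s * (B (real k + s) \<omega> - B (real k) \<omega>))"
        unfolding G(3) incr_path_def using G(2) by (intro sum.cong refl) auto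
      ultimately show ?thesis by (simp only: sum_product mult.assoc mult.left_commute)
    qed
    then have "expectation (\<lambda>\<omega>. l (incr_path 0 \<omega>) * l' (incr_path (real k) \<omega>))
       = expectation (\<lambda>\<omega>. \<Sum>t\<in>F. \<Sum>s\<in>G. a t * b s * ((B t \<omega> - B 0 \<omega>) * (B (real k + s) \<omega> - B (real k) \<omega>)))" by simp
    also have "\<dots> = (\<Sum>t\<in>F. expectation (\<lambda>\<omega>. \<Sum>s\<in>G. a t * b s * ((B t \<omega> - B 0 \<omega>) * (B (real k + s) \<omega> - B (real k) \<omega>))))"
      by (rule Bochner_Integration.integral_sum)
        (intro Bochner_Integration.integrable_sum integrable_mult_right i, use F(2) G(2) in auto)
    also have "\<dots> = (\<Sum>t\<in>F. \<Sum>s\<in>G. a t * b s * ?m t s k)"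
    proof (rule sum.cong[OF refl])
      fix t assume "t \<in> F"
      then have "expectation (\<lambda>\<omega>. \<Sum>s\<in>G. a t * b s * ((B t \<omega> - B 0 \<omega>) * (B (real k + s) \<omega> - B (real k) \<omega>)))
        = (\<Sum>s\<in>G. expectation (\<lambda>\<omega>. a t * b s * ((B t \<omega> - B 0 \<omega>) * (B (real k + s) \<omega> - B (real k) \<omega>))))"
        by (intro Bochner_Integration.integral_sum integrable_mult_right i) (use F(2) G(2) in auto)
      then show "expectation (\<lambda>\<omega>. \<Sum>s\<in>G. a t * b s * ((B t \<omega> - B 0 \<omega>) * (B (real k + s) \<omega> - B (real k) \<omega>))) = (\<Sum>s\<in>G. a t * b s * ?m t s k)"
        by (simp only: integral_mult_right_zero)
    qed
    finally show ?thesis .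
  qed
  have m: "(\<lambda>k. ?m t s k) \<longlonglongrightarrow> 0" if ts: "0 \<le> t" "0 \<le> s" for t s
  proof -
    have eq: "?m t s k = kappa / 2 * (\<bar>real k + s\<bar> powr (2 * H) - \<bar>real k + s - t\<bar> powr (2 * H) - (\<bar>real k\<bar> powr (2 * H) - \<bar>real k - t\<bar> powr (2 * H)))" for k
    proof -
      have alg: "c * (x + y - z - w) = c * (y - z - (w - x))" for c x y z w :: real by (simp add: algebra_simps)
      have abs: "\<bar>t - (real k + s)\<bar> = \<bar>real k + s - t\<bar>" "\<bar>t - real k\<bar> = \<bar>real k - t\<bar>" "\<bar>0 - (real k + s)\<bar> = \<bar>real k + s\<bar>" "\<bar>0 - real k\<bar> = \<bar>real k\<bar>"
        by linarith+
      have "?m t s k = kappa / 2 * (\<bar>t - real k\<bar> powr (2 * H) + \<bar>0 - (real k + s)\<bar> powr (2 * H) - \<bar>t - (real k + s)\<bar> powr (2 * H) - \<bar>0 - real k\<bar> powr (2 * H))"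
        by (rule increment_product_moment) (use ts in auto)
      then show ?thesis unfolding abs alg .
    qed
    show ?thesis unfolding eq
      by (rule tendsto_mult_right_zero[OF powr_second_difference]) (use hurst ts in auto)
  qed
  have "(\<lambda>k. \<Sum>t\<in>F. \<Sum>s\<in>G. a t * b s * ?m t s k) \<longlonglongrightarrow> (\<Sum>t\<in>F. \<Sum>s\<in>G. a t * b s * 0)"
    by (intro tendsto_sum tendsto_mult tendsto_const m) (use F(2) G(2) in auto)
  then show ?thesis unfolding eq by simp
qed

lemma trig_incr_integrable: "T \<in> trig \<Longrightarrow> 0 \<le> k \<Longrightarrow> integrable M (\<lambda>\<omega>. T (incr_path k \<omega>))"
  by (intro integrable_incr_path incr.integrable_trig)

lemma trig_incr_mult_integrable:
  assumes "T \<in> trig" "S \<in> trig" "0 \<le> j" "0 \<le> k"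
  shows "integrable M (\<lambda>\<omega>. T (incr_path j \<omega>) * S (incr_path k \<omega>))"
proof -
  obtain K where K: "\<And>w. \<bar>T w\<bar> \<le> K" using trig_bounded[OF assms(1)] by blast
  obtain L where L: "\<And>w. \<bar>S w\<bar> \<le> L" using trig_bounded[OF assms(2)] by blast
  have [measurable]: "(\<lambda>\<omega>. T (incr_path j \<omega>)) \<in> borel_measurable M" "(\<lambda>\<omega>. S (incr_path k \<omega>)) \<in> borel_measurable M"
    using trig_incr_integrable[OF assms(1,3)] trig_incr_integrable[OF assms(2,4)] by auto
  show ?thesis
  proof (rule integrable_const_bound[of _ "K * L"])
    have "\<bar>T w\<bar> * \<bar>S w'\<bar> \<le> K * L" for w w'
      using K[of w] L[of w'] abs_ge_zero[of "T w"] by (intro mult_mono abs_ge_zero) linarith+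
    then show "AE \<omega> in M. norm (T (incr_path j \<omega>) * S (incr_path k \<omega>)) \<le> K * L" by (simp add: abs_mult)
  qed measurable
qed

text \<open>A product of cosines is half the sum of the cosines of difference and sum. These
  arguments are again Gaussian linear forms, of variances V + W - 2 c k and V + W + 2 c k, and the
  expected cosine depends continuously on the variance. As c k tends to 0 the expression
  factorises.\<close>

lemma trig_mixing_cos:
  assumes l: "l \<in> linform" "l' \<in> linform"
  shows "(\<lambda>k. expectation (\<lambda>\<omega>. cos (l (incr_path 0 \<omega>) + \<theta>) * cos (l' (incr_path (real k) \<omega>) + \<phi>)))
     \<longlonglongrightarrow> expectation (\<lambda>\<omega>. cos (l (incr_path 0 \<omega>) + \<theta>)) * expectation (\<lambda>\<omega>. cos (l' (incr_path 0 \<omega>) + \<phi>))"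
proof -
  define V where "V = expectation (\<lambda>\<omega>. (l (incr_path 0 \<omega>))\<^sup>2)"
  define W where "W = expectation (\<lambda>\<omega>. (l' (incr_path 0 \<omega>))\<^sup>2)"
  define c where "c = (\<lambda>k::nat. expectation (\<lambda>\<omega>. l (incr_path 0 \<omega>) * l' (incr_path (real k) \<omega>)))"
  obtain p where p: "p \<in> linform" "\<And>\<omega>. l (incr_path 0 \<omega>) = p (path \<omega>)" using linform_incr_path[OF l(1), of 0] by auto
  have eq: "expectation (\<lambda>\<omega>. cos (l (incr_path 0 \<omega>) + \<theta>) * cos (l' (incr_path (real k) \<omega>) + \<phi>))
     = (1/2) * (cos (\<theta> - \<phi>) * exp (- (V + W - 2 * c k) / 2)) + (1/2) * (cos (\<theta> + \<phi>) * exp (- (V + W + 2 * c k) / 2))" for k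
  proof -
    obtain q where q: "q \<in> linform" "\<And>\<omega>. l' (incr_path (real k) \<omega>) = q (path \<omega>)" using linform_incr_path[OF l(2), of "real k"] by auto
    have W: "W = expectation (\<lambda>\<omega>. (q (path \<omega>))\<^sup>2)"
    proof -
      have m: "(\<lambda>w. (l' w)\<^sup>2) \<in> borel_measurable path_space" using measurable_linform[OF l(2)] by measurable
      have "W = (\<integral>w. (l' w)\<^sup>2 \<partial>incr_law)" unfolding W_def by (rule expectation_incr_path[OF _ m]) simp
      also have "\<dots> = expectation (\<lambda>\<omega>. (l' (incr_path (real k) \<omega>))\<^sup>2)" by (rule expectation_incr_path[OF _ m, symmetric]) simp
      finally show ?thesis unfolding q(2) .
    qed
    have V: "V = expectation (\<lambda>\<omega>. (p (path \<omega>))\<^sup>2)" unfolding V_def p(2) ..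
    have c: "c k = expectation (\<lambda>\<omega>. p (path \<omega>) * q (path \<omega>))" unfolding c_def p(2) q(2) ..
    note i = linform_facts(2)[OF p(1)] linform_facts(2)[OF q(1)] linform_mult_integrable[OF p(1) q(1)]
    have s1: "expectation (\<lambda>\<omega>. (p (path \<omega>) - q (path \<omega>))\<^sup>2) = V + W - 2 * c k"
      unfolding V W c power2_diff using i by (simp add: mult.assoc)
    have s2: "expectation (\<lambda>\<omega>. (p (path \<omega>) + q (path \<omega>))\<^sup>2) = V + W + 2 * c k"
      unfolding V W c power2_sum using i by (simp add: mult.assoc)
    have ic: "integrable M (\<lambda>\<omega>. cos (r (path \<omega>) + \<psi>))" if "r \<in> linform" for r \<psi>
      using linform_normal(1)[OF that] by (intro integrable_const_bound[of _ 1]) auto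
    have "expectation (\<lambda>\<omega>. cos (p (path \<omega>) + \<theta>) * cos (q (path \<omega>) + \<phi>))
      = expectation (\<lambda>\<omega>. (1/2) * cos ((p (path \<omega>) - q (path \<omega>)) + (\<theta> - \<phi>)) + (1/2) * cos ((p (path \<omega>) + q (path \<omega>)) + (\<theta> + \<phi>)))"
    proof (rule Bochner_Integration.integral_cong[OF refl])
      fix \<omega>
      have e: "p (path \<omega>) + \<theta> - (q (path \<omega>) + \<phi>) = (p (path \<omega>) - q (path \<omega>)) + (\<theta> - \<phi>)"
        "p (path \<omega>) + \<theta> + (q (path \<omega>) + \<phi>) = (p (path \<omega>) + q (path \<omega>)) + (\<theta> + \<phi>)" by simp_all
      show "cos (p (path \<omega>) + \<theta>) * cos (q (path \<omega>) + \<phi>)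
        = (1/2) * cos ((p (path \<omega>) - q (path \<omega>)) + (\<theta> - \<phi>)) + (1/2) * cos ((p (path \<omega>) + q (path \<omega>)) + (\<theta> + \<phi>))"
        unfolding cos_times_cos e by (simp only: add_divide_distrib times_divide_eq_left mult_1)
    qed
    also have "\<dots> = (1/2) * expectation (\<lambda>\<omega>. cos ((p (path \<omega>) - q (path \<omega>)) + (\<theta> - \<phi>)))
       + (1/2) * expectation (\<lambda>\<omega>. cos ((p (path \<omega>) + q (path \<omega>)) + (\<theta> + \<phi>)))"
      by (simp only: Bochner_Integration.integral_add[OF integrable_mult_right[OF ic[OF linform_diff[OF p(1) q(1)]]]
            integrable_mult_right[OF ic[OF linform_add[OF p(1) q(1)]]]] integral_mult_right_zero)
    also have "\<dots> = (1/2) * (cos (\<theta> - \<phi>) * exp (- (V + W - 2 * c k) / 2)) + (1/2) * (cos (\<theta> + \<phi>) * exp (- (V + W + 2 * c k) / 2))"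
      unfolding linform_facts(3)[OF linform_diff[OF p(1) q(1)]] linform_facts(3)[OF linform_add[OF p(1) q(1)]] s1 s2 ..
    finally show ?thesis unfolding p(2) q(2) .
  qed
  have c0: "c \<longlonglongrightarrow> 0" unfolding c_def by (rule cross_moment_limit[OF l])
  have "(\<lambda>k. (1/2) * (cos (\<theta> - \<phi>) * exp (- (V + W - 2 * c k) / 2)) + (1/2) * (cos (\<theta> + \<phi>) * exp (- (V + W + 2 * c k) / 2)))
    \<longlonglongrightarrow> (1/2) * (cos (\<theta> - \<phi>) * exp (- (V + W - 2 * 0) / 2)) + (1/2) * (cos (\<theta> + \<phi>) * exp (- (V + W + 2 * 0) / 2))"
    by (intro tendsto_intros c0) auto
  also have "(1/2) * (cos (\<theta> - \<phi>) * exp (- (V + W - 2 * 0) / 2)) + (1/2) * (cos (\<theta> + \<phi>) * exp (- (V + W + 2 * 0) / 2))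
     = (cos \<theta> * exp (- V / 2)) * (cos \<phi> * exp (- W / 2))"
  proof -
    have "exp (- (V + W) / 2) = exp (- V / 2) * exp (- W / 2)" by (simp add: exp_add[symmetric] add_divide_distrib diff_divide_distrib)
    then show ?thesis by (simp add: cos_add cos_diff algebra_simps)
  qed
  also have "cos \<theta> * exp (- V / 2) = expectation (\<lambda>\<omega>. cos (l (incr_path 0 \<omega>) + \<theta>))"
    unfolding V_def p(2) using linform_facts(3)[OF p(1)] by simp
  also have "cos \<phi> * exp (- W / 2) = expectation (\<lambda>\<omega>. cos (l' (incr_path 0 \<omega>) + \<phi>))"
  proof -
    obtain q where q: "q \<in> linform" "\<And>\<omega>. l' (incr_path 0 \<omega>) = q (path \<omega>)" using linform_incr_path[OF l(2), of 0] by auto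
    show ?thesis unfolding W_def q(2) using linform_facts(3)[OF q(1)] by simp
  qed
  finally show ?thesis unfolding eq .
qed

lemma trig_mixing:
  assumes "T \<in> trig" "S \<in> trig"
  shows "(\<lambda>k. expectation (\<lambda>\<omega>. T (incr_path 0 \<omega>) * S (incr_path (real k) \<omega>)))
     \<longlonglongrightarrow> expectation (\<lambda>\<omega>. T (incr_path 0 \<omega>)) * expectation (\<lambda>\<omega>. S (incr_path 0 \<omega>))"
  using assms
proof (induction arbitrary: S rule: trig.induct)
  case (trig_cos l \<theta>)
  have T: "(\<lambda>w. cos (l w + \<theta>)) \<in> trig" by (rule trig.trig_cos) fact
  from trig_cos(2) show ?case
  proof (induction rule: trig.induct)
    case (trig_cos l' \<phi>)
    then show ?case by (intro trig_mixing_cos \<open>l \<in> linform\<close>)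
  next
    case (trig_add S1 S2)
    note i = trig_incr_mult_integrable[OF T trig_add(1), of 0] trig_incr_mult_integrable[OF T trig_add(2), of 0]
      trig_incr_integrable[OF trig_add(1), of 0] trig_incr_integrable[OF trig_add(2), of 0]
    show ?case using tendsto_add[OF trig_add.IH] i by (simp add: distrib_left)
  next
    case (trig_scale S1 r)
    show ?case using tendsto_mult_left[OF trig_scale.IH, of r] by (simp add: mult.left_commute)
  qed
next
  case (trig_add T1 T2)
  note i = trig_incr_mult_integrable[OF trig_add(1) trig_add.prems, of 0] trig_incr_mult_integrable[OF trig_add(2) trig_add.prems, of 0]
    trig_incr_integrable[OF trig_add(1), of 0] trig_incr_integrable[OF trig_add(2), of 0]
  show ?case using tendsto_add[OF trig_add.IH(1)[OF trig_add.prems] trig_add.IH(2)[OF trig_add.prems]] i by (simp add: distrib_right)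
next
  case (trig_scale T1 r)
  show ?case using tendsto_mult_left[OF trig_scale.IH[OF trig_scale.prems], of r] by (simp add: mult.assoc)
qed

text \<open>Expresses the increment path from s + k as a function of the one from s, so that joint
  laws of the two follow from the law of a single increment path.\<close>

definition path_shift :: "real \<Rightarrow> (real \<Rightarrow> real) \<Rightarrow> real \<Rightarrow> real" where
  "path_shift k w = (\<lambda>t\<in>{0..}. w (k + t) - w k)"

lemma measurable_path_shift: "0 \<le> k \<Longrightarrow> path_shift k \<in> measurable path_space path_space"
  unfolding path_shift_def
  by (intro measurable_restrict borel_measurable_diff measurable_component_singleton) auto

lemma incr_path_shift: "0 \<le> s \<Longrightarrow> 0 \<le> k \<Longrightarrow> incr_path (s + k) \<omega> = path_shift k (incr_path s \<omega>)"
  by (auto simp: incr_path_def path_shift_def fun_eq_iff restrict_def add.assoc)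

lemma trig_stationary:
  assumes T: "T \<in> trig" and sk: "0 \<le> s" "0 \<le> k"
  shows "expectation (\<lambda>\<omega>. T (incr_path s \<omega>) * T (incr_path (s + k) \<omega>)) = expectation (\<lambda>\<omega>. T (incr_path 0 \<omega>) * T (incr_path k \<omega>))"
proof -
  have m: "(\<lambda>w. T w * T (path_shift k w)) \<in> borel_measurable path_space"
    using measurable_trig[OF T] measurable_compose[OF measurable_path_shift[OF sk(2)] measurable_trig[OF T]]
    by (intro borel_measurable_times)
  have "expectation (\<lambda>\<omega>. T (incr_path s \<omega>) * T (incr_path (s + k) \<omega>)) = (\<integral>w. T w * T (path_shift k w) \<partial>incr_law)"
    unfolding incr_path_shift[OF sk] by (rule expectation_incr_path[OF sk(1) m])
  also have "\<dots> = expectation (\<lambda>\<omega>. T (incr_path 0 \<omega>) * T (incr_path (0 + k) \<omega>))"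
    unfolding incr_path_shift[OF order_refl sk(2)] by (rule expectation_incr_path[OF order_refl m, symmetric])
  finally show ?thesis by simp
qed

text \<open>The variance of the average is a double average of covariances that depend only on the
  distance |i - j| and tend to 0 by mixing.\<close>

lemma trig_lln:
  assumes T: "T \<in> trig" and m: "0 < m"
  shows "(\<lambda>n. expectation (\<lambda>\<omega>. \<bar>(\<Sum>i<n. T (incr_path (real (i * m)) \<omega>)) / real n - (\<integral>w. T w \<partial>incr_law)\<bar>)) \<longlonglongrightarrow> 0"
proof (rule L2_null_imp_L1_null)
  define \<mu> where "\<mu> = (\<integral>w. T w \<partial>incr_law)"
  define Z where "Z = (\<lambda>i \<omega>. T (incr_path (real (i * m)) \<omega>))"
  define r where "r = (\<lambda>d::nat. expectation (\<lambda>\<omega>. T (incr_path 0 \<omega>) * T (incr_path (real (d * m)) \<omega>)) - \<mu> * \<mu>)"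
  have Tm: "T \<in> borel_measurable path_space" by (rule measurable_trig[OF T])
  have iZ: "integrable M (Z i)" "integrable M (\<lambda>\<omega>. Z i \<omega> * Z j \<omega>)" for i j
    unfolding Z_def by (intro trig_incr_integrable trig_incr_mult_integrable T; simp)+
  have EZ: "expectation (Z i) = \<mu>" for i
    unfolding Z_def \<mu>_def by (rule expectation_incr_path[OF _ Tm]) simp
  have cov: "expectation (\<lambda>\<omega>. (Z i \<omega> - \<mu>) * (Z j \<omega> - \<mu>)) = r ((j - i) + (i - j))" for i j
  proof -
    have le: "expectation (\<lambda>\<omega>. Z i \<omega> * Z j \<omega>) - \<mu> * \<mu> = r (j - i)" if "i \<le> j" for i j
    proof -
      have "real (j * m) = real (i * m) + real ((j - i) * m)" using that by (simp add: algebra_simps flip: of_nat_add of_nat_mult)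
      then show ?thesis unfolding Z_def r_def using trig_stationary[OF T, of "real (i * m)" "real ((j - i) * m)"] by simp
    qed
    have "expectation (\<lambda>\<omega>. (Z i \<omega> - \<mu>) * (Z j \<omega> - \<mu>)) = expectation (\<lambda>\<omega>. Z i \<omega> * Z j \<omega> - \<mu> * Z i \<omega> - \<mu> * Z j \<omega> + \<mu> * \<mu>)"
      by (intro Bochner_Integration.integral_cong refl) (simp add: algebra_simps)
    also have "\<dots> = expectation (\<lambda>\<omega>. Z i \<omega> * Z j \<omega>) - \<mu> * \<mu>"
      using iZ prob_space by (simp add: EZ)
    also have "\<dots> = r ((j - i) + (i - j))"
    proof (cases "i \<le> j")
      case True then show ?thesis using le by simp
    next
      case False then show ?thesis using le[of j i] by (simp add: mult.commute)
    qed
    finally show ?thesis .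
  qed
  have "r \<longlonglongrightarrow> \<mu> * \<mu> - \<mu> * \<mu>"
  proof -
    have "expectation (\<lambda>\<omega>. T (incr_path 0 \<omega>)) = \<mu>" unfolding \<mu>_def by (rule expectation_incr_path[OF order_refl Tm])
    then have "(\<lambda>k. expectation (\<lambda>\<omega>. T (incr_path 0 \<omega>) * T (incr_path (real k) \<omega>))) \<longlonglongrightarrow> \<mu> * \<mu>" using trig_mixing[OF T T] by simp
    from LIMSEQ_subseq_LIMSEQ[OF this, of "\<lambda>d. d * m"] m
    have "(\<lambda>d. expectation (\<lambda>\<omega>. T (incr_path 0 \<omega>) * T (incr_path (real (d * m)) \<omega>))) \<longlonglongrightarrow> \<mu> * \<mu>"
      by (simp add: strict_mono_def comp_def del: of_nat_mult)
    then show ?thesis unfolding r_def by (intro tendsto_diff tendsto_const)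
  qed
  then have r0: "r \<longlonglongrightarrow> 0" by simp
  let ?X = "\<lambda>n \<omega>. (\<Sum>i<n. T (incr_path (real (i * m)) \<omega>)) / real n - (\<integral>w. T w \<partial>incr_law)"
  show "integrable M (?X n)" for n
    using iZ(1) unfolding Z_def by simp
  have X: "(?X n \<omega>)\<^sup>2 = (\<Sum>i<n. \<Sum>j<n. (Z i \<omega> - \<mu>) * (Z j \<omega> - \<mu>)) / (real n)\<^sup>2" if "0 < n" for n \<omega>
  proof -
    have "?X n \<omega> = (\<Sum>i<n. Z i \<omega> - \<mu>) / real n"
      using that by (simp add: Z_def \<mu>_def sum_subtractf diff_divide_distrib)
    then have "(?X n \<omega>)\<^sup>2 = ((\<Sum>i<n. Z i \<omega> - \<mu>) * (\<Sum>j<n. Z j \<omega> - \<mu>)) / (real n)\<^sup>2" by (simp only: power2_eq_square times_divide_times_eq)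
    then show ?thesis by (simp only: sum_product)
  qed
  have iZZ: "integrable M (\<lambda>\<omega>. (Z i \<omega> - \<mu>) * (Z j \<omega> - \<mu>))" for i j
  proof -
    have "integrable M (\<lambda>\<omega>. Z i \<omega> * Z j \<omega> - \<mu> * Z i \<omega> - \<mu> * Z j \<omega> + \<mu> * \<mu>)" using iZ by simp
    moreover have "(\<lambda>\<omega>. Z i \<omega> * Z j \<omega> - \<mu> * Z i \<omega> - \<mu> * Z j \<omega> + \<mu> * \<mu>) = (\<lambda>\<omega>. (Z i \<omega> - \<mu>) * (Z j \<omega> - \<mu>))"
      by (simp add: fun_eq_iff algebra_simps)
    ultimately show ?thesis by simp
  qed
  show "integrable M (\<lambda>\<omega>. (?X n \<omega>)\<^sup>2)" for n
  proof (cases "n = 0")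
    case False
    then have "(\<lambda>\<omega>. (?X n \<omega>)\<^sup>2) = (\<lambda>\<omega>. (\<Sum>i<n. \<Sum>j<n. (Z i \<omega> - \<mu>) * (Z j \<omega> - \<mu>)) / (real n)\<^sup>2)"
      by (intro ext X) simp
    then show ?thesis using iZZ by (simp only:) (intro integrable_divide_zero Bochner_Integration.integrable_sum impI)
  qed simp
  have "expectation (\<lambda>\<omega>. (?X n \<omega>)\<^sup>2) = (\<Sum>i<n. \<Sum>j<n. r ((j - i) + (i - j))) / (real n)\<^sup>2" if "0 < n" for n
  proof -
    have "expectation (\<lambda>\<omega>. (?X n \<omega>)\<^sup>2) = expectation (\<lambda>\<omega>. (\<Sum>i<n. \<Sum>j<n. (Z i \<omega> - \<mu>) * (Z j \<omega> - \<mu>)) / (real n)\<^sup>2)"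
      using X[OF that] by simp
    also have "\<dots> = (\<Sum>i<n. \<Sum>j<n. expectation (\<lambda>\<omega>. (Z i \<omega> - \<mu>) * (Z j \<omega> - \<mu>))) / (real n)\<^sup>2"
      using iZZ by (simp add: Bochner_Integration.integral_sum)
    finally show ?thesis unfolding cov .
  qed
  then have "\<forall>\<^sub>F n in sequentially. (\<Sum>i<n. \<Sum>j<n. r ((j - i) + (i - j))) / (real n)\<^sup>2 = expectation (\<lambda>\<omega>. (?X n \<omega>)\<^sup>2)"
    unfolding eventually_sequentially by (intro exI[of _ 1]) auto
  from Lim_transform_eventually[OF double_sum_average_null[OF r0] this]
  show "(\<lambda>n. expectation (\<lambda>\<omega>. (?X n \<omega>)\<^sup>2)) \<longlonglongrightarrow> 0" .
qed

text \<open>Replacing F by a trigonometric T costs the same L^1 amount in the average for every n,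
  because all increment paths have the same law. One third of e each goes to this replacement, to
  \<open>trig_lln\<close>, and to the difference of the means.\<close>

theorem incr_lln:
  assumes F: "integrable incr_law F" and m: "0 < m"
  shows "(\<lambda>n. expectation (\<lambda>\<omega>. \<bar>(\<Sum>i<n. F (incr_path (real (i * m)) \<omega>)) / real n - (\<integral>w. F w \<partial>incr_law)\<bar>)) \<longlonglongrightarrow> 0"
  unfolding tendsto_iff dist_real_def
proof (intro allI impI)
  fix e :: real assume "0 < e"
  then have e3: "0 < e/3" by simp
  obtain T where T: "T \<in> trig" "(\<integral>w. \<bar>F w - T w\<bar> \<partial>incr_law) < e/3"
    by (rule incr.trig_approxD[OF incr.trig_dense[OF F] e3])
  have iT: "integrable incr_law T" by (rule incr.integrable_trig[OF T(1)])
  have Fm: "F \<in> borel_measurable path_space" using borel_measurable_integrable[OF F] measurable_cong_sets[OF incr.sets_P refl] by blast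
  have Tm: "T \<in> borel_measurable path_space" by (rule measurable_trig[OF T(1)])
  let ?A = "\<lambda>G n \<omega>. (\<Sum>i<n. G (incr_path (real (i * m)) \<omega>)) / real n" and ?\<mu> = "\<lambda>G. \<integral>w. G w \<partial>incr_law"
  have iA: "integrable M (?A G n)" if "integrable incr_law G" for G :: "(real \<Rightarrow> real) \<Rightarrow> real" and n
    by (intro integrable_divide_zero Bochner_Integration.integrable_sum impI integrable_incr_path that) simp
  have \<mu>: "\<bar>?\<mu> T - ?\<mu> F\<bar> < e/3"
  proof -
    have "?\<mu> T - ?\<mu> F = (\<integral>w. T w - F w \<partial>incr_law)" using iT F by simp
    also have "\<bar>\<dots>\<bar> \<le> (\<integral>w. \<bar>T w - F w\<bar> \<partial>incr_law)" by (rule integral_abs_bound)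
    also have "\<dots> = (\<integral>w. \<bar>F w - T w\<bar> \<partial>incr_law)" by (simp add: abs_minus_commute)
    finally show ?thesis using T(2) by linarith
  qed
  have AFT: "expectation (\<lambda>\<omega>. \<bar>?A F n \<omega> - ?A T n \<omega>\<bar>) \<le> e/3" for n
  proof -
    have iFT: "integrable incr_law (\<lambda>w. \<bar>F w - T w\<bar>)" using F iT by simp
    have "expectation (\<lambda>\<omega>. \<bar>?A F n \<omega> - ?A T n \<omega>\<bar>) \<le> expectation (?A (\<lambda>w. \<bar>F w - T w\<bar>) n)"
    proof (rule integral_mono)
      show "integrable M (\<lambda>\<omega>. \<bar>?A F n \<omega> - ?A T n \<omega>\<bar>)"
        by (intro integrable_abs Bochner_Integration.integrable_diff iA F iT)
      show "integrable M (?A (\<lambda>w. \<bar>F w - T w\<bar>) n)" by (rule iA[OF iFT])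
      show "\<bar>?A F n \<omega> - ?A T n \<omega>\<bar> \<le> ?A (\<lambda>w. \<bar>F w - T w\<bar>) n \<omega>" for \<omega>
        unfolding diff_divide_distrib[symmetric] sum_subtractf[symmetric] abs_divide abs_of_nat
        by (intro divide_right_mono sum_abs) simp
    qed
    also have "\<dots> = (\<Sum>i<n. expectation (\<lambda>\<omega>. \<bar>F (incr_path (real (i * m)) \<omega>) - T (incr_path (real (i * m)) \<omega>)\<bar>)) / real n"
      using integrable_incr_path[OF _ iFT] by (simp del: of_nat_mult add: Bochner_Integration.integral_sum)
    also have "\<dots> = (\<Sum>i<n. (\<integral>w. \<bar>F w - T w\<bar> \<partial>incr_law)) / real n"
      using Fm Tm by (subst expectation_incr_path) auto
    also have "\<dots> \<le> (\<integral>w. \<bar>F w - T w\<bar> \<partial>incr_law)" by (cases "n = 0") auto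
    finally show ?thesis using T(2) by linarith
  qed
  have "\<forall>\<^sub>F n in sequentially. expectation (\<lambda>\<omega>. \<bar>?A T n \<omega> - ?\<mu> T\<bar>) < e/3"
    by (rule order_tendstoD(2)[OF trig_lln[OF T(1) m] e3])
  then show "\<forall>\<^sub>F n in sequentially. \<bar>expectation (\<lambda>\<omega>. \<bar>?A F n \<omega> - ?\<mu> F\<bar>) - 0\<bar> < e"
  proof eventually_elim
    case (elim n)
    have i1: "integrable M (\<lambda>\<omega>. \<bar>?A F n \<omega> - ?A T n \<omega>\<bar>)" "integrable M (\<lambda>\<omega>. \<bar>?A T n \<omega> - ?\<mu> T\<bar>)"
      by (intro integrable_abs Bochner_Integration.integrable_diff iA F iT integrable_const)+
    have i2: "integrable M (\<lambda>\<omega>. \<bar>?A F n \<omega> - ?\<mu> F\<bar>)"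
      by (intro integrable_abs Bochner_Integration.integrable_diff iA F iT integrable_const)
    have "expectation (\<lambda>\<omega>. \<bar>?A F n \<omega> - ?\<mu> F\<bar>) \<le> expectation (\<lambda>\<omega>. (\<bar>?A F n \<omega> - ?A T n \<omega>\<bar> + \<bar>?A T n \<omega> - ?\<mu> T\<bar>) + \<bar>?\<mu> T - ?\<mu> F\<bar>)"
      by (rule integral_mono[OF i2], intro Bochner_Integration.integrable_add i1 integrable_const, linarith)
    also have "\<dots> = expectation (\<lambda>\<omega>. \<bar>?A F n \<omega> - ?A T n \<omega>\<bar>) + expectation (\<lambda>\<omega>. \<bar>?A T n \<omega> - ?\<mu> T\<bar>) + \<bar>?\<mu> T - ?\<mu> F\<bar>"
      using i1 prob_space by (simp add: Bochner_Integration.integral_add[OF Bochner_Integration.integrable_add[OF i1] integrable_const] Bochner_Integration.integral_add[OF i1])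
    also have "\<dots> < e" using AFT[of n] elim \<mu> by linarith
    finally have "expectation (\<lambda>\<omega>. \<bar>?A F n \<omega> - ?\<mu> F\<bar>) < e" .
    moreover have "0 \<le> expectation (\<lambda>\<omega>. \<bar>?A F n \<omega> - ?\<mu> F\<bar>)" by (rule Bochner_Integration.integral_nonneg) simp
    ultimately show ?case by simp
  qed
qed

end

section \<open>Expected truncated variation\<close>

lemma borel_measurable_dyadic_tv:
  assumes "\<And>u. 0 \<le> u \<Longrightarrow> X u \<in> borel_measurable N" "0 \<le> t"
  shows "(\<lambda>\<omega>. dyadic_tv c (\<lambda>u. X u \<omega>) t) \<in> borel_measurable N"
  unfolding dyadic_tv_def
proof (intro borel_measurable_SUP)
  fix m :: nat
  have "(\<lambda>\<omega>. dtv c (\<lambda>k. X (t * real k / 2 ^ m) \<omega>) (2 ^ m)) \<in> borel_measurable N"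
    using assms by (intro measurable_dtv assms(1)) auto
  then show "(\<lambda>\<omega>. ennreal (dtv c (\<lambda>k. X (t * real k / 2 ^ m) \<omega>) (2 ^ m))) \<in> borel_measurable N" by measurable
qed auto

lemma dyadic_tv_eq_tv:
  assumes x: "continuous_on {0..t} x" and c: "0 < c" and t: "0 < t"
  shows "enn2real (dyadic_tv c (\<lambda>u\<in>{0..}. x u) t) = tv c x 0 t"
proof -
  have "continuous_on {0..t} (\<lambda>u\<in>{0..}. x u) \<longleftrightarrow> continuous_on {0..t} x"
    by (rule continuous_on_cong) auto
  with x have x': "continuous_on {0..t} (\<lambda>u\<in>{0..}. x u)" by simp
  have "truncated_variation c (\<lambda>u\<in>{0..}. x u) 0 t = truncated_variation c x 0 t"
    by (rule truncated_variation_increments) auto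
  then show ?thesis unfolding truncated_variation_eq_dyadic_tv[OF x' c t, symmetric] tv_def by simp
qed

text \<open>Where |u| > w the factor (|u| / w)^(2 q - 1) exceeds 1. The even exponent is the one for
  which Gaussian moments are explicit.\<close>

lemma excess_le_power:
  fixes u w :: real
  assumes w: "0 < w" and q: "0 < q"
  shows "max (\<bar>u\<bar> - w) 0 \<le> u ^ (2 * q) / w ^ (2 * q - 1)"
proof (cases "\<bar>u\<bar> \<le> w")
  case True
  then have "max (\<bar>u\<bar> - w) 0 = 0" by simp
  moreover have "0 \<le> u ^ (2 * q) / w ^ (2 * q - 1)" using w by simp
  ultimately show ?thesis by simp
next
  case False
  have e: "2 * q = Suc (2 * q - 1)" using q by simp
  have "w ^ (2 * q - 1) \<le> \<bar>u\<bar> ^ (2 * q - 1)" using False w by (intro power_mono) auto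
  then have "\<bar>u\<bar> * w ^ (2 * q - 1) \<le> \<bar>u\<bar> * \<bar>u\<bar> ^ (2 * q - 1)" by (intro mult_left_mono) auto
  also have "\<dots> = \<bar>u\<bar> ^ (2 * q)" by (subst (2) e) simp
  also have "\<dots> = u ^ (2 * q)" by (simp add: power_mult)
  finally have "\<bar>u\<bar> \<le> u ^ (2 * q) / w ^ (2 * q - 1)" using w by (simp add: pos_le_divide_eq)
  moreover have "max (\<bar>u\<bar> - w) 0 \<le> \<bar>u\<bar>" using w by simp
  ultimately show ?thesis by linarith
qed

lemma (in prob_space) normal_law_even_moment:
  assumes L[measurable]: "L \<in> borel_measurable M" and D: "distr M borel L = normal_law 0 v" and v: "0 \<le> v"
  shows "integrable M (\<lambda>\<omega>. (L \<omega>) ^ (2 * q))" "expectation (\<lambda>\<omega>. (L \<omega>) ^ (2 * q)) = v ^ q * (fact (2 * q) / (2 ^ q * fact q))"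
proof -
  let ?N = std_normal_distribution
  have D': "distr M borel L = distr ?N borel (\<lambda>x. 0 + sqrt v * x)" unfolding D by (rule normal_law_eq[OF v])
  have pm: "(\<lambda>x::real. x ^ (2 * q)) \<in> borel_measurable borel" by measurable
  have nm: "(\<lambda>x. 0 + sqrt v * x) \<in> measurable ?N borel" by simp
  have pw: "(0 + sqrt v * x) ^ (2 * q) = v ^ q * x ^ (2 * q)" for x
    using v by (simp add: power_mult_distrib power_mult)
  have "integrable M (\<lambda>\<omega>. (L \<omega>) ^ (2 * q)) \<longleftrightarrow> integrable (distr M borel L) (\<lambda>x. x ^ (2 * q))"
    by (rule integrable_distr_eq[OF L pm, symmetric])
  also have "\<dots> \<longleftrightarrow> integrable ?N (\<lambda>x. v ^ q * x ^ (2 * q))"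
    unfolding D' integrable_distr_eq[OF nm pm] pw ..
  finally show "integrable M (\<lambda>\<omega>. (L \<omega>) ^ (2 * q))"
    using std_normal_distribution_even_moments(2)[of q] by simp
  have "expectation (\<lambda>\<omega>. (L \<omega>) ^ (2 * q)) = (\<integral>x. x ^ (2 * q) \<partial>distr M borel L)"
    by (rule integral_distr[OF L pm, symmetric])
  also have "\<dots> = (\<integral>x. v ^ q * x ^ (2 * q) \<partial>?N)" unfolding D' integral_distr[OF nm pm] pw ..
  also have "\<dots> = v ^ q * (fact (2 * q) / (2 ^ q * fact q))"
    unfolding integral_mult_right_zero std_normal_distribution_even_moments(1) ..
  finally show "expectation (\<lambda>\<omega>. (L \<omega>) ^ (2 * q)) = v ^ q * (fact (2 * q) / (2 ^ q * fact q))" .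
qed

section \<open>Integrability of the truncated variation over a unit interval\<close>

context fractional_brownian_motion
begin

lemma path_continuous: "\<omega> \<in> space M \<Longrightarrow> 0 \<le> a \<Longrightarrow> continuous_on {a..b} (path \<omega>)"
  using continuous_paths by (rule continuous_on_subset) auto

lemma measurable_tv_path:
  assumes "0 < c" "0 \<le> t"
  shows "(\<lambda>\<omega>. tv c (path \<omega>) 0 t) \<in> borel_measurable M"
proof (cases "t = 0")
  case True
  then show ?thesis using assms by simp
next
  case False
  have [measurable]: "(\<lambda>\<omega>. dyadic_tv c (path \<omega>) t) \<in> borel_measurable M"
    by (rule borel_measurable_dyadic_tv) (use assms in auto)
  have "(\<lambda>\<omega>. enn2real (dyadic_tv c (path \<omega>) t)) \<in> borel_measurable M" by measurable
  moreover have "tv c (path \<omega>) 0 t = enn2real (dyadic_tv c (path \<omega>) t)" if "\<omega> \<in> space M" for \<omega>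
    using truncated_variation_eq_dyadic_tv[OF path_continuous[OF that order_refl] assms(1)] False assms(2)
    by (simp add: tv_def)
  ultimately show ?thesis by (subst measurable_cong) auto
qed

text \<open>
  Increments over dyadic intervals of length \<open>2\<^sup>-\<^sup>j\<close> have size \<open>2\<^sup>-\<^sup>j\<^sup>H\<close>; in a chaining with thresholds that
  decay geometrically, but more slowly, a high even moment makes the expected excesses summable.
\<close>
lemma expected_tv_finite: "(\<integral>\<^sup>+\<omega>. truncated_variation 1 (path \<omega>) 0 1 \<partial>M) < \<infinity>"
proof -
  obtain q0 :: nat where q0: "1 / H < real q0" using reals_Archimedean2 by blast
  define q where "q = q0"
  have q: "0 < q" "1 \<le> H * real q"
  proof -
    have "0 < 1 / H" using hurst by simp
    with q0 show "0 < q" unfolding q_def by (cases q0) auto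
    show "1 \<le> H * real q" using q0 hurst by (simp add: q_def pos_divide_less_eq mult.commute)
  qed
  \<comment> \<open>Half the exponent of the increments. Below, w0 = (1 - r) / 2 keeps the partial
    sums of 2 w j under the truncation level 1.\<close>
  define r where "r = (2::real) powr (- H / 2)"
  have r: "0 < r" "r < 1" using hurst powr_less_cancel_iff[of 2 "- H / 2" 0] by (auto simp: r_def)
  define w0 where "w0 = (1 - r) / 2"
  have w0: "0 < w0" using r by (simp add: w0_def)
  define w where "w = (\<lambda>j::nat. w0 * r ^ j)"
  have w: "0 < w j" for j using w0 r by (simp add: w_def)
  have wsum: "(\<Sum>j\<le>m. 2 * w j) \<le> 1" for m
  proof -
    have "(\<Sum>j\<le>m. 2 * w j) = (1 - r) * (\<Sum>j\<le>m. r ^ j)" by (simp add: w_def w0_def sum_distrib_left)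
    also have "\<dots> = 1 - r ^ Suc m" using sum_gp_basic[of r m] by simp
    also have "\<dots> \<le> 1" using r by simp
    finally show ?thesis .
  qed
  let ?\<Delta> = "\<lambda>j i \<omega>. B (real (Suc i) / 2 ^ j) \<omega> - B (real i / 2 ^ j) \<omega>"
  define v where "v = (\<lambda>j::nat. kappa * (1 / 2 ^ j) powr (2 * H))"
  have v0: "0 \<le> v j" for j using kappa(1) by (simp add: v_def)
  define Mq where "Mq = (fact (2 * q) / (2 ^ q * fact q) :: real)"
  have \<Delta>m: "(\<lambda>\<omega>. ?\<Delta> j i \<omega>) \<in> borel_measurable M" for j i by (intro borel_measurable_diff B_measurable) auto
  have \<Delta>d: "distr M borel (\<lambda>\<omega>. ?\<Delta> j i \<omega>) = normal_law 0 (v j)" for j i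
  proof -
    have e: "real (Suc i) / 2 ^ j - real i / 2 ^ j = 1 / 2 ^ j" unfolding diff_divide_distrib[symmetric] by simp
    have "distr M borel (\<lambda>\<omega>. ?\<Delta> j i \<omega>) = normal_law 0 (kappa * \<bar>real (Suc i) / 2 ^ j - real i / 2 ^ j\<bar> powr (2 * H))"
      by (rule kappa(2)) auto
    then show ?thesis unfolding e v_def by simp
  qed
  have step: "(\<integral>\<^sup>+\<omega>. ennreal (max (\<bar>?\<Delta> j i \<omega>\<bar> - w j) 0) \<partial>M) \<le> ennreal (v j ^ q * Mq / w j ^ (2 * q - 1))" for j i
  proof -
    note mom = normal_law_even_moment[OF \<Delta>m[of i j] \<Delta>d[of i j] v0[of j], of q]
    have "(\<integral>\<^sup>+\<omega>. ennreal (max (\<bar>?\<Delta> j i \<omega>\<bar> - w j) 0) \<partial>M) \<le> (\<integral>\<^sup>+\<omega>. ennreal ((?\<Delta> j i \<omega>) ^ (2 * q) / w j ^ (2 * q - 1)) \<partial>M)"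
      by (intro nn_integral_mono ennreal_leI excess_le_power w q)
    also have "\<dots> = ennreal (expectation (\<lambda>\<omega>. (?\<Delta> j i \<omega>) ^ (2 * q) / w j ^ (2 * q - 1)))"
      by (rule nn_integral_eq_integral) (use mom(1) w[of j] in \<open>auto intro!: divide_nonneg_pos\<close>)
    also have "expectation (\<lambda>\<omega>. (?\<Delta> j i \<omega>) ^ (2 * q) / w j ^ (2 * q - 1)) = v j ^ q * Mq / w j ^ (2 * q - 1)"
      using mom(2) by (simp add: Mq_def)
    finally show ?thesis .
  qed
  define D where "D = kappa ^ q * Mq / w0 ^ (2 * q - 1)"
  \<comment> \<open>At level j there are 2^j intervals; the moment contributes 2^(-2 H q j), and
    dividing by the power of the threshold contributes 2^(H (2 q - 1) j / 2). The exponents add up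
    to (1 - H q - H / 2) j, which is negative multiples of j since H q \<ge> 1.\<close>
  define \<theta> where "\<theta> = (2::real) powr (1 - H * real q - H / 2)"
  have \<theta>: "0 \<le> \<theta>" "\<theta> < 1"
    using q(2) hurst powr_less_cancel_iff[of 2 "1 - H * real q - H / 2" 0] by (auto simp: \<theta>_def)
  have level: "2 ^ j * (v j ^ q * Mq / w j ^ (2 * q - 1)) = D * \<theta> ^ j" for j
  proof -
    have p2: "(1 / 2 ^ j :: real) = 2 powr (- real j)" by (simp add: powr_minus powr_realpow divide_inverse)
    have "v j ^ q = kappa ^ q * ((1 / 2 ^ j) powr (2 * H)) ^ q" by (simp add: v_def power_mult_distrib)
    also have "((1 / 2 ^ j) powr (2 * H)) ^ q = 2 powr (- real j * (2 * H) * real q)"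
      unfolding p2 by (simp add: powr_powr powr_power ac_simps)
    finally have v': "v j ^ q = kappa ^ q * 2 powr (- real j * (2 * H) * real q)" .
    have "w j ^ (2 * q - 1) = w0 ^ (2 * q - 1) * (r ^ j) ^ (2 * q - 1)" by (simp add: w_def power_mult_distrib)
    also have "(r ^ j) ^ (2 * q - 1) = 2 powr (- H / 2 * real j * real (2 * q - 1))"
      unfolding r_def by (simp add: powr_power power_mult[symmetric] ac_simps)
    finally have w': "w j ^ (2 * q - 1) = w0 ^ (2 * q - 1) * 2 powr (- H / 2 * real j * real (2 * q - 1))" .
    have th: "\<theta> ^ j = 2 powr ((1 - H * real q - H / 2) * real j)" by (simp add: \<theta>_def powr_power mult.commute)
    have q1: "real (2 * q - 1) = 2 * real q - 1" using q(1) by (simp add: of_nat_diff)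
    have "(2::real) powr (real j) * 2 powr (- real j * (2 * H) * real q) / 2 powr (- H / 2 * real j * real (2 * q - 1)) = \<theta> ^ j"
      unfolding th powr_add[symmetric] powr_diff[symmetric] q1 by (rule arg_cong[of _ _ "\<lambda>x. 2 powr x"]) (simp add: field_simps)
    then have A: "(2::real) ^ j * 2 powr (- real j * (2 * H) * real q) / 2 powr (- H / 2 * real j * real (2 * q - 1)) = \<theta> ^ j"
      by (simp only: powr_realpow zero_less_numeral)
    have B: "2 ^ j * (kappa ^ q * X * Mq / (w0 ^ (2 * q - 1) * Y)) = D * (2 ^ j * X / Y)" for X Y :: real
      unfolding D_def by simp
    show ?thesis unfolding v' w' B A ..
  qed
  have D0: "0 \<le> D" using kappa(1) w0 by (simp add: D_def Mq_def)
  have "(\<integral>\<^sup>+\<omega>. truncated_variation 1 (path \<omega>) 0 1 \<partial>M)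
     \<le> (\<integral>\<^sup>+\<omega>. (\<Sum>j. \<Sum>i<2 ^ j. ennreal (max (\<bar>?\<Delta> j i \<omega>\<bar> - w j) 0)) \<partial>M)"
  proof (rule nn_integral_mono)
    fix \<omega> assume "\<omega> \<in> space M"
    show "truncated_variation 1 (path \<omega>) 0 1 \<le> (\<Sum>j. \<Sum>i<2 ^ j. ennreal (max (\<bar>?\<Delta> j i \<omega>\<bar> - w j) 0))"
      by (rule truncated_variation_chaining[OF path_continuous[OF \<open>\<omega> \<in> space M\<close> order_refl] less_imp_le[OF w] wsum])
  qed
  also have "\<dots> = (\<Sum>j. \<Sum>i<2 ^ j. (\<integral>\<^sup>+\<omega>. ennreal (max (\<bar>?\<Delta> j i \<omega>\<bar> - w j) 0) \<partial>M))"
  proof -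
    have m: "(\<lambda>\<omega>. ennreal (max (\<bar>?\<Delta> j i \<omega>\<bar> - w j) 0)) \<in> borel_measurable M" for j i
      using \<Delta>m[of i j] by measurable
    have m2: "(\<lambda>\<omega>. \<Sum>i<2 ^ j. ennreal (max (\<bar>?\<Delta> j i \<omega>\<bar> - w j) 0)) \<in> borel_measurable M" for j
      by (rule borel_measurable_sum) (rule m)
    show ?thesis unfolding nn_integral_suminf[OF m2] by (intro suminf_cong nn_integral_sum m)
  qed
  also have "\<dots> \<le> (\<Sum>j. ennreal (D * \<theta> ^ j))"
  proof (intro suminf_le summableI)
    fix j
    have "(\<Sum>i<2 ^ j. (\<integral>\<^sup>+\<omega>. ennreal (max (\<bar>?\<Delta> j i \<omega>\<bar> - w j) 0) \<partial>M)) \<le> (\<Sum>i<(2::nat) ^ j. ennreal (v j ^ q * Mq / w j ^ (2 * q - 1)))"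
      by (rule sum_mono) (rule step)
    also have "\<dots> = ennreal (\<Sum>i<(2::nat) ^ j. v j ^ q * Mq / w j ^ (2 * q - 1))"
      using v0[of j] w[of j] by (intro sum_ennreal) (simp add: Mq_def)
    also have "(\<Sum>i<(2::nat) ^ j. v j ^ q * Mq / w j ^ (2 * q - 1)) = D * \<theta> ^ j"
      unfolding level[symmetric] by simp
    finally show "(\<Sum>i<2 ^ j. (\<integral>\<^sup>+\<omega>. ennreal (max (\<bar>?\<Delta> j i \<omega>\<bar> - w j) 0) \<partial>M)) \<le> ennreal (D * \<theta> ^ j)" .
  qed
  also have "\<dots> = ennreal (\<Sum>j. D * \<theta> ^ j)"
    using D0 \<theta> by (intro suminf_ennreal2 summable_mult summable_geometric) auto
  also have "\<dots> < \<infinity>" by simp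
  finally show ?thesis .
qed

text \<open>A functional on \<open>path_space\<close>, which contains discontinuous paths; the
  dyadic form makes it measurable there, as the law of large numbers requires.\<close>

definition tv_functional :: "nat \<Rightarrow> (real \<Rightarrow> real) \<Rightarrow> real" where
  "tv_functional m w = enn2real (dyadic_tv 1 w (real m))"

lemma measurable_tv_functional: "tv_functional m \<in> borel_measurable path_space"
proof -
  have [measurable]: "(\<lambda>w. dyadic_tv 1 (\<lambda>u. w u) (real m)) \<in> borel_measurable path_space"
    by (rule borel_measurable_dyadic_tv) (auto intro: measurable_component_singleton)
  show ?thesis unfolding tv_functional_def[abs_def] by measurable
qed

lemma tv_functional_incr_path:
  assumes "\<omega> \<in> space M" "0 \<le> k" "0 < m"
  shows "tv_functional m (incr_path k \<omega>) = tv 1 (path \<omega>) k (k + real m)"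
proof -
  have c: "continuous_on {0..real m} (\<lambda>t. B (k + t) \<omega> - B k \<omega>)"
    using assms by (intro continuous_intros continuous_on_compose2[OF path_continuous[OF assms(1,2), of "k + real m"]]) auto
  have "tv_functional m (incr_path k \<omega>) = tv 1 (\<lambda>t. B (k + t) \<omega> - B k \<omega>) 0 (real m)"
    unfolding tv_functional_def incr_path_def using assms(3) by (intro dyadic_tv_eq_tv c) auto
  also have "\<dots> = tv (1 * 1) (\<lambda>t. 1 * path \<omega> (1 * t + k)) 0 (real m)"
    unfolding tv_def by (intro arg_cong[of _ _ enn2real]) (subst truncated_variation_increments[where y = "\<lambda>t. 1 * path \<omega> (1 * t + k)"], auto simp: add.commute)
  also have "\<dots> = 1 * tv 1 (path \<omega>) (1 * 0 + k) (1 * real m + k)"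
    by (rule tv_scale) (use path_continuous[OF assms(1,2)] in auto)
  finally show ?thesis by (simp add: add.commute)
qed

lemma tv_unit_integrable: "integrable M (\<lambda>\<omega>. tv 1 (path \<omega>) 0 1)"
proof (rule integrableI_bounded)
  show "(\<lambda>\<omega>. tv 1 (path \<omega>) 0 1) \<in> borel_measurable M" by (rule measurable_tv_path) auto
  have "(\<integral>\<^sup>+\<omega>. ennreal (norm (tv 1 (path \<omega>) 0 1)) \<partial>M) = (\<integral>\<^sup>+\<omega>. truncated_variation 1 (path \<omega>) 0 1 \<partial>M)"
  proof (rule nn_integral_cong)
    fix \<omega> assume \<omega>: "\<omega> \<in> space M"
    interpret continuous_path "path \<omega>" 0 1 by standard (rule path_continuous[OF \<omega> order_refl])
    show "ennreal (norm (tv 1 (path \<omega>) 0 1)) = truncated_variation 1 (path \<omega>) 0 1"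
      using ennreal_tv[of 1 0 1] by simp
  qed
  then show "(\<integral>\<^sup>+\<omega>. ennreal (norm (tv 1 (path \<omega>) 0 1)) \<partial>M) < \<infinity>" using expected_tv_finite by simp
qed

lemma tv_functional_integrable_iff:
  assumes "0 < m"
  shows "integrable incr_law (tv_functional m) \<longleftrightarrow> integrable M (\<lambda>\<omega>. tv 1 (path \<omega>) 0 (real m))"
proof -
  have "integrable incr_law (tv_functional m) \<longleftrightarrow> integrable M (\<lambda>\<omega>. tv_functional m (incr_path 0 \<omega>))"
    unfolding incr_law_def by (rule integrable_distr_eq[OF measurable_incr_path[OF order_refl] measurable_tv_functional])
  also have "\<dots> \<longleftrightarrow> integrable M (\<lambda>\<omega>. tv 1 (path \<omega>) 0 (real m))"
    using tv_functional_incr_path[OF _ order_refl assms] by (intro Bochner_Integration.integrable_cong refl) simp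
  finally show ?thesis .
qed

text \<open>Superadditivity gives the first bound; in the second, each added block costs at most the
  truncation level 1.\<close>

lemma tv_blocks:
  assumes \<omega>: "\<omega> \<in> space M" and m: "0 < m"
  shows "(\<Sum>i<n. tv_functional m (incr_path (real (i * m)) \<omega>)) \<le> tv 1 (path \<omega>) 0 (real (n * m))"
    "tv 1 (path \<omega>) 0 (real (n * m)) \<le> (\<Sum>i<n. tv_functional m (incr_path (real (i * m)) \<omega>)) + real n"
proof (induction n)
  case 0
  { case 1 show ?case by simp next case 2 show ?case by simp }
next
  case (Suc n)
  interpret continuous_path "path \<omega>" 0 "real (Suc n * m)" by standard (rule path_continuous[OF \<omega> order_refl])
  have f: "tv_functional m (incr_path (real (n * m)) \<omega>) = tv 1 (path \<omega>) (real (n * m)) (real (Suc n * m))"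
    using tv_functional_incr_path[OF \<omega> _ m, of "real (n * m)"] by (simp add: algebra_simps)
  have le: "real (n * m) \<le> real (Suc n * m)" by (simp del: of_nat_mult)
  note A = tv_superadditive[of 1 0 "real (n * m)" "real (Suc n * m)"] tv_subadditive[of 1 0 "real (n * m)" "real (Suc n * m)"]
  { case 1 show ?case using A(1) Suc.IH(1) le by (simp add: f del: of_nat_mult)
  next case 2 show ?case using A(2) Suc.IH(2) le by (simp add: f del: of_nat_mult) }
qed

lemma tv_path_mono: "\<omega> \<in> space M \<Longrightarrow> 0 < c \<Longrightarrow> 0 \<le> s \<Longrightarrow> s \<le> t \<Longrightarrow> tv c (path \<omega>) 0 s \<le> tv c (path \<omega>) 0 t"
proof -
  assume a: "\<omega> \<in> space M" "0 < c" "0 \<le> s" "s \<le> t"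
  interpret continuous_path "path \<omega>" 0 t by standard (rule path_continuous[OF a(1) order_refl])
  show ?thesis using a by (intro tv_mono) auto
qed

lemma tv_integrable:
  assumes "0 \<le> t"
  shows "integrable M (\<lambda>\<omega>. tv 1 (path \<omega>) 0 t)"
proof -
  obtain n :: nat where n: "t \<le> real n" using real_arch_simple by blast
  have F: "integrable incr_law (tv_functional 1)"
    using tv_functional_integrable_iff[of 1] tv_unit_integrable by simp
  have "integrable M (\<lambda>\<omega>. (\<Sum>i<n. tv_functional 1 (incr_path (real (i * 1)) \<omega>)) + real n)"
    by (intro Bochner_Integration.integrable_add Bochner_Integration.integrable_sum integrable_incr_path F integrable_const) simp
  then show ?thesis
  proof (rule Bochner_Integration.integrable_bound)
    show "(\<lambda>\<omega>. tv 1 (path \<omega>) 0 t) \<in> borel_measurable M" using assms by (intro measurable_tv_path) auto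
    show "AE \<omega> in M. norm (tv 1 (path \<omega>) 0 t) \<le> norm ((\<Sum>i<n. tv_functional 1 (incr_path (real (i * 1)) \<omega>)) + real n)"
    proof (rule AE_I2)
      fix \<omega> assume \<omega>: "\<omega> \<in> space M"
      have "tv 1 (path \<omega>) 0 t \<le> tv 1 (path \<omega>) 0 (real (n * 1))"
        using assms n by (intro tv_path_mono \<omega>) auto
      also have "\<dots> \<le> (\<Sum>i<n. tv_functional 1 (incr_path (real (i * 1)) \<omega>)) + real n"
        by (rule tv_blocks(2)[OF \<omega>]) simp
      finally show "norm (tv 1 (path \<omega>) 0 t) \<le> norm ((\<Sum>i<n. tv_functional 1 (incr_path (real (i * 1)) \<omega>)) + real n)"
        by simp
    qed
  qed
qed

section \<open>Block averages and the limiting rate\<close>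

definition mean_tv :: "nat \<Rightarrow> real" where
  "mean_tv m = expectation (\<lambda>\<omega>. tv 1 (path \<omega>) 0 (real m))"

lemma mean_tv_nonneg: "0 \<le> mean_tv m"
  unfolding mean_tv_def by (rule Bochner_Integration.integral_nonneg) simp

lemma tv_functional_integrable: "0 < m \<Longrightarrow> integrable incr_law (tv_functional m)"
  using tv_functional_integrable_iff tv_integrable by simp

lemma expectation_tv_functional:
  assumes "0 < m" "0 \<le> k"
  shows "expectation (\<lambda>\<omega>. tv_functional m (incr_path k \<omega>)) = mean_tv m" "(\<integral>w. tv_functional m w \<partial>incr_law) = mean_tv m"
proof -
  have "(\<integral>w. tv_functional m w \<partial>incr_law) = expectation (\<lambda>\<omega>. tv_functional m (incr_path 0 \<omega>))"
    by (rule expectation_incr_path[OF order_refl measurable_tv_functional, symmetric])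
  also have "\<dots> = mean_tv m" unfolding mean_tv_def
    using tv_functional_incr_path[OF _ order_refl assms(1)] by (intro Bochner_Integration.integral_cong refl) simp
  finally show *: "(\<integral>w. tv_functional m w \<partial>incr_law) = mean_tv m" .
  show "expectation (\<lambda>\<omega>. tv_functional m (incr_path k \<omega>)) = mean_tv m"
    unfolding expectation_incr_path[OF assms(2) measurable_tv_functional] * ..
qed

text \<open>With k = floor (N / m) full blocks the error has four sources: the cuts, at most k + 1;
  one incomplete block, of mean at most \<open>mean_tv m\<close>; replacing N / m by k, again
  \<open>mean_tv m\<close>; and k times the error of the law of large numbers. The cuts do not
  vanish relative to N, which leaves a multiple of 1 / m; the crude bound 1 for the last error
  already suffices, since k \<le> N / m.\<close>

lemma tv_block_average:
  assumes m: "0 < m"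
  shows "\<forall>\<^sub>F N in at_top. expectation (\<lambda>\<omega>. \<bar>tv 1 (path \<omega>) 0 N / N - mean_tv m / real m\<bar>) \<le> 3 / real m"
proof -
  let ?f = "\<lambda>i \<omega>. tv_functional m (incr_path (real (i * m)) \<omega>)"
  let ?S = "\<lambda>n \<omega>. \<Sum>i<n. ?f i \<omega>"
  let ?\<epsilon> = "\<lambda>n. expectation (\<lambda>\<omega>. \<bar>?S n \<omega> / real n - mean_tv m\<bar>)"
  let ?n = "\<lambda>N::real. nat \<lfloor>N / real m\<rfloor>"
  have iF: "integrable M (?f i)" for i by (intro integrable_incr_path tv_functional_integrable m) simp
  have iS: "integrable M (?S n)" for n by (intro Bochner_Integration.integrable_sum iF)
  have \<epsilon>: "?\<epsilon> \<longlonglongrightarrow> 0"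
    using incr_lln[OF tv_functional_integrable[OF m] m] unfolding expectation_tv_functional(2)[OF m order_refl] .
  have lim: "filterlim ?n at_top at_top"
  proof -
    have "filterlim (\<lambda>N::real. N / real m) at_top at_top"
      using m filterlim_tendsto_pos_mult_at_top[OF tendsto_const[of "1 / real m"] _ filterlim_ident] by simp
    from filterlim_compose[OF filterlim_nat_sequentially filterlim_compose[OF filterlim_floor_sequentially this]]
    show ?thesis by (simp add: comp_def)
  qed
  have e1: "\<forall>\<^sub>F N in at_top. ?\<epsilon> (?n N) < 1"
    using filterlim_iff[THEN iffD1, OF filterlim_compose[OF \<epsilon> lim]] order_tendstoD(2)[OF filterlim_compose[OF \<epsilon> lim], of 1] by simp
  \<comment> \<open>From this N on, the terms that do not grow with k satisfy 2
    \<open>mean_tv m\<close> + 1 \<le> N / m, the third of the three summands.\<close>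
  have e2: "\<forall>\<^sub>F N in at_top. real m * (2 * mean_tv m + 1) + 1 \<le> N" by (rule eventually_ge_at_top)
  from e1 e2 show ?thesis
  proof eventually_elim
    case (elim N)
    let ?k = "?n N" and ?Z = "\<lambda>\<omega>. tv 1 (path \<omega>) 0 N"
    have m1: "1 \<le> real m" using m by simp
    have a0: "0 \<le> mean_tv m" by (rule mean_tv_nonneg)
    have "0 \<le> real m * (2 * mean_tv m + 1)" using a0 by simp
    then have N0: "0 < N" using elim(2) by linarith
    have "0 \<le> N / real m" using N0 by simp
    then have "real ?k = of_int \<lfloor>N / real m\<rfloor>" by simp
    then have kN: "real ?k \<le> N / real m" "N / real m < real ?k + 1" by linarith+
    have kN': "real (?k * m) \<le> N" "N \<le> real (Suc ?k * m)"
    proof -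
      show "real (?k * m) \<le> N" using kN(1) m1 by (simp add: pos_le_divide_eq)
      have "N < (real ?k + 1) * real m" using kN(2) m1 by (simp add: pos_divide_less_eq)
      also have "(real ?k + 1) * real m = real (Suc ?k * m)" unfolding of_nat_mult of_nat_Suc by (simp only: add.commute)
      finally show "N \<le> real (Suc ?k * m)" by (rule less_imp_le)
    qed
    have bd: "\<bar>?Z \<omega> - N * (mean_tv m / real m)\<bar> \<le> (?f ?k \<omega> + (real ?k + 1)) + real ?k * \<bar>?S ?k \<omega> / real ?k - mean_tv m\<bar> + mean_tv m" if \<omega>: "\<omega> \<in> space M" for \<omega>
    proof -
      have "?S ?k \<omega> \<le> tv 1 (path \<omega>) 0 (real (?k * m))" by (rule tv_blocks(1)[OF \<omega> m])
      also have "\<dots> \<le> ?Z \<omega>" using kN' by (intro tv_path_mono \<omega>) auto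
      finally have A: "?S ?k \<omega> \<le> ?Z \<omega>" .
      have "?Z \<omega> \<le> tv 1 (path \<omega>) 0 (real (Suc ?k * m))" using kN' N0 by (intro tv_path_mono \<omega>) auto
      also have "\<dots> \<le> ?S (Suc ?k) \<omega> + real (Suc ?k)" by (rule tv_blocks(2)[OF \<omega> m])
      finally have A': "?Z \<omega> \<le> ?S ?k \<omega> + ?f ?k \<omega> + (real ?k + 1)" by simp
      have B: "\<bar>?S ?k \<omega> - real ?k * mean_tv m\<bar> = real ?k * \<bar>?S ?k \<omega> / real ?k - mean_tv m\<bar>"
      proof (cases "?k = 0")
        case False
        then have "?S ?k \<omega> - real ?k * mean_tv m = real ?k * (?S ?k \<omega> / real ?k - mean_tv m)" by (simp add: right_diff_distrib)
        then show ?thesis by (simp only: abs_mult abs_of_nat)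
      qed simp
      have "\<bar>real ?k * mean_tv m - N * (mean_tv m / real m)\<bar> = \<bar>real ?k - N / real m\<bar> * mean_tv m"
      proof -
        have "real ?k * mean_tv m - N * (mean_tv m / real m) = (real ?k - N / real m) * mean_tv m"
          unfolding left_diff_distrib by (simp only: times_divide_eq_left times_divide_eq_right)
        then show ?thesis using a0 by (simp only: abs_mult abs_of_nonneg)
      qed
      also have "\<dots> \<le> 1 * mean_tv m"
      proof -
        have "\<bar>real ?k - N / real m\<bar> \<le> 1" using kN by linarith
        from mult_right_mono[OF this a0] show ?thesis .
      qed
      finally have C: "\<bar>real ?k * mean_tv m - N * (mean_tv m / real m)\<bar> \<le> mean_tv m" by simp
      have gen: "\<bar>z - n'\<bar> \<le> (f + k1) + p + a" if "s \<le> z" "z \<le> s + f + k1" "\<bar>s - ka\<bar> = p" "\<bar>ka - n'\<bar> \<le> a"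
        for z n' s f k1 p ka a :: real using that by linarith
      show ?thesis by (rule gen[OF A A' B C])
    qed
    have iZ: "integrable M ?Z" using N0 by (intro tv_integrable) simp
    have i\<epsilon>: "integrable M (\<lambda>\<omega>. \<bar>?S ?k \<omega> / real ?k - mean_tv m\<bar>)"
      by (intro integrable_abs Bochner_Integration.integrable_diff integrable_divide_zero impI iS integrable_const)
    have "expectation (\<lambda>\<omega>. \<bar>?Z \<omega> - N * (mean_tv m / real m)\<bar>)
      \<le> expectation (\<lambda>\<omega>. (?f ?k \<omega> + (real ?k + 1)) + real ?k * \<bar>?S ?k \<omega> / real ?k - mean_tv m\<bar> + mean_tv m)"
      by (rule integral_mono) (use iZ iF i\<epsilon> bd in auto)
    also have "\<dots> = (mean_tv m + (real ?k + 1)) + real ?k * ?\<epsilon> ?k + mean_tv m"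
    proof -
      have i1: "integrable M (\<lambda>\<omega>. ?f ?k \<omega> + (real ?k + 1))" by (intro Bochner_Integration.integrable_add iF integrable_const)
      have i2: "integrable M (\<lambda>\<omega>. real ?k * \<bar>?S ?k \<omega> / real ?k - mean_tv m\<bar>)" by (intro integrable_mult_right i\<epsilon>)
      show ?thesis
        unfolding Bochner_Integration.integral_add[OF Bochner_Integration.integrable_add[OF i1 i2] integrable_const]
          Bochner_Integration.integral_add[OF i1 i2] Bochner_Integration.integral_add[OF iF integrable_const]
          integral_mult_right_zero expectation_tv_functional(1)[OF m of_nat_0_le_iff]
        using prob_space by simp
    qed
    also have "\<dots> \<le> (mean_tv m + (real ?k + 1)) + real ?k * 1 + mean_tv m"
      using elim(1) by (intro add_mono mult_left_mono order_refl) auto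
    also have "\<dots> = 2 * real ?k + (2 * mean_tv m + 1)" by simp
    also have "\<dots> \<le> 2 * (N / real m) + N / real m"
    proof -
      have "2 * mean_tv m + 1 \<le> N / real m" using elim(2) m by (simp add: pos_le_divide_eq mult.commute)
      then show ?thesis using kN(1) by linarith
    qed
    also have "\<dots> = N * (3 / real m)" by simp
    finally have fin: "expectation (\<lambda>\<omega>. \<bar>?Z \<omega> - N * (mean_tv m / real m)\<bar>) \<le> N * (3 / real m)" .
    have e: "\<bar>?Z \<omega> / N - mean_tv m / real m\<bar> = \<bar>?Z \<omega> - N * (mean_tv m / real m)\<bar> / N" for \<omega>
    proof -
      have "?Z \<omega> / N - mean_tv m / real m = (?Z \<omega> - N * (mean_tv m / real m)) / N" using N0 by (simp add: diff_divide_distrib)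
      then show ?thesis using N0 by (simp only: abs_divide abs_of_pos)
    qed
    show ?case unfolding e integral_divide_zero using fin N0 by (simp only: pos_divide_le_eq mult.commute)
  qed
qed

text \<open>Both block means are compared with the same random variable, the truncated variation
  over [0, N] divided by N, for one large N.\<close>

lemma mean_tv_cauchy:
  assumes "0 < m" "0 < m'"
  shows "\<bar>mean_tv m / real m - mean_tv m' / real m'\<bar> \<le> 3 / real m + 3 / real m'"
proof -
  have "\<forall>\<^sub>F N::real in at_top. \<bar>mean_tv m / real m - mean_tv m' / real m'\<bar> \<le> 3 / real m + 3 / real m'"
    using tv_block_average[OF assms(1)] tv_block_average[OF assms(2)] eventually_ge_at_top[of "0::real"]
  proof eventually_elim
    case (elim N)
    let ?Z = "\<lambda>\<omega>. tv 1 (path \<omega>) 0 N / N"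
    have iZ: "integrable M ?Z" using elim(3) by (intro integrable_divide_zero impI tv_integrable)
    have i: "integrable M (\<lambda>\<omega>. \<bar>?Z \<omega> - c\<bar>)" for c using iZ by (intro integrable_abs Bochner_Integration.integrable_diff integrable_const)
    have "\<bar>mean_tv m / real m - mean_tv m' / real m'\<bar> = expectation (\<lambda>\<omega>. \<bar>mean_tv m / real m - mean_tv m' / real m'\<bar>)"
      using prob_space by simp
    also have "\<dots> \<le> expectation (\<lambda>\<omega>. \<bar>?Z \<omega> - mean_tv m / real m\<bar> + \<bar>?Z \<omega> - mean_tv m' / real m'\<bar>)"
      by (rule integral_mono) (use i in auto)
    also have "\<dots> = expectation (\<lambda>\<omega>. \<bar>?Z \<omega> - mean_tv m / real m\<bar>) + expectation (\<lambda>\<omega>. \<bar>?Z \<omega> - mean_tv m' / real m'\<bar>)"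
      by (rule Bochner_Integration.integral_add[OF i i])
    finally show ?case using elim by linarith
  qed
  then show ?thesis by simp
qed

definition tv_rate :: real where
  "tv_rate = lim (\<lambda>m. mean_tv m / real m)"

lemma mean_tv_limit: "(\<lambda>m. mean_tv m / real m) \<longlonglongrightarrow> tv_rate"
proof -
  have "Cauchy (\<lambda>m. mean_tv m / real m)"
  proof (rule metric_CauchyI)
    fix e :: real assume e: "0 < e"
    obtain k :: nat where k: "6 / e < real k" using reals_Archimedean2 by blast
    have k0: "0 < real k" using k e by (meson divide_pos_pos less_trans zero_less_numeral)
    have "dist (mean_tv m / real m) (mean_tv n / real n) < e" if "k \<le> m" "k \<le> n" for m n
    proof -
      have "\<bar>mean_tv m / real m - mean_tv n / real n\<bar> \<le> 3 / real m + 3 / real n"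
        using that k0 by (intro mean_tv_cauchy) auto
      also have "\<dots> \<le> 3 / real k + 3 / real k" using that k0 by (intro add_mono divide_left_mono) auto
      also have "\<dots> = 6 / real k" by simp
      also have "\<dots> < e" using k k0 e by (simp add: pos_divide_less_eq mult.commute)
      finally show ?thesis by (simp add: dist_real_def)
    qed
    then show "\<exists>k. \<forall>m\<ge>k. \<forall>n\<ge>k. dist (mean_tv m / real m) (mean_tv n / real n) < e" by blast
  qed
  then show ?thesis unfolding tv_rate_def by (simp add: Cauchy_convergent_iff convergent_LIMSEQ_iff)
qed

lemma tv_rate_nonneg: "0 \<le> tv_rate"
  by (rule LIMSEQ_le_const[OF mean_tv_limit]) (auto intro!: divide_nonneg_nonneg mean_tv_nonneg)

lemma mean_tv_rate_near:
  assumes "0 < m"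
  shows "\<bar>mean_tv m / real m - tv_rate\<bar> \<le> 3 / real m"
proof (rule LIMSEQ_le)
  show "(\<lambda>n. \<bar>mean_tv m / real m - mean_tv n / real n\<bar>) \<longlonglongrightarrow> \<bar>mean_tv m / real m - tv_rate\<bar>"
    by (intro tendsto_intros mean_tv_limit)
  show "(\<lambda>n. 3 / real m + 3 / real n) \<longlonglongrightarrow> 3 / real m"
    using tendsto_add[OF tendsto_const lim_const_over_n[of 3], of "3 / real m"] by simp
  show "\<exists>N. \<forall>n\<ge>N. \<bar>mean_tv m / real m - mean_tv n / real n\<bar> \<le> 3 / real m + 3 / real n"
    using mean_tv_cauchy[OF assms] by (intro exI[of _ 1]) auto
qed

theorem tv_ergodic: "((\<lambda>N. expectation (\<lambda>\<omega>. \<bar>tv 1 (path \<omega>) 0 N / N - tv_rate\<bar>)) \<longlongrightarrow> 0) at_top"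
  unfolding tendsto_iff dist_real_def
proof (intro allI impI)
  fix e :: real assume e: "0 < e"
  obtain m :: nat where m: "6 / e < real m" using reals_Archimedean2 by blast
  have m0: "0 < real m" using m e by (meson divide_pos_pos less_trans zero_less_numeral)
  have m6: "6 / real m < e" using m m0 e by (simp add: pos_divide_less_eq mult.commute)
  have "0 < m" using m0 by simp
  from tv_block_average[OF this] eventually_ge_at_top[of "0::real"]
  show "\<forall>\<^sub>F N in at_top. \<bar>expectation (\<lambda>\<omega>. \<bar>tv 1 (path \<omega>) 0 N / N - tv_rate\<bar>) - 0\<bar> < e"
  proof eventually_elim
    case (elim N)
    let ?Z = "\<lambda>\<omega>. tv 1 (path \<omega>) 0 N / N"
    have iZ: "integrable M ?Z" using elim(2) by (intro integrable_divide_zero impI tv_integrable)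
    have i: "integrable M (\<lambda>\<omega>. \<bar>?Z \<omega> - c\<bar>)" for c using iZ by (intro integrable_abs Bochner_Integration.integrable_diff integrable_const)
    have "expectation (\<lambda>\<omega>. \<bar>?Z \<omega> - tv_rate\<bar>) \<le> expectation (\<lambda>\<omega>. \<bar>?Z \<omega> - mean_tv m / real m\<bar> + 3 / real m)"
    proof (rule integral_mono)
      show "\<bar>?Z \<omega> - tv_rate\<bar> \<le> \<bar>?Z \<omega> - mean_tv m / real m\<bar> + 3 / real m" for \<omega>
        using mean_tv_rate_near[OF \<open>0 < m\<close>] by linarith
    qed (use i in auto)
    also have "\<dots> = expectation (\<lambda>\<omega>. \<bar>?Z \<omega> - mean_tv m / real m\<bar>) + 3 / real m"
      unfolding Bochner_Integration.integral_add[OF i integrable_const] using prob_space by simp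
    also have "\<dots> \<le> 6 / real m" using elim(1) by simp
    finally have "expectation (\<lambda>\<omega>. \<bar>?Z \<omega> - tv_rate\<bar>) < e" using m6 by linarith
    moreover have "0 \<le> expectation (\<lambda>\<omega>. \<bar>?Z \<omega> - tv_rate\<bar>)" by (rule Bochner_Integration.integral_nonneg) simp
    ultimately show ?case by simp
  qed
qed

lemma tv_constant_eq: "tv_constant M B = ennreal tv_rate"
proof -
  have eq: "(\<integral>\<^sup>+\<omega>. truncated_variation 1 (\<lambda>t. B t \<omega>) 0 (real n) \<partial>M) / of_nat n = ennreal (mean_tv n / real n)" if "0 < n" for n
  proof -
    have "(\<integral>\<^sup>+\<omega>. truncated_variation 1 (\<lambda>t. B t \<omega>) 0 (real n) \<partial>M) = (\<integral>\<^sup>+\<omega>. ennreal (tv 1 (path \<omega>) 0 (real n)) \<partial>M)"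
    proof (rule nn_integral_cong)
      fix \<omega> assume \<omega>: "\<omega> \<in> space M"
      interpret continuous_path "path \<omega>" 0 "real n" by standard (rule path_continuous[OF \<omega> order_refl])
      show "truncated_variation 1 (path \<omega>) 0 (real n) = ennreal (tv 1 (path \<omega>) 0 (real n))"
        using ennreal_tv[of 1 0 "real n"] by simp
    qed
    also have "\<dots> = ennreal (mean_tv n)" unfolding mean_tv_def
      by (rule nn_integral_eq_integral) (auto intro: tv_integrable)
    finally show ?thesis using that mean_tv_nonneg[of n]
      by (simp add: divide_ennreal ennreal_of_nat_eq_real_of_nat)
  qed
  have "\<forall>\<^sub>F n in sequentially. ennreal (mean_tv n / real n) = (\<integral>\<^sup>+\<omega>. truncated_variation 1 (\<lambda>t. B t \<omega>) 0 (real n) \<partial>M) / of_nat n"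
    using eq unfolding eventually_sequentially by (intro exI[of _ 1]) auto
  from Lim_transform_eventually[OF tendsto_ennrealI[OF mean_tv_limit] this]
  show ?thesis unfolding tv_constant_def by (rule limI)
qed

text \<open>With A = c powr (1 / H) one has A powr (- H) = 1 / c. Self-similarity with factor A thus
  divides the path by c, turning truncation level c into 1, and shortens time by A, turning [0, N]
  into [0, t]. The equality of path laws is transported through the measurable functional G.\<close>

lemma tv_scaling_law:
  assumes c: "0 < c" and t: "0 < t"
  shows "distr M borel (\<lambda>\<omega>. c powr (1 / H - 1) * tv c (path \<omega>) 0 t)
    = distr M borel (\<lambda>\<omega>. c powr (1 / H) * tv 1 (path \<omega>) 0 (t * c powr (- 1 / H)))"
proof -
  define A where "A = c powr (1 / H)"
  define N where "N = t * c powr (- 1 / H)"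
  have A: "0 < A" using c by (simp add: A_def)
  have N: "0 < N" using c t by (simp add: N_def)
  have AN: "A * N = t" using c by (simp add: A_def N_def powr_add[symmetric] mult.left_commute)
  have AH: "A powr (- H) = 1 / c" using c hurst by (simp add: A_def powr_powr powr_minus divide_inverse)
  define G where "G = (\<lambda>w. A * enn2real (dyadic_tv 1 w N))"
  have Gm: "G \<in> borel_measurable path_space"
  proof -
    have [measurable]: "(\<lambda>w. dyadic_tv 1 (\<lambda>u. w u) N) \<in> borel_measurable path_space"
      by (rule borel_measurable_dyadic_tv) (use N in \<open>auto intro: measurable_component_singleton\<close>)
    show ?thesis unfolding G_def by measurable
  qed
  have law: "distr (process_law M X) borel G = distr M borel (\<lambda>\<omega>. A * tv 1 (\<lambda>u. X u \<omega>) 0 N)"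
    if X: "\<And>u. 0 \<le> u \<Longrightarrow> X u \<in> borel_measurable M" "\<And>\<omega>. \<omega> \<in> space M \<Longrightarrow> continuous_on {0..N} (\<lambda>u. X u \<omega>)" for X
  proof -
    have "distr (process_law M X) borel G = distr M borel (G \<circ> (\<lambda>\<omega>. \<lambda>u\<in>{0..}. X u \<omega>))"
      unfolding process_law_def by (rule distr_distr[OF Gm measurable_restrict]) (use X(1) in auto)
    also have "\<dots> = distr M borel (\<lambda>\<omega>. A * tv 1 (\<lambda>u. X u \<omega>) 0 N)"
      unfolding G_def using dyadic_tv_eq_tv[OF X(2) zero_less_one N] by (intro distr_cong refl) simp
    finally show ?thesis .
  qed
  let ?X = "\<lambda>u \<omega>. A powr (- H) * B (A * u) \<omega>"
  have l: "c powr (1 / H - 1) * tv c (path \<omega>) 0 t = A * tv 1 (\<lambda>u. ?X u \<omega>) 0 N" if "\<omega> \<in> space M" for \<omega>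
  proof -
    have "tv (1 / c * c) (\<lambda>u. 1 / c * path \<omega> (A * u + 0)) 0 N = 1 / c * tv c (path \<omega>) (A * 0 + 0) (A * N + 0)"
      by (rule tv_scale) (use A N c path_continuous[OF that] in auto)
    then have "tv 1 (\<lambda>u. ?X u \<omega>) 0 N = 1 / c * tv c (path \<omega>) 0 t" using c by (simp add: AH AN)
    moreover have "A * (1 / c) = c powr (1 / H - 1)" using c by (simp add: A_def powr_diff)
    ultimately show ?thesis by (metis mult.assoc)
  qed
  have "distr M borel (\<lambda>\<omega>. c powr (1 / H - 1) * tv c (path \<omega>) 0 t) = distr M borel (\<lambda>\<omega>. A * tv 1 (\<lambda>u. ?X u \<omega>) 0 N)"
    by (intro distr_cong refl l)
  also have "\<dots> = distr (process_law M ?X) borel G"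
  proof (rule law[symmetric])
    show "?X u \<in> borel_measurable M" if "0 \<le> u" for u using that A by (intro borel_measurable_times measurable_const B_measurable) auto
    show "continuous_on {0..N} (\<lambda>u. ?X u \<omega>)" if "\<omega> \<in> space M" for \<omega>
      using A by (intro continuous_intros continuous_on_compose2[OF path_continuous[OF that order_refl, of "A * N"]]) auto
  qed
  also have "\<dots> = distr (process_law M B) borel G" unfolding self_similar[OF A] ..
  also have "\<dots> = distr M borel (\<lambda>\<omega>. A * tv 1 (path \<omega>) 0 N)"
    by (rule law) (auto intro: path_continuous)
  finally show ?thesis unfolding A_def N_def .
qed

lemma tv_scaled_integrable:
  assumes c: "0 < c" and t: "0 \<le> t"
  shows "integrable M (\<lambda>\<omega>. c powr (1 / H - 1) * tv c (path \<omega>) 0 t)"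
proof (cases "t = 0")
  case False
  with t have t: "0 < t" by simp
  have m: "(\<lambda>\<omega>. c powr (1 / H - 1) * tv c (path \<omega>) 0 t) \<in> borel_measurable M"
    by (intro borel_measurable_times borel_measurable_const measurable_tv_path) (use c t in simp_all)
  have N: "0 \<le> t * c powr (- 1 / H)" using t by simp
  have m': "(\<lambda>\<omega>. c powr (1 / H) * tv 1 (path \<omega>) 0 (t * c powr (- 1 / H))) \<in> borel_measurable M"
    by (intro borel_measurable_times borel_measurable_const measurable_tv_path N) simp
  have "integrable M (\<lambda>\<omega>. c powr (1 / H) * tv 1 (path \<omega>) 0 (t * c powr (- 1 / H)))"
    by (intro integrable_mult_right tv_integrable N)
  then have "integrable (distr M borel (\<lambda>\<omega>. c powr (1 / H) * tv 1 (path \<omega>) 0 (t * c powr (- 1 / H)))) (\<lambda>x. x)"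
    using integrable_distr_eq[OF m', of "\<lambda>x. x"] by simp
  then have "integrable (distr M borel (\<lambda>\<omega>. c powr (1 / H - 1) * tv c (path \<omega>) 0 t)) (\<lambda>x. x)"
    by (simp only: tv_scaling_law[OF c t])
  then show ?thesis using integrable_distr_eq[OF m, of "\<lambda>x. x"] by simp
next
  case True
  then show ?thesis using c by simp
qed

lemma tv_scaling:
  assumes c: "0 < c" and t: "0 < t"
  shows "expectation (\<lambda>\<omega>. \<bar>c powr (1 / H - 1) * tv c (path \<omega>) 0 t - tv_rate * t\<bar>)
    = t * expectation (\<lambda>\<omega>. \<bar>tv 1 (path \<omega>) 0 (t * c powr (- 1 / H)) / (t * c powr (- 1 / H)) - tv_rate\<bar>)"
proof -
  define N where "N = t * c powr (- 1 / H)"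
  have N: "0 < N" using c t by (simp add: N_def)
  have AN: "c powr (1 / H) = t / N" using c t by (simp add: N_def powr_minus field_simps)
  have m: "(\<lambda>\<omega>. c powr (1 / H - 1) * tv c (path \<omega>) 0 t) \<in> borel_measurable M"
    by (intro borel_measurable_times borel_measurable_const measurable_tv_path) (use c t in simp_all)
  have m': "(\<lambda>\<omega>. t / N * tv 1 (path \<omega>) 0 N) \<in> borel_measurable M"
    by (intro borel_measurable_times borel_measurable_const measurable_tv_path less_imp_le[OF N]) simp
  have r: "\<bar>t / N * tv 1 (path \<omega>) 0 N - tv_rate * t\<bar> = t * \<bar>tv 1 (path \<omega>) 0 N / N - tv_rate\<bar>" for \<omega>
  proof -
    have "t / N * tv 1 (path \<omega>) 0 N - tv_rate * t = t * (tv 1 (path \<omega>) 0 N / N - tv_rate)" by (simp add: right_diff_distrib)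
    then show ?thesis using t by (simp only: abs_mult abs_of_pos)
  qed
  have "expectation (\<lambda>\<omega>. \<bar>c powr (1 / H - 1) * tv c (path \<omega>) 0 t - tv_rate * t\<bar>)
      = (\<integral>x. \<bar>x - tv_rate * t\<bar> \<partial>distr M borel (\<lambda>\<omega>. c powr (1 / H - 1) * tv c (path \<omega>) 0 t))"
    by (subst integral_distr[OF m]) auto
  also have "\<dots> = expectation (\<lambda>\<omega>. \<bar>t / N * tv 1 (path \<omega>) 0 N - tv_rate * t\<bar>)"
    unfolding tv_scaling_law[OF c t] N_def[symmetric] AN by (subst integral_distr[OF m']) auto
  also have "\<dots> = t * expectation (\<lambda>\<omega>. \<bar>tv 1 (path \<omega>) 0 N / N - tv_rate\<bar>)"
    unfolding r by simp
  finally show ?thesis unfolding N_def .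
qed

theorem tv_small_scale_limit:
  assumes "0 \<le> t"
  shows "((\<lambda>c. expectation (\<lambda>\<omega>. \<bar>c powr (1 / H - 1) * tv c (path \<omega>) 0 t - tv_rate * t\<bar>)) \<longlongrightarrow> 0) (at_right 0)"
proof (cases "t = 0")
  case True
  have "\<forall>\<^sub>F c in at_right 0. expectation (\<lambda>\<omega>. \<bar>c powr (1 / H - 1) * tv c (path \<omega>) 0 t - tv_rate * t\<bar>) = 0"
    using eventually_at_right_less[of "0::real"] by eventually_elim (simp add: True)
  then show ?thesis by (rule tendsto_eventually)
next
  case False
  with assms have t: "0 < t" by simp
  have "LIM c at_right 0. (c::real) powr (- 1 / H) :> at_top"
  proof -
    have "LIM c at_right 0. exp ((1 / H) * - ln (c::real)) :> at_top"
      by (rule filterlim_compose[OF exp_at_top filterlim_tendsto_pos_mult_at_top[OF tendsto_const _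
            filterlim_compose[OF filterlim_uminus_at_top_at_bot ln_at_0]]]) (use hurst in auto)
    moreover have "\<forall>\<^sub>F c in at_right 0. exp ((1 / H) * - ln (c::real)) = c powr (- 1 / H)"
      using eventually_at_right_less[of "0::real"] by eventually_elim (simp add: powr_def)
    ultimately show ?thesis by (rule filterlim_cong[OF refl refl, THEN iffD1, rotated])
  qed
  then have "LIM c at_right 0. t * c powr (- 1 / H) :> at_top"
    using t by (intro filterlim_tendsto_pos_mult_at_top[OF tendsto_const])
  from tendsto_mult_right_zero[OF filterlim_compose[OF tv_ergodic this], of t]
  have "((\<lambda>c. t * expectation (\<lambda>\<omega>. \<bar>tv 1 (path \<omega>) 0 (t * c powr (- 1 / H)) / (t * c powr (- 1 / H)) - tv_rate\<bar>)) \<longlongrightarrow> 0) (at_right 0)" .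
  moreover have "\<forall>\<^sub>F c in at_right 0. t * expectation (\<lambda>\<omega>. \<bar>tv 1 (path \<omega>) 0 (t * c powr (- 1 / H)) / (t * c powr (- 1 / H)) - tv_rate\<bar>)
     = expectation (\<lambda>\<omega>. \<bar>c powr (1 / H - 1) * tv c (path \<omega>) 0 t - tv_rate * t\<bar>)"
    using eventually_at_right_less[of "0::real"] by eventually_elim (simp add: tv_scaling[OF _ t])
  ultimately show ?thesis by (rule Lim_transform_eventually)
qed

end

section \<open>Absolute continuity of the occupation measure\<close>

definition dyadic_cell :: "nat \<Rightarrow> int \<Rightarrow> real set" where
  "dyadic_cell n i = {y. \<lfloor>y * 2 ^ n\<rfloor> = i}"

lemma dyadic_cell_eq: "dyadic_cell n i = {of_int i / 2 ^ n..<(of_int i + 1) / 2 ^ n}"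
  by (auto simp: dyadic_cell_def floor_eq_iff field_simps)

lemma measurable_dyadic_cell [measurable]: "dyadic_cell n i \<in> sets borel"
  unfolding dyadic_cell_eq by simp

lemma emeasure_dyadic_cell: "emeasure lborel (dyadic_cell n i) = ennreal (1 / 2 ^ n)"
  unfolding dyadic_cell_eq by (simp add: divide_right_mono add_divide_distrib)

text \<open>
  By Cauchy--Schwarz over dyadic cells the energy bounds the mass of a union of cells, hence of open
  sets, hence of sets of small Lebesgue measure.
\<close>
definition dyadic_energy :: "real measure \<Rightarrow> nat \<Rightarrow> ennreal" where
  "dyadic_energy \<mu> n = (\<integral>\<^sup>+x. \<integral>\<^sup>+y. indicator {0} (\<lfloor>x * 2 ^ n\<rfloor> - \<lfloor>y * 2 ^ n\<rfloor>) \<partial>\<mu> \<partial>\<mu>)"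

lemma cells_mass_le:
  assumes \<mu>: "finite_measure \<mu>" "sets \<mu> = sets borel" and J: "finite J" and E: "2 ^ n * dyadic_energy \<mu> n \<le> ennreal K" and K: "0 \<le> K"
  shows "(measure \<mu> (\<Union>i\<in>J. dyadic_cell n i))\<^sup>2 \<le> K * measure lborel (\<Union>i\<in>J. dyadic_cell n i)"
proof -
  interpret finite_measure \<mu> by fact
  have cm[measurable]: "dyadic_cell n i \<in> sets \<mu>" for i using \<mu>(2) by simp
  have disj: "disjoint_family_on (dyadic_cell n) J" by (auto simp: disjoint_family_on_def dyadic_cell_def)
  have "measure \<mu> (\<Union>i\<in>J. dyadic_cell n i) = (\<Sum>i\<in>J. measure \<mu> (dyadic_cell n i))"
    by (rule finite_measure_finite_Union[OF J _ disj]) auto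
  then have "(measure \<mu> (\<Union>i\<in>J. dyadic_cell n i))\<^sup>2 \<le> (\<Sum>i\<in>J. (measure \<mu> (dyadic_cell n i))\<^sup>2) * real (card J)"
    by (simp only: sum_squared_le_sum_of_squares)
  moreover have "measure lborel (\<Union>i\<in>J. dyadic_cell n i) = real (card J) / 2 ^ n"
  proof -
    have "emeasure lborel (\<Union>i\<in>J. dyadic_cell n i) = (\<Sum>i\<in>J. emeasure lborel (dyadic_cell n i))"
      by (rule sum_emeasure[symmetric]) (use J disj in auto)
    also have "\<dots> = ennreal (real (card J) / 2 ^ n)"
      unfolding emeasure_dyadic_cell by (simp add: ennreal_of_nat_eq_real_of_nat ennreal_mult[symmetric])
    finally show ?thesis by (simp add: measure_def)
  qed
  moreover have "2 ^ n * (\<Sum>i\<in>J. (measure \<mu> (dyadic_cell n i))\<^sup>2) \<le> K"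
  proof -
    have "ennreal (\<Sum>i\<in>J. (measure \<mu> (dyadic_cell n i))\<^sup>2) = (\<Sum>i\<in>J. \<integral>\<^sup>+x. indicator (dyadic_cell n i) x * emeasure \<mu> (dyadic_cell n i) \<partial>\<mu>)"
    proof -
      have "(\<integral>\<^sup>+x. indicator (dyadic_cell n i) x * emeasure \<mu> (dyadic_cell n i) \<partial>\<mu>) = ennreal ((measure \<mu> (dyadic_cell n i))\<^sup>2)" for i
        by (simp add: nn_integral_multc emeasure_eq_measure ennreal_mult[symmetric] power2_eq_square)
      then show ?thesis by (simp add: sum_ennreal)
    qed
    also have "\<dots> = (\<integral>\<^sup>+x. (\<Sum>i\<in>J. indicator (dyadic_cell n i) x * emeasure \<mu> (dyadic_cell n i)) \<partial>\<mu>)"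
      by (rule nn_integral_sum[symmetric]) measurable
    also have "\<dots> \<le> dyadic_energy \<mu> n"
      unfolding dyadic_energy_def
    proof (rule nn_integral_mono)
      fix x :: real
      let ?i = "\<lfloor>x * 2 ^ n\<rfloor>"
      \<comment> \<open>The point x lies in exactly one cell of level n, so at most one summand
        survives.\<close>
      have "(\<Sum>i\<in>J. indicator (dyadic_cell n i) x * emeasure \<mu> (dyadic_cell n i)) \<le> emeasure \<mu> (dyadic_cell n ?i)"
      proof -
        have "(\<Sum>i\<in>J. indicator (dyadic_cell n i) x * emeasure \<mu> (dyadic_cell n i)) = (\<Sum>i\<in>J. if i = ?i then emeasure \<mu> (dyadic_cell n i) else 0)"
          by (intro sum.cong refl) (auto simp: dyadic_cell_def indicator_def)
        also have "\<dots> \<le> emeasure \<mu> (dyadic_cell n ?i)" using J by (simp add: sum.delta')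
        finally show ?thesis .
      qed
      also have "\<dots> = (\<integral>\<^sup>+y. indicator (dyadic_cell n ?i) y \<partial>\<mu>)" by simp
      also have "\<dots> = (\<integral>\<^sup>+y. indicator {0} (?i - \<lfloor>y * 2 ^ n\<rfloor>) \<partial>\<mu>)"
        by (intro nn_integral_cong) (auto simp: indicator_def dyadic_cell_def)
      finally show "(\<Sum>i\<in>J. indicator (dyadic_cell n i) x * emeasure \<mu> (dyadic_cell n i)) \<le> (\<integral>\<^sup>+y. indicator {0} (?i - \<lfloor>y * 2 ^ n\<rfloor>) \<partial>\<mu>)" .
    qed
    finally have "2 ^ n * ennreal (\<Sum>i\<in>J. (measure \<mu> (dyadic_cell n i))\<^sup>2) \<le> 2 ^ n * dyadic_energy \<mu> n"
      by (rule mult_left_mono) simp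
    also note E
    finally have "ennreal (2 ^ n * (\<Sum>i\<in>J. (measure \<mu> (dyadic_cell n i))\<^sup>2)) \<le> ennreal K"
      by (simp add: ennreal_mult sum_nonneg ennreal_power[symmetric])
    then show ?thesis using K by (simp add: ennreal_le_iff)
  qed
  ultimately have "(measure \<mu> (\<Union>i\<in>J. dyadic_cell n i))\<^sup>2 \<le> (2 ^ n * (\<Sum>i\<in>J. (measure \<mu> (dyadic_cell n i))\<^sup>2)) * measure lborel (\<Union>i\<in>J. dyadic_cell n i)"
    by (simp add: mult.assoc)
  also have "\<dots> \<le> K * measure lborel (\<Union>i\<in>J. dyadic_cell n i)"
    using \<open>2 ^ n * (\<Sum>i\<in>J. (measure \<mu> (dyadic_cell n i))\<^sup>2) \<le> K\<close> by (intro mult_right_mono) auto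
  finally show ?thesis .
qed

text \<open>The cells of level n inside U, with indices bounded to keep them finitely many,
  eventually contain each point of U. Fatou's lemma therefore carries the estimate for cells over to
  U, along the levels r k at which the energy is controlled.\<close>

lemma open_mass_le:
  assumes \<mu>: "finite_measure \<mu>" "sets \<mu> = sets borel" and K: "0 \<le> K"
    and E: "\<And>k::nat. 2 ^ r k * dyadic_energy \<mu> (r k) \<le> ennreal K" and r: "strict_mono r"
    and U: "open U" "emeasure lborel U \<le> ennreal e" "0 \<le> e"
  shows "emeasure \<mu> U \<le> ennreal (sqrt (K * e))"
proof -
  interpret finite_measure \<mu> by fact
  define J where "J = (\<lambda>n. {i \<in> {- (int n * 2 ^ n)..int n * 2 ^ n}. dyadic_cell n i \<subseteq> U})"
  define A where "A = (\<lambda>n. \<Union>i\<in>J n. dyadic_cell n i)"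
  have fin: "finite (J n)" for n unfolding J_def by (rule finite_subset[of _ "{- (int n * 2 ^ n)..int n * 2 ^ n}"]) auto
  have Am: "A n \<in> sets borel" for n unfolding A_def using fin by (intro sets.finite_UN) auto
  have AU: "A n \<subseteq> U" for n by (auto simp: A_def J_def)
  have Um: "U \<in> sets borel" using U(1) by simp
  have mass: "emeasure \<mu> (A (r k)) \<le> ennreal (sqrt (K * e))" for k
  proof -
    have "emeasure lborel (A (r k)) \<le> ennreal e" using emeasure_mono[OF AU, of lborel] Um U(2) by (metis order_trans sets_lborel)
    then have "measure lborel (A (r k)) \<le> e" using U(3) unfolding measure_def by (rule enn2real_leI[OF _ , rotated]) 
    then have "K * measure lborel (A (r k)) \<le> K * e" using K by (rule mult_left_mono)
    with cells_mass_le[OF \<mu> fin E[of k] K, of "r k"] have "(measure \<mu> (A (r k)))\<^sup>2 \<le> K * e" unfolding A_def by linarith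
    then have "measure \<mu> (A (r k)) \<le> sqrt (K * e)" by (rule real_le_rsqrt)
    then show ?thesis unfolding emeasure_eq_measure by (rule ennreal_leI)
  qed
  have evA: "\<forall>\<^sub>F n in sequentially. y \<in> A n" if y: "y \<in> U" for y
  proof -
    obtain d where d: "0 < d" "ball y d \<subseteq> U" using U(1) y by (auto simp: open_contains_ball)
    obtain n1 :: nat where n1: "1 / d < 2 ^ n1" using real_arch_pow[of 2 "1 / d"] by auto
    obtain n2 :: nat where n2: "\<bar>y\<bar> + 1 < real n2" using reals_Archimedean2 by blast
    have "y \<in> A n" if n: "max n1 n2 \<le> n" for n
    proof -
      let ?i = "\<lfloor>y * 2 ^ n\<rfloor>"
      have "(2::real) ^ n1 \<le> 2 ^ n" using n by (intro power_increasing) auto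
      then have "1 / d < 2 ^ n" using n1 by linarith
      then have h: "1 / 2 ^ n < d" using d(1) by (simp add: field_simps)
      have "dyadic_cell n ?i \<subseteq> ball y d"
      proof
        fix z assume "z \<in> dyadic_cell n ?i"
        then have "\<lfloor>z * 2 ^ n\<rfloor> = \<lfloor>y * 2 ^ n\<rfloor>" by (simp add: dyadic_cell_def)
        then have "\<bar>z * 2 ^ n - y * 2 ^ n\<bar> < 1" by linarith
        then have "\<bar>z - y\<bar> * 2 ^ n < 1" by (simp add: left_diff_distrib[symmetric] abs_mult)
        then have "\<bar>z - y\<bar> < 1 / 2 ^ n" by (simp add: pos_less_divide_eq)
        then show "z \<in> ball y d" using h by (simp add: dist_real_def abs_minus_commute)
      qed
      moreover have "?i \<in> {- (int n * 2 ^ n)..int n * 2 ^ n}"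
      proof -
        have "\<bar>y\<bar> + 1 < real n" using n2 n by linarith
        then have "(\<bar>y\<bar> + 1) * 2 ^ n < real n * 2 ^ n" by simp
        then have "\<bar>y * 2 ^ n\<bar> + 2 ^ n < real n * 2 ^ n" by (simp add: abs_mult distrib_right)
        moreover have one: "(1::real) \<le> 2 ^ n" by simp
        ultimately have "\<bar>y * 2 ^ n\<bar> + 1 < real n * 2 ^ n" using one by linarith
        then have "\<bar>y * 2 ^ n\<bar> + 1 < real_of_int (int n * 2 ^ n)" by simp
        then show ?thesis by (simp only: atLeastAtMost_iff) linarith
      qed
      ultimately have "?i \<in> J n" using d(2) by (auto simp: J_def)
      then show ?thesis unfolding A_def by (auto simp: dyadic_cell_def)
    qed
    then show ?thesis unfolding eventually_sequentially by blast
  qed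
  have "emeasure \<mu> U = (\<integral>\<^sup>+y. indicator U y \<partial>\<mu>)" using Um \<mu>(2) by simp
  also have "\<dots> \<le> (\<integral>\<^sup>+y. liminf (\<lambda>k. indicator (A (r k)) y) \<partial>\<mu>)"
  proof (rule nn_integral_mono)
    fix y
    show "indicator U y \<le> liminf (\<lambda>k. indicator (A (r k)) y :: ennreal)"
    proof (cases "y \<in> U")
      case True
      have "\<forall>\<^sub>F k in sequentially. y \<in> A (r k)"
        using eventually_subseq[OF r evA[OF True]] .
      then have "\<forall>\<^sub>F k in sequentially. indicator U y \<le> (indicator (A (r k)) y :: ennreal)"
        by eventually_elim (simp add: indicator_def)
      then show ?thesis by (rule Liminf_bounded)
    qed simp
  qed
  also have "\<dots> \<le> liminf (\<lambda>k. \<integral>\<^sup>+y. indicator (A (r k)) y \<partial>\<mu>)"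
    using Am \<mu>(2) by (intro nn_integral_liminf borel_measurable_indicator) simp
  also have "\<dots> \<le> liminf (\<lambda>k. ennreal (sqrt (K * e)))"
    using mass Am \<mu>(2) by (intro Liminf_mono always_eventually allI) simp
  also have "\<dots> = ennreal (sqrt (K * e))" by (simp add: Liminf_const)
  finally show ?thesis .
qed

text \<open>Only the lower limit is assumed finite because Fatou's lemma will supply nothing more;
  it still bounds the energy at infinitely many levels. Outer regularity then passes from open sets
  to null sets.\<close>

lemma finite_energy_absolutely_continuous:
  assumes \<mu>: "finite_measure \<mu>" "sets \<mu> = sets borel" and E: "liminf (\<lambda>n. 2 ^ n * dyadic_energy \<mu> n) < \<infinity>"
  shows "absolutely_continuous lborel \<mu>"
proof -
  obtain L where L: "liminf (\<lambda>n. 2 ^ n * dyadic_energy \<mu> n) < ennreal L" "0 \<le> L"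
  proof -
    obtain l where l: "0 \<le> l" "liminf (\<lambda>n. 2 ^ n * dyadic_energy \<mu> n) = ennreal l"
      using E by (cases "liminf (\<lambda>n. 2 ^ n * dyadic_energy \<mu> n)") auto
    show ?thesis by (rule that[of "l + 1"]) (use l in \<open>auto simp: ennreal_less_iff\<close>)
  qed
  have "\<exists>\<^sub>F n in sequentially. 2 ^ n * dyadic_energy \<mu> n < ennreal L"
  proof (rule ccontr)
    assume "\<not> ?thesis"
    then have "\<forall>\<^sub>F n in sequentially. ennreal L \<le> 2 ^ n * dyadic_energy \<mu> n" by (simp add: not_frequently not_less)
    then have "ennreal L \<le> liminf (\<lambda>n. 2 ^ n * dyadic_energy \<mu> n)" by (rule Liminf_bounded)
    with L show False by simp
  qed
  then have "infinite {n. 2 ^ n * dyadic_energy \<mu> n < ennreal L}"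
    by (simp add: frequently_cofinite[symmetric] cofinite_eq_sequentially)
  then obtain r :: "nat \<Rightarrow> nat" where r: "strict_mono r" "\<And>k. r k \<in> {n. 2 ^ n * dyadic_energy \<mu> n < ennreal L}"
    using infinite_enumerate by blast
  have E': "2 ^ r k * dyadic_energy \<mu> (r k) \<le> ennreal L" for k using r(2)[of k] by (simp add: less_imp_le)
  show ?thesis
    unfolding absolutely_continuous_def
  proof
    fix N :: "real set" assume N: "N \<in> null_sets lborel"
    then have Nb: "N \<in> sets borel" by (auto simp: null_sets_def)
    have le: "emeasure \<mu> N \<le> ennreal e" if e: "0 < e" for e
    proof -
      \<comment> \<open>Makes sqrt (L d) at most e in the bound for open sets; the summand 1 covers
        L = 0.\<close>
      define d where "d = e\<^sup>2 / (L + 1)"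
      have d: "0 < d" using e L(2) by (simp add: d_def)
      obtain U where U: "open U" "N \<subseteq> U" "emeasure lborel (U - N) < ennreal d" using outer_regular_lborel[OF Nb d] by blast
      have "emeasure lborel U \<le> emeasure lborel (U - N) + emeasure lborel N"
        using U(1,2) Nb by (intro order_trans[OF eq_refl emeasure_subadditive[of "U - N" lborel N]] arg_cong[of _ _ "emeasure lborel"]) auto
      also have "\<dots> = emeasure lborel (U - N)" using N by (simp add: null_sets_def)
      finally have Ud: "emeasure lborel U \<le> ennreal d" using U(3) by simp
      have "emeasure \<mu> N \<le> emeasure \<mu> U" using U(1,2) \<mu>(2) by (intro emeasure_mono) auto
      also have "\<dots> \<le> ennreal (sqrt (L * d))" using d by (intro open_mass_le[OF \<mu> L(2) E' r(1) U(1) Ud]) simp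
      also have "\<dots> \<le> ennreal e"
      proof (rule ennreal_leI)
        have "L * d \<le> (L + 1) * d" using d by (intro mult_right_mono) auto
        also have "L + 1 \<noteq> 0" using L(2) by linarith
        then have "(L + 1) * d = e\<^sup>2" unfolding d_def by simp
        finally show "sqrt (L * d) \<le> e" using e by (intro real_le_lsqrt) auto
      qed
      finally show ?thesis .
    qed
    interpret finite_measure \<mu> by fact
    have "measure \<mu> N \<le> 0 + e" if "0 < e" for e
      using le[OF that] that unfolding emeasure_eq_measure by simp
    then have "measure \<mu> N \<le> 0" by (rule field_le_epsilon)
    then have "emeasure \<mu> N = 0" unfolding emeasure_eq_measure by (simp add: ennreal_neg)
    then show "N \<in> null_sets \<mu>" using Nb \<mu>(2) by auto
  qed
qed

subsection \<open>Absolute continuity as a measurable event\<close>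

text \<open>A countable family on which absolute continuity can be tested. Finite unions of base
  sets are included so that every open set is an increasing limit of members.\<close>

definition basic_opens :: "real set set" where
  "basic_opens = Union ` {F. finite F \<and> F \<subseteq> (SOME B. countable B \<and> topological_basis B)}"

lemma some_basis:
  "countable (SOME B :: real set set. countable B \<and> topological_basis B)"
  "topological_basis (SOME B :: real set set. countable B \<and> topological_basis B)"
  using someI_ex[OF ex_countable_basis[where 'a = real]] by auto

lemma countable_basic_opens: "countable basic_opens"
  unfolding basic_opens_def by (intro countable_image countable_Collect_finite_subset some_basis)

lemma open_basic_opens: "U \<in> basic_opens \<Longrightarrow> open U"
  unfolding basic_opens_def using topological_basis_open[OF some_basis(2)] by (auto intro!: open_Union)

text \<open>The \<epsilon>-\<delta> form of absolute continuity, with countable quantifiers. If it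
  failed, sets of Lebesgue measure below 2^(-j) would keep a fixed \<mu>-mass; by Borel-Cantelli
  almost every point lies in only finitely many of them, which contradicts dominated convergence
  under the finite measure \<mu>. The converse encloses a null set in a small open set.\<close>

lemma absolutely_continuous_iff_basic:
  assumes \<mu>: "finite_measure \<mu>" "sets \<mu> = sets borel"
  shows "absolutely_continuous lborel \<mu> \<longleftrightarrow>
    (\<forall>k::nat. \<exists>j::nat. \<forall>U\<in>basic_opens. emeasure lborel U < ennreal (1 / 2 ^ j) \<longrightarrow> emeasure \<mu> U \<le> ennreal (1 / real (Suc k)))"
proof (intro iffI allI)
  interpret finite_measure \<mu> by fact
  fix k :: nat
  assume ac: "absolutely_continuous lborel \<mu>"
  show "\<exists>j::nat. \<forall>U\<in>basic_opens. emeasure lborel U < ennreal (1 / 2 ^ j) \<longrightarrow> emeasure \<mu> U \<le> ennreal (1 / real (Suc k))"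
  proof (rule ccontr)
    assume "\<not> ?thesis"
    then have "\<forall>j. \<exists>U. U \<in> basic_opens \<and> emeasure lborel U < ennreal (1 / 2 ^ j) \<and> ennreal (1 / real (Suc k)) < emeasure \<mu> U"
      by (auto simp: not_le)
    then obtain U where U: "\<And>j. U j \<in> basic_opens" "\<And>j. emeasure lborel (U j) < ennreal (1 / 2 ^ j)" "\<And>j. ennreal (1 / real (Suc k)) < emeasure \<mu> (U j)"
      by metis
    have Um: "U j \<in> sets borel" for j using open_basic_opens[OF U(1)] by simp
    have meas: "measure lborel (U j) \<le> (1 / 2) ^ j" for j
      using U(2)[of j] unfolding measure_def by (intro enn2real_leI) (auto simp: power_one_over less_imp_le)
    have "AE x in lborel. \<forall>\<^sub>F j in sequentially. x \<in> space lborel - U j"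
    proof (rule borel_cantelli_AE1)
      show "emeasure lborel (U j) < \<infinity>" for j using U(2)[of j] by (rule order_less_trans) simp
      show "summable (\<lambda>j. measure lborel (U j))"
        by (rule summable_comparison_test'[of "\<lambda>j. (1 / 2 :: real) ^ j" 0]) (use meas in \<open>auto intro: summable_geometric\<close>)
    qed (use Um in simp)
    then have "AE x in \<mu>. \<forall>\<^sub>F j in sequentially. x \<in> space lborel - U j"
      using absolutely_continuous_AE[OF _ ac] \<mu>(2) by simp
    then have lim: "AE x in \<mu>. (\<lambda>j. indicator (U j) x :: real) \<longlonglongrightarrow> 0"
    proof eventually_elim
      case (elim x)
      then have "\<forall>\<^sub>F j in sequentially. indicator (U j) x = (0::real)" by eventually_elim simp
      then show ?case by (rule tendsto_eventually)
    qed
    have "(\<lambda>j. \<integral>x. indicator (U j) x \<partial>\<mu>) \<longlonglongrightarrow> (\<integral>x. (0::real) \<partial>\<mu>)"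
    proof (rule integral_dominated_convergence[where w = "\<lambda>_. 1"])
      show "AE x in \<mu>. norm (indicator (U j) x :: real) \<le> 1" for j by (intro AE_I2) (simp add: indicator_def)
    qed (use Um \<mu>(2) lim in auto)
    moreover have "U j \<inter> space \<mu> = U j" for j using sets.sets_into_space[of "U j" \<mu>] Um[of j] \<mu>(2) by auto
    ultimately have "(\<lambda>j. measure \<mu> (U j)) \<longlonglongrightarrow> 0" by simp
    from order_tendstoD(2)[OF this, of "1 / real (Suc k)"]
    obtain j where "measure \<mu> (U j) < 1 / real (Suc k)"
      by (metis eventually_happens' of_nat_0_less_iff sequentially_bot zero_less_Suc zero_less_divide_1_iff)
    then have "emeasure \<mu> (U j) \<le> ennreal (1 / real (Suc k))" unfolding emeasure_eq_measure by (intro ennreal_leI) simp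
    with U(3)[of j] show False by simp
  qed
next
  interpret finite_measure \<mu> by fact
  assume crit: "\<forall>k::nat. \<exists>j::nat. \<forall>U\<in>basic_opens. emeasure lborel U < ennreal (1 / 2 ^ j) \<longrightarrow> emeasure \<mu> U \<le> ennreal (1 / real (Suc k))"
  show "absolutely_continuous lborel \<mu>"
    unfolding absolutely_continuous_def
  proof
    fix N :: "real set" assume N: "N \<in> null_sets lborel"
    then have Nb: "N \<in> sets borel" by (auto simp: null_sets_def)
    have le: "emeasure \<mu> N \<le> ennreal (1 / real (Suc k))" for k
    proof -
      obtain j where j: "\<And>U. U \<in> basic_opens \<Longrightarrow> emeasure lborel U < ennreal (1 / 2 ^ j) \<Longrightarrow> emeasure \<mu> U \<le> ennreal (1 / real (Suc k))"
        using crit by blast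
      obtain V where V: "open V" "N \<subseteq> V" "emeasure lborel (V - N) < ennreal (1 / 2 ^ j)"
        using outer_regular_lborel[OF Nb, of "1 / 2 ^ j"] by auto
      have "emeasure lborel V \<le> emeasure lborel (V - N) + emeasure lborel N"
        using V(1,2) Nb by (intro order_trans[OF eq_refl emeasure_subadditive[of "V - N" lborel N]] arg_cong[of _ _ "emeasure lborel"]) auto
      also have "\<dots> = emeasure lborel (V - N)" using N by (simp add: null_sets_def)
      finally have Vj: "emeasure lborel V < ennreal (1 / 2 ^ j)" using V(3) by simp
      obtain \<B> where \<B>: "\<B> \<subseteq> (SOME B. countable B \<and> topological_basis B)" "V = \<Union>\<B>"
        using some_basis(2) V(1) unfolding topological_basis_def by blast
      have "emeasure \<mu> V \<le> ennreal (1 / real (Suc k))"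
      proof (cases "\<B> = {}")
        case False
        have cB: "countable \<B>" using \<B>(1) some_basis(1) by (rule countable_subset)
        \<comment> \<open>Partial unions are members of the family, inherit the small Lebesgue
          measure of V, and increase to V.\<close>
        let ?U = "\<lambda>m. \<Union>(from_nat_into \<B> ` {..m})"
        have UB: "?U m \<in> basic_opens" for m
          unfolding basic_opens_def using \<B>(1) from_nat_into[OF False] by (intro imageI) auto
        have Um: "?U m \<in> sets \<mu>" for m using open_basic_opens[OF UB[of m]] \<mu>(2) by simp
        have un: "(\<Union>m. ?U m) = V" 
        proof -
          have "(\<Union>m. ?U m) = \<Union>(range (from_nat_into \<B>))" by blast
          then show ?thesis unfolding \<B>(2) range_from_nat_into[OF False cB] .
        qed
        have "emeasure \<mu> V = (SUP m. emeasure \<mu> (?U m))"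
          unfolding un[symmetric] by (rule SUP_emeasure_incseq[symmetric]) (use Um in \<open>auto simp: incseq_def, fastforce\<close>)
        also have "\<dots> \<le> ennreal (1 / real (Suc k))"
        proof (rule SUP_least)
          fix m
          have "emeasure lborel (?U m) \<le> emeasure lborel V" using V(1) un by (intro emeasure_mono) auto
          then show "emeasure \<mu> (?U m) \<le> ennreal (1 / real (Suc k))" using Vj by (intro j UB) simp
        qed
        finally show ?thesis .
      qed (simp add: \<B>(2))
      moreover have "emeasure \<mu> N \<le> emeasure \<mu> V" using V(1,2) \<mu>(2) by (intro emeasure_mono) auto
      ultimately show ?thesis by simp
    qed
    have "(\<lambda>k. ennreal (1 / real (Suc k))) \<longlonglongrightarrow> ennreal 0"
      by (intro tendsto_ennrealI) (use LIMSEQ_inverse_real_of_nat in \<open>simp add: inverse_eq_divide\<close>)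
    then have "emeasure \<mu> N \<le> ennreal 0" by (rule LIMSEQ_le_const) (use le in blast)
    then show "N \<in> null_sets \<mu>" using Nb \<mu>(2) by auto
  qed
qed

subsection \<open>The occupation measure of fractional Brownian motion\<close>

text \<open>Each side of the singularity at r contributes at most the integral of u powr (- H) over
  [0, T], which is finite because H < 1 and does not depend on r.\<close>

lemma abs_powr_kernel_finite:
  assumes H: "0 < H" "H < 1"
  shows "\<exists>J. \<forall>r\<in>{0..T}. (\<integral>\<^sup>+s. indicator {0..T} s * ennreal (\<bar>s - r\<bar> powr (- H)) \<partial>lborel) \<le> ennreal J"
proof -
  define f where "f = (\<lambda>u::real. indicator {0..max T 0} u * \<bar>u\<bar> powr (- H))"
  have fm[measurable]: "f \<in> borel_measurable borel" unfolding f_def by measurable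
  obtain J where J: "(\<integral>\<^sup>+u. ennreal (f u) \<partial>lborel) = ennreal J" "0 \<le> J"
  proof -
    have "((\<lambda>x. x powr (- H)) has_integral (max T 0 powr (- H + 1) / (- H + 1))) {0..max T 0}"
      by (rule has_integral_powr_from_0) (use H in auto)
    then have "((\<lambda>x. if x \<in> {0..max T 0} then x powr (- H) else 0) has_integral (max T 0 powr (- H + 1) / (- H + 1))) UNIV"
      by (simp only: has_integral_restrict_UNIV)
    moreover have "(\<lambda>x. if x \<in> {0..max T 0} then x powr (- H) else 0) = f" by (auto simp: f_def indicator_def fun_eq_iff)
    ultimately have "(f has_integral (max T 0 powr (- H + 1) / (- H + 1))) UNIV" by simp
    from nn_integral_has_integral_lborel[OF fm _ this] show ?thesis
      by (intro that) (use H in \<open>auto simp: f_def\<close>)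
  qed
  have "(\<integral>\<^sup>+s. indicator {0..T} s * ennreal (\<bar>s - r\<bar> powr (- H)) \<partial>lborel) \<le> ennreal (J + J)" if r: "r \<in> {0..T}" for r
  proof -
    have "(\<integral>\<^sup>+s. indicator {0..T} s * ennreal (\<bar>s - r\<bar> powr (- H)) \<partial>lborel) \<le> (\<integral>\<^sup>+s. ennreal (f (s - r)) + ennreal (f (r - s)) \<partial>lborel)"
    proof (rule nn_integral_mono)
      fix s
      show "indicator {0..T} s * ennreal (\<bar>s - r\<bar> powr (- H)) \<le> ennreal (f (s - r)) + ennreal (f (r - s))"
      proof (cases "s \<in> {0..T}")
        case True
        show ?thesis
        proof (cases "r \<le> s")
          case True
          with \<open>s \<in> {0..T}\<close> r have "ennreal (f (s - r)) = ennreal (\<bar>s - r\<bar> powr (- H))" by (simp add: f_def)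
          then show ?thesis using \<open>s \<in> {0..T}\<close> by simp
        next
          case False
          with \<open>s \<in> {0..T}\<close> r have "ennreal (f (r - s)) = ennreal (\<bar>s - r\<bar> powr (- H))" by (simp add: f_def abs_minus_commute)
          then show ?thesis using \<open>s \<in> {0..T}\<close> by simp
        qed
      qed simp
    qed
    also have "\<dots> = (\<integral>\<^sup>+s. ennreal (f (s - r)) \<partial>lborel) + (\<integral>\<^sup>+s. ennreal (f (r - s)) \<partial>lborel)"
      by (rule nn_integral_add) auto
    also have "(\<integral>\<^sup>+s. ennreal (f (s - r)) \<partial>lborel) = ennreal J"
      using nn_integral_real_affine[of "\<lambda>s. ennreal (f (s - r))" 1 r] J(1) by simp
    also have "(\<integral>\<^sup>+s. ennreal (f (r - s)) \<partial>lborel) = ennreal J"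
      using nn_integral_real_affine[of "\<lambda>s. ennreal (f (r - s))" "-1" r] J(1) by simp
    finally show ?thesis by (simp only: ennreal_plus[OF J(2) J(2)])
  qed
  then show ?thesis by blast
qed

lemma (in prob_space) normal_small_ball:
  assumes L[measurable]: "L \<in> borel_measurable M" and D: "distr M borel L = normal_law 0 v" and v: "0 < v" and h: "0 \<le> h"
  shows "emeasure M {\<omega> \<in> space M. \<bar>L \<omega>\<bar> \<le> h} \<le> ennreal (2 * h / sqrt (2 * pi * v))"
proof -
  have e: "{\<omega> \<in> space M. \<bar>L \<omega>\<bar> \<le> h} = L -` {-h..h} \<inter> space M" by (auto simp: abs_le_iff)
  have "emeasure M {\<omega> \<in> space M. \<bar>L \<omega>\<bar> \<le> h} = emeasure (normal_law 0 v) {-h..h}"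
    unfolding e D[symmetric] by (rule emeasure_distr[symmetric]) auto
  also have "\<dots> = (\<integral>\<^sup>+x. ennreal (normal_density 0 (sqrt v) x) * indicator {-h..h} x \<partial>lborel)"
    using v by (simp add: normal_law_def emeasure_density)
  also have "\<dots> \<le> (\<integral>\<^sup>+x. ennreal (1 / sqrt (2 * pi * v)) * indicator {-h..h} x \<partial>lborel)"
    using v by (intro nn_integral_mono mult_right_mono ennreal_leI) (auto simp: normal_density_def divide_simps mult_le_cancel_right1)
  also have "\<dots> = ennreal (1 / sqrt (2 * pi * v)) * emeasure lborel {-h..h}" by (rule nn_integral_cmult_indicator) simp
  also have "\<dots> = ennreal (2 * h / sqrt (2 * pi * v))" using h v by (simp add: ennreal_mult[symmetric])
  finally show ?thesis .
qed

context fractional_brownian_motion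
begin

text \<open>Step functions in time, with values of B at rational times, converge by continuity of
  the paths. The maximum with 0 is there because \<open>lborel\<close> covers the whole line while
  nothing is known of B at negative times.\<close>

lemma measurable_joint: "(\<lambda>(s, \<omega>). B (max 0 s) \<omega>) \<in> borel_measurable (lborel \<Otimes>\<^sub>M M)"
proof -
  let ?g = "\<lambda>n (p :: real \<times> 'a). nat \<lfloor>max 0 (fst p) * real (Suc n)\<rfloor>"
  let ?u = "\<lambda>n (p :: real \<times> 'a). B (real (?g n p) / real (Suc n)) (snd p)"
  show ?thesis
  proof (rule borel_measurable_LIMSEQ_real[where u = ?u])
  show "?u n \<in> borel_measurable (lborel \<Otimes>\<^sub>M M)" for n
  proof (rule measurable_compose_countable[where f = "\<lambda>i p. B (real i / real (Suc n)) (snd p)" and g = "?g n"])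
    show "(\<lambda>p. B (real i / real (Suc n)) (snd p)) \<in> borel_measurable (lborel \<Otimes>\<^sub>M M)" for i
      by (intro measurable_compose[OF measurable_snd B_measurable]) auto
    show "?g n \<in> measurable (lborel \<Otimes>\<^sub>M M) (count_space UNIV)" by measurable
  qed
  fix p :: "real \<times> 'a" assume "p \<in> space (lborel \<Otimes>\<^sub>M M)"
  then have \<omega>: "snd p \<in> space M" by (auto simp: space_pair_measure)
  let ?s = "max 0 (fst p)"
  have s: "0 \<le> ?s" by simp
  have "(\<lambda>n. real (?g n p) / real (Suc n)) \<longlonglongrightarrow> ?s"
  proof (rule tendsto_sandwich[where f = "\<lambda>n. ?s - 1 / real (Suc n)" and h = "\<lambda>_. ?s"])
    have b: "?s * real (Suc n) - 1 \<le> real (?g n p) \<and> real (?g n p) \<le> ?s * real (Suc n)" for n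
    proof -
      have "0 \<le> ?s * real (Suc n)" using s by simp
      then have "real (?g n p) = of_int \<lfloor>?s * real (Suc n)\<rfloor>" by simp
      then show ?thesis by linarith
    qed
    have "?s - 1 / real (Suc n) = (?s * real (Suc n) - 1) / real (Suc n)" for n by (simp add: field_simps)
    then show "\<forall>\<^sub>F n in sequentially. ?s - 1 / real (Suc n) \<le> real (?g n p) / real (Suc n)"
      using b by (intro always_eventually allI) (simp only: divide_right_mono of_nat_0_le_iff)
    show "\<forall>\<^sub>F n in sequentially. real (?g n p) / real (Suc n) \<le> ?s"
      using b by (intro always_eventually allI) (simp only: pos_divide_le_eq of_nat_0_less_iff zero_less_Suc)
    show "(\<lambda>n. ?s - 1 / real (Suc n)) \<longlonglongrightarrow> ?s"
      using tendsto_diff[OF tendsto_const[of ?s] LIMSEQ_inverse_real_of_nat] by (simp add: inverse_eq_divide)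
  qed simp
  then have "(\<lambda>n. path (snd p) (real (?g n p) / real (Suc n))) \<longlonglongrightarrow> path (snd p) ?s"
    by (intro continuous_on_tendsto_compose[OF continuous_paths[OF \<omega>]] always_eventually) auto
  then show "(\<lambda>n. ?u n p) \<longlonglongrightarrow> (case p of (s, \<omega>) \<Rightarrow> B (max 0 s) \<omega>)" by (simp add: case_prod_beta)
  qed
qed

lemma measurable_joint_comp:
  assumes "f \<in> measurable N borel" "g \<in> measurable N M"
  shows "(\<lambda>x. B (max 0 (f x)) (g x)) \<in> borel_measurable N"
proof -
  have "(\<lambda>x. (f x, g x)) \<in> measurable N (lborel \<Otimes>\<^sub>M M)" using assms by (intro measurable_Pair) auto
  from measurable_compose[OF this measurable_joint] show ?thesis by simp
qed

abbreviation occ :: "real \<Rightarrow> 'a \<Rightarrow> real measure" where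
  "occ t \<omega> \<equiv> occupation_measure B t \<omega>"

lemma path_measurable_restrict:
  assumes "\<omega> \<in> space M"
  shows "path \<omega> \<in> borel_measurable (restrict_space lborel {0..t})"
proof -
  have "path \<omega> \<in> borel_measurable (restrict_space borel {0..t})"
    by (rule borel_measurable_continuous_on_restrict[OF path_continuous[OF assms order_refl]])
  then show ?thesis using measurable_cong_sets[OF sets_restrict_space_cong[OF sets_lborel] refl] by blast
qed

lemma nn_integral_occ:
  assumes \<omega>: "\<omega> \<in> space M" and [measurable]: "f \<in> borel_measurable borel"
  shows "(\<integral>\<^sup>+y. f y \<partial>occ t \<omega>) = (\<integral>\<^sup>+s. indicator {0..t} s * f (B (max 0 s) \<omega>) \<partial>lborel)"
proof -
  have "(\<integral>\<^sup>+y. f y \<partial>occ t \<omega>) = (\<integral>\<^sup>+s. f (B s \<omega>) \<partial>restrict_space lborel {0..t})"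
    unfolding occupation_measure_def by (rule nn_integral_distr[OF path_measurable_restrict[OF \<omega>]]) measurable
  also have "\<dots> = (\<integral>\<^sup>+s. f (B s \<omega>) * indicator {0..t} s \<partial>lborel)"
    by (rule nn_integral_restrict_space) simp
  also have "\<dots> = (\<integral>\<^sup>+s. indicator {0..t} s * f (B (max 0 s) \<omega>) \<partial>lborel)"
    by (intro nn_integral_cong) (auto simp: indicator_def max_def)
  finally show ?thesis .
qed

lemma sets_occ [simp]: "sets (occ t \<omega>) = sets borel"
  by (simp add: occupation_measure_def)

lemma emeasure_occ:
  assumes "\<omega> \<in> space M" "A \<in> sets borel"
  shows "emeasure (occ t \<omega>) A = (\<integral>\<^sup>+s. indicator {0..t} s * indicator A (B (max 0 s) \<omega>) \<partial>lborel)"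
  using nn_integral_occ[OF assms(1), of "indicator A" t] assms(2) by simp

lemma finite_occ:
  assumes "\<omega> \<in> space M"
  shows "finite_measure (occ t \<omega>)"
proof
  have "emeasure (occ t \<omega>) (space (occ t \<omega>)) = (\<integral>\<^sup>+s. indicator {0..t} s \<partial>lborel)"
    using emeasure_occ[OF assms, of UNIV t] by (simp add: occupation_measure_def)
  also have "\<dots> < \<infinity>" by (simp add: emeasure_lborel_Icc_eq)
  finally show "emeasure (occ t \<omega>) (space (occ t \<omega>)) \<noteq> \<infinity>" by simp
qed

lemma measurable_emeasure_occ:
  assumes A[measurable]: "A \<in> sets borel"
  shows "(\<lambda>\<omega>. emeasure (occ t \<omega>) A) \<in> borel_measurable M"
proof -
  have "(\<lambda>p. B (max 0 (snd p)) (fst p)) \<in> borel_measurable (M \<Otimes>\<^sub>M lborel)"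
    by (rule measurable_joint_comp) auto
  then have "(\<lambda>(\<omega>, s). indicator {0..t} s * indicator A (B (max 0 s) \<omega>) :: ennreal) \<in> borel_measurable (M \<Otimes>\<^sub>M lborel)"
    unfolding case_prod_beta by measurable
  from lborel.borel_measurable_nn_integral[OF this]
  have "(\<lambda>\<omega>. \<integral>\<^sup>+s. indicator {0..t} s * indicator A (B (max 0 s) \<omega>) \<partial>lborel) \<in> borel_measurable M" by simp
  then show ?thesis by (rule measurable_cong[THEN iffD2, rotated]) (rule emeasure_occ[OF _ A])
qed

text \<open>Kept as an event, not just as an almost sure property: off it \<open>local_time\<close>
  takes the value 0, and the limit measures must be measurable there as well.\<close>

definition ac_event :: "real \<Rightarrow> 'a set" where
  "ac_event t = {\<omega> \<in> space M. absolutely_continuous lborel (occ t \<omega>)}"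

lemma ac_event_sets [measurable]: "ac_event t \<in> sets M"
proof -
  have "ac_event t = {\<omega> \<in> space M. \<forall>k::nat. \<exists>j::nat. \<forall>U\<in>basic_opens. emeasure lborel U < ennreal (1 / 2 ^ j) \<longrightarrow> emeasure (occ t \<omega>) U \<le> ennreal (1 / real (Suc k))}"
    unfolding ac_event_def using absolutely_continuous_iff_basic[OF finite_occ sets_occ] by blast
  also have "\<dots> \<in> sets M"
  proof (intro sets.sets_Collect_countable_All sets.sets_Collect_countable_Ex sets.sets_Collect_countable_All' countable_basic_opens
      sets.sets_Collect_imp sets.sets_Collect_const)
    fix k :: nat and U assume "U \<in> basic_opens"
    then have "U \<in> sets borel" using open_basic_opens by simp
    note [measurable] = measurable_emeasure_occ[OF this, of t]
    show "{\<omega> \<in> space M. emeasure (occ t \<omega>) U \<le> ennreal (1 / real (Suc k))} \<in> sets M" by measurable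
  qed
  finally show ?thesis .
qed

lemma ac_event_antimono: "s \<le> t \<Longrightarrow> ac_event t \<subseteq> ac_event s"
proof
  fix \<omega> assume st: "s \<le> t" and \<omega>: "\<omega> \<in> ac_event t"
  then have \<omega>M: "\<omega> \<in> space M" and ac: "null_sets lborel \<subseteq> null_sets (occ t \<omega>)"
    by (auto simp: ac_event_def absolutely_continuous_def)
  have "N \<in> null_sets (occ s \<omega>)" if N: "N \<in> null_sets lborel" for N
  proof -
    have Nb: "N \<in> sets borel" using N by (auto simp: null_sets_def)
    have "emeasure (occ s \<omega>) N \<le> emeasure (occ t \<omega>) N"
      unfolding emeasure_occ[OF \<omega>M Nb] using st by (intro nn_integral_mono mult_right_mono) (auto simp: indicator_def)
    also have "\<dots> = 0" using ac N by (auto simp: null_sets_def)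
    finally show ?thesis using Nb by auto
  qed
  then show "\<omega> \<in> ac_event s" using \<omega>M by (auto simp: ac_event_def absolutely_continuous_def)
qed

text \<open>The times in [0, t] outside all [0, s n] consist of t alone, a Lebesgue null set.
  Together with \<open>ac_event_antimono\<close> this makes membership in \<open>ac_event\<close>
  left-continuous in time.\<close>

lemma ac_event_limit:
  assumes s: "incseq s" "s \<longlonglongrightarrow> t" "\<And>n. s n < t" and \<omega>: "\<And>n. \<omega> \<in> ac_event (s n)"
  shows "\<omega> \<in> ac_event t"
proof -
  have \<omega>M: "\<omega> \<in> space M" using \<omega>[of 0] by (simp add: ac_event_def)
  have "N \<in> null_sets (occ t \<omega>)" if N: "N \<in> null_sets lborel" for N
  proof -
    have Nb: "N \<in> sets borel" using N by (auto simp: null_sets_def)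
    let ?f = "\<lambda>n r. indicator {0..s n} r * indicator N (B (max 0 r) \<omega>) :: ennreal"
    have fm: "(\<lambda>r. indicator {0..u} r * indicator N (B (max 0 r) \<omega>) :: ennreal) \<in> borel_measurable lborel" for u
    proof -
      have [measurable]: "(\<lambda>r. B (max 0 r) \<omega>) \<in> borel_measurable lborel" by (rule measurable_joint_comp) (use \<omega>M in auto)
      show ?thesis using Nb by measurable
    qed
    have "(\<integral>\<^sup>+r. ?f n r \<partial>lborel) = 0" for n
      using \<omega>[of n] N unfolding emeasure_occ[OF \<omega>M Nb, symmetric] ac_event_def absolutely_continuous_def by (auto simp: null_sets_def)
    then have "AE r in lborel. ?f n r = 0" for n using nn_integral_0_iff_AE[OF fm] by blast
    then have "AE r in lborel. \<forall>n. ?f n r = 0" unfolding AE_all_countable by (rule allI)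
    with AE_lborel_singleton[of t] have "AE r in lborel. indicator {0..t} r * indicator N (B (max 0 r) \<omega>) = (0::ennreal)"
    proof eventually_elim
      case (elim r)
      show ?case
      proof (cases "r \<in> {0..t}")
        case True
        with elim(1) have "r < t" by auto
        from order_tendstoD(1)[OF s(2) this] obtain n where "r < s n" by (blast dest: eventually_happens'[OF sequentially_bot])
        then have "r \<in> {0..s n}" using True by auto
        with elim(2)[rule_format, of n] show ?thesis by simp
      qed simp
    qed
    then have "(\<integral>\<^sup>+r. indicator {0..t} r * indicator N (B (max 0 r) \<omega>) \<partial>lborel) = 0" using nn_integral_0_iff_AE[OF fm] by blast
    then show ?thesis using Nb unfolding emeasure_occ[OF \<omega>M Nb, symmetric] by auto
  qed
  then show ?thesis using \<omega>M by (auto simp: ac_event_def absolutely_continuous_def)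
qed

text \<open>Tonelli turns the expected energy into a double time integral of the probability that B
  s and B r share a cell. This forces |B r - B s| \<le> 2^(-n), which has probability at most D
  2^(-n) |r - s| powr (- H) since a centred Gaussian density is bounded by its peak. The kernel is
  integrable, so 2^n times the expected energy is bounded in n, and Fatou's lemma applies.\<close>

theorem ac_event_AE: "AE \<omega> in M. \<omega> \<in> ac_event T"
proof -
  let ?c = "\<lambda>n s r \<omega>. indicator {0} (\<lfloor>B (max 0 s) \<omega> * 2 ^ n\<rfloor> - \<lfloor>B (max 0 r) \<omega> * 2 ^ n\<rfloor>) :: ennreal"
  let ?k = "\<lambda>n s r \<omega>. indicator {0..T} s * (indicator {0..T} r * ?c n s r \<omega>)"
  have km: "(\<lambda>x. ?k n (f x) (g x) (h x)) \<in> borel_measurable N"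
    if [measurable]: "f \<in> measurable N borel" "g \<in> measurable N borel" "h \<in> measurable N M" for n N and f g :: "('c \<times> 'd) \<Rightarrow> real" and h
  proof -
    have [measurable]: "(\<lambda>x. B (max 0 (f x)) (h x)) \<in> borel_measurable N" "(\<lambda>x. B (max 0 (g x)) (h x)) \<in> borel_measurable N"
      by (rule measurable_joint_comp; measurable)+
    show ?thesis by measurable
  qed
  have energy: "dyadic_energy (occ T \<omega>) n = (\<integral>\<^sup>+s. \<integral>\<^sup>+r. ?k n s r \<omega> \<partial>lborel \<partial>lborel)" if \<omega>: "\<omega> \<in> space M" for \<omega> n
  proof -
    have Bm[measurable]: "(\<lambda>r. B (max 0 r) \<omega>) \<in> borel_measurable lborel" by (rule measurable_joint_comp) (use \<omega> in auto)
    have in1: "(\<integral>\<^sup>+y. indicator {0} (\<lfloor>x * 2 ^ n\<rfloor> - \<lfloor>y * 2 ^ n\<rfloor>) \<partial>occ T \<omega>)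
       = (\<integral>\<^sup>+r. indicator {0..T} r * indicator {0} (\<lfloor>x * 2 ^ n\<rfloor> - \<lfloor>B (max 0 r) \<omega> * 2 ^ n\<rfloor>) \<partial>lborel)" for x
      by (rule nn_integral_occ[OF \<omega>]) measurable
    have "dyadic_energy (occ T \<omega>) n = (\<integral>\<^sup>+s. indicator {0..T} s * (\<integral>\<^sup>+r. indicator {0..T} r * ?c n s r \<omega> \<partial>lborel) \<partial>lborel)"
      unfolding dyadic_energy_def in1 by (rule nn_integral_occ[OF \<omega>]) measurable
    also have "\<dots> = (\<integral>\<^sup>+s. \<integral>\<^sup>+r. ?k n s r \<omega> \<partial>lborel \<partial>lborel)"
      by (intro nn_integral_cong nn_integral_cmult[symmetric]) measurable
    finally show ?thesis .
  qed
  obtain J where J: "\<And>r. r \<in> {0..T} \<Longrightarrow> (\<integral>\<^sup>+s. indicator {0..T} s * ennreal (\<bar>s - r\<bar> powr (- H)) \<partial>lborel) \<le> ennreal J"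
    using abs_powr_kernel_finite[OF hurst, of T] by blast
  define D where "D = 2 / sqrt (2 * pi * kappa)"
  have D: "0 \<le> D" using kappa(1) by (simp add: D_def)
  have ball: "(\<integral>\<^sup>+\<omega>. ?k n s r \<omega> \<partial>M) \<le> indicator {0..T} s * (ennreal (D / 2 ^ n) * (indicator {0..T} r * ennreal (\<bar>r - s\<bar> powr (- H))))"
    if sr: "r \<noteq> s" for n s r
  proof (cases "s \<in> {0..T} \<and> r \<in> {0..T}")
    case True
    let ?L = "\<lambda>\<omega>. B r \<omega> - B s \<omega>"
    have pos: "0 < kappa * \<bar>r - s\<bar> powr (2 * H)" using kappa(1) sr by simp
    have "(\<integral>\<^sup>+\<omega>. ?k n s r \<omega> \<partial>M) \<le> (\<integral>\<^sup>+\<omega>. indicator {\<omega> \<in> space M. \<bar>?L \<omega>\<bar> \<le> 1 / 2 ^ n} \<omega> \<partial>M)"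
    proof (rule nn_integral_mono)
      fix \<omega> assume "\<omega> \<in> space M"
      have "\<bar>?L \<omega>\<bar> \<le> 1 / 2 ^ n" if "\<lfloor>B s \<omega> * 2 ^ n\<rfloor> = \<lfloor>B r \<omega> * 2 ^ n\<rfloor>"
      proof -
        have "\<bar>B r \<omega> * 2 ^ n - B s \<omega> * 2 ^ n\<bar> \<le> 1" using that by linarith
        then have "\<bar>?L \<omega>\<bar> * 2 ^ n \<le> 1" by (simp add: left_diff_distrib[symmetric] abs_mult)
        then show ?thesis by (simp add: pos_le_divide_eq)
      qed
      then show "?k n s r \<omega> \<le> indicator {\<omega> \<in> space M. \<bar>?L \<omega>\<bar> \<le> 1 / 2 ^ n} \<omega>"
        using True \<open>\<omega> \<in> space M\<close> by (auto simp: indicator_def)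
    qed
    also have "\<dots> = emeasure M {\<omega> \<in> space M. \<bar>?L \<omega>\<bar> \<le> 1 / 2 ^ n}"
    proof (rule nn_integral_indicator)
      have [measurable]: "B r \<in> borel_measurable M" "B s \<in> borel_measurable M" using True by auto
      show "{\<omega> \<in> space M. \<bar>?L \<omega>\<bar> \<le> 1 / 2 ^ n} \<in> sets M" by measurable
    qed
    also have "\<dots> \<le> ennreal (2 * (1 / 2 ^ n) / sqrt (2 * pi * (kappa * \<bar>r - s\<bar> powr (2 * H))))"
      by (rule normal_small_ball[OF _ kappa(2) pos]) (use True in auto)
    also have "2 * (1 / 2 ^ n) / sqrt (2 * pi * (kappa * \<bar>r - s\<bar> powr (2 * H))) = D / 2 ^ n * \<bar>r - s\<bar> powr (- H)"
    proof -
      have "sqrt (\<bar>r - s\<bar> powr (2 * H)) = \<bar>r - s\<bar> powr H"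
        by (intro real_sqrt_unique) (simp_all add: power2_eq_square powr_add[symmetric])
      then have "sqrt (2 * pi * (kappa * \<bar>r - s\<bar> powr (2 * H))) = sqrt (2 * pi * kappa) * \<bar>r - s\<bar> powr H"
        by (simp add: real_sqrt_mult)
      then show ?thesis by (simp add: D_def powr_minus divide_inverse)
    qed
    finally show ?thesis using True D by (simp add: ennreal_mult[symmetric])
  qed (auto simp: indicator_def)
  have em: "(\<lambda>\<omega>. dyadic_energy (occ T \<omega>) n) \<in> borel_measurable M" for n
  proof -
    have "(\<lambda>x. ?k n (snd (fst x)) (snd x) (fst (fst x))) \<in> borel_measurable ((M \<Otimes>\<^sub>M lborel) \<Otimes>\<^sub>M lborel)"
      by (rule km) measurable
    then have "(\<lambda>p. \<integral>\<^sup>+r. ?k n (snd p) r (fst p) \<partial>lborel) \<in> borel_measurable (M \<Otimes>\<^sub>M lborel)"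
      using lborel.borel_measurable_nn_integral[of "\<lambda>p r. ?k n (snd p) r (fst p)" "M \<Otimes>\<^sub>M lborel"] by (simp add: case_prod_beta)
    then have "(\<lambda>\<omega>. \<integral>\<^sup>+s. \<integral>\<^sup>+r. ?k n s r \<omega> \<partial>lborel \<partial>lborel) \<in> borel_measurable M"
      using lborel.borel_measurable_nn_integral[of "\<lambda>\<omega> s. \<integral>\<^sup>+r. ?k n s r \<omega> \<partial>lborel" M] by (simp add: case_prod_beta)
    then show ?thesis by (rule measurable_cong[THEN iffD2, rotated]) (rule energy)
  qed
  have bound: "(\<integral>\<^sup>+\<omega>. 2 ^ n * dyadic_energy (occ T \<omega>) n \<partial>M) \<le> ennreal (D * J * max T 0)" for n
  proof -
    have m3: "(\<lambda>x. ?k n (fst (fst x)) (snd x) (snd (fst x))) \<in> borel_measurable ((lborel \<Otimes>\<^sub>M M) \<Otimes>\<^sub>M lborel)"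
      by (rule km) measurable
    have m2: "(\<lambda>(s, \<omega>). \<integral>\<^sup>+r. ?k n s r \<omega> \<partial>lborel) \<in> borel_measurable (lborel \<Otimes>\<^sub>M M)"
      using lborel.borel_measurable_nn_integral[of "\<lambda>p r. ?k n (fst p) r (snd p)" "lborel \<Otimes>\<^sub>M M"] m3 by (simp add: case_prod_beta)
    interpret pair_sigma_finite lborel M by (intro pair_sigma_finite.intro lborel.sigma_finite_measure_axioms sigma_finite_measure_axioms)
    have "(\<integral>\<^sup>+\<omega>. dyadic_energy (occ T \<omega>) n \<partial>M) = (\<integral>\<^sup>+\<omega>. \<integral>\<^sup>+s. \<integral>\<^sup>+r. ?k n s r \<omega> \<partial>lborel \<partial>lborel \<partial>M)"
      by (intro nn_integral_cong energy)
    also have "\<dots> = (\<integral>\<^sup>+s. \<integral>\<^sup>+\<omega>. \<integral>\<^sup>+r. ?k n s r \<omega> \<partial>lborel \<partial>M \<partial>lborel)"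
      by (rule Fubini'[OF m2])
    also have "\<dots> = (\<integral>\<^sup>+s. \<integral>\<^sup>+r. \<integral>\<^sup>+\<omega>. ?k n s r \<omega> \<partial>M \<partial>lborel \<partial>lborel)"
    proof (rule nn_integral_cong)
      fix s :: real
      have "(\<lambda>(r, \<omega>). ?k n s r \<omega>) \<in> borel_measurable (lborel \<Otimes>\<^sub>M M)"
        unfolding case_prod_beta by (rule km) measurable
      from Fubini'[OF this] show "(\<integral>\<^sup>+\<omega>. \<integral>\<^sup>+r. ?k n s r \<omega> \<partial>lborel \<partial>M) = (\<integral>\<^sup>+r. \<integral>\<^sup>+\<omega>. ?k n s r \<omega> \<partial>M \<partial>lborel)" .
    qed
    also have "\<dots> \<le> (\<integral>\<^sup>+s. ennreal (D / 2 ^ n * J) * indicator {0..T} s \<partial>lborel)"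
    proof (rule nn_integral_mono)
      fix s :: real
      have "(\<integral>\<^sup>+r. \<integral>\<^sup>+\<omega>. ?k n s r \<omega> \<partial>M \<partial>lborel)
        \<le> (\<integral>\<^sup>+r. indicator {0..T} s * (ennreal (D / 2 ^ n) * (indicator {0..T} r * ennreal (\<bar>r - s\<bar> powr (- H)))) \<partial>lborel)"
      \<comment> \<open>On the diagonal r = s both times share a cell for certain, while
        \<open>0 powr (- H)\<close> is 0, so the bound fails there; the diagonal is a null
        set.\<close>
      proof (rule nn_integral_mono_AE)
        show "AE r in lborel. (\<integral>\<^sup>+\<omega>. ?k n s r \<omega> \<partial>M)
          \<le> indicator {0..T} s * (ennreal (D / 2 ^ n) * (indicator {0..T} r * ennreal (\<bar>r - s\<bar> powr (- H))))"
          using AE_lborel_singleton[of s] by eventually_elim (rule ball)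
      qed
      also have "\<dots> = indicator {0..T} s * (ennreal (D / 2 ^ n) * (\<integral>\<^sup>+r. indicator {0..T} r * ennreal (\<bar>r - s\<bar> powr (- H)) \<partial>lborel))"
        by (subst nn_integral_cmult, measurable, subst nn_integral_cmult, measurable)
      also have "\<dots> \<le> ennreal (D / 2 ^ n * J) * indicator {0..T} s"
      proof (cases "s \<in> {0..T}")
        case True
        have "ennreal (D / 2 ^ n) * (\<integral>\<^sup>+r. indicator {0..T} r * ennreal (\<bar>r - s\<bar> powr (- H)) \<partial>lborel) \<le> ennreal (D / 2 ^ n) * ennreal J"
          by (intro mult_left_mono J True) simp
        also have "ennreal (D / 2 ^ n) * ennreal J = ennreal (D / 2 ^ n * J)" using D by (intro ennreal_mult'[symmetric]) simp
        finally show ?thesis using True by simp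
      qed simp
      finally show "(\<integral>\<^sup>+r. \<integral>\<^sup>+\<omega>. ?k n s r \<omega> \<partial>M \<partial>lborel) \<le> ennreal (D / 2 ^ n * J) * indicator {0..T} s" .
    qed
    also have "\<dots> = ennreal (D / 2 ^ n * J) * ennreal (max T 0)"
      by (subst nn_integral_cmult_indicator) (auto simp: emeasure_lborel_Icc_eq max_def)
    finally have le: "(\<integral>\<^sup>+\<omega>. dyadic_energy (occ T \<omega>) n \<partial>M) \<le> ennreal (D / 2 ^ n * J) * ennreal (max T 0)" .
    have "(\<integral>\<^sup>+\<omega>. 2 ^ n * dyadic_energy (occ T \<omega>) n \<partial>M) = 2 ^ n * (\<integral>\<^sup>+\<omega>. dyadic_energy (occ T \<omega>) n \<partial>M)"
      by (rule nn_integral_cmult[OF em])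
    also have "\<dots> \<le> 2 ^ n * (ennreal (D / 2 ^ n * J) * ennreal (max T 0))" by (rule mult_left_mono[OF le]) simp
    also have "\<dots> \<le> ennreal (D * J * max T 0)"
    \<comment> \<open>The existence statement that provides J does not fix its sign;
      \<open>ennreal\<close> sends negative values to 0.\<close>
    proof (cases "0 \<le> J")
      case True
      define T0 where "T0 = max T 0"
      have T0: "0 \<le> T0" by (simp add: T0_def)
      have "(2::ennreal) ^ n = ennreal (2 ^ n)" by (simp add: ennreal_power[symmetric])
      then have "2 ^ n * (ennreal (D / 2 ^ n * J) * ennreal (max T 0)) = ennreal (2 ^ n * (D / 2 ^ n * J * max T 0))"
        unfolding T0_def[symmetric] using D True T0 by (simp add: ennreal_mult[symmetric])
      also have "2 ^ n * (D / 2 ^ n * J * max T 0) = D * J * max T 0" by simp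
      finally show ?thesis by simp
    next
      case False
      then have "D / 2 ^ n * J \<le> 0" using D by (simp add: mult_nonneg_nonpos divide_nonpos_pos)
      then have "ennreal (D / 2 ^ n * J) = 0" by (rule ennreal_neg)
      then show ?thesis by simp
    qed
    finally show ?thesis .
  qed
  have um: "(\<lambda>\<omega>. 2 ^ n * dyadic_energy (occ T \<omega>) n) \<in> borel_measurable M" for n using em[of n] by measurable
  have "(\<integral>\<^sup>+\<omega>. liminf (\<lambda>n. 2 ^ n * dyadic_energy (occ T \<omega>) n) \<partial>M) \<le> liminf (\<lambda>n. \<integral>\<^sup>+\<omega>. 2 ^ n * dyadic_energy (occ T \<omega>) n \<partial>M)"
    by (rule nn_integral_liminf[OF um])
  also have "\<dots> \<le> liminf (\<lambda>n. ennreal (D * J * max T 0))" by (intro Liminf_mono always_eventually allI bound)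
  also have "\<dots> < \<infinity>" by (simp add: Liminf_const)
  finally have "(\<integral>\<^sup>+\<omega>. liminf (\<lambda>n. 2 ^ n * dyadic_energy (occ T \<omega>) n) \<partial>M) \<noteq> \<infinity>" by simp
  then have "AE \<omega> in M. liminf (\<lambda>n. 2 ^ n * dyadic_energy (occ T \<omega>) n) \<noteq> \<infinity>"
    by (intro nn_integral_noteq_infinite borel_measurable_liminf um)
  with AE_space show ?thesis
  proof eventually_elim
    case (elim \<omega>)
    have "absolutely_continuous lborel (occ T \<omega>)"
      by (rule finite_energy_absolutely_continuous[OF finite_occ[OF elim(1)] sets_occ]) (use elim(2) in \<open>simp add: less_top\<close>)
    then show ?case using elim(1) by (simp add: ac_event_def)
  qed
qed

end

section \<open>Path regularity in time and measurability\<close>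

text \<open>Left-continuity is the right one-sided notion here: rational times approaching t from
  the left stay in [0, T], also for t = T. The end point 0 is rational.\<close>

lemma SUP_rational_left_continuous:
  fixes F :: "real \<Rightarrow> real"
  assumes F: "\<And>t. 0 < t \<Longrightarrow> t \<le> T \<Longrightarrow> (F \<longlongrightarrow> F t) (at_left t)"
  shows "(SUP t\<in>{0..T}. ennreal \<bar>F t\<bar>) = (SUP t\<in>{0..T} \<inter> \<rat>. ennreal \<bar>F t\<bar>)"
proof (rule antisym)
  show "(SUP t\<in>{0..T}. ennreal \<bar>F t\<bar>) \<le> (SUP t\<in>{0..T} \<inter> \<rat>. ennreal \<bar>F t\<bar>)"
  proof (rule SUP_least)
    fix t assume t: "t \<in> {0..T}"
    show "ennreal \<bar>F t\<bar> \<le> (SUP t\<in>{0..T} \<inter> \<rat>. ennreal \<bar>F t\<bar>)"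
    proof (cases "t = 0")
      case True
      then show ?thesis using t by (intro SUP_upper) auto
    next
      case False
      then have t0: "0 < t" "t \<le> T" using t by auto
      show ?thesis
      proof (rule ccontr)
        assume "\<not> ?thesis"
        then have lt: "(SUP t\<in>{0..T} \<inter> \<rat>. ennreal \<bar>F t\<bar>) < ennreal \<bar>F t\<bar>" by simp
        have "((\<lambda>s. ennreal \<bar>F s\<bar>) \<longlongrightarrow> ennreal \<bar>F t\<bar>) (at_left t)"
          by (intro tendsto_ennrealI tendsto_rabs F t0)
        then have "\<forall>\<^sub>F s in at_left t. (SUP t\<in>{0..T} \<inter> \<rat>. ennreal \<bar>F t\<bar>) < ennreal \<bar>F s\<bar>"
          using lt by (rule order_tendstoD(1))
        then obtain b where b: "b < t" "\<And>s. b < s \<Longrightarrow> s < t \<Longrightarrow> (SUP t\<in>{0..T} \<inter> \<rat>. ennreal \<bar>F t\<bar>) < ennreal \<bar>F s\<bar>"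
          unfolding eventually_at_left[OF t0(1)] by auto
        obtain s where s: "s \<in> \<rat>" "max b 0 < s" "s < t" using Rats_dense_in_real[of "max b 0" t] b(1) t0 by auto
        have "ennreal \<bar>F s\<bar> \<le> (SUP t\<in>{0..T} \<inter> \<rat>. ennreal \<bar>F t\<bar>)" using s t0 by (intro SUP_upper) auto
        moreover have "(SUP t\<in>{0..T} \<inter> \<rat>. ennreal \<bar>F t\<bar>) < ennreal \<bar>F s\<bar>" using s by (intro b(2)) auto
        ultimately show False by simp
      qed
    qed
  qed
  show "(SUP t\<in>{0..T} \<inter> \<rat>. ennreal \<bar>F t\<bar>) \<le> (SUP t\<in>{0..T}. ennreal \<bar>F t\<bar>)"
    by (rule SUP_subset_mono) auto
qed

text \<open>The lower level is passed with a strict inequality, so a descent complete at t was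
  already complete slightly earlier. This makes crossing numbers left-continuous in time.\<close>

lemma descents_left:
  assumes x: "continuous_on {s..t} x" and st: "s < t" and ab: "b < a" and d: "descents x a b s n t"
  shows "\<exists>t'. s \<le> t' \<and> t' < t \<and> descents x a b s n t'"
proof (cases n)
  case 0
  then show ?thesis using st by auto
next
  case (Suc m)
  then obtain u v where uv: "descents x a b s m u" "u \<le> v" "v \<le> t" "a \<le> x u" "x v < b" using d by auto
  have su: "s \<le> u" using descents_ge[OF uv(1)] .
  show ?thesis
  proof (cases "v < t")
    case True
    then show ?thesis using uv su Suc by (intro exI[of _ v]) auto
  next
    case False
    then have v: "v = t" using uv(3) by simp
    then have ut: "u < t" using uv ab by (metis less_eq_real_def less_trans not_less)
    obtain \<delta> where \<delta>: "0 < \<delta>" "\<And>z. z \<in> {s..t} \<Longrightarrow> dist z t < \<delta> \<Longrightarrow> dist (x z) (x t) < b - x t"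
      using x[unfolded continuous_on_iff, rule_format, of t "b - x t"] uv(5) st v by auto
    define v' where "v' = max u (t - \<delta> / 2)"
    have v': "u \<le> v'" "v' < t" "dist v' t < \<delta>" using ut \<delta>(1) by (auto simp: v'_def dist_real_def max_def)
    have "dist (x v') (x t) < b - x t" using v' su by (intro \<delta>(2)) auto
    then have "x v' < b" by (simp add: dist_real_def)
    then show ?thesis using uv(1,4) v' su Suc by (intro exI[of _ v']) auto
  qed
qed

lemma crossings_left:
  assumes x: "continuous_on {s..t} x" and c: "0 < c" and st: "s < t"
  shows "\<exists>t'. s \<le> t' \<and> t' < t \<and> (\<forall>r\<in>{t'..t}. crossings x y c s r = crossings x y c s t)"
proof -
  have mx: "continuous_on {s..t} (\<lambda>u. - x u)" using x by (intro continuous_intros)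
  obtain t1 where t1: "s \<le> t1" "t1 < t" "descents x (y + c/2) (y - c/2) s (down_crossings x y c s t) t1"
    using descents_left[OF x st _ le_down_crossings_iff[OF x c less_imp_le[OF st], THEN iffD1, OF order_refl]] c by force
  obtain t2 where t2: "s \<le> t2" "t2 < t" "descents (\<lambda>u. - x u) (- y + c/2) (- y - c/2) s (up_crossings x y c s t) t2"
    using descents_left[OF mx st _ le_up_crossings_iff[OF x c less_imp_le[OF st], THEN iffD1, OF order_refl]] c by force
  have eq: "crossings x y c s r = crossings x y c s t" if r: "t1 \<le> r" "t2 \<le> r" "r \<le> t" for r
  proof (rule antisym)
    have sr: "s \<le> r" using r t1 by simp
    have xr: "continuous_on {s..r} x" using x by (rule continuous_on_subset) (use r in auto)
    show "crossings x y c s r \<le> crossings x y c s t" using crossings_mono[OF x c sr r(3)] .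
    have "down_crossings x y c s t \<le> down_crossings x y c s r"
      using descents_mono[OF t1(3)] r(1) by (simp add: le_down_crossings_iff[OF xr c sr])
    moreover have "up_crossings x y c s t \<le> up_crossings x y c s r"
      using descents_mono[OF t2(3)] r(2) by (simp add: le_up_crossings_iff[OF xr c sr])
    ultimately show "crossings x y c s t \<le> crossings x y c s r" by (simp add: crossings_def)
  qed
  show ?thesis
  proof (intro exI conjI ballI)
    show "s \<le> max t1 t2" using t1(1) by simp
    show "max t1 t2 < t" using t1(2) t2(2) by simp
    show "crossings x y c s r = crossings x y c s t" if "r \<in> {max t1 t2..t}" for r using that by (intro eq) simp_all
  qed
qed

lemma crossing_integral_left_continuous:
  assumes x: "continuous_on {0..t} x" and c: "0 < c" and t: "0 < t"
    and g: "g \<in> borel_measurable borel" "\<And>y. \<bar>g y\<bar> \<le> K"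
    and S: "\<And>n. 0 < S n" "\<And>n. S n < t" "S \<longlonglongrightarrow> t"
  shows "(\<lambda>n. crossing_integral g c x 0 (S n)) \<longlonglongrightarrow> crossing_integral g c x 0 t"
  unfolding crossing_integral_def
proof (rule integral_dominated_convergence[where w = "\<lambda>y. K * real (crossings x y c 0 t)"])
  have xS: "continuous_on {0..S n} x" for n using x by (rule continuous_on_subset) (use S(2)[of n] in auto)
  have t0: "0 \<le> t" and S0: "0 \<le> S n" for n using t S(1)[of n] by auto
  show "(\<lambda>y. g y * real (crossings x y c 0 t)) \<in> borel_measurable lborel"
    using integrable_crossings[OF x c t0 g] by (rule borel_measurable_integrable)
  show "(\<lambda>y. g y * real (crossings x y c 0 (S n))) \<in> borel_measurable lborel" for n
    using integrable_crossings[OF xS c S0 g] by (rule borel_measurable_integrable)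
  show "integrable lborel (\<lambda>y. K * real (crossings x y c 0 t))"
    by (intro integrable_mult_right integrable_crossings_1[OF x c t0])
  show "AE y in lborel. (\<lambda>n. g y * real (crossings x y c 0 (S n))) \<longlonglongrightarrow> g y * real (crossings x y c 0 t)"
  proof (rule AE_I2)
    fix y
    obtain t' where t': "t' < t" "\<And>r. t' \<le> r \<Longrightarrow> r \<le> t \<Longrightarrow> crossings x y c 0 r = crossings x y c 0 t"
      using crossings_left[OF x c t, of y] by (metis atLeastAtMost_iff)
    have "\<forall>\<^sub>F n in sequentially. t' < S n" using S(3) t'(1) by (rule order_tendstoD(1))
    then have "\<forall>\<^sub>F n in sequentially. g y * real (crossings x y c 0 (S n)) = g y * real (crossings x y c 0 t)"
    proof eventually_elim
      case (elim n)
      have "crossings x y c 0 (S n) = crossings x y c 0 t" by (rule t'(2)[OF less_imp_le[OF elim] less_imp_le[OF S(2)]])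
      then show ?case by simp
    qed
    then show "(\<lambda>n. g y * real (crossings x y c 0 (S n))) \<longlonglongrightarrow> g y * real (crossings x y c 0 t)" by (rule tendsto_eventually)
  qed
  show "AE y in lborel. norm (g y * real (crossings x y c 0 (S n))) \<le> K * real (crossings x y c 0 t)" for n
  proof (rule AE_I2)
    fix y
    have "crossings x y c 0 (S n) \<le> crossings x y c 0 t" using crossings_mono[OF x c S0 less_imp_le[OF S(2)]] .
    then show "norm (g y * real (crossings x y c 0 (S n))) \<le> K * real (crossings x y c 0 t)"
      unfolding real_norm_def abs_mult using g(2)[of y] abs_ge_zero[of "g y"] by (intro mult_mono) simp_all
  qed
qed

context fractional_brownian_motion
begin

abbreviation crossing_measure :: "real \<Rightarrow> real \<Rightarrow> 'a \<Rightarrow> real measure" where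
  "crossing_measure c t \<omega> \<equiv> density lborel (\<lambda>y. ennreal (c powr (1 / H - 1) * real (crossings (path \<omega>) y c 0 t)))"

abbreviation limit_measure :: "real \<Rightarrow> 'a \<Rightarrow> real measure" where
  "limit_measure t \<omega> \<equiv> density lborel (\<lambda>y. tv_constant M B * local_time B t y \<omega>)"

subsection \<open>The limit measures\<close>

lemma limit_measure_ac:
  assumes "\<omega> \<in> ac_event t"
  shows "limit_measure t \<omega> = density (occ t \<omega>) (\<lambda>_. ennreal tv_rate)"
proof -
  define f where "f = RN_deriv lborel (occ t \<omega>)"
  have f[measurable]: "f \<in> borel_measurable borel" using borel_measurable_RN_deriv[of lborel "occ t \<omega>"] by (simp add: f_def)
  have "density lborel f = occ t \<omega>"
    unfolding f_def using assms by (intro sigma_finite_measure.density_RN_deriv[OF sigma_finite_lborel]) (auto simp: ac_event_def)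
  then have "density (occ t \<omega>) (\<lambda>_. ennreal tv_rate) = density (density lborel f) (\<lambda>_. ennreal tv_rate)" by simp
  also have "\<dots> = density lborel (\<lambda>y. f y * ennreal tv_rate)" by (rule density_density_eq) auto
  finally show ?thesis by (simp add: local_time_def tv_constant_eq f_def mult.commute)
qed

lemma limit_measure_not_ac:
  assumes "\<omega> \<in> space M" "\<omega> \<notin> ac_event t"
  shows "limit_measure t \<omega> = null_measure lborel"
proof -
  have "\<not> (\<exists>f. f \<in> borel_measurable lborel \<and> density lborel f = occ t \<omega>)"
  proof
    assume "\<exists>f. f \<in> borel_measurable lborel \<and> density lborel f = occ t \<omega>"
    then obtain f where f: "f \<in> borel_measurable lborel" "density lborel f = occ t \<omega>" by blast
    from absolutely_continuousI_density[OF f(1)] show False unfolding f(2) using assms by (simp add: ac_event_def)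
  qed
  then have "local_time B t y \<omega> = 0" for y
    unfolding local_time_def RN_deriv_def by (simp only: if_False)
  then show ?thesis by (auto intro!: measure_eqI simp: emeasure_density)
qed

lemma emeasure_limit_measure:
  assumes "\<omega> \<in> space M" "A \<in> sets borel"
  shows "emeasure (limit_measure t \<omega>) A = (if \<omega> \<in> ac_event t then ennreal tv_rate * emeasure (occ t \<omega>) A else 0)"
proof (cases "\<omega> \<in> ac_event t")
  case True
  show ?thesis unfolding limit_measure_ac[OF True] using True assms(2) by (simp add: emeasure_density_const)
next
  case False
  show ?thesis unfolding limit_measure_not_ac[OF assms(1) False] using False by simp
qed

lemma finite_random_limit_measure: "finite_random_measure M (limit_measure t)"
  unfolding finite_random_measure_def
proof (intro conjI ballI)
  fix \<omega> assume \<omega>: "\<omega> \<in> space M"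
  interpret O: finite_measure "occ t \<omega>" using finite_occ[OF \<omega>] .
  have "emeasure (occ t \<omega>) UNIV < top" using O.emeasure_finite[of UNIV] unfolding infinity_ennreal_def less_top .
  then have "ennreal tv_rate * emeasure (occ t \<omega>) UNIV < top" by (simp only: ennreal_mult_less_top ennreal_less_top simp_thms)
  then have "emeasure (limit_measure t \<omega>) UNIV < top"
    unfolding emeasure_limit_measure[OF \<omega> sets.top[of borel, unfolded space_borel]] by (rule if_split[THEN iffD2, OF conjI[OF impI impI]]) simp
  then show "finite_borel_measure (limit_measure t \<omega>)"
    by (intro finite_borel_measure.intro finite_measureI finite_borel_measure_axioms.intro) simp_all
next
  fix A :: "real set" assume A: "A \<in> sets borel"
  have "(\<lambda>\<omega>. if \<omega> \<in> ac_event t then ennreal tv_rate * emeasure (occ t \<omega>) A else 0) \<in> borel_measurable M"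
    using measurable_emeasure_occ[OF A, of t] by measurable
  then show "(\<lambda>\<omega>. emeasure (limit_measure t \<omega>) A) \<in> borel_measurable M"
    by (rule measurable_cong[THEN iffD2, rotated]) (rule emeasure_limit_measure[OF _ A])
qed

lemma integral_occ:
  assumes \<omega>: "\<omega> \<in> space M" and g: "continuous_on UNIV (g :: real \<Rightarrow> real)"
  shows "(\<integral>y. g y \<partial>occ t \<omega>) = (\<integral>s. indicator {0..t} s * g (B (max 0 s) \<omega>) \<partial>lborel)"
    "(\<integral>y. g y \<partial>occ t \<omega>) = integral {0..t} (\<lambda>s. g (path \<omega> s))"
proof -
  have gm: "g \<in> borel_measurable borel" using g by (rule borel_measurable_continuous_onI)
  have 1: "(\<integral>y. g y \<partial>occ t \<omega>) = (\<integral>s. indicator {0..t} s *\<^sub>R g (path \<omega> s) \<partial>lborel)"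
    unfolding occupation_measure_def
    by (subst integral_distr[OF path_measurable_restrict[OF \<omega>] gm], subst integral_restrict_space) auto
  also have "\<dots> = (\<integral>s. indicator {0..t} s * g (B (max 0 s) \<omega>) \<partial>lborel)"
    by (intro Bochner_Integration.integral_cong refl) (auto simp: indicator_def)
  finally show "(\<integral>y. g y \<partial>occ t \<omega>) = (\<integral>s. indicator {0..t} s * g (B (max 0 s) \<omega>) \<partial>lborel)" .
  have "continuous_on {0..t} (\<lambda>s. g (path \<omega> s))"
    by (rule continuous_on_compose2[OF g path_continuous[OF \<omega> order_refl]]) auto
  then have "set_integrable lborel {0..t} (\<lambda>s. g (path \<omega> s))" by (rule borel_integrable_atLeastAtMost')
  then show "(\<integral>y. g y \<partial>occ t \<omega>) = integral {0..t} (\<lambda>s. g (path \<omega> s))"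
    using set_borel_integral_eq_integral(2)[of "{0..t}" "\<lambda>s. g (path \<omega> s)"] 1 by (simp add: set_lebesgue_integral_def)
qed

lemma integral_limit_measure:
  assumes \<omega>: "\<omega> \<in> space M" and g: "continuous_on UNIV (g :: real \<Rightarrow> real)"
  shows "(\<integral>y. g y \<partial>limit_measure t \<omega>) = (if \<omega> \<in> ac_event t then tv_rate * (\<integral>y. g y \<partial>occ t \<omega>) else 0)"
proof (cases "\<omega> \<in> ac_event t")
  case True
  have gm: "g \<in> borel_measurable (occ t \<omega>)" using borel_measurable_continuous_onI[OF g] by (simp add: measurable_cong_sets[OF sets_occ refl])
  show ?thesis unfolding limit_measure_ac[OF True] using True tv_rate_nonneg
    by (subst integral_density[OF gm]) auto
next
  case False
  show ?thesis unfolding limit_measure_not_ac[OF \<omega> False] using False by simp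
qed

lemma measurable_integral_limit_measure:
  assumes g: "continuous_on UNIV (g :: real \<Rightarrow> real)"
  shows "(\<lambda>\<omega>. \<integral>y. g y \<partial>limit_measure t \<omega>) \<in> borel_measurable M"
proof -
  have gm[measurable]: "g \<in> borel_measurable borel" using g by (rule borel_measurable_continuous_onI)
  have [measurable]: "(\<lambda>p. B (max 0 (snd p)) (fst p)) \<in> borel_measurable (M \<Otimes>\<^sub>M lborel)"
    by (rule measurable_joint_comp) auto
  have "(\<lambda>\<omega>. \<integral>s. indicator {0..t} s * g (B (max 0 s) \<omega>) \<partial>lborel) \<in> borel_measurable M"
    by (rule lborel.borel_measurable_lebesgue_integral) (simp add: case_prod_beta)
  then have "(\<lambda>\<omega>. if \<omega> \<in> ac_event t then tv_rate * (\<integral>s. indicator {0..t} s * g (B (max 0 s) \<omega>) \<partial>lborel) else 0) \<in> borel_measurable M"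
    by measurable
  then show ?thesis
    by (rule measurable_cong[THEN iffD2, rotated]) (simp add: integral_limit_measure[OF _ g] integral_occ(1)[OF _ g])
qed

text \<open>If absolute continuity fails at t, then by \<open>ac_event_limit\<close> it already
  fails at some S m and at all later S n, so both sides are eventually 0. Left-continuity thus holds
  for every outcome, the exceptional ones included.\<close>

lemma integral_limit_measure_left_continuous:
  assumes \<omega>: "\<omega> \<in> space M" and g: "continuous_on UNIV (g :: real \<Rightarrow> real)"
    and S: "\<And>n. 0 < S n" "\<And>n. S n < t" "incseq S" "S \<longlonglongrightarrow> t"
  shows "(\<lambda>n. \<integral>y. g y \<partial>limit_measure (S n) \<omega>) \<longlonglongrightarrow> (\<integral>y. g y \<partial>limit_measure t \<omega>)"
proof (cases "\<omega> \<in> ac_event t")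
  case True
  then have ac: "\<omega> \<in> ac_event (S n)" for n using ac_event_antimono[OF less_imp_le[OF S(2)]] by blast
  have "continuous_on {0..t} (\<lambda>s. g (path \<omega> s))"
    by (rule continuous_on_compose2[OF g path_continuous[OF \<omega> order_refl]]) auto
  then have "continuous_on {0..t} (\<lambda>u. integral {0..u} (\<lambda>s. g (path \<omega> s)))"
    by (intro indefinite_integral_continuous_1 integrable_continuous_real)
  then have "(\<lambda>n. integral {0..S n} (\<lambda>s. g (path \<omega> s))) \<longlonglongrightarrow> integral {0..t} (\<lambda>s. g (path \<omega> s))"
    by (rule continuous_on_tendsto_compose[OF _ S(4)]) (use S(1,2) less_trans[OF S(1,2)] in \<open>auto intro!: always_eventually less_imp_le\<close>)
  then show ?thesis using True ac by (simp add: integral_limit_measure[OF \<omega> g] integral_occ(2)[OF \<omega> g] tendsto_mult_left)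
next
  case False
  then obtain m where m: "\<omega> \<notin> ac_event (S m)" using ac_event_limit[OF S(3,4,2)] by blast
  have "\<forall>\<^sub>F n in sequentially. (\<integral>y. g y \<partial>limit_measure (S n) \<omega>) = (\<integral>y. g y \<partial>limit_measure t \<omega>)"
    using eventually_ge_at_top[of m]
  proof eventually_elim
    case (elim n)
    then have "\<omega> \<notin> ac_event (S n)" using m ac_event_antimono[OF incseqD[OF S(3) elim]] by blast
    then show ?case using False by (simp add: integral_limit_measure[OF \<omega> g])
  qed
  then show ?thesis by (rule tendsto_eventually)
qed

subsection \<open>The crossing measures\<close>

lemma measurable_crossings_joint:
  assumes "0 < c" "0 \<le> t"
  shows "(\<lambda>p. real (crossings (path (fst p)) (snd p) c 0 t)) \<in> borel_measurable (M \<Otimes>\<^sub>M lborel)"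
proof -
  have "(\<lambda>p. crossings (\<lambda>u. B u (fst p)) (snd p) c 0 t) \<in> measurable (M \<Otimes>\<^sub>M lborel) (count_space UNIV)"
  proof (rule measurable_crossings)
    show "(\<lambda>p. B u (fst p)) \<in> borel_measurable (M \<Otimes>\<^sub>M lborel)" if "u \<in> {0..t}" for u
      using that by (intro measurable_compose[OF measurable_fst B_measurable]) auto
    show "continuous_on {0..t} (\<lambda>u. B u (fst p))" if "p \<in> space (M \<Otimes>\<^sub>M lborel)" for p
      using that by (intro path_continuous) (auto simp: space_pair_measure)
  qed (use assms in auto)
  then show ?thesis by (rule measurable_compose) simp
qed

lemma integrable_scaled_crossings:
  assumes "\<omega> \<in> space M" "0 < c" "0 \<le> t"
  shows "integrable lborel (\<lambda>y. k * real (crossings (path \<omega>) y c 0 t))"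
  by (rule integrable_mult_right[OF integrable_crossings_1[OF path_continuous[OF assms(1) order_refl] assms(2,3)]])

lemma emeasure_crossing_measure:
  assumes "\<omega> \<in> space M" "0 < c" "0 \<le> t" "A \<in> sets borel"
  shows "emeasure (crossing_measure c t \<omega>) A
    = (\<integral>\<^sup>+y. ennreal (c powr (1 / H - 1) * real (crossings (path \<omega>) y c 0 t)) * indicator A y \<partial>lborel)"
proof (rule emeasure_density)
  show "(\<lambda>y. ennreal (c powr (1 / H - 1) * real (crossings (path \<omega>) y c 0 t))) \<in> borel_measurable lborel"
    by (rule measurable_compose[OF borel_measurable_integrable[OF integrable_scaled_crossings[OF assms(1-3)]] measurable_ennreal])
  show "A \<in> sets lborel" using assms(4) by simp
qed

lemma finite_random_crossing_measure:
  assumes c: "0 < c" and t: "0 \<le> t"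
  shows "finite_random_measure M (crossing_measure c t)"
  unfolding finite_random_measure_def
proof (intro conjI ballI)
  fix \<omega> assume \<omega>: "\<omega> \<in> space M"
  have "emeasure (crossing_measure c t \<omega>) UNIV
      = (\<integral>\<^sup>+y. ennreal (c powr (1 / H - 1) * real (crossings (path \<omega>) y c 0 t)) \<partial>lborel)"
    using emeasure_crossing_measure[OF \<omega> c t, of UNIV] by simp
  also have "\<dots> = ennreal (\<integral>y. c powr (1 / H - 1) * real (crossings (path \<omega>) y c 0 t) \<partial>lborel)"
    by (rule nn_integral_eq_integral[OF integrable_scaled_crossings[OF \<omega> c t]]) simp
  also have "\<dots> < top" by (rule ennreal_less_top)
  finally show "finite_borel_measure (crossing_measure c t \<omega>)"
    by (intro finite_borel_measure.intro finite_measureI finite_borel_measure_axioms.intro) simp_all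
next
  fix A :: "real set" assume A[measurable]: "A \<in> sets borel"
  define N where "N = (\<lambda>p. real (crossings (path (fst p)) (snd p) c 0 t))"
  have [measurable]: "N \<in> borel_measurable (M \<Otimes>\<^sub>M lborel)" unfolding N_def by (rule measurable_crossings_joint[OF c t])
  have "(\<lambda>p. ennreal (c powr (1 / H - 1) * N p) * indicator A (snd p)) \<in> borel_measurable (M \<Otimes>\<^sub>M lborel)" by measurable
  then have "(\<lambda>\<omega>. \<integral>\<^sup>+y. ennreal (c powr (1 / H - 1) * real (crossings (path \<omega>) y c 0 t)) * indicator A y \<partial>lborel) \<in> borel_measurable M"
    unfolding N_def by (intro lborel.borel_measurable_nn_integral) (simp only: case_prod_beta')
  then show "(\<lambda>\<omega>. emeasure (crossing_measure c t \<omega>) A) \<in> borel_measurable M"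
    by (rule measurable_cong[THEN iffD2, rotated]) (rule emeasure_crossing_measure[OF _ c t A])
qed

lemma integral_crossing_measure:
  assumes \<omega>: "\<omega> \<in> space M" and c: "0 < c" and t: "0 \<le> t" and g: "g \<in> borel_measurable borel"
  shows "(\<integral>y. g y \<partial>crossing_measure c t \<omega>) = c powr (1 / H - 1) * crossing_integral g c (path \<omega>) 0 t"
proof -
  have "(\<integral>y. g y \<partial>crossing_measure c t \<omega>) = (\<integral>y. (c powr (1 / H - 1) * real (crossings (path \<omega>) y c 0 t)) *\<^sub>R g y \<partial>lborel)"
    by (rule integral_density[OF _ borel_measurable_integrable[OF integrable_scaled_crossings[OF \<omega> c t]]]) (use g in simp_all)
  also have "\<dots> = (\<integral>y. c powr (1 / H - 1) * (g y * real (crossings (path \<omega>) y c 0 t)) \<partial>lborel)"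
    by (intro Bochner_Integration.integral_cong refl) simp
  finally show ?thesis by (simp add: crossing_integral_def)
qed

lemma measurable_crossing_integral:
  assumes c: "0 < c" and t: "0 \<le> t" and g[measurable]: "g \<in> borel_measurable borel"
  shows "(\<lambda>\<omega>. crossing_integral g c (path \<omega>) 0 t) \<in> borel_measurable M"
proof -
  define N where "N = (\<lambda>p. real (crossings (path (fst p)) (snd p) c 0 t))"
  have [measurable]: "N \<in> borel_measurable (M \<Otimes>\<^sub>M lborel)" unfolding N_def by (rule measurable_crossings_joint[OF c t])
  have "(\<lambda>p. g (snd p) * N p) \<in> borel_measurable (M \<Otimes>\<^sub>M lborel)" by measurable
  then show ?thesis unfolding crossing_integral_def N_def
    by (intro lborel.borel_measurable_lebesgue_integral) (simp only: case_prod_beta')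
qed

text \<open>Both integrals are left-continuous in t for every outcome, so the supremum may be taken
  over rational times.\<close>

lemma measurable_weak_sup_distance:
  assumes c: "0 < c" and g: "continuous_on UNIV g" "\<And>y. \<bar>g y\<bar> \<le> K"
  shows "weak_sup_distance g T (crossing_measure c) limit_measure \<in> borel_measurable M"
proof -
  have gm: "g \<in> borel_measurable borel" using g(1) by (rule borel_measurable_continuous_onI)
  define F where "F = (\<lambda>t \<omega>. (\<integral>y. g y \<partial>crossing_measure c t \<omega>) - (\<integral>y. g y \<partial>limit_measure t \<omega>))"
  have Fm: "F t \<in> borel_measurable M" if t: "0 \<le> t" for t
  proof -
    have "(\<lambda>\<omega>. c powr (1 / H - 1) * crossing_integral g c (path \<omega>) 0 t - (\<integral>y. g y \<partial>limit_measure t \<omega>)) \<in> borel_measurable M"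
      using measurable_crossing_integral[OF c t gm] measurable_integral_limit_measure[OF g(1), of t] by measurable
    then show ?thesis unfolding F_def
      by (rule measurable_cong[THEN iffD2, rotated]) (simp add: integral_crossing_measure[OF _ c t gm])
  qed
  have left: "((\<lambda>t. F t \<omega>) \<longlongrightarrow> F t \<omega>) (at_left t)" if \<omega>: "\<omega> \<in> space M" and t: "0 < t" for t \<omega>
  proof (rule tendsto_at_left_sequentially[OF t])
    fix S :: "nat \<Rightarrow> real" assume S: "\<And>n. S n < t" "\<And>n. 0 < S n" "incseq S" "S \<longlonglongrightarrow> t"
    have "(\<lambda>n. c powr (1 / H - 1) * crossing_integral g c (path \<omega>) 0 (S n) - (\<integral>y. g y \<partial>limit_measure (S n) \<omega>))
        \<longlonglongrightarrow> c powr (1 / H - 1) * crossing_integral g c (path \<omega>) 0 t - (\<integral>y. g y \<partial>limit_measure t \<omega>)"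
      by (intro tendsto_diff tendsto_mult_left integral_limit_measure_left_continuous[OF \<omega> g(1) S(2,1,3,4)]
          crossing_integral_left_continuous[OF path_continuous[OF \<omega> order_refl] c t gm g(2) S(2,1,4)])
    then show "(\<lambda>n. F (S n) \<omega>) \<longlonglongrightarrow> F t \<omega>"
      unfolding F_def using t S(2) by (simp add: integral_crossing_measure[OF \<omega> c _ gm] less_imp_le)
  qed
  have "(\<lambda>\<omega>. SUP t\<in>{0..T} \<inter> \<rat>. ennreal \<bar>F t \<omega>\<bar>) \<in> borel_measurable M"
  proof (rule borel_measurable_SUP)
    show "countable ({0..T} \<inter> \<rat>)" using countable_rat by (rule countable_subset[rotated]) simp
    show "(\<lambda>\<omega>. ennreal \<bar>F t \<omega>\<bar>) \<in> borel_measurable M" if "t \<in> {0..T} \<inter> \<rat>" for t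
      using Fm[of t] that by auto
  qed
  then show ?thesis
  proof (rule measurable_cong[THEN iffD2, rotated])
    fix \<omega> assume \<omega>: "\<omega> \<in> space M"
    show "weak_sup_distance g T (crossing_measure c) limit_measure \<omega> = (SUP t\<in>{0..T} \<inter> \<rat>. ennreal \<bar>F t \<omega>\<bar>)"
      unfolding weak_sup_distance_def F_def[symmetric]
      using SUP_rational_left_continuous[of T "\<lambda>t. F t \<omega>"] left[OF \<omega>] unfolding F_def by simp
  qed
qed

subsection \<open>Almost sure convergence along a subsequence\<close>

text \<open>A diagonal choice: S k j adds the errors at the first j + 1 rational times, and r n is
  picked so that the expectation of S (r n) n is below 1 / (n + 1). A further subsequence converges
  almost surely. Since S dominates the error at any fixed rational time once n is large, a single
  null set serves all of them.\<close>

lemma tv_subsequence: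
  assumes c: "\<And>k. 0 < c k" "c \<longlonglongrightarrow> 0"
  shows "\<exists>r. strict_mono r \<and> (AE \<omega> in M. \<forall>t\<in>\<rat> \<inter> {0..}.
           (\<lambda>n. c (r n) powr (1 / H - 1) * tv (c (r n)) (path \<omega>) 0 t) \<longlonglongrightarrow> tv_rate * t)"
proof -
  define q where "q = from_nat_into (\<rat> \<inter> {0::real..})"
  have ne: "\<rat> \<inter> {0::real..} \<noteq> {}" by (auto intro: exI[of _ 0])
  have q0: "0 \<le> q i" for i using from_nat_into[OF ne, of i] by (auto simp: q_def)
  have qr: "range q = \<rat> \<inter> {0..}" unfolding q_def
    by (rule range_from_nat_into[OF ne]) (use countable_rat in \<open>blast intro: countable_subset\<close>)
  define f where "f = (\<lambda>k t \<omega>. \<bar>c k powr (1 / H - 1) * tv (c k) (path \<omega>) 0 t - tv_rate * t\<bar>)"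
  have fi: "integrable M (f k t)" if "0 \<le> t" for k t
    unfolding f_def using that c(1) by (intro integrable_abs Bochner_Integration.integrable_diff tv_scaled_integrable) auto
  have cr: "filterlim c (at_right 0) sequentially"
    using c by (intro tendsto_imp_filterlim_at_right) auto
  have fl: "(\<lambda>k. expectation (f k t)) \<longlonglongrightarrow> 0" if "0 \<le> t" for t
    unfolding f_def by (rule filterlim_compose[OF tv_small_scale_limit[OF that] cr])
  define S where "S = (\<lambda>k j \<omega>. \<Sum>i\<le>j. f k (q i) \<omega>)"
  have Si: "integrable M (S k j)" for k j unfolding S_def by (intro Bochner_Integration.integrable_sum fi q0)
  have Sn: "0 \<le> S k j \<omega>" for k j \<omega> by (auto simp: S_def f_def intro!: sum_nonneg)
  have "\<forall>\<^sub>F k in sequentially. expectation (S k j) < 1 / real (Suc j)" for j :: nat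
  proof -
    have "(\<lambda>k. \<Sum>i\<le>j. expectation (f k (q i))) \<longlonglongrightarrow> (\<Sum>i\<le>j. 0)" by (intro tendsto_sum fl q0)
    moreover have "(\<Sum>i\<le>j. expectation (f k (q i))) = expectation (S k j)" for k
      unfolding S_def by (intro Bochner_Integration.integral_sum[symmetric] fi q0)
    ultimately have "(\<lambda>k. expectation (S k j)) \<longlonglongrightarrow> 0" by simp
    then show ?thesis by (rule order_tendstoD(2)) simp
  qed
  then have ex: "\<exists>k>m. expectation (S k j) < 1 / real (Suc j)" for j m :: nat
    using eventually_happens'[OF sequentially_bot eventually_conj[OF _ eventually_gt_at_top[of m]]] by blast
  have "\<exists>r. \<forall>n. expectation (S (r n) n) < 1 / real (Suc n) \<and> r n < r (Suc n)"
    by (rule dependent_nat_choice) (use ex in blast)+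
  then obtain r where r: "\<And>n. expectation (S (r n) n) < 1 / real (Suc n)" "\<And>n. r n < r (Suc n)" by blast
  have "(\<lambda>n. \<integral>\<omega>. norm (S (r n) n \<omega>) \<partial>M) \<longlonglongrightarrow> 0"
  proof (rule tendsto_sandwich[OF _ _ tendsto_const LIMSEQ_inverse_real_of_nat])
    show "\<forall>\<^sub>F n in sequentially. (\<integral>\<omega>. norm (S (r n) n \<omega>) \<partial>M) \<le> inverse (real (Suc n))"
      using r(1) Sn by (auto intro!: always_eventually less_imp_le simp: inverse_eq_divide simp del: of_nat_Suc)
  qed (simp add: Sn)
  from tendsto_L1_AE_subseq[OF Si this] obtain r' where r': "strict_mono r'"
    and AE: "AE \<omega> in M. (\<lambda>n. S (r (r' n)) (r' n) \<omega>) \<longlonglongrightarrow> 0" by blast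
  have "strict_mono (r \<circ> r')" using strict_mono_Suc_iff[of r] r(2) r' by (intro strict_mono_o) auto
  moreover have "AE \<omega> in M. \<forall>t\<in>\<rat> \<inter> {0..}.
      (\<lambda>n. c ((r \<circ> r') n) powr (1 / H - 1) * tv (c ((r \<circ> r') n)) (path \<omega>) 0 t) \<longlonglongrightarrow> tv_rate * t"
    using AE
  proof eventually_elim
    case (elim \<omega>)
    show ?case
    proof
      fix t :: real assume "t \<in> \<rat> \<inter> {0..}"
      then obtain i where i: "t = q i" using qr by blast
      have "(\<lambda>n. f (r (r' n)) t \<omega>) \<longlonglongrightarrow> 0"
      proof (rule tendsto_sandwich[OF _ _ tendsto_const elim])
        show "\<forall>\<^sub>F n in sequentially. f (r (r' n)) t \<omega> \<le> S (r (r' n)) (r' n) \<omega>"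
          using eventually_ge_at_top[of i]
        proof eventually_elim
          case (elim n)
          then have "i \<le> r' n" using seq_suble[OF r', of n] by linarith
          then show ?case unfolding S_def i by (intro member_le_sum) (auto simp: f_def)
        qed
      qed (simp add: f_def)
      then show "(\<lambda>n. c ((r \<circ> r') n) powr (1 / H - 1) * tv (c ((r \<circ> r') n)) (path \<omega>) 0 t) \<longlonglongrightarrow> tv_rate * t"
        by (simp add: f_def tendsto_rabs_zero_iff LIM_zero_iff)
    qed
  qed
  ultimately show ?thesis by (intro exI[of _ "r \<circ> r'"] conjI)
qed

lemma tv_limit_path:
  assumes \<omega>: "\<omega> \<in> space M" and c: "\<And>n. 0 < c n" "c \<longlonglongrightarrow> 0" and T: "0 \<le> T"
    and lim: "\<And>t. t \<in> \<rat> \<Longrightarrow> 0 \<le> t \<Longrightarrow> (\<lambda>n. c n powr (1 / H - 1) * tv (c n) (path \<omega>) 0 t) \<longlonglongrightarrow> tv_rate * t"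
  shows "tv_limit (path \<omega>) T tv_rate c (\<lambda>n. c n powr (1 / H - 1))"
proof
  show "0 \<le> T" by fact
  show "continuous_on {0..T} (path \<omega>)" using \<omega> by (rule path_continuous) simp
  show "0 < c n" for n by fact
  show "0 \<le> c n powr (1 / H - 1)" for n by simp
  show z: "(\<lambda>n. c n powr (1 / H - 1)) \<longlonglongrightarrow> 0"
    by (rule tendsto_zero_powrI[OF c(2) tendsto_const]) (use c(1) hurst in \<open>auto intro!: always_eventually less_imp_le\<close>)
  show "(\<lambda>n. c n powr (1 / H - 1) * c n) \<longlonglongrightarrow> 0" using tendsto_mult[OF z c(2)] by simp
  fix t assume "t \<in> {0..T}"
  then have t: "0 \<le> t" by simp
  have mono: "c n powr (1 / H - 1) * tv (c n) (path \<omega>) 0 u \<le> c n powr (1 / H - 1) * tv (c n) (path \<omega>) 0 v"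
    if "0 \<le> u" "u \<le> v" for n u v
    using tv_path_mono[OF \<omega> c(1) that] by (intro mult_left_mono) auto
  show "(\<lambda>n. c n powr (1 / H - 1) * tv (c n) (path \<omega>) 0 t) \<longlonglongrightarrow> tv_rate * t"
  proof (rule order_tendstoI)
    fix l assume l: "l < tv_rate * t"
    have "\<exists>u\<in>\<rat>. 0 \<le> u \<and> u \<le> t \<and> l < tv_rate * u"
    proof (cases "t = 0")
      case True
      then show ?thesis using l by (intro bexI[of _ 0]) auto
    next
      case False
      have "((\<lambda>u. tv_rate * u) \<longlongrightarrow> tv_rate * t) (at_left t)" by (intro tendsto_intros)
      then have "\<forall>\<^sub>F u in at_left t. l < tv_rate * u" using l by (rule order_tendstoD(1))
      then obtain b where b: "b < t" "\<And>u. b < u \<Longrightarrow> u < t \<Longrightarrow> l < tv_rate * u"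
        unfolding eventually_at_left[of "t - 1" t, simplified] by auto
      obtain u where u: "u \<in> \<rat>" "max b 0 < u" "u < t" using Rats_dense_in_real[of "max b 0" t] b(1) t False by auto
      then show ?thesis using b(2)[of u] by (intro bexI[of _ u]) auto
    qed
    then obtain u where u: "u \<in> \<rat>" "0 \<le> u" "u \<le> t" "l < tv_rate * u" by blast
    show "\<forall>\<^sub>F n in sequentially. l < c n powr (1 / H - 1) * tv (c n) (path \<omega>) 0 t"
      using order_tendstoD(1)[OF lim[OF u(1,2)] u(4)]
      by eventually_elim (use mono[OF u(2,3)] less_le_trans in blast)
  next
    fix l assume l: "tv_rate * t < l"
    have "((\<lambda>u. tv_rate * u) \<longlongrightarrow> tv_rate * t) (at_right t)" by (intro tendsto_intros)
    then have "\<forall>\<^sub>F u in at_right t. tv_rate * u < l" using l by (rule order_tendstoD(2))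
    then obtain b where b: "t < b" "\<And>u. t < u \<Longrightarrow> u < b \<Longrightarrow> tv_rate * u < l"
      unfolding eventually_at_right[of t "t + 1", simplified] by auto
    obtain u where u: "u \<in> \<rat>" "t < u" "u < b" using Rats_dense_in_real[OF b(1)] by auto
    show "\<forall>\<^sub>F n in sequentially. c n powr (1 / H - 1) * tv (c n) (path \<omega>) 0 t < l"
      using order_tendstoD(2)[OF lim[OF u(1)] b(2)[OF u(2,3)]] t u(2)
      by (auto elim!: eventually_mono intro: le_less_trans[OF mono[OF t less_imp_le[OF u(2)]]])
  qed
qed

subsection \<open>Weak convergence\<close>

lemma crossing_measure_weakly_converges:
  assumes \<omega>: "\<omega> \<in> ac_event t" and c: "\<And>n. 0 < c n" and t: "0 \<le> t"
    and lim: "tv_limit (path \<omega>) t tv_rate c (\<lambda>n. c n powr (1 / H - 1))"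
  shows "weakly_converges (\<lambda>n. crossing_measure (c n) t \<omega>) (limit_measure t \<omega>)"
proof -
  interpret tv_limit "path \<omega>" t tv_rate c "\<lambda>n. c n powr (1 / H - 1)" by fact
  have sp: "\<omega> \<in> space M" using \<omega> by (simp add: ac_event_def)
  have "(\<lambda>n. \<integral>y. g y \<partial>crossing_measure (c n) t \<omega>) \<longlonglongrightarrow> (\<integral>y. g y \<partial>limit_measure t \<omega>)"
    if g: "continuous_on UNIV g" "bounded (range g)" for g :: "real \<Rightarrow> real"
  proof -
    obtain K where K: "\<And>y. \<bar>g y\<bar> \<le> K" using g(2) by (auto simp: bounded_iff)
    have "(\<lambda>n. c n powr (1 / H - 1) * crossing_integral g (c n) (path \<omega>) 0 t) \<longlonglongrightarrow> tv_rate * integral {0..t} (\<lambda>s. g (path \<omega> s))"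
      by (rule crossing_integral_limit[OF _ g(1) K]) (use t in auto)
    then show ?thesis using \<omega>
      by (simp add: integral_crossing_measure[OF sp c t borel_measurable_continuous_onI[OF g(1)]]
          integral_limit_measure[OF sp g(1)] integral_occ(2)[OF sp g(1)])
  qed
  then show ?thesis
    using finite_random_crossing_measure[OF c t] finite_random_limit_measure sp
    by (simp add: weakly_converges_def finite_random_measure_def)
qed

text \<open>The path limit is taken up to T + 1 because the uniform limit is stated for horizons of
  positive length, while T may be 0.\<close>

lemma weak_sup_distance_le:
  assumes \<omega>: "\<omega> \<in> ac_event T" and c: "\<And>n. 0 < c n" and T: "0 \<le> T"
    and lim: "tv_limit (path \<omega>) (T + 1) tv_rate c (\<lambda>n. c n powr (1 / H - 1))"
    and g: "continuous_on UNIV g" "\<And>y. \<bar>g y\<bar> \<le> K" and e: "0 < e"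
  shows "\<forall>\<^sub>F n in sequentially. weak_sup_distance g T (crossing_measure (c n)) limit_measure \<omega> \<le> ennreal e"
proof -
  interpret L: tv_limit "path \<omega>" "T + 1" tv_rate c "\<lambda>n. c n powr (1 / H - 1)" by fact
  have sp: "\<omega> \<in> space M" using \<omega> by (simp add: ac_event_def)
  have T1: "0 < T + 1" using T by simp
  show ?thesis using L.crossing_integral_limit_uniform[OF g e T1]
  proof eventually_elim
    case (elim n)
    show ?case unfolding weak_sup_distance_def
    proof (rule SUP_least)
      fix t assume t: "t \<in> {0..T}"
      then have "\<omega> \<in> ac_event t" using \<omega> ac_event_antimono[of t T] by auto
      then show "ennreal \<bar>(\<integral>y. g y \<partial>crossing_measure (c n) t \<omega>) - (\<integral>y. g y \<partial>limit_measure t \<omega>)\<bar> \<le> ennreal e"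
        using elim[rule_format, of t] t e
        by (simp add: integral_crossing_measure[OF sp c _ borel_measurable_continuous_onI[OF g(1)]]
            integral_limit_measure[OF sp g(1)] integral_occ(2)[OF sp g(1)] ennreal_leI)
    qed
  qed
qed

lemma subsequence_in_probability:
  assumes c: "\<And>n. 0 < c n" "c \<longlonglongrightarrow> 0" and T: "0 \<le> T"
    and g: "continuous_on UNIV g" "\<And>y. \<bar>g y\<bar> \<le> K" and e: "0 < e"
  shows "\<exists>r. strict_mono r \<and> (\<lambda>n. prob {\<omega> \<in> space M. weak_sup_distance g T (crossing_measure (c (r n))) limit_measure \<omega> > ennreal e}) \<longlonglongrightarrow> 0"
proof -
  obtain r where r: "strict_mono r" and AE: "AE \<omega> in M. \<forall>t\<in>\<rat> \<inter> {0..}.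
      (\<lambda>n. c (r n) powr (1 / H - 1) * tv (c (r n)) (path \<omega>) 0 t) \<longlonglongrightarrow> tv_rate * t"
    using tv_subsequence[of c, OF c] by blast
  have cr: "(\<lambda>n. c (r n)) \<longlonglongrightarrow> 0" using LIMSEQ_subseq_LIMSEQ[OF c(2) r] by (simp add: o_def)
  define E where "E = (\<lambda>n. {\<omega> \<in> space M. weak_sup_distance g T (crossing_measure (c (r n))) limit_measure \<omega> > ennreal e})"
  have E: "E n \<in> sets M" for n
  proof -
    have [measurable]: "weak_sup_distance g T (crossing_measure (c (r n))) limit_measure \<in> borel_measurable M"
      by (rule measurable_weak_sup_distance[OF c(1) g])
    show ?thesis unfolding E_def by measurable
  qed
  have "(\<lambda>n. \<integral>\<omega>. indicator (E n) \<omega> \<partial>M) \<longlonglongrightarrow> (\<integral>\<omega>. (0::real) \<partial>M)"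
  proof (rule integral_dominated_convergence[where w = "\<lambda>_. 1"])
    show "AE \<omega> in M. (\<lambda>n. indicator (E n) \<omega>) \<longlonglongrightarrow> (0::real)"
      using AE ac_event_AE[of T] AE_space
    proof eventually_elim
      case (elim \<omega>)
      have "tv_limit (path \<omega>) (T + 1) tv_rate (\<lambda>n. c (r n)) (\<lambda>n. c (r n) powr (1 / H - 1))"
        by (rule tv_limit_path[OF elim(3) c(1) cr]) (use elim(1) T in auto)
      from weak_sup_distance_le[OF elim(2) c(1) T this g e]
      have "\<forall>\<^sub>F n in sequentially. indicator (E n) \<omega> = (0::real)"
        by eventually_elim (auto simp: E_def indicator_def)
      then show ?case by (rule tendsto_eventually)
    qed
  qed (use E in \<open>auto simp: indicator_def\<close>)
  then have "(\<lambda>n. prob (E n)) \<longlonglongrightarrow> 0" using E by simp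
  then show ?thesis using r unfolding E_def by blast
qed

text \<open>The subsequence principle: if the probabilities failed to vanish along some null
  sequence, they would stay above some d > 0 along a subsequence, from which
  \<open>subsequence_in_probability\<close> extracts a further one tending to 0.\<close>

theorem crossing_measure_in_probability:
  assumes T: "0 \<le> T" and g: "continuous_on UNIV g" "\<And>y. \<bar>g y\<bar> \<le> K" and e: "0 < e"
  shows "((\<lambda>c. prob {\<omega> \<in> space M. weak_sup_distance g T (crossing_measure c) limit_measure \<omega> > ennreal e}) \<longlongrightarrow> 0) (at_right 0)"
    (is "(?p \<longlongrightarrow> 0) _")
proof (rule tendsto_at_right_sequentially[OF zero_less_one])
  fix c :: "nat \<Rightarrow> real" assume c: "\<And>n. 0 < c n" "c \<longlonglongrightarrow> 0"
  show "(\<lambda>n. ?p (c n)) \<longlonglongrightarrow> 0"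
  proof (rule ccontr)
    assume "\<not> (\<lambda>n. ?p (c n)) \<longlonglongrightarrow> 0"
    then obtain d where d: "0 < d" "\<not> (\<forall>\<^sub>F n in sequentially. ?p (c n) < d)"
      unfolding tendsto_iff by (auto simp: dist_real_def)
    then have "infinite {n. \<not> ?p (c n) < d}"
      by (simp add: eventually_sequentially infinite_nat_iff_unbounded_le) 
    from infinite_enumerate[OF this] obtain s :: "nat \<Rightarrow> nat" where s: "strict_mono s" "\<And>n. \<not> ?p (c (s n)) < d" by blast
    have cs: "(\<lambda>n. c (s n)) \<longlonglongrightarrow> 0" using LIMSEQ_subseq_LIMSEQ[OF c(2) s(1)] by (simp add: o_def)
    obtain r where "(\<lambda>n. ?p (c (s (r n)))) \<longlonglongrightarrow> 0"
      using subsequence_in_probability[of "\<lambda>n. c (s n)", OF c(1) cs T g e] by blast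
    then have "\<forall>\<^sub>F n in sequentially. ?p (c (s (r n))) < d" using d(1) by (rule order_tendstoD(2))
    then show False using s(2) by simp
  qed
qed

end

theorem fact5p1:
  fixes M :: "'a measure" and H :: real and B :: "real \<Rightarrow> 'a \<Rightarrow> real"
  assumes "fractional_brownian_motion M H B"
  shows "(\<exists>(c :: nat \<Rightarrow> real) \<Omega>\<^sub>H.
            (\<forall>n. 0 < c n) \<and> c \<longlonglongrightarrow> 0 \<and> \<Omega>\<^sub>H \<in> sets M \<and> measure M \<Omega>\<^sub>H = 1 \<and>
            (\<forall>\<omega>\<in>\<Omega>\<^sub>H. \<forall>t\<ge>0.
               weakly_converges
                 (\<lambda>n. density lborel (\<lambda>y. ennreal (c n powr (1 / H - 1) *
                         real (crossings (\<lambda>u. B u \<omega>) y (c n) 0 t))))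
                 (density lborel (\<lambda>y. tv_constant M B * local_time B t y \<omega>)))) \<and>
         weakly_locally_uniformly_in_probability M
           (\<lambda>c t \<omega>. density lborel (\<lambda>y. ennreal (c powr (1 / H - 1) *
                        real (crossings (\<lambda>u. B u \<omega>) y c 0 t))))
           (\<lambda>t \<omega>. density lborel (\<lambda>y. tv_constant M B * local_time B t y \<omega>))"
proof -
  interpret fractional_brownian_motion M H B by fact
  have k: "0 < 1 / real (Suc k)" "(\<lambda>k. 1 / real (Suc k)) \<longlonglongrightarrow> 0" for k
    using LIMSEQ_inverse_real_of_nat by (simp_all add: inverse_eq_divide)
  obtain r where r: "strict_mono r" and AE: "AE \<omega> in M. \<forall>t\<in>\<rat> \<inter> {0..}.
      (\<lambda>n. (1 / real (Suc (r n))) powr (1 / H - 1) * tv (1 / real (Suc (r n))) (path \<omega>) 0 t) \<longlonglongrightarrow> tv_rate * t"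
    using tv_subsequence[of "\<lambda>k. 1 / real (Suc k)", OF k] by blast
  define c where "c = (\<lambda>n. 1 / real (Suc (r n)))"
  have c: "\<And>n. 0 < c n" "c \<longlonglongrightarrow> 0"
    using LIMSEQ_subseq_LIMSEQ[OF k(2) r] by (simp_all add: c_def o_def)
  \<comment> \<open>Absolute continuity at all integer times, one null set in total, covers every t
    by \<open>ac_event_antimono\<close>.\<close>
  have "AE \<omega> in M. (\<forall>t\<in>\<rat> \<inter> {0..}. (\<lambda>n. c n powr (1 / H - 1) * tv (c n) (path \<omega>) 0 t) \<longlonglongrightarrow> tv_rate * t) \<and> (\<forall>N::nat. \<omega> \<in> ac_event (real N))"
    by (intro AE_conjI AE_all_countable[THEN iffD2] allI ac_event_AE) (use AE in \<open>simp only: c_def\<close>)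
  \<comment> \<open>The set of good outcomes need not itself be exhibited as measurable; the
    complement of a measurable null set Z containing the bad ones serves as \<Omega>_H.\<close>
  then obtain Z where Z: "{\<omega> \<in> space M. \<not> ((\<forall>t\<in>\<rat> \<inter> {0..}. (\<lambda>n. c n powr (1 / H - 1) * tv (c n) (path \<omega>) 0 t) \<longlonglongrightarrow> tv_rate * t) \<and> (\<forall>N::nat. \<omega> \<in> ac_event (real N)))} \<subseteq> Z"
      "emeasure M Z = 0" "Z \<in> sets M" by (rule AE_E)
  have "prob Z = 0" using Z(2) by (simp add: measure_def)
  then have "prob (space M - Z) = 1" using prob_compl[OF Z(3)] by linarith
  moreover have "weakly_converges (\<lambda>n. crossing_measure (c n) t \<omega>) (limit_measure t \<omega>)"
    if \<omega>: "\<omega> \<in> space M - Z" and t: "0 \<le> t" for \<omega> t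
  proof (rule crossing_measure_weakly_converges[OF _ c(1) t])
    have *: "\<forall>t\<in>\<rat> \<inter> {0..}. (\<lambda>n. c n powr (1 / H - 1) * tv (c n) (path \<omega>) 0 t) \<longlonglongrightarrow> tv_rate * t" "\<And>N::nat. \<omega> \<in> ac_event (real N)"
      using Z(1) \<omega> by blast+
    obtain N :: nat where "t \<le> real N" using real_arch_simple by blast
    then show "\<omega> \<in> ac_event t" using *(2)[of N] ac_event_antimono by blast
    show "tv_limit (path \<omega>) t tv_rate c (\<lambda>n. c n powr (1 / H - 1))"
      by (rule tv_limit_path[OF _ c t]) (use \<omega> *(1) in auto)
  qed
  ultimately have 1: "\<exists>(c :: nat \<Rightarrow> real) \<Omega>\<^sub>H. (\<forall>n. 0 < c n) \<and> c \<longlonglongrightarrow> 0 \<and> \<Omega>\<^sub>H \<in> sets M \<and> prob \<Omega>\<^sub>H = 1 \<and>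
      (\<forall>\<omega>\<in>\<Omega>\<^sub>H. \<forall>t\<ge>0. weakly_converges (\<lambda>n. crossing_measure (c n) t \<omega>) (limit_measure t \<omega>))"
    using c Z(3) by (intro exI[of _ c] exI[of _ "space M - Z"]) auto
  have 2: "weakly_locally_uniformly_in_probability M crossing_measure limit_measure"
    unfolding weakly_locally_uniformly_in_probability_def
  proof (intro conjI allI impI)
    fix g :: "real \<Rightarrow> real" and T :: real
    assume gT: "continuous_on UNIV g \<and> bounded (range g) \<and> 0 \<le> T"
    then obtain K where K: "\<And>y. \<bar>g y\<bar> \<le> K" by (auto simp: bounded_iff)
    show "weak_sup_distance g T (crossing_measure c) limit_measure \<in> borel_measurable M" if "0 < c" for c
      by (rule measurable_weak_sup_distance[OF that _ K]) (use gT in simp)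
    show "((\<lambda>c. prob {\<omega> \<in> space M. ennreal \<epsilon> < weak_sup_distance g T (crossing_measure c) limit_measure \<omega>}) \<longlongrightarrow> 0) (at_right 0)"
      if "0 < \<epsilon>" for \<epsilon>
      by (rule crossing_measure_in_probability[OF _ _ K that]) (use gT in simp_all)
  qed (auto intro: finite_random_crossing_measure finite_random_limit_measure)
  from 1 2 show ?thesis by (rule conjI)
qed

end
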